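(* Let $k$ be a field, let $A,B,C$ be finite dimensional elementary $k$-algebras with $A$ of finite global dimension, and let $\{e_1,\dots,e_n\}$, $\{f_1,\dots,f_m\}$, $\{g_1,\dots,g_p\}$ be complete sets of orthogonal primitive idempotents of $A$, $B$, $C$ respectively. Let $C_A$ be the Cartan matrix of $A$. Then the following two equivalent statements hold: (1) For every endomorphism $\phi$ of a finite dimensional $B$-$A$-bimodule $M$ and every endomorphism $\psi$ of a finite dimensional $C$-$A$-bimodule $N$, $$\underline{\underline{\mathrm{tr}}}(\mathrm{RHom}_A(\phi,\psi)) := \sum_{l\ge 0}(-1)^l\, \underline{\underline{\mathrm{tr}}}(\mathrm{Ext}^l_A(\phi,\psi)) = \langle \underline{\underline{\mathrm{tr}}}\, \phi,\underline{\underline{\mathrm{tr}}}\, \psi \rangle_A,$$ where $\langle -,- \rangle_A : k^{n\times m} \times k^{n\times p} \to k^{m\times p}$, $(x,y)\mapsto x^T C_A^{-T} y$. (2) For every endomorphism $\phi$ of a finite dimensional $B$-$A$-bimodule $M$ and every endomorphism $\psi$ of a finite dimensional $A$-$C$-bimodule $N$, $$\underline{\underline{\mathrm{tr}}}(\phi\otimes^L_A\psi) := \sum_{l\ge 0}(-1)^l\, \underline{\underline{\mathrm{tr}}}(\mathrm{Tor}^A_l(\phi,\psi)) = \langle (\underline{\underline{\mathrm{tr}}}\, \psi)^T,\underline{\underline{\mathrm{tr}}}\,\phi \rangle_{A^{\mathrm{op}}},$$ where $\langle -,- \rangle_{A^{\mathrm{op}}} : k^{n\times p} \times k^{n\times m}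 \to k^{p\times m}$, $(x,y)\mapsto x^T C_A^{-1} y$.
   Context: $k$ is a fixed field; algebras are associative unital $k$-algebras; $\dim=\dim_k$; $T$ denotes transpose and $C^{-T}=(C^{-1})^T$. A finite dimensional algebra $A$ is elementary if $A/\mathrm{rad}\,A$ is isomorphic to a direct product of finitely many copies of $k$. A $B$-$A$-bimodule is a left $B$-, right $A$-bimodule on which $k$ acts centrally. Cartan matrix: $C_A=(c_{ij})\in\mathbb{Z}^{n\times n}$ with $c_{ij}=\dim\mathrm{Hom}_A(e_iA,e_jA)=\dim e_jAe_i$. When $A$ has finite global dimension, $\det C_A=\pm1$, so $C_A^{-1}$ is an integer matrix; here its entries are regarded in $k$. Trace matrix: if $R,S$ are finite dimensional elementary algebras with chosen complete sets of orthogonal primitive idempotents $\{r_1,\dots,r_a\}$ of $R$ and $\{s_1,\dots,s_b\}$ of $S$, and $\theta$ is an endomorphism of a finite dimensional $S$-$R$-bimodule $X$, then $\underline{\underline{\mathrm{tr}}}\,\theta\in k^{a\times b}$ is the matrix whose $(i,j)$ entry is the trace of the restriction of $\theta$ to $s_jXr_i$. $\mathrm{Ext}^l_A(M,N)$ (Ext of right $A$-modules) is a $C$-$B$-bimodule and $\mathrm{Ext}^l_A(\phi,\psi)$ is its bimodule endomorphism induced by precomposition with $\phi$ and postcomposition with $\psi$; its trace matrix is $m\times p$. $\mathrm{Tor}^A_l(M,N)$ is a $B$-$C$-bimodule with induced endomorphism $\mathrm{Tor}^A_l(\phi,\psi)$; its trace matrix is $p\times m$. *)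

theory Defs
  imports "Jordan_Normal_Form.VS_Connect" "HOL-Algebra.QuotRing"
begin

text \<open>
  The ground field is a type \<open>'k::field\<close>, seen as the ring record \<^term>\<open>class_ring\<close>. An algebra
  is a record \<open>('k, 'a) module\<close>: it has the fields of a ring and, in addition, \<^const>\<open>smult\<close>.
  For modules and plain vector spaces the fields \<open>mult\<close> and \<open>one\<close> of the record are junk.
\<close>

section \<open>Algebras\<close>

definition k_algebra :: "('k::field, 'a) module \<Rightarrow> bool" where
  "k_algebra A \<longleftrightarrow> ring A \<and> vectorspace class_ring A \<and>
     (\<forall>c. \<forall>x\<in>carrier A. \<forall>y\<in>carrier A.
        (c \<odot>\<^bsub>A\<^esub> x) \<otimes>\<^bsub>A\<^esub> y = c \<odot>\<^bsub>A\<^esub> (x \<otimes>\<^bsub>A\<^esub> y) \<and>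
        x \<otimes>\<^bsub>A\<^esub> (c \<odot>\<^bsub>A\<^esub> y) = c \<odot>\<^bsub>A\<^esub> (x \<otimes>\<^bsub>A\<^esub> y))"

definition fd_algebra :: "('k::field, 'a) module \<Rightarrow> bool" where
  "fd_algebra A \<longleftrightarrow> k_algebra A \<and> vectorspace.fin_dim class_ring A"

definition right_ideal :: "'a set \<Rightarrow> ('k::field, 'a) module \<Rightarrow> bool" where
  "right_ideal I A \<longleftrightarrow> additive_subgroup I A \<and> (\<forall>x\<in>I. \<forall>a\<in>carrier A. x \<otimes>\<^bsub>A\<^esub> a \<in> I)"

definition maximal_right_ideal :: "'a set \<Rightarrow> ('k::field, 'a) module \<Rightarrow> bool" where
  "maximal_right_ideal I A \<longleftrightarrow> right_ideal I A \<and> I \<noteq> carrier A \<and>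
     (\<forall>J. right_ideal J A \<longrightarrow> I \<subseteq> J \<longrightarrow> J = I \<or> J = carrier A)"

text \<open>Jacobson radical.\<close>
definition rad :: "('k::field, 'a) module \<Rightarrow> 'a set" where
  "rad A = {x \<in> carrier A. \<forall>I. maximal_right_ideal I A \<longrightarrow> x \<in> I}"

text \<open>The ring \<open>k \<times> \<dots> \<times> k\<close> with \<open>r\<close> factors.\<close>
definition prod_ring :: "nat \<Rightarrow> (nat \<Rightarrow> 'k::field) ring" where
  "prod_ring r = \<lparr>carrier = {..<r} \<rightarrow>\<^sub>E UNIV,
     mult = (\<lambda>u v. \<lambda>i\<in>{..<r}. u i * v i), one = (\<lambda>i\<in>{..<r}. 1),
     zero = (\<lambda>i\<in>{..<r}. 0), add = (\<lambda>u v. \<lambda>i\<in>{..<r}. u i + v i)\<rparr>"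

text \<open>The second conjunct says that the ring isomorphism \<open>h\<close> is \<open>k\<close>-linear for the scalar
  multiplication of the quotient, \<open>c (x + rad A) = c x + rad A\<close>.\<close>
definition elementary :: "('k::field, 'a) module \<Rightarrow> bool" where
  "elementary A \<longleftrightarrow> (\<exists>r. \<exists>h \<in> ring_iso (A Quot (rad A)) (prod_ring r :: (nat \<Rightarrow> 'k) ring).
     \<forall>c. \<forall>x\<in>carrier A. h (rad A +>\<^bsub>A\<^esub> (c \<odot>\<^bsub>A\<^esub> x)) = (\<lambda>i\<in>{..<r}. c * h (rad A +>\<^bsub>A\<^esub> x) i))"

definition idempotent :: "('k::field, 'a) module \<Rightarrow> 'a \<Rightarrow> bool" where
  "idempotent A u \<longleftrightarrow> u \<in> carrier A \<and> u \<otimes>\<^bsub>A\<^esub> u = u"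

definition primitive_idempotent :: "('k::field, 'a) module \<Rightarrow> 'a \<Rightarrow> bool" where
  "primitive_idempotent A u \<longleftrightarrow> idempotent A u \<and> u \<noteq> \<zero>\<^bsub>A\<^esub> \<and>
     \<not> (\<exists>v w. idempotent A v \<and> idempotent A w \<and> v \<noteq> \<zero>\<^bsub>A\<^esub> \<and> w \<noteq> \<zero>\<^bsub>A\<^esub> \<and>
        v \<otimes>\<^bsub>A\<^esub> w = \<zero>\<^bsub>A\<^esub> \<and> w \<otimes>\<^bsub>A\<^esub> v = \<zero>\<^bsub>A\<^esub> \<and> u = v \<oplus>\<^bsub>A\<^esub> w)"

definition complete_idempotents :: "('k::field, 'a) module \<Rightarrow> 'a list \<Rightarrow> bool" where
  "complete_idempotents A es \<longleftrightarrow>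
     (\<forall>i<length es. primitive_idempotent A (es ! i)) \<and>
     (\<forall>i<length es. \<forall>j<length es. i \<noteq> j \<longrightarrow> es ! i \<otimes>\<^bsub>A\<^esub> es ! j = \<zero>\<^bsub>A\<^esub>) \<and>
     (\<Oplus>\<^bsub>A\<^esub>i\<in>{..<length es}. es ! i) = \<one>\<^bsub>A\<^esub>"

section \<open>Modules and bimodules\<close>

record ('k, 'v, 'a) rmod = "('k, 'v) module" +
  ract :: "'v \<Rightarrow> 'a \<Rightarrow> 'v"

record ('k, 'v, 'a, 'b) bimod = "('k, 'v, 'a) rmod" +
  lact :: "'b \<Rightarrow> 'v \<Rightarrow> 'v"

definition right_module :: "('k::field, 'a) module \<Rightarrow> ('k, 'v, 'a, 'z) rmod_scheme \<Rightarrow> bool" where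
  "right_module A M \<longleftrightarrow> vectorspace class_ring M \<and>
     (\<forall>x\<in>carrier M. \<forall>a\<in>carrier A. ract M x a \<in> carrier M) \<and>
     (\<forall>x\<in>carrier M. \<forall>y\<in>carrier M. \<forall>a\<in>carrier A.
        ract M (x \<oplus>\<^bsub>M\<^esub> y) a = ract M x a \<oplus>\<^bsub>M\<^esub> ract M y a) \<and>
     (\<forall>x\<in>carrier M. \<forall>a\<in>carrier A. \<forall>b\<in>carrier A.
        ract M x (a \<oplus>\<^bsub>A\<^esub> b) = ract M x a \<oplus>\<^bsub>M\<^esub> ract M x b) \<and>
     (\<forall>c. \<forall>x\<in>carrier M. \<forall>a\<in>carrier A.
        ract M (c \<odot>\<^bsub>M\<^esub> x) a = c \<odot>\<^bsub>M\<^esub> ract M x a \<and> ract M x (c \<odot>\<^bsub>A\<^esub> a) = c \<odot>\<^bsub>M\<^esub> ract M x a) \<and>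
     (\<forall>x\<in>carrier M. \<forall>a\<in>carrier A. \<forall>b\<in>carrier A.
        ract M x (a \<otimes>\<^bsub>A\<^esub> b) = ract M (ract M x a) b) \<and>
     (\<forall>x\<in>carrier M. ract M x \<one>\<^bsub>A\<^esub> = x)"

definition left_module :: "('k::field, 'b) module \<Rightarrow> ('k, 'v, 'a, 'b, 'z) bimod_scheme \<Rightarrow> bool" where
  "left_module B M \<longleftrightarrow> vectorspace class_ring M \<and>
     (\<forall>b\<in>carrier B. \<forall>x\<in>carrier M. lact M b x \<in> carrier M) \<and>
     (\<forall>b\<in>carrier B. \<forall>x\<in>carrier M. \<forall>y\<in>carrier M.
        lact M b (x \<oplus>\<^bsub>M\<^esub> y) = lact M b x \<oplus>\<^bsub>M\<^esub> lact M b y) \<and>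
     (\<forall>a\<in>carrier B. \<forall>b\<in>carrier B. \<forall>x\<in>carrier M.
        lact M (a \<oplus>\<^bsub>B\<^esub> b) x = lact M a x \<oplus>\<^bsub>M\<^esub> lact M b x) \<and>
     (\<forall>c. \<forall>b\<in>carrier B. \<forall>x\<in>carrier M.
        lact M b (c \<odot>\<^bsub>M\<^esub> x) = c \<odot>\<^bsub>M\<^esub> lact M b x \<and> lact M (c \<odot>\<^bsub>B\<^esub> b) x = c \<odot>\<^bsub>M\<^esub> lact M b x) \<and>
     (\<forall>a\<in>carrier B. \<forall>b\<in>carrier B. \<forall>x\<in>carrier M.
        lact M (a \<otimes>\<^bsub>B\<^esub> b) x = lact M a (lact M b x)) \<and>
     (\<forall>x\<in>carrier M. lact M \<one>\<^bsub>B\<^esub> x = x)"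

text \<open>\<open>B\<close>-\<open>A\<close>-bimodules. Both actions are bilinear for the same scalar multiplication on \<open>M\<close>,
  so \<open>k\<close> acts centrally.\<close>
definition bimodule ::
  "('k::field, 'b) module \<Rightarrow> ('k, 'a) module \<Rightarrow> ('k, 'v, 'a, 'b) bimod \<Rightarrow> bool" where
  "bimodule B A M \<longleftrightarrow> left_module B M \<and> right_module A M \<and>
     (\<forall>b\<in>carrier B. \<forall>x\<in>carrier M. \<forall>a\<in>carrier A.
        ract M (lact M b x) a = lact M b (ract M x a))"

definition fd_bimodule ::
  "('k::field, 'b) module \<Rightarrow> ('k, 'a) module \<Rightarrow> ('k, 'v, 'a, 'b) bimod \<Rightarrow> bool" where
  "fd_bimodule B A M \<longleftrightarrow> bimodule B A M \<and> vectorspace.fin_dim class_ring M"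

definition rmod_hom :: "('k::field, 'a) module \<Rightarrow> ('k, 'v, 'a, 'y) rmod_scheme \<Rightarrow>
    ('k, 'w, 'a, 'z) rmod_scheme \<Rightarrow> ('v \<Rightarrow> 'w) set" where
  "rmod_hom A M N = {f. f \<in> carrier M \<rightarrow> carrier N \<and>
     (\<forall>x\<in>carrier M. \<forall>y\<in>carrier M. f (x \<oplus>\<^bsub>M\<^esub> y) = f x \<oplus>\<^bsub>N\<^esub> f y) \<and>
     (\<forall>x\<in>carrier M. \<forall>a\<in>carrier A. f (ract M x a) = ract N (f x) a)}"

definition bimod_end :: "('k::field, 'b) module \<Rightarrow> ('k, 'a) module \<Rightarrow>
    ('k, 'v, 'a, 'b) bimod \<Rightarrow> ('v \<Rightarrow> 'v) set" where
  "bimod_end B A M = {f \<in> rmod_hom A M M.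
     \<forall>b\<in>carrier B. \<forall>x\<in>carrier M. f (lact M b x) = lact M b (f x)}"

text \<open>Elements of \<open>Hom\<^sub>A(M, N)\<close> are made extensional, so that equal maps are equal functions.\<close>
definition hom_space :: "('k::field, 'a) module \<Rightarrow> ('k, 'v, 'a, 'y) rmod_scheme \<Rightarrow>
    ('k, 'w, 'a, 'z) rmod_scheme \<Rightarrow> ('k, 'v \<Rightarrow> 'w) module" where
  "hom_space A M N = \<lparr>carrier = rmod_hom A M N \<inter> extensional (carrier M),
     mult = undefined, one = undefined,
     zero = (\<lambda>x\<in>carrier M. \<zero>\<^bsub>N\<^esub>),
     add = (\<lambda>f g. \<lambda>x\<in>carrier M. f x \<oplus>\<^bsub>N\<^esub> g x),
     smult = (\<lambda>c f. \<lambda>x\<in>carrier M. c \<odot>\<^bsub>N\<^esub> f x)\<rparr>"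

text \<open>The right ideal \<open>u A\<close> as a right \<open>A\<close>-module.\<close>
definition principal :: "('k::field, 'a) module \<Rightarrow> 'a \<Rightarrow> ('k, 'a, 'a) rmod" where
  "principal A u = \<lparr>carrier = {u \<otimes>\<^bsub>A\<^esub> a | a. a \<in> carrier A},
     mult = undefined, one = undefined, zero = \<zero>\<^bsub>A\<^esub>, add = add A, smult = smult A,
     ract = mult A\<rparr>"

section \<open>Cartan matrix\<close>

definition cartan :: "('k::field, 'a) module \<Rightarrow> 'a list \<Rightarrow> int mat" where
  "cartan A es = mat (length es) (length es) (\<lambda>(i, j).
     int (vectorspace.dim class_ring
       (hom_space A (principal A (es ! i)) (principal A (es ! j)))))"

definition mat_inv :: "int mat \<Rightarrow> int mat" where
  "mat_inv C = (THE X. X \<in> carrier_mat (dim_row C) (dim_row C) \<and>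
     inverts_mat C X \<and> inverts_mat X C)"

text \<open>\<open>C\<^sub>A\<close> is inverted over the integers, and only then are the entries mapped to \<open>k\<close>.\<close>
definition cartan_inv :: "('k::field, 'a) module \<Rightarrow> 'a list \<Rightarrow> 'k mat" where
  "cartan_inv A es = map_mat of_int (mat_inv (cartan A es))"

definition euler_form ::
  "('k::field, 'a) module \<Rightarrow> 'a list \<Rightarrow> 'k mat \<Rightarrow> 'k mat \<Rightarrow> 'k mat" where
  "euler_form A es x y = transpose_mat x * transpose_mat (cartan_inv A es) * y"

definition euler_form_op ::
  "('k::field, 'a) module \<Rightarrow> 'a list \<Rightarrow> 'k mat \<Rightarrow> 'k mat \<Rightarrow> 'k mat" where
  "euler_form_op A es x y = transpose_mat x * cartan_inv A es * y"

section \<open>Traces\<close>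

definition coords :: "('k::field, 'v, 'z) module_scheme \<Rightarrow> 'v set \<Rightarrow> 'v \<Rightarrow> 'v \<Rightarrow> 'k" where
  "coords V S v = (THE c. c \<in> S \<rightarrow>\<^sub>E UNIV \<and> module.lincomb V c S = v)"

definition lin_trace :: "('k::field, 'v, 'z) module_scheme \<Rightarrow> ('v \<Rightarrow> 'v) \<Rightarrow> 'k" where
  "lin_trace V f = (let S = (SOME S. finite S \<and> vectorspace.basis class_ring V S)
     in \<Sum>v\<in>S. coords V S (f v) v)"

text \<open>For an \<open>S\<close>-\<open>R\<close>-bimodule \<open>X\<close> with idempotents \<open>rs\<close> of \<open>R\<close> and \<open>ss\<close> of \<open>S\<close>.\<close>
definition trace_matrix ::
  "'r list \<Rightarrow> 's list \<Rightarrow> ('k::field, 'v, 'r, 's) bimod \<Rightarrow> ('v \<Rightarrow> 'v) \<Rightarrow> 'k mat" where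
  "trace_matrix rs ss X \<theta> = mat (length rs) (length ss) (\<lambda>(i, j).
     lin_trace (X\<lparr>carrier := {lact X (ss ! j) (ract X x (rs ! i)) | x. x \<in> carrier X}\<rparr>) \<theta>)"

section \<open>Projective resolutions and global dimension\<close>

definition free_rmod :: "('k::field, 'a) module \<Rightarrow> 'i set \<Rightarrow> ('k, 'i \<Rightarrow> 'a, 'a) rmod" where
  "free_rmod A I = \<lparr>carrier = {x. (\<forall>i\<in>I. x i \<in> carrier A) \<and> (\<forall>i. i \<notin> I \<longrightarrow> x i = \<zero>\<^bsub>A\<^esub>) \<and>
       finite {i. x i \<noteq> \<zero>\<^bsub>A\<^esub>}},
     mult = undefined, one = undefined, zero = (\<lambda>i. \<zero>\<^bsub>A\<^esub>),
     add = (\<lambda>x y i. x i \<oplus>\<^bsub>A\<^esub> y i), smult = (\<lambda>c x i. c \<odot>\<^bsub>A\<^esub> x i),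
     ract = (\<lambda>x a i. x i \<otimes>\<^bsub>A\<^esub> a)\<rparr>"

text \<open>Direct summand of a free module. Index sets in the type of the elements of \<open>P\<close> suffice, since
  every module is a quotient of the free module on its own carrier.\<close>
definition projective :: "('k::field, 'a) module \<Rightarrow> ('k, 'p, 'a, 'z) rmod_scheme \<Rightarrow> bool" where
  "projective A P \<longleftrightarrow> right_module A P \<and>
     (\<exists>(I :: 'p set). \<exists>s\<in>rmod_hom A P (free_rmod A I). \<exists>q\<in>rmod_hom A (free_rmod A I) P.
        \<forall>x\<in>carrier P. q (s x) = x)"

text \<open>\<open>\<dots> \<rightarrow> obj 1 \<rightarrow> obj 0 \<rightarrow> M \<rightarrow> 0\<close>, with \<open>bd l\<close> going from \<open>obj (l + 1)\<close> to \<open>obj l\<close>.\<close>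
record ('k, 'p, 'a, 'm) resolution =
  obj :: "nat \<Rightarrow> ('k, 'p, 'a) rmod"
  bd :: "nat \<Rightarrow> 'p \<Rightarrow> 'p"
  aug :: "'p \<Rightarrow> 'm"

definition projective_resolution :: "('k::field, 'a) module \<Rightarrow> ('k, 'm, 'a, 'z) rmod_scheme \<Rightarrow>
    ('k, 'p, 'a, 'm) resolution \<Rightarrow> bool" where
  "projective_resolution A M P \<longleftrightarrow>
     (\<forall>l. projective A (obj P l)) \<and>
     (\<forall>l. bd P l \<in> rmod_hom A (obj P (Suc l)) (obj P l)) \<and>
     aug P \<in> rmod_hom A (obj P 0) M \<and>
     aug P ` carrier (obj P 0) = carrier M \<and>
     bd P 0 ` carrier (obj P 1) = {x \<in> carrier (obj P 0). aug P x = \<zero>\<^bsub>M\<^esub>} \<and>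
     (\<forall>l. bd P (Suc l) ` carrier (obj P (Suc (Suc l))) =
        {x \<in> carrier (obj P (Suc l)). bd P l x = \<zero>\<^bsub>obj P l\<^esub>})"

text \<open>
  There is a common bound on the lengths of projective resolutions of right modules. The modules and
  the terms of the resolutions are taken with elements in \<open>nat \<Rightarrow> 'a\<close>. This is no restriction: up to
  isomorphism this type contains every finitely generated module (indeed every module of at most its
  cardinality) and, with a module, also the free modules and syzygies of its free resolutions; and
  the global dimension is attained on cyclic modules by Auslander's theorem.
\<close>
definition finite_gldim :: "('k::field, 'a) module \<Rightarrow> bool" where
  "finite_gldim A \<longleftrightarrow> (\<exists>d. \<forall>(M :: ('k, nat \<Rightarrow> 'a, 'a) rmod). right_module A M \<longrightarrow>
     (\<exists>(P :: ('k, nat \<Rightarrow> 'a, 'a, nat \<Rightarrow> 'a) resolution). projective_resolution A M P \<and>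
        (\<forall>l>d. carrier (obj P l) = {\<zero>\<^bsub>obj P l\<^esub>})))"

text \<open>A chain map over \<open>\<phi> : M \<rightarrow> M\<close>; it is unique up to homotopy.\<close>
definition chain_lift :: "('k::field, 'a) module \<Rightarrow> ('k, 'p, 'a, 'm) resolution \<Rightarrow>
    ('m \<Rightarrow> 'm) \<Rightarrow> nat \<Rightarrow> 'p \<Rightarrow> 'p" where
  "chain_lift A P \<phi> = (SOME \<Phi>.
     (\<forall>l. \<Phi> l \<in> rmod_hom A (obj P l) (obj P l)) \<and>
     (\<forall>x\<in>carrier (obj P 0). aug P (\<Phi> 0 x) = \<phi> (aug P x)) \<and>
     (\<forall>l. \<forall>x\<in>carrier (obj P (Suc l)). bd P l (\<Phi> (Suc l) x) = \<Phi> l (bd P l x)))"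

section \<open>Quotient spaces\<close>

definition quot_space :: "('k::field, 'v, 'z) module_scheme \<Rightarrow> 'v set \<Rightarrow> ('k, 'v set) module" where
  "quot_space V W = \<lparr>carrier = a_rcosets\<^bsub>V\<^esub> W,
     mult = undefined, one = undefined, zero = W, add = set_add V,
     smult = (\<lambda>c X. W <+>\<^bsub>V\<^esub> (\<lambda>x. c \<odot>\<^bsub>V\<^esub> x) ` X)\<rparr>"

text \<open>For linear \<open>f\<close> from a space containing \<open>U\<close> to \<open>V\<close> with \<open>f(U) \<subseteq> W\<close>, this maps the coset
  \<open>U + x\<close> to \<open>W + f x\<close>.\<close>
definition quot_map :: "('k::field, 'v, 'z) module_scheme \<Rightarrow> 'v set \<Rightarrow> ('u \<Rightarrow> 'v) \<Rightarrow>
    'u set \<Rightarrow> 'v set" where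
  "quot_map V W f X = W <+>\<^bsub>V\<^esub> f ` X"

section \<open>Ext\<close>

text \<open>Cohomology of the complex \<open>Hom\<^sub>A(P, N)\<close>.\<close>

definition ext_cocycles :: "('k::field, 'a) module \<Rightarrow> ('k, 'p, 'a, 'm) resolution \<Rightarrow>
    ('k, 'n, 'a, 'z) rmod_scheme \<Rightarrow> nat \<Rightarrow> ('p \<Rightarrow> 'n) set" where
  "ext_cocycles A P N l = {z \<in> carrier (hom_space A (obj P l) N).
     \<forall>x\<in>carrier (obj P (Suc l)). z (bd P l x) = \<zero>\<^bsub>N\<^esub>}"

definition ext_coboundaries :: "('k::field, 'a) module \<Rightarrow> ('k, 'p, 'a, 'm) resolution \<Rightarrow>
    ('k, 'n, 'a, 'z) rmod_scheme \<Rightarrow> nat \<Rightarrow> ('p \<Rightarrow> 'n) set" where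
  "ext_coboundaries A P N l = (case l of
     0 \<Rightarrow> {\<zero>\<^bsub>hom_space A (obj P 0) N\<^esub>}
   | Suc j \<Rightarrow> (\<lambda>z. \<lambda>x\<in>carrier (obj P (Suc j)). z (bd P j x)) ` carrier (hom_space A (obj P j) N))"

definition ext_space :: "('k::field, 'a) module \<Rightarrow> ('k, 'p, 'a, 'm) resolution \<Rightarrow>
    ('k, 'n, 'a, 'z) rmod_scheme \<Rightarrow> nat \<Rightarrow> ('k, ('p \<Rightarrow> 'n) set) module" where
  "ext_space A P N l =
     quot_space ((hom_space A (obj P l) N)\<lparr>carrier := ext_cocycles A P N l\<rparr>) (ext_coboundaries A P N l)"

text \<open>\<open>Ext\<^sup>l(\<phi>, \<psi>)\<close>: the class of \<open>z\<close> goes to the class of \<open>\<psi> \<circ> z \<circ> \<Phi>\<^sub>l\<close>, with \<open>\<Phi>\<close> a lift of \<open>\<phi>\<close>.\<close>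
definition ext_map :: "('k::field, 'a) module \<Rightarrow> ('k, 'p, 'a, 'm) resolution \<Rightarrow>
    ('k, 'n, 'a, 'z) rmod_scheme \<Rightarrow> ('m \<Rightarrow> 'm) \<Rightarrow> ('n \<Rightarrow> 'n) \<Rightarrow> nat \<Rightarrow>
    ('p \<Rightarrow> 'n) set \<Rightarrow> ('p \<Rightarrow> 'n) set" where
  "ext_map A P N \<phi> \<psi> l = quot_map (hom_space A (obj P l) N) (ext_coboundaries A P N l)
     (\<lambda>z. \<lambda>x\<in>carrier (obj P l). \<psi> (z (chain_lift A P \<phi> l x)))"

text \<open>\<open>Ext\<^sup>l\<^sub>A(M, N)\<close>, computed from the projective resolution \<open>P\<close> of \<open>M\<close>, for a \<open>B\<close>-\<open>A\<close>-bimodule \<open>M\<close>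
  and a \<open>C\<close>-\<open>A\<close>-bimodule \<open>N\<close>. It is a \<open>C\<close>-\<open>B\<close>-bimodule by functoriality.\<close>
definition Ext :: "('k::field, 'a) module \<Rightarrow> ('k, 'p, 'a, 'm) resolution \<Rightarrow>
    ('k, 'm, 'a, 'b) bimod \<Rightarrow> ('k, 'n, 'a, 'c) bimod \<Rightarrow> nat \<Rightarrow>
    ('k, ('p \<Rightarrow> 'n) set, 'b, 'c) bimod" where
  "Ext A P M N l = \<lparr>carrier = carrier (ext_space A P N l),
     mult = undefined, one = undefined,
     zero = zero (ext_space A P N l), add = add (ext_space A P N l),
     smult = smult (ext_space A P N l),
     ract = (\<lambda>X b. ext_map A P N (lact M b) (\<lambda>y. y) l X),
     lact = (\<lambda>c X. ext_map A P N (\<lambda>x. x) (lact N c) l X)\<rparr>"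

section \<open>Tensor products and Tor\<close>

text \<open>The vector space with basis \<open>carrier P \<times> carrier N\<close>.\<close>
definition free_pairs :: "('k::field, 'p, 'y) module_scheme \<Rightarrow> ('k, 'n, 'z) module_scheme \<Rightarrow>
    ('k, 'p \<times> 'n \<Rightarrow> 'k) module" where
  "free_pairs P N = \<lparr>carrier = {h. finite {t. h t \<noteq> 0} \<and> {t. h t \<noteq> 0} \<subseteq> carrier P \<times> carrier N},
     mult = undefined, one = undefined, zero = (\<lambda>t. 0),
     add = (\<lambda>h h' t. h t + h' t), smult = (\<lambda>c h t. c * h t)\<rparr>"

definition pair_vec :: "'p \<Rightarrow> 'n \<Rightarrow> 'p \<times> 'n \<Rightarrow> 'k::field" where
  "pair_vec x y = (\<lambda>t. if t = (x, y) then 1 else 0)"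

definition tensor_rels :: "('k::field, 'a) module \<Rightarrow> ('k, 'p, 'a, 'y) rmod_scheme \<Rightarrow>
    ('k, 'n, 'c, 'a, 'z) bimod_scheme \<Rightarrow> ('p \<times> 'n \<Rightarrow> 'k) set" where
  "tensor_rels A P N =
     {\<lambda>t. pair_vec (x \<oplus>\<^bsub>P\<^esub> x') y t - pair_vec x y t - pair_vec x' y t | x x' y.
        x \<in> carrier P \<and> x' \<in> carrier P \<and> y \<in> carrier N} \<union>
     {\<lambda>t. pair_vec x (y \<oplus>\<^bsub>N\<^esub> y') t - pair_vec x y t - pair_vec x y' t | x y y'.
        x \<in> carrier P \<and> y \<in> carrier N \<and> y' \<in> carrier N} \<union>
     {\<lambda>t. pair_vec (ract P x a) y t - pair_vec x (lact N a y) t | x a y.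
        x \<in> carrier P \<and> a \<in> carrier A \<and> y \<in> carrier N} \<union>
     {\<lambda>t. pair_vec (c \<odot>\<^bsub>P\<^esub> x) y t - c * pair_vec x y t | c x y.
        x \<in> carrier P \<and> y \<in> carrier N}"

definition tensor_null :: "('k::field, 'a) module \<Rightarrow> ('k, 'p, 'a, 'y) rmod_scheme \<Rightarrow>
    ('k, 'n, 'c, 'a, 'z) bimod_scheme \<Rightarrow> ('p \<times> 'n \<Rightarrow> 'k) set" where
  "tensor_null A P N = LinearCombinations.module.span class_ring (free_pairs P N) (tensor_rels A P N)"

definition tensor :: "('k::field, 'a) module \<Rightarrow> ('k, 'p, 'a, 'y) rmod_scheme \<Rightarrow>
    ('k, 'n, 'c, 'a, 'z) bimod_scheme \<Rightarrow> ('k, ('p \<times> 'n \<Rightarrow> 'k) set) module" where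
  "tensor A P N = quot_space (free_pairs P N) (tensor_null A P N)"

text \<open>The linear map with \<open>(x, y) \<mapsto> (f x, g y)\<close> on basis elements.\<close>
definition free_pairs_map :: "('p \<Rightarrow> 'q) \<Rightarrow> ('n \<Rightarrow> 'r) \<Rightarrow> ('p \<times> 'n \<Rightarrow> 'k::field) \<Rightarrow> 'q \<times> 'r \<Rightarrow> 'k" where
  "free_pairs_map f g h = (\<lambda>t. \<Sum>s\<in>{s. h s \<noteq> 0 \<and> map_prod f g s = t}. h s)"

text \<open>\<open>f \<otimes> g\<close> with target \<open>Q \<otimes>\<^sub>A N\<close>.\<close>
definition tensor_map :: "('k::field, 'a) module \<Rightarrow> ('k, 'q, 'a, 'y) rmod_scheme \<Rightarrow>
    ('k, 'r, 'c, 'a, 'z) bimod_scheme \<Rightarrow> ('p \<Rightarrow> 'q) \<Rightarrow> ('n \<Rightarrow> 'r) \<Rightarrow>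
    ('p \<times> 'n \<Rightarrow> 'k) set \<Rightarrow> ('q \<times> 'r \<Rightarrow> 'k) set" where
  "tensor_map A Q N f g = quot_map (free_pairs Q N) (tensor_null A Q N) (free_pairs_map f g)"

text \<open>Homology of the complex \<open>P \<otimes>\<^sub>A N\<close>.\<close>

definition tor_cycles :: "('k::field, 'a) module \<Rightarrow> ('k, 'p, 'a, 'm) resolution \<Rightarrow>
    ('k, 'n, 'c, 'a, 'z) bimod_scheme \<Rightarrow> nat \<Rightarrow> ('p \<times> 'n \<Rightarrow> 'k) set set" where
  "tor_cycles A P N l = (case l of
     0 \<Rightarrow> carrier (tensor A (obj P 0) N)
   | Suc j \<Rightarrow> {X \<in> carrier (tensor A (obj P (Suc j)) N).
       tensor_map A (obj P j) N (bd P j) (\<lambda>y. y) X = \<zero>\<^bsub>tensor A (obj P j) N\<^esub>})"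

definition tor_boundaries :: "('k::field, 'a) module \<Rightarrow> ('k, 'p, 'a, 'm) resolution \<Rightarrow>
    ('k, 'n, 'c, 'a, 'z) bimod_scheme \<Rightarrow> nat \<Rightarrow> ('p \<times> 'n \<Rightarrow> 'k) set set" where
  "tor_boundaries A P N l =
     tensor_map A (obj P l) N (bd P l) (\<lambda>y. y) ` carrier (tensor A (obj P (Suc l)) N)"

definition tor_space :: "('k::field, 'a) module \<Rightarrow> ('k, 'p, 'a, 'm) resolution \<Rightarrow>
    ('k, 'n, 'c, 'a, 'z) bimod_scheme \<Rightarrow> nat \<Rightarrow> ('k, ('p \<times> 'n \<Rightarrow> 'k) set set) module" where
  "tor_space A P N l =
     quot_space ((tensor A (obj P l) N)\<lparr>carrier := tor_cycles A P N l\<rparr>) (tor_boundaries A P N l)"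

definition tor_map :: "('k::field, 'a) module \<Rightarrow> ('k, 'p, 'a, 'm) resolution \<Rightarrow>
    ('k, 'n, 'c, 'a, 'z) bimod_scheme \<Rightarrow> ('m \<Rightarrow> 'm) \<Rightarrow> ('n \<Rightarrow> 'n) \<Rightarrow> nat \<Rightarrow>
    ('p \<times> 'n \<Rightarrow> 'k) set set \<Rightarrow> ('p \<times> 'n \<Rightarrow> 'k) set set" where
  "tor_map A P N \<phi> \<psi> l = quot_map (tensor A (obj P l) N) (tor_boundaries A P N l)
     (tensor_map A (obj P l) N (chain_lift A P \<phi> l) \<psi>)"

text \<open>\<open>Tor\<^sup>A\<^sub>l(M, N)\<close>, computed from the projective resolution \<open>P\<close> of \<open>M\<close>, for a \<open>B\<close>-\<open>A\<close>-bimodule \<open>M\<close>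
  and an \<open>A\<close>-\<open>C\<close>-bimodule \<open>N\<close>. It is a \<open>B\<close>-\<open>C\<close>-bimodule by functoriality.\<close>
definition Tor :: "('k::field, 'a) module \<Rightarrow> ('k, 'p, 'a, 'm) resolution \<Rightarrow>
    ('k, 'm, 'a, 'b) bimod \<Rightarrow> ('k, 'n, 'c, 'a) bimod \<Rightarrow> nat \<Rightarrow>
    ('k, ('p \<times> 'n \<Rightarrow> 'k) set set, 'c, 'b) bimod" where
  "Tor A P M N l = \<lparr>carrier = carrier (tor_space A P N l),
     mult = undefined, one = undefined,
     zero = zero (tor_space A P N l), add = add (tor_space A P N l),
     smult = smult (tor_space A P N l),
     ract = (\<lambda>X c. tor_map A P N (\<lambda>x. x) (\<lambda>y. ract N y c) l X),
     lact = (\<lambda>b X. tor_map A P N (lact M b) (\<lambda>y. y) l X)\<rparr>"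

section \<open>Alternating sums of trace matrices\<close>

text \<open>What is needed for \<open>\<Sum>\<^sub>l (-1)\<^sup>l tr \<theta>\<^sub>l\<close> to make sense for endomorphisms of the \<open>X\<^sub>l\<close>.\<close>
definition fd_total :: "(nat \<Rightarrow> ('k::field, 'v, 'r, 's) bimod) \<Rightarrow> bool" where
  "fd_total X \<longleftrightarrow> (\<forall>l. vectorspace.fin_dim class_ring (X l)) \<and>
     finite {l. carrier (X l) \<noteq> {\<zero>\<^bsub>X l\<^esub>}}"

definition alt_trace_matrix :: "'r list \<Rightarrow> 's list \<Rightarrow> (nat \<Rightarrow> ('k::field, 'v, 'r, 's) bimod) \<Rightarrow>
    (nat \<Rightarrow> 'v \<Rightarrow> 'v) \<Rightarrow> 'k mat" where
  "alt_trace_matrix rs ss X \<theta> = mat (length rs) (length ss) (\<lambda>ij.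
     \<Sum>l | carrier (X l) \<noteq> {\<zero>\<^bsub>X l\<^esub>}. (- 1) ^ l * trace_matrix rs ss (X l) (\<theta> l) $$ ij)"

end

theory Submission
  imports Defs
begin

text \<open>
  Since \<open>A\<close> has finite global dimension, \<open>M\<close> has a finite resolution \<open>Q\<close> by finitely generated
  projectives. It is homotopy equivalent to the given resolution, and the idempotents \<open>f\<^sub>i\<close>, \<open>g\<^sub>k\<close> cutting
  out the entries of the trace matrices are absorbed into \<open>\<phi>\<close> and \<open>\<psi>\<close>; so both sides can be computed on \<open>Q\<close>.
  On a projective with dual basis \<open>(q\<^sub>i, S\<^sub>i)\<close> the map \<open>z \<mapsto> \<psi> \<circ> z \<circ> \<Phi>\<close> of \<open>Hom\<^sub>A(Q, N)\<close> has trace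
  \<open>\<Sum>\<^sub>i tr(y \<mapsto> \<psi>(y a\<^sub>i))\<close> with \<open>a\<^sub>i = S\<^sub>i(\<Phi> q\<^sub>i)\<close>. The functional \<open>a \<mapsto> tr(y \<mapsto> \<psi>(y a))\<close> kills nilpotent elements,
  so on \<open>a\<close> it equals \<open>\<Sum>\<^sub>j \<chi>\<^sub>j(a) tr(y \<mapsto> \<psi>(y e\<^sub>j))\<close> for the characters \<open>\<chi>\<^sub>j\<close> of \<open>A/rad A\<close>; likewise for
  tensor products. Hence only the numbers \<open>t\<^sub>j = \<Sum>\<^sub>l (-1)\<^sup>l \<Sum>\<^sub>i \<chi>\<^sub>j(a\<^sub>i)\<close> matter. The same computation for the
  traces of \<open>\<phi>\<close> on \<open>M e\<^sub>a\<close> gives \<open>tr(\<phi>|M e\<^sub>a) = \<Sum>\<^sub>j dim(e\<^sub>j A e\<^sub>a) t\<^sub>j\<close>, which the inverse of the Cartan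
  matrix solves for \<open>t\<close>.
\<close>

text \<open>The given resolution may be infinitely long, with terms of infinite dimension. Traces
  then make sense on its cohomology but not on its terms; hence the detour through \<open>Q\<close>,
  and hence finiteness (\<open>fd_total\<close>) is part of the claim. The hypothesis on global
  dimension speaks of modules with elements in \<open>nat \<Rightarrow> 'a\<close>, while
  \<open>M\<close> lives in an arbitrary type. It is therefore applied to the kernel of a free cover
  of \<open>M\<close>, which sits in a free module of finite rank and so in that type.

  Each character is a coordinate of \<open>A/rad A\<close> at which its idempotent does not vanish.
  No bijection between idempotents and factors \<open>k\<close> is set up: orthogonality alone makes
  the values at the \<open>e j\<close> a Kronecker delta.

  Invertibility of the Cartan matrix over the integers is proved on the way, from finite resolutions
  of one-dimensional modules. For this the relation between projectives and Cartan entries is needed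
  a second time, for dimensions instead of traces; there left ideals are filtered with
  one-dimensional factors.\<close>

abbreviation vsp :: "('k::field, 'v, 'z) module_scheme \<Rightarrow> bool" where
  "vsp V \<equiv> vectorspace class_ring V"

abbreviation fd :: "('k::field, 'v, 'z) module_scheme \<Rightarrow> bool" where
  "fd V \<equiv> vectorspace.fin_dim class_ring V"

abbreviation vdim :: "('k::field, 'v, 'z) module_scheme \<Rightarrow> nat" where
  "vdim V \<equiv> vectorspace.dim class_ring V"

abbreviation lin :: "('k::field, 'v, 'y) module_scheme \<Rightarrow> ('k, 'w, 'z) module_scheme \<Rightarrow> ('v \<Rightarrow> 'w) set" where
  "lin V W \<equiv> LinearCombinations.module_hom class_ring V W"

abbreviation zero_space :: "('k::field, 'v, 'z) module_scheme \<Rightarrow> bool" where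
  "zero_space V \<equiv> carrier V = {\<zero>\<^bsub>V\<^esub>}"

section \<open>Vector spaces over the ground field as records, and linear maps\<close>

lemma vspI:
  fixes V :: "('k::field, 'v, 'z) module_scheme"
  assumes "\<zero>\<^bsub>V\<^esub> \<in> carrier V"
    and "\<And>x y. x \<in> carrier V \<Longrightarrow> y \<in> carrier V \<Longrightarrow> x \<oplus>\<^bsub>V\<^esub> y \<in> carrier V"
    and "\<And>c x. x \<in> carrier V \<Longrightarrow> c \<odot>\<^bsub>V\<^esub> x \<in> carrier V"
    and "\<And>x y. x \<in> carrier V \<Longrightarrow> y \<in> carrier V \<Longrightarrow> x \<oplus>\<^bsub>V\<^esub> y = y \<oplus>\<^bsub>V\<^esub> x"
    and "\<And>x y z. x \<in> carrier V \<Longrightarrow> y \<in> carrier V \<Longrightarrow> z \<in> carrier V \<Longrightarrow>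
      (x \<oplus>\<^bsub>V\<^esub> y) \<oplus>\<^bsub>V\<^esub> z = x \<oplus>\<^bsub>V\<^esub> (y \<oplus>\<^bsub>V\<^esub> z)"
    and "\<And>x. x \<in> carrier V \<Longrightarrow> x \<oplus>\<^bsub>V\<^esub> \<zero>\<^bsub>V\<^esub> = x"
    and "\<And>x. x \<in> carrier V \<Longrightarrow> x \<oplus>\<^bsub>V\<^esub> ((- 1) \<odot>\<^bsub>V\<^esub> x) = \<zero>\<^bsub>V\<^esub>"
    and "\<And>c d x. x \<in> carrier V \<Longrightarrow> (c * d) \<odot>\<^bsub>V\<^esub> x = c \<odot>\<^bsub>V\<^esub> (d \<odot>\<^bsub>V\<^esub> x)"
    and "\<And>x. x \<in> carrier V \<Longrightarrow> 1 \<odot>\<^bsub>V\<^esub> x = x"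
    and "\<And>c d x. x \<in> carrier V \<Longrightarrow> (c + d) \<odot>\<^bsub>V\<^esub> x = (c \<odot>\<^bsub>V\<^esub> x) \<oplus>\<^bsub>V\<^esub> (d \<odot>\<^bsub>V\<^esub> x)"
    and "\<And>c x y. x \<in> carrier V \<Longrightarrow> y \<in> carrier V \<Longrightarrow>
      c \<odot>\<^bsub>V\<^esub> (x \<oplus>\<^bsub>V\<^esub> y) = (c \<odot>\<^bsub>V\<^esub> x) \<oplus>\<^bsub>V\<^esub> (c \<odot>\<^bsub>V\<^esub> y)"
  shows "vsp V"
proof (rule vs_criteria[OF class_field])
  show "\<forall>v\<in>carrier V. \<exists>neg_v\<in>carrier V. v \<oplus>\<^bsub>V\<^esub> neg_v = \<zero>\<^bsub>V\<^esub>"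
    using assms(3,7) by blast
qed (use assms in auto)

context
  fixes V :: "('k::field, 'v, 'z) module_scheme"
  assumes V: "vsp V"
begin

interpretation V: vectorspace class_ring V by (rule V)

lemma vsp_abelian_monoid: "abelian_monoid V" by unfold_locales
lemma vsp_module: "Module.module class_ring V" by unfold_locales

lemma vs_zero [simp, intro]: "\<zero>\<^bsub>V\<^esub> \<in> carrier V" by simp
lemma vs_add [simp, intro]: "x \<in> carrier V \<Longrightarrow> y \<in> carrier V \<Longrightarrow> x \<oplus>\<^bsub>V\<^esub> y \<in> carrier V" by simp
lemma vs_minus [simp, intro]: "x \<in> carrier V \<Longrightarrow> y \<in> carrier V \<Longrightarrow> x \<ominus>\<^bsub>V\<^esub> y \<in> carrier V" by simp
lemma vs_smult [simp, intro]: "x \<in> carrier V \<Longrightarrow> c \<odot>\<^bsub>V\<^esub> x \<in> carrier V"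
  using V.smult_closed[of c x] by simp
lemma vs_finsum [simp, intro]: "g \<in> I \<rightarrow> carrier V \<Longrightarrow> finsum V g I \<in> carrier V"
  by (rule V.finsum_closed)

lemma vs_add_zero [simp]: "x \<in> carrier V \<Longrightarrow> x \<oplus>\<^bsub>V\<^esub> \<zero>\<^bsub>V\<^esub> = x" by simp
lemma vs_zero_add [simp]: "x \<in> carrier V \<Longrightarrow> \<zero>\<^bsub>V\<^esub> \<oplus>\<^bsub>V\<^esub> x = x" by simp
lemma vs_zero_smult [simp]: "x \<in> carrier V \<Longrightarrow> 0 \<odot>\<^bsub>V\<^esub> x = \<zero>\<^bsub>V\<^esub>"
  using V.smult_l_null[of x] by simp
lemma vs_smult_zero [simp]: "c \<odot>\<^bsub>V\<^esub> \<zero>\<^bsub>V\<^esub> = \<zero>\<^bsub>V\<^esub>"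
  using V.smult_r_null[of c] by simp
lemma vs_one_smult [simp]: "x \<in> carrier V \<Longrightarrow> 1 \<odot>\<^bsub>V\<^esub> x = x"
  using V.smult_one[of x] by simp
lemma vs_smult_smult: "x \<in> carrier V \<Longrightarrow> (c * d) \<odot>\<^bsub>V\<^esub> x = c \<odot>\<^bsub>V\<^esub> (d \<odot>\<^bsub>V\<^esub> x)"
  using V.smult_assoc1[of c d x] by simp
lemma vs_smult_l_distr: "x \<in> carrier V \<Longrightarrow> (c + d) \<odot>\<^bsub>V\<^esub> x = (c \<odot>\<^bsub>V\<^esub> x) \<oplus>\<^bsub>V\<^esub> (d \<odot>\<^bsub>V\<^esub> x)"
  using V.smult_l_distr[of c d x] by simp
lemma vs_smult_r_distr: "x \<in> carrier V \<Longrightarrow> y \<in> carrier V \<Longrightarrow>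
    c \<odot>\<^bsub>V\<^esub> (x \<oplus>\<^bsub>V\<^esub> y) = (c \<odot>\<^bsub>V\<^esub> x) \<oplus>\<^bsub>V\<^esub> (c \<odot>\<^bsub>V\<^esub> y)"
  using V.smult_r_distr[of c x y] by simp
lemma vs_neg_eq: "x \<in> carrier V \<Longrightarrow> \<ominus>\<^bsub>V\<^esub> x = (- 1) \<odot>\<^bsub>V\<^esub> x"
  using V.smult_minus_1[of x] by (simp add: class_ring_simps)
lemma vs_minus_eq: "x \<in> carrier V \<Longrightarrow> y \<in> carrier V \<Longrightarrow> x \<ominus>\<^bsub>V\<^esub> y = x \<oplus>\<^bsub>V\<^esub> ((- 1) \<odot>\<^bsub>V\<^esub> y)"
  by (simp add: a_minus_def vs_neg_eq)
lemma vs_add_comm: "x \<in> carrier V \<Longrightarrow> y \<in> carrier V \<Longrightarrow> x \<oplus>\<^bsub>V\<^esub> y = y \<oplus>\<^bsub>V\<^esub> x"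
  by (rule V.a_comm)
lemma vs_add_assoc: "x \<in> carrier V \<Longrightarrow> y \<in> carrier V \<Longrightarrow> z \<in> carrier V \<Longrightarrow>
    (x \<oplus>\<^bsub>V\<^esub> y) \<oplus>\<^bsub>V\<^esub> z = x \<oplus>\<^bsub>V\<^esub> (y \<oplus>\<^bsub>V\<^esub> z)"
  by (rule V.a_assoc)
lemma vs_add_left_comm: "x \<in> carrier V \<Longrightarrow> y \<in> carrier V \<Longrightarrow> z \<in> carrier V \<Longrightarrow>
    x \<oplus>\<^bsub>V\<^esub> (y \<oplus>\<^bsub>V\<^esub> z) = y \<oplus>\<^bsub>V\<^esub> (x \<oplus>\<^bsub>V\<^esub> z)"
  by (rule V.a_lcomm)
lemmas vs_ac = vs_add_assoc vs_add_comm vs_add_left_comm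
lemma vs_minus_self [simp]: "x \<in> carrier V \<Longrightarrow> x \<ominus>\<^bsub>V\<^esub> x = \<zero>\<^bsub>V\<^esub>"
  by (simp add: V.r_neg a_minus_def)
lemma vs_minus_zero_iff: "x \<in> carrier V \<Longrightarrow> y \<in> carrier V \<Longrightarrow> x \<ominus>\<^bsub>V\<^esub> y = \<zero>\<^bsub>V\<^esub> \<longleftrightarrow> x = y"
proof
  assume xy: "x \<in> carrier V" "y \<in> carrier V" "x \<ominus>\<^bsub>V\<^esub> y = \<zero>\<^bsub>V\<^esub>"
  then have "x \<oplus>\<^bsub>V\<^esub> \<ominus>\<^bsub>V\<^esub> y = \<zero>\<^bsub>V\<^esub>" by (simp add: a_minus_def)
  with xy have "\<ominus>\<^bsub>V\<^esub> (\<ominus>\<^bsub>V\<^esub> y) = x" by (intro V.minus_equality) auto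
  with xy show "x = y" by simp
qed (simp add: a_minus_def V.r_neg)
lemma vs_minus_add_cancel [simp]: "x \<in> carrier V \<Longrightarrow> y \<in> carrier V \<Longrightarrow> (x \<ominus>\<^bsub>V\<^esub> y) \<oplus>\<^bsub>V\<^esub> y = x"
  by (simp add: a_minus_def V.a_assoc V.l_neg)
lemma vs_add_minus_cancel [simp]: "x \<in> carrier V \<Longrightarrow> y \<in> carrier V \<Longrightarrow> (x \<oplus>\<^bsub>V\<^esub> y) \<ominus>\<^bsub>V\<^esub> y = x"
  by (simp add: a_minus_def V.a_assoc V.r_neg)
lemma vs_finsum_add: "g \<in> I \<rightarrow> carrier V \<Longrightarrow> h \<in> I \<rightarrow> carrier V \<Longrightarrow>
    finsum V (\<lambda>i. g i \<oplus>\<^bsub>V\<^esub> h i) I = finsum V g I \<oplus>\<^bsub>V\<^esub> finsum V h I"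
  by (rule V.finsum_addf)
lemma vs_finsum_cong: "I = J \<Longrightarrow> (\<And>i. i \<in> J \<Longrightarrow> g i = h i) \<Longrightarrow> h \<in> J \<rightarrow> carrier V \<Longrightarrow>
    finsum V g I = finsum V h J"
  by (rule V.finsum_cong) (auto simp: simp_implies_def)
lemma vs_finsum_zero [simp]: "finsum V (\<lambda>i. \<zero>\<^bsub>V\<^esub>) I = \<zero>\<^bsub>V\<^esub>" by simp
lemma vs_finsum_insert: "finite I \<Longrightarrow> i \<notin> I \<Longrightarrow> g \<in> I \<rightarrow> carrier V \<Longrightarrow> g i \<in> carrier V \<Longrightarrow>
    finsum V g (insert i I) = g i \<oplus>\<^bsub>V\<^esub> finsum V g I"
  by (rule V.finsum_insert)
lemma vs_finsum_mono: "finite J \<Longrightarrow> I \<subseteq> J \<Longrightarrow> g \<in> J \<rightarrow> carrier V \<Longrightarrow>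
    (\<And>i. i \<in> J - I \<Longrightarrow> g i = \<zero>\<^bsub>V\<^esub>) \<Longrightarrow> finsum V g I = finsum V g J"
  by (rule V.add.finprod_mono_neutral_cong_left) auto

end

lemma linI:
  assumes "\<And>x. x \<in> carrier V \<Longrightarrow> f x \<in> carrier W"
    and "\<And>x y. x \<in> carrier V \<Longrightarrow> y \<in> carrier V \<Longrightarrow> f (x \<oplus>\<^bsub>V\<^esub> y) = f x \<oplus>\<^bsub>W\<^esub> f y"
    and "\<And>c x. x \<in> carrier V \<Longrightarrow> f (c \<odot>\<^bsub>V\<^esub> x) = c \<odot>\<^bsub>W\<^esub> f x"
  shows "f \<in> lin V W"
  unfolding LinearCombinations.module_hom_def using assms by simp

lemma lin_closed [simp]: "f \<in> lin V W \<Longrightarrow> x \<in> carrier V \<Longrightarrow> f x \<in> carrier W"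
  by (auto simp: LinearCombinations.module_hom_def)
lemma lin_add: "f \<in> lin V W \<Longrightarrow> x \<in> carrier V \<Longrightarrow> y \<in> carrier V \<Longrightarrow> f (x \<oplus>\<^bsub>V\<^esub> y) = f x \<oplus>\<^bsub>W\<^esub> f y"
  unfolding LinearCombinations.module_hom_def by blast
lemma lin_smult: "f \<in> lin V W \<Longrightarrow> x \<in> carrier V \<Longrightarrow> f (c \<odot>\<^bsub>V\<^esub> x) = c \<odot>\<^bsub>W\<^esub> f x"
  unfolding LinearCombinations.module_hom_def by simp

lemma lin_zero: "vsp V \<Longrightarrow> vsp W \<Longrightarrow> f \<in> lin V W \<Longrightarrow> f \<zero>\<^bsub>V\<^esub> = \<zero>\<^bsub>W\<^esub>"
  using lin_smult[of f V W "\<zero>\<^bsub>V\<^esub>" 0] by simp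

lemma lin_minus: "vsp V \<Longrightarrow> vsp W \<Longrightarrow> f \<in> lin V W \<Longrightarrow> x \<in> carrier V \<Longrightarrow> y \<in> carrier V \<Longrightarrow>
   f (x \<ominus>\<^bsub>V\<^esub> y) = f x \<ominus>\<^bsub>W\<^esub> f y"
  by (simp add: vs_minus_eq lin_add lin_smult)

lemma lin_finsum:
  assumes "vsp V" "vsp W" "f \<in> lin V W" "g \<in> I \<rightarrow> carrier V"
  shows "f (finsum V g I) = finsum W (\<lambda>i. f (g i)) I"
  using assms(4)
proof (induction I rule: infinite_finite_induct)
  \<comment> \<open>A \<open>finsum\<close> over an infinite set is zero by convention, so only
    \<open>f\<close> preserving zero is left.\<close>
  case (infinite I)
  then show ?case
    using assms by (simp add: finsum_def finprod_def lin_zero abelian_monoid.finsum_infinite vsp_abelian_monoid)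
next
  case empty
  then show ?case using assms by (simp add: lin_zero abelian_monoid.finsum_empty vsp_abelian_monoid)
next
  case (insert i I)
  then show ?case using assms
    by (simp add: vs_finsum_insert lin_add Pi_def)
qed

text \<open>The field as a space over itself, so that functionals are the members of
  \<open>lin V kmod\<close> and inherit all facts on linear maps.\<close>

definition kmod :: "('k::field, 'k) module" where
  "kmod = \<lparr>carrier = UNIV, mult = (*), one = 1, zero = 0, add = (+), smult = (*)\<rparr>"

lemma kmod_simps [simp]: "carrier kmod = UNIV" "zero kmod = 0" "add kmod = (+)" "smult kmod = (*)"
  by (auto simp: kmod_def)

lemma vsp_kmod [simp]: "vsp kmod"
  by (rule vspI) (auto simp: algebra_simps)

lemma finsum_kmod [simp]: "finsum kmod g I = sum g I"
proof (induction I rule: infinite_finite_induct)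
  case (infinite I)
  then show ?case using abelian_monoid.finsum_infinite[OF vsp_abelian_monoid[OF vsp_kmod]] by simp
next
  case empty
  then show ?case using abelian_monoid.finsum_empty[OF vsp_abelian_monoid[OF vsp_kmod]] by simp
next
  case (insert i I)
  then show ?case by (simp add: vs_finsum_insert)
qed

lemma lin_kmod_finsum: "vsp V \<Longrightarrow> f \<in> lin V kmod \<Longrightarrow> g \<in> I \<rightarrow> carrier V \<Longrightarrow>
    f (finsum V g I) = (\<Sum>i\<in>I. f (g i))"
  using lin_finsum[of V kmod f g I] by simp

lemma lin_id [simp]: "(\<lambda>x. x) \<in> lin V V"
  by (rule linI) auto
lemma lin_zero_map: "vsp W \<Longrightarrow> (\<lambda>x. \<zero>\<^bsub>W\<^esub>) \<in> lin V W"
  by (rule linI) auto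
lemma lin_comp: "f \<in> lin U V \<Longrightarrow> g \<in> lin V W \<Longrightarrow> (\<lambda>x. g (f x)) \<in> lin U W"
  by (rule linI) (auto simp: lin_add lin_smult)
lemma lin_add_map: "vsp W \<Longrightarrow> f \<in> lin V W \<Longrightarrow> g \<in> lin V W \<Longrightarrow> (\<lambda>x. f x \<oplus>\<^bsub>W\<^esub> g x) \<in> lin V W"
  by (rule linI) (auto simp: lin_add lin_smult vs_ac vs_smult_r_distr)
lemma lin_smult_map: "vsp W \<Longrightarrow> f \<in> lin V W \<Longrightarrow> (\<lambda>x. c \<odot>\<^bsub>W\<^esub> f x) \<in> lin V W"
proof (rule linI)
  assume W: "vsp W" and f: "f \<in> lin V W"
  show "c \<odot>\<^bsub>W\<^esub> f (d \<odot>\<^bsub>V\<^esub> x) = d \<odot>\<^bsub>W\<^esub> (c \<odot>\<^bsub>W\<^esub> f x)" if "x \<in> carrier V" for d x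
    using that W f vs_smult_smult[OF W, of "f x" c d] vs_smult_smult[OF W, of "f x" d c]
    by (simp add: lin_smult mult.commute)
qed (auto simp: lin_add vs_smult_r_distr)
lemma lin_cong: "(\<And>x. x \<in> carrier V \<Longrightarrow> f x = g x) \<Longrightarrow> vsp V \<Longrightarrow> f \<in> lin V W \<Longrightarrow> g \<in> lin V W"
proof (rule linI)
  assume eq: "\<And>x. x \<in> carrier V \<Longrightarrow> f x = g x" and V: "vsp V" and f: "f \<in> lin V W"
  show "g x \<in> carrier W" if "x \<in> carrier V" for x using eq[OF that] lin_closed[OF f that] by simp
  show "g (x \<oplus>\<^bsub>V\<^esub> y) = g x \<oplus>\<^bsub>W\<^esub> g y" if "x \<in> carrier V" "y \<in> carrier V" for x y
    using lin_add[OF f that] eq V that by simp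
  show "g (c \<odot>\<^bsub>V\<^esub> x) = c \<odot>\<^bsub>W\<^esub> g x" if "x \<in> carrier V" for c x
    using lin_smult[OF f that] eq V that by simp
qed

lemma lin_minus_map:
  assumes "vsp V" "vsp W" "f \<in> lin V W" "g \<in> lin V W" shows "(\<lambda>x. f x \<ominus>\<^bsub>W\<^esub> g x) \<in> lin V W"
  by (rule lin_cong[OF _ assms(1) lin_add_map[OF assms(2,3) lin_smult_map[OF assms(2,4), of "-1"]]])
     (use assms in \<open>simp add: vs_minus_eq\<close>)

lemma lin_scale: "vsp W \<Longrightarrow> \<xi> \<in> lin V kmod \<Longrightarrow> w \<in> carrier W \<Longrightarrow> (\<lambda>x. \<xi> x \<odot>\<^bsub>W\<^esub> w) \<in> lin V W"
  by (rule linI) (auto simp: lin_add lin_smult vs_smult_l_distr vs_smult_smult)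

section \<open>Subspaces, kernels and images\<close>

definition subsp :: "('k::field, 'v, 'z) module_scheme \<Rightarrow> 'v set \<Rightarrow> bool" where
  "subsp V U \<longleftrightarrow> U \<subseteq> carrier V \<and> \<zero>\<^bsub>V\<^esub> \<in> U \<and> (\<forall>x\<in>U. \<forall>y\<in>U. x \<oplus>\<^bsub>V\<^esub> y \<in> U) \<and> (\<forall>c. \<forall>x\<in>U. c \<odot>\<^bsub>V\<^esub> x \<in> U)"

lemma subspI: "U \<subseteq> carrier V \<Longrightarrow> \<zero>\<^bsub>V\<^esub> \<in> U \<Longrightarrow> (\<And>x y. x \<in> U \<Longrightarrow> y \<in> U \<Longrightarrow> x \<oplus>\<^bsub>V\<^esub> y \<in> U) \<Longrightarrow>
    (\<And>c x. x \<in> U \<Longrightarrow> c \<odot>\<^bsub>V\<^esub> x \<in> U) \<Longrightarrow> subsp V U"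
  by (auto simp: subsp_def)

lemma subspD:
  assumes "subsp V U"
  shows "U \<subseteq> carrier V" "\<zero>\<^bsub>V\<^esub> \<in> U" "\<And>x y. x \<in> U \<Longrightarrow> y \<in> U \<Longrightarrow> x \<oplus>\<^bsub>V\<^esub> y \<in> U"
    "\<And>c x. x \<in> U \<Longrightarrow> c \<odot>\<^bsub>V\<^esub> x \<in> U"
  using assms by (auto simp: subsp_def)

lemma subsp_self [simp]: "vsp V \<Longrightarrow> subsp V (carrier V)"
  by (rule subspI) auto

lemma vsp_subsp:
  assumes "vsp V" "subsp V U"
  shows "vsp (V\<lparr>carrier := U\<rparr>)"
proof -
  have [simp]: "x \<in> U \<Longrightarrow> x \<in> carrier V" for x using assms(2) by (auto simp: subsp_def)
  have n: "x \<oplus>\<^bsub>V\<^esub> ((- 1) \<odot>\<^bsub>V\<^esub> x) = \<zero>\<^bsub>V\<^esub>" if "x \<in> U" for x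
    using that assms(1) by (simp flip: vs_minus_eq)
  show ?thesis
    by (rule vspI) (use assms subspD[OF assms(2)] n in
      \<open>auto simp: vs_ac vs_smult_smult vs_smult_l_distr vs_smult_r_distr\<close>)
qed

text \<open>Changing the carrier changes the record over which \<open>finsum\<close> is formed; the
  inclusion is linear and hence carries one sum to the other.\<close>

lemma finsum_subsp:
  assumes "vsp V" "subsp V U" "g \<in> I \<rightarrow> U"
  shows "finsum (V\<lparr>carrier := U\<rparr>) g I = finsum V g I"
proof -
  have "(\<lambda>x. x) \<in> lin (V\<lparr>carrier := U\<rparr>) V"
    using subspD[OF assms(2)] by (intro linI) auto
  from lin_finsum[OF vsp_subsp[OF assms(1,2)] assms(1) this, of g I] show ?thesis using assms(3) by auto
qed

lemma subsp_finsum: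
  assumes "vsp V" "subsp V U" "g \<in> I \<rightarrow> U"
  shows "finsum V g I \<in> U"
  using vs_finsum[OF vsp_subsp[OF assms(1,2)], of g I] assms finsum_subsp[OF assms] by simp

lemma subsp_ker: "vsp V \<Longrightarrow> vsp W \<Longrightarrow> f \<in> lin V W \<Longrightarrow> subsp V {x \<in> carrier V. f x = \<zero>\<^bsub>W\<^esub>}"
  by (rule subspI) (auto simp: lin_zero lin_add lin_smult)
lemma subsp_image: 
  assumes "vsp V" "vsp W" "f \<in> lin V W" "subsp V U" shows "subsp W (f ` U)"
proof -
  have [simp]: "x \<in> U \<Longrightarrow> x \<in> carrier V" for x using assms(4) by (auto simp: subsp_def)
  show ?thesis
  proof (rule subspI)
    show "\<zero>\<^bsub>W\<^esub> \<in> f ` U" using assms lin_zero[OF assms(1-3)] subspD(2)[OF assms(4)] by force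
    show "x \<oplus>\<^bsub>W\<^esub> y \<in> f ` U" if "x \<in> f ` U" "y \<in> f ` U" for x y
      using that lin_add[OF assms(3)] subspD[OF assms(4)] by (auto simp flip: lin_add[OF assms(3)])
    show "c \<odot>\<^bsub>W\<^esub> x \<in> f ` U" if "x \<in> f ` U" for c x
      using that subspD[OF assms(4)] by (auto simp flip: lin_smult[OF assms(3)])
  qed (use assms in auto)
qed

lemma lin_restrict: "f \<in> lin V W \<Longrightarrow> U \<subseteq> carrier V \<Longrightarrow> f ` U \<subseteq> X \<Longrightarrow> f \<in> lin (V\<lparr>carrier := U\<rparr>) (W\<lparr>carrier := X\<rparr>)"
  by (rule linI) (auto simp: lin_add lin_smult subset_iff)
lemma lin_restrict_dom: "f \<in> lin V W \<Longrightarrow> U \<subseteq> carrier V \<Longrightarrow> f \<in> lin (V\<lparr>carrier := U\<rparr>) W"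
  by (rule linI) (auto simp: lin_add lin_smult subset_iff)
section \<open>Frames\<close>

text \<open>A finite family of vectors with functionals that reproduce every vector. The vectors may
  be dependent; so frames pass to retracts, where bases would not, and still compute traces.\<close>

definition frame :: "('k::field, 'v, 'z) module_scheme \<Rightarrow> 'i set \<Rightarrow> ('i \<Rightarrow> 'v) \<Rightarrow> ('i \<Rightarrow> 'v \<Rightarrow> 'k) \<Rightarrow> bool" where
  "frame V I v \<xi> \<longleftrightarrow> finite I \<and> v \<in> I \<rightarrow> carrier V \<and> (\<forall>i\<in>I. \<xi> i \<in> lin V kmod) \<and>
     (\<forall>x\<in>carrier V. finsum V (\<lambda>i. \<xi> i x \<odot>\<^bsub>V\<^esub> v i) I = x)"

lemma frameD:
  assumes "frame V I v \<xi>"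
  shows "finite I" "v \<in> I \<rightarrow> carrier V" "i \<in> I \<Longrightarrow> v i \<in> carrier V" "i \<in> I \<Longrightarrow> \<xi> i \<in> lin V kmod"
   "x \<in> carrier V \<Longrightarrow> finsum V (\<lambda>i. \<xi> i x \<odot>\<^bsub>V\<^esub> v i) I = x"
  using assms by (auto simp: frame_def)

text \<open>Expanding \<open>f (v i)\<close> in the second frame and \<open>g (w j)\<close> in the
  first turns both sides into the same double sum. Besides the cyclicity of the trace this contains
  its independence of the frame, by taking the identity for one of the maps.\<close>

lemma frame_trace_comm:
  assumes V: "vsp V" "frame V I v \<xi>" and W: "vsp W" "frame W J w \<eta>"
    and f: "f \<in> lin V W" and g: "g \<in> lin W V"
  shows "(\<Sum>i\<in>I. \<xi> i (g (f (v i)))) = (\<Sum>j\<in>J. \<eta> j (f (g (w j))))"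
proof -
  have 1: "\<xi> i (g (f (v i))) = (\<Sum>j\<in>J. \<eta> j (f (v i)) * \<xi> i (g (w j)))" if "i \<in> I" for i
  proof -
    note fv = frameD(3)[OF V(2) that]
    have "f (v i) = finsum W (\<lambda>j. \<eta> j (f (v i)) \<odot>\<^bsub>W\<^esub> w j) J"
      using frameD(5)[OF W(2)] lin_closed[OF f fv] by simp
    then have "\<xi> i (g (f (v i))) = \<xi> i (g (finsum W (\<lambda>j. \<eta> j (f (v i)) \<odot>\<^bsub>W\<^esub> w j) J))" by simp
    also have "\<dots> = (\<Sum>j\<in>J. \<xi> i (g (\<eta> j (f (v i)) \<odot>\<^bsub>W\<^esub> w j)))"
      using frameD(3)[OF W(2)] W(1)
      by (intro lin_kmod_finsum[OF W(1) lin_comp[OF g frameD(4)[OF V(2) that]]]) auto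
    also have "\<dots> = (\<Sum>j\<in>J. \<eta> j (f (v i)) * \<xi> i (g (w j)))"
      using lin_smult[OF lin_comp[OF g frameD(4)[OF V(2) that]]] frameD(3)[OF W(2)]
      by (intro sum.cong) auto
    finally show ?thesis .
  qed
  have 2: "\<eta> j (f (g (w j))) = (\<Sum>i\<in>I. \<xi> i (g (w j)) * \<eta> j (f (v i)))" if "j \<in> J" for j
  proof -
    note gw = frameD(3)[OF W(2) that]
    have "g (w j) = finsum V (\<lambda>i. \<xi> i (g (w j)) \<odot>\<^bsub>V\<^esub> v i) I"
      using frameD(5)[OF V(2)] lin_closed[OF g gw] by simp
    then have "\<eta> j (f (g (w j))) = \<eta> j (f (finsum V (\<lambda>i. \<xi> i (g (w j)) \<odot>\<^bsub>V\<^esub> v i) I))" by simp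
    also have "\<dots> = (\<Sum>i\<in>I. \<eta> j (f (\<xi> i (g (w j)) \<odot>\<^bsub>V\<^esub> v i)))"
      using frameD(3)[OF V(2)] V(1)
      by (intro lin_kmod_finsum[OF V(1) lin_comp[OF f frameD(4)[OF W(2) that]]]) auto
    also have "\<dots> = (\<Sum>i\<in>I. \<xi> i (g (w j)) * \<eta> j (f (v i)))"
      using lin_smult[OF lin_comp[OF f frameD(4)[OF W(2) that]]] frameD(3)[OF V(2)]
      by (intro sum.cong) auto
    finally show ?thesis .
  qed
  have "(\<Sum>i\<in>I. \<xi> i (g (f (v i)))) = (\<Sum>i\<in>I. \<Sum>j\<in>J. \<eta> j (f (v i)) * \<xi> i (g (w j)))"
    using 1 by simp
  also have "\<dots> = (\<Sum>j\<in>J. \<Sum>i\<in>I. \<eta> j (f (v i)) * \<xi> i (g (w j)))"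
    by (rule sum.swap)
  also have "\<dots> = (\<Sum>j\<in>J. \<eta> j (f (g (w j))))"
    using 2 by (simp add: mult.commute)
  finally show ?thesis .
qed

lemma frame_retract:
  assumes W: "vsp W" "frame W I w \<eta>" and V: "vsp V" and u: "u \<in> lin V W" and v: "v \<in> lin W V"
    and vu: "\<And>x. x \<in> carrier V \<Longrightarrow> v (u x) = x"
  shows "frame V I (\<lambda>i. v (w i)) (\<lambda>i x. \<eta> i (u x))"
  unfolding frame_def
proof (intro conjI ballI)
  show "finite I" by (rule frameD[OF W(2)])
  show "(\<lambda>i. v (w i)) \<in> I \<rightarrow> carrier V" using frameD[OF W(2)] v by auto
  show "i \<in> I \<Longrightarrow> (\<lambda>x. \<eta> i (u x)) \<in> lin V kmod" for i using frameD[OF W(2)] u lin_comp by blast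
  fix x assume x: "x \<in> carrier V"
  have "x = v (finsum W (\<lambda>i. \<eta> i (u x) \<odot>\<^bsub>W\<^esub> w i) I)" using x vu u frameD(5)[OF W(2), of "u x"] by simp
  also have "\<dots> = finsum V (\<lambda>i. v (\<eta> i (u x) \<odot>\<^bsub>W\<^esub> w i)) I"
    using W frameD[OF W(2)] by (intro lin_finsum V v) auto
  also have "\<dots> = finsum V (\<lambda>i. \<eta> i (u x) \<odot>\<^bsub>V\<^esub> v (w i)) I"
    using W V v frameD[OF W(2)] by (intro vs_finsum_cong V refl) (auto simp: lin_smult)
  finally show "finsum V (\<lambda>i. \<eta> i (u x) \<odot>\<^bsub>V\<^esub> v (w i)) I = x" by simp
qed

text \<open>Complements by induction on the number of functionals that separate the points of
  \<open>U\<close>. If the last functional is not zero on \<open>U\<close>, the line of a vector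
  where it takes the value 1 splits off, and the rest of \<open>U\<close> is separated by the
  remaining functionals.\<close>

lemma frame_exists_retraction:
  assumes V: "vsp V" and J: "finite J" and xi: "\<And>i. i \<in> J \<Longrightarrow> \<xi> i \<in> lin V kmod"
    and U: "subsp V U" and inj: "\<And>x. x \<in> U \<Longrightarrow> (\<And>i. i \<in> J \<Longrightarrow> \<xi> i x = 0) \<Longrightarrow> x = \<zero>\<^bsub>V\<^esub>"
  shows "\<exists>\<rho>\<in>lin V V. \<rho> ` carrier V \<subseteq> U \<and> (\<forall>x\<in>U. \<rho> x = x)"
  using J xi U inj
proof (induction J arbitrary: U rule: finite_induct)
  case empty
  then have "U = {\<zero>\<^bsub>V\<^esub>}" by (auto simp: subsp_def)
  then show ?case using V by (intro bexI[of _ "\<lambda>x. \<zero>\<^bsub>V\<^esub>"]) (auto simp: lin_zero_map)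
next
  case (insert j J)
  note Us = subspD[OF insert.prems(2)]
  have xj: "\<xi> j \<in> lin V kmod" using insert by auto
  let ?U = "{x \<in> U. \<xi> j x = 0}"
  have sU: "subsp V ?U"
  proof (rule subspI)
    show "\<zero>\<^bsub>V\<^esub> \<in> ?U" using Us lin_zero[OF V vsp_kmod xj] by simp
    show "x \<in> ?U \<Longrightarrow> y \<in> ?U \<Longrightarrow> x \<oplus>\<^bsub>V\<^esub> y \<in> ?U" for x y
      using Us(1,3) lin_add[OF xj, of x y] by auto
    show "x \<in> ?U \<Longrightarrow> c \<odot>\<^bsub>V\<^esub> x \<in> ?U" for c x using Us(1,4) lin_smult[OF xj, of x c] by auto
  qed (use Us in auto)
  obtain \<rho> where r: "\<rho> \<in> lin V V" "\<rho> ` carrier V \<subseteq> ?U" "\<And>x. x \<in> ?U \<Longrightarrow> \<rho> x = x"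
  proof -
    have "\<exists>\<rho>\<in>lin V V. \<rho> ` carrier V \<subseteq> ?U \<and> (\<forall>x\<in>?U. \<rho> x = x)"
    proof (rule insert.IH[OF _ sU])
      show "\<xi> i \<in> lin V kmod" if "i \<in> J" for i using insert.prems(1) that by simp
      show "x = \<zero>\<^bsub>V\<^esub>" if "x \<in> ?U" "\<And>i. i \<in> J \<Longrightarrow> \<xi> i x = 0" for x
        using insert.prems(3)[of x] that by blast
    qed
    then show thesis using that by blast
  qed
  show ?case
  proof (cases "?U = U")
    case True
    then show ?thesis using r by (intro bexI[of _ \<rho>]) auto
  next
    case False
    then obtain u0 where u0: "u0 \<in> U" "\<xi> j u0 \<noteq> 0" by auto
    define u where "u = inverse (\<xi> j u0) \<odot>\<^bsub>V\<^esub> u0"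
    have u: "u \<in> U" "\<xi> j u = 1" "u \<in> carrier V"
      unfolding u_def using u0 Us(1) Us(4)[OF u0(1)] lin_smult[OF xj, of u0] by auto
    \<comment> \<open>\<open>\<sigma>\<close> projects along \<open>u\<close> to the kernel of
      \<open>\<xi> j\<close>, where the retraction of the induction hypothesis applies;
      \<open>\<tau>\<close> puts the removed multiple of \<open>u\<close> back.\<close>
    define \<sigma> where "\<sigma> = (\<lambda>x. x \<oplus>\<^bsub>V\<^esub> ((- \<xi> j x) \<odot>\<^bsub>V\<^esub> u))"
    have nx: "(\<lambda>x. - \<xi> j x) \<in> lin V kmod" using lin_smult_map[OF vsp_kmod xj, of "-1"] by simp
    have \<sigma>: "\<sigma> \<in> lin V V" unfolding \<sigma>_def
      by (intro lin_add_map lin_scale nx u lin_id V)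
    define \<tau> where "\<tau> = (\<lambda>x. \<rho> (\<sigma> x) \<oplus>\<^bsub>V\<^esub> (\<xi> j x \<odot>\<^bsub>V\<^esub> u))"
    have "\<tau> \<in> lin V V" unfolding \<tau>_def by (intro lin_add_map lin_scale xj u V lin_comp[OF \<sigma> r(1)])
    moreover have "\<tau> x \<in> U" if "x \<in> carrier V" for x
    proof -
      have "\<rho> (\<sigma> x) \<in> U" using r(2) lin_closed[OF \<sigma> that] by blast
      then show ?thesis unfolding \<tau>_def by (intro Us(3,4) u)
    qed
    moreover have "\<tau> x = x" if x: "x \<in> U" for x
    proof -
      have xc: "x \<in> carrier V" using x Us by auto
      have "\<sigma> x \<in> U" unfolding \<sigma>_def by (intro Us(3,4) x u)
      moreover have "\<xi> j (\<sigma> x) = 0" using xj xc u V by (simp add: \<sigma>_def lin_add lin_smult)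
      ultimately have "\<rho> (\<sigma> x) = \<sigma> x" by (intro r(3)) simp
      moreover have "((- \<xi> j x) \<odot>\<^bsub>V\<^esub> u) \<oplus>\<^bsub>V\<^esub> (\<xi> j x \<odot>\<^bsub>V\<^esub> u) = \<zero>\<^bsub>V\<^esub>"
        using vs_smult_l_distr[OF V u(3), of "- \<xi> j x" "\<xi> j x"] V u by simp
      ultimately show ?thesis using xc u V
        by (simp add: \<tau>_def \<sigma>_def vs_add_assoc)
    qed
    ultimately show ?thesis by (intro bexI[of _ \<tau>]) auto
  qed
qed

section \<open>Traces and dimensions\<close>

lemma basis_frame:
  assumes V: "vsp V" and S: "finite S" "vectorspace.basis class_ring V S"
  shows "frame V S (\<lambda>s. s) (\<lambda>s x. coords V S x s)"
proof -
  interpret V: vectorspace class_ring V by (rule V)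
  have SV: "S \<subseteq> carrier V" using S(2) by (simp add: V.basis_def)
  have ex1: "\<exists>!a. a \<in> S \<rightarrow>\<^sub>E UNIV \<and> V.lincomb a S = x" if "x \<in> carrier V" for x
    using V.basis_criterion[OF S(1) SV] S(2) that by simp
  have co: "coords V S x \<in> S \<rightarrow>\<^sub>E UNIV \<and> V.lincomb (coords V S x) S = x" if "x \<in> carrier V" for x
    unfolding coords_def by (rule theI'[OF ex1[OF that]])
  have un: "coords V S x s = a s" if "x \<in> carrier V" "a \<in> S \<rightarrow> UNIV" "V.lincomb a S = x" "s \<in> S" for x a s
  proof -
    have "V.lincomb (restrict a S) S = x" unfolding that(3)[symmetric]
      by (rule V.lincomb_cong) (use SV in auto)
    then have "coords V S x = restrict a S" using ex1[OF that(1)] co[OF that(1)] by auto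
    then show ?thesis using that by simp
  qed
  show ?thesis unfolding frame_def
  proof (intro conjI ballI)
    show "(\<lambda>s. s) \<in> S \<rightarrow> carrier V" using SV by auto
    fix x assume x: "x \<in> carrier V"
    show "finsum V (\<lambda>s. coords V S x s \<odot>\<^bsub>V\<^esub> s) S = x" using co[OF x] by (simp add: V.lincomb_def)
  next
    fix s assume s: "s \<in> S"
    show "(\<lambda>x. coords V S x s) \<in> lin V kmod"
    proof (rule linI)
      show "coords V S (x \<oplus>\<^bsub>V\<^esub> y) s = coords V S x s \<oplus>\<^bsub>kmod\<^esub> coords V S y s"
        if xy: "x \<in> carrier V" "y \<in> carrier V" for x y
      proof (simp, rule un[OF _ _ _ s])
        show "V.lincomb (\<lambda>s. coords V S x s + coords V S y s) S = x \<oplus>\<^bsub>V\<^esub> y"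
          using V.lincomb_sum[OF S(1) SV, of "coords V S x" "coords V S y"] co xy by simp
      qed (use xy in auto)
      show "coords V S (c \<odot>\<^bsub>V\<^esub> x) s = c \<odot>\<^bsub>kmod\<^esub> coords V S x s" if x: "x \<in> carrier V" for c x
      proof (simp, rule un[OF _ _ _ s])
        show "V.lincomb (\<lambda>s. c * coords V S x s) S = c \<odot>\<^bsub>V\<^esub> x"
          using V.lincomb_smult[OF SV, of "coords V S x" c] co x by simp
      qed (use x V in auto)
    qed auto
  qed (rule S)
qed

lemma fd_frame:
  assumes "vsp V" "fd V"
  obtains S \<xi> where "frame V S (\<lambda>s. s) \<xi>"
  using vectorspace.finite_basis_exists[OF assms] basis_frame[OF assms(1)] by blast

lemma subsp_span:
  assumes "vsp V" "S \<subseteq> carrier V"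
  shows "subsp V (LinearCombinations.module.span class_ring V S)"
proof -
  interpret V: vectorspace class_ring V by (rule assms)
  have *: "submodule class_ring (V.span S) V" by (rule V.span_is_submodule[OF assms(2)])
  show ?thesis
  proof (rule subspI)
    show "V.span S \<subseteq> carrier V" by (rule submodule.subset[OF *])
    show "\<zero>\<^bsub>V\<^esub> \<in> V.span S" by (rule submodule.zero_closed[OF *])
    show "x \<in> V.span S \<Longrightarrow> y \<in> V.span S \<Longrightarrow> x \<oplus>\<^bsub>V\<^esub> y \<in> V.span S" for x y by (rule submodule.m_closed[OF *])
    show "x \<in> V.span S \<Longrightarrow> c \<odot>\<^bsub>V\<^esub> x \<in> V.span S" for x c using submodule.smult_closed[OF *, of c x] by simp
  qed
qed

lemma frame_fd:
  assumes V: "vsp V" and F: "frame V I v \<xi>"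
  shows "fd V"
proof -
  interpret V: vectorspace class_ring V by (rule V)
  have vI: "v ` I \<subseteq> carrier V" using frameD[OF F] by auto
  have "x \<in> V.span (v ` I)" if x: "x \<in> carrier V" for x
  proof -
    have "finsum V (\<lambda>i. \<xi> i x \<odot>\<^bsub>V\<^esub> v i) I \<in> V.span (v ` I)"
      using V.in_own_span[OF vI] subspD[OF subsp_span[OF V vI]] by (intro subsp_finsum V subsp_span vI) auto
    then show ?thesis using frameD(5)[OF F x] by simp
  qed
  then have "V.gen_set (v ` I)" using V.span_is_subset2[OF vI] by auto
  then show ?thesis unfolding V.fin_dim_def using vI frameD(1)[OF F] by blast
qed

text \<open>Frees the trace from the basis picked by \<open>SOME\<close> in
  \<open>lin_trace\<close>.\<close>

lemma lin_trace_frame: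
  assumes V: "vsp V" and F: "frame V I v \<xi>" and f: "f \<in> lin V V"
  shows "lin_trace V f = (\<Sum>i\<in>I. \<xi> i (f (v i)))"
proof -
  define S where "S = (SOME S. finite S \<and> vectorspace.basis class_ring V S)"
  have S: "finite S \<and> vectorspace.basis class_ring V S"
    unfolding S_def using vectorspace.finite_basis_exists[OF V frame_fd[OF V F]] by (rule someI_ex)
  have "lin_trace V f = (\<Sum>s\<in>S. coords V S (f s) s)" by (simp add: lin_trace_def S_def Let_def)
  also have "\<dots> = (\<Sum>i\<in>I. \<xi> i (f (v i)))"
    using frame_trace_comm[OF V basis_frame[OF V] V F f lin_id] S by simp
  finally show ?thesis .
qed

lemma lin_trace_cong:
  assumes "vsp V" "fd V" "f \<in> lin V V" "\<And>x. x \<in> carrier V \<Longrightarrow> f x = g x"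
  shows "lin_trace V f = lin_trace V g"
proof -
  obtain S \<xi> where F: "frame V S (\<lambda>s. s) \<xi>" by (rule fd_frame[OF assms(1,2)])
  have g: "g \<in> lin V V" by (rule lin_cong[OF assms(4,1,3)])
  show ?thesis using assms(4) frameD(3)[OF F]
    by (simp add: lin_trace_frame[OF assms(1) F] assms(3) g)
qed

lemma lin_trace_comm:
  assumes "vsp V" "fd V" "vsp W" "fd W" "f \<in> lin V W" "g \<in> lin W V"
  shows "lin_trace V (\<lambda>x. g (f x)) = lin_trace W (\<lambda>y. f (g y))"
proof -
  obtain S \<xi> where F: "frame V S (\<lambda>s. s) \<xi>" by (rule fd_frame[OF assms(1,2)])
  obtain T \<eta> where G: "frame W T (\<lambda>s. s) \<eta>" by (rule fd_frame[OF assms(3,4)])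
  show ?thesis using frame_trace_comm[OF assms(1) F assms(3) G assms(5,6)]
      lin_trace_frame[OF assms(1) F lin_comp[OF assms(5,6)]] lin_trace_frame[OF assms(3) G lin_comp[OF assms(6,5)]]
    by simp
qed

lemma lin_trace_add:
  assumes "vsp V" "fd V" "f \<in> lin V V" "g \<in> lin V V"
  shows "lin_trace V (\<lambda>x. f x \<oplus>\<^bsub>V\<^esub> g x) = lin_trace V f + lin_trace V g"
proof -
  obtain S \<xi> where F: "frame V S (\<lambda>s. s) \<xi>" by (rule fd_frame[OF assms(1,2)])
  have "\<xi> i (f i \<oplus>\<^bsub>V\<^esub> g i) = \<xi> i (f i) + \<xi> i (g i)" if "i \<in> S" for i
    using lin_add[OF frameD(4)[OF F that], of "f i" "g i"] assms frameD(3)[OF F that] by simp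
  then show ?thesis
    by (simp add: lin_trace_frame[OF assms(1) F] assms lin_add_map sum.distrib)
qed

lemma lin_trace_smult:
  assumes "vsp V" "fd V" "f \<in> lin V V"
  shows "lin_trace V (\<lambda>x. c \<odot>\<^bsub>V\<^esub> f x) = c * lin_trace V f"
proof -
  obtain S \<xi> where F: "frame V S (\<lambda>s. s) \<xi>" by (rule fd_frame[OF assms(1,2)])
  have "\<xi> i (c \<odot>\<^bsub>V\<^esub> f i) = c * \<xi> i (f i)" if "i \<in> S" for i
    using lin_smult[OF frameD(4)[OF F that], of "f i"] assms frameD(3)[OF F that] by simp
  then show ?thesis
    by (simp add: lin_trace_frame[OF assms(1) F] assms lin_smult_map sum_distrib_left)
qed

lemma lin_trace_zero:
  assumes "vsp V" "fd V" "\<And>x. x \<in> carrier V \<Longrightarrow> f x = \<zero>\<^bsub>V\<^esub>"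
  shows "lin_trace V f = 0"
proof -
  have "lin_trace V f = lin_trace V (\<lambda>x. \<zero>\<^bsub>V\<^esub>)"
    by (rule lin_trace_cong[OF assms(1,2), symmetric]) (use assms in \<open>auto intro: lin_zero_map\<close>)
  also have "\<dots> = lin_trace V (\<lambda>x. 0 \<odot>\<^bsub>V\<^esub> x)"
    using assms by (intro lin_trace_cong lin_zero_map) auto
  also have "\<dots> = 0" using lin_trace_smult[OF assms(1,2) lin_id, of 0] by simp
  finally show ?thesis .
qed

lemma fd_retract:
  assumes "vsp W" "fd W" "vsp V" "u \<in> lin V W" "v \<in> lin W V" "\<And>x. x \<in> carrier V \<Longrightarrow> v (u x) = x"
  shows "fd V"
proof -
  obtain T \<eta> where G: "frame W T (\<lambda>s. s) \<eta>" by (rule fd_frame[OF assms(1,2)])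
  show ?thesis by (rule frame_fd[OF assms(3) frame_retract[OF assms(1) G assms(3-6)]])
qed

text \<open>The coordinate functionals of a frame of \<open>V\<close> separate points, as
  \<open>frame_exists_retraction\<close> demands.\<close>

lemma subsp_retraction:
  assumes V: "vsp V" "fd V" and U: "subsp V U"
  obtains \<rho> where "\<rho> \<in> lin V V" "\<And>x. x \<in> carrier V \<Longrightarrow> \<rho> x \<in> U" "\<And>x. x \<in> U \<Longrightarrow> \<rho> x = x"
proof -
  obtain S \<xi> where F: "frame V S (\<lambda>s. s) \<xi>" by (rule fd_frame[OF V])
  have "\<exists>\<rho>\<in>lin V V. \<rho> ` carrier V \<subseteq> U \<and> (\<forall>x\<in>U. \<rho> x = x)"
  proof (rule frame_exists_retraction[OF V(1) frameD(1,4)[OF F] U])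
    fix x assume x: "x \<in> U" "\<And>i. i \<in> S \<Longrightarrow> \<xi> i x = 0"
    have xc: "x \<in> carrier V" using x U by (auto simp: subsp_def)
    have "x = finsum V (\<lambda>i. \<xi> i x \<odot>\<^bsub>V\<^esub> i) S" using frameD(5)[OF F xc] by simp
    also have "\<dots> = finsum V (\<lambda>i. \<zero>\<^bsub>V\<^esub>) S"
      by (rule vs_finsum_cong) (use V x frameD(3)[OF F] in auto)
    finally show "x = \<zero>\<^bsub>V\<^esub>" using V by simp
  qed
  then show thesis using that by (auto simp: image_subset_iff)
qed

lemma fd_subsp:
  assumes V: "vsp V" "fd V" and U: "subsp V U"
  shows "fd (V\<lparr>carrier := U\<rparr>)"
proof -
  obtain \<rho> where r: "\<rho> \<in> lin V V" "\<And>x. x \<in> carrier V \<Longrightarrow> \<rho> x \<in> U" "\<And>x. x \<in> U \<Longrightarrow> \<rho> x = x"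
    by (rule subsp_retraction[OF assms]) blast
  have Uc: "U \<subseteq> carrier V" by (rule subspD[OF U])
  show ?thesis
  proof (rule fd_retract[OF V vsp_subsp[OF V(1) U]])
    show "(\<lambda>x. x) \<in> lin (V\<lparr>carrier := U\<rparr>) V" by (rule lin_restrict_dom[OF lin_id Uc])
    show "\<rho> \<in> lin V (V\<lparr>carrier := U\<rparr>)" using lin_restrict[OF r(1), of "carrier V" U] r(2) by auto
  qed (use r in auto)
qed

text \<open>Factor \<open>f\<close> as \<open>V \<rightarrow> U \<rightarrow> V\<close> with the
  inclusion as second map; cyclicity moves the trace to \<open>U\<close>.\<close>

lemma lin_trace_image:
  assumes V: "vsp V" "fd V" and U: "subsp V U" and f: "f \<in> lin V V" "\<And>x. x \<in> carrier V \<Longrightarrow> f x \<in> U"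
  shows "lin_trace V f = lin_trace (V\<lparr>carrier := U\<rparr>) f"
proof -
  have Uc: "U \<subseteq> carrier V" by (rule subspD[OF U])
  show ?thesis
    using lin_trace_comm[OF V vsp_subsp[OF V(1) U] fd_subsp[OF V U], of f "\<lambda>x. x"]
      lin_restrict[OF f(1), of "carrier V" U] lin_restrict_dom[OF lin_id Uc] f(2) by auto
qed

text \<open>The whole trace is carried by the image of \<open>f\<close>, on which the exponent of
  nilpotency has dropped by one. The argument needs no eigenvalues and holds in every
  characteristic.\<close>

lemma lin_trace_nilpotent:
  assumes V: "vsp V" "fd V" and f: "f \<in> lin V V" and n: "\<And>x. x \<in> carrier V \<Longrightarrow> (f ^^ n) x = \<zero>\<^bsub>V\<^esub>"
  shows "lin_trace V f = 0"
  using assms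
proof (induction n arbitrary: V)
  \<comment> \<open>With exponent 0 the hypothesis says that every vector is zero; it is used for
    \<open>f x\<close>.\<close>
  case 0
  have "f x = \<zero>\<^bsub>V\<^esub>" if "x \<in> carrier V" for x
    using "0.prems"(4)[OF lin_closed[OF "0.prems"(3) that]] by simp
  then show ?case by (intro lin_trace_zero "0.prems")
next
  case (Suc n)
  let ?U = "f ` carrier V"
  let ?W = "V\<lparr>carrier := ?U\<rparr>"
  have U: "subsp V ?U" using subsp_image[OF Suc.prems(1,1,3) subsp_self] Suc.prems by auto
  have UV: "?U \<subseteq> carrier V" by (rule subspD[OF U])
  have "lin_trace V f = lin_trace ?W f"
    by (rule lin_trace_image[OF Suc.prems(1,2) U Suc.prems(3)]) auto
  also have "\<dots> = 0"
  proof (rule Suc.IH)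
    show "vsp ?W" "fd ?W" using vsp_subsp fd_subsp U Suc.prems by auto
    show "f \<in> lin ?W ?W" using UV by (intro lin_restrict[OF Suc.prems(3) UV]) auto
    show "(f ^^ n) x = \<zero>\<^bsub>?W\<^esub>" if "x \<in> carrier ?W" for x
      using that Suc.prems(4) by (auto simp: funpow_swap1)
  qed
  finally show ?case .
qed

text \<open>A short exact sequence splits: \<open>\<rho>\<close> retracts to the kernel of
  \<open>q\<close>, and \<open>\<sigma>\<close> is the section that maps to the complement belonging
  to \<open>\<rho>\<close>.\<close>

lemma lin_section:
  assumes V: "vsp V" "fd V" and W: "vsp W" and q: "q \<in> lin V W" "q ` carrier V = carrier W"
  obtains \<rho> \<sigma> where "\<rho> \<in> lin V V" "\<sigma> \<in> lin W V" "\<And>x. x \<in> carrier V \<Longrightarrow> q (\<rho> x) = \<zero>\<^bsub>W\<^esub>"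
    "\<And>y. y \<in> carrier W \<Longrightarrow> q (\<sigma> y) = y" "\<And>x. x \<in> carrier V \<Longrightarrow> \<rho> x \<oplus>\<^bsub>V\<^esub> \<sigma> (q x) = x"
    "\<And>x. x \<in> carrier V \<Longrightarrow> q x = \<zero>\<^bsub>W\<^esub> \<Longrightarrow> \<rho> x = x"
proof -
  obtain \<rho> where r: "\<rho> \<in> lin V V" "\<And>x. x \<in> carrier V \<Longrightarrow> \<rho> x \<in> {x \<in> carrier V. q x = \<zero>\<^bsub>W\<^esub>}"
      "\<And>x. x \<in> {x \<in> carrier V. q x = \<zero>\<^bsub>W\<^esub>} \<Longrightarrow> \<rho> x = x"
    by (rule subsp_retraction[OF V subsp_ker[OF V(1) W q(1)]]) blast
  define p where "p x = x \<ominus>\<^bsub>V\<^esub> \<rho> x" for x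
  have p: "p \<in> lin V V" unfolding p_def by (rule lin_minus_map[OF V(1,1) lin_id r(1)])
  have p0: "p x = p y" if "x \<in> carrier V" "y \<in> carrier V" "q x = q y" for x y
  proof -
    have "x \<ominus>\<^bsub>V\<^esub> y \<in> {x \<in> carrier V. q x = \<zero>\<^bsub>W\<^esub>}"
      using that V W q by (simp add: lin_minus)
    then have "p (x \<ominus>\<^bsub>V\<^esub> y) = \<zero>\<^bsub>V\<^esub>" using r(3)[of "x \<ominus>\<^bsub>V\<^esub> y"] V that by (simp add: p_def)
    then show ?thesis using that V p by (simp add: lin_minus[OF V(1,1) p] vs_minus_zero_iff)
  qed
  \<comment> \<open>An arbitrary choice of preimages, in general not linear. Since \<open>p\<close>
    vanishes on the kernel of \<open>q\<close>, it does not see the choice, and \<open>p\<close>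
    after \<open>\<tau>\<close> is linear.\<close>
  define \<tau> where "\<tau> y = (SOME x. x \<in> carrier V \<and> q x = y)" for y
  have \<tau>: "\<tau> y \<in> carrier V \<and> q (\<tau> y) = y" if "y \<in> carrier W" for y
    unfolding \<tau>_def by (rule someI_ex) (use q(2) that in force)
  define \<sigma> where "\<sigma> y = p (\<tau> y)" for y
  have \<sigma>q: "\<sigma> (q x) = p x" if "x \<in> carrier V" for x
    unfolding \<sigma>_def using that q \<tau>[of "q x"] by (intro p0) auto
  have qq: "\<exists>x\<in>carrier V. y = q x" if "y \<in> carrier W" for y using that q(2) by auto
  have s: "\<sigma> \<in> lin W V"
  proof (rule linI)
    show "\<sigma> y \<in> carrier V" if "y \<in> carrier W" for y using \<tau>[OF that] p by (simp add: \<sigma>_def)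
    show "\<sigma> (x \<oplus>\<^bsub>W\<^esub> y) = \<sigma> x \<oplus>\<^bsub>V\<^esub> \<sigma> y" if xy: "x \<in> carrier W" "y \<in> carrier W" for x y
    proof -
      obtain x' y' where x': "x' \<in> carrier V" "x = q x'" "y' \<in> carrier V" "y = q y'" using qq xy by meson
      then have "x \<oplus>\<^bsub>W\<^esub> y = q (x' \<oplus>\<^bsub>V\<^esub> y')" using lin_add[OF q(1)] by simp
      then show ?thesis using x' \<sigma>q V p by (simp add: lin_add)
    qed
    show "\<sigma> (c \<odot>\<^bsub>W\<^esub> y) = c \<odot>\<^bsub>V\<^esub> \<sigma> y" if y: "y \<in> carrier W" for c y
    proof -
      obtain y' where y': "y' \<in> carrier V" "y = q y'" using qq y by meson
      then have "c \<odot>\<^bsub>W\<^esub> y = q (c \<odot>\<^bsub>V\<^esub> y')" using lin_smult[OF q(1)] by simp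
      then show ?thesis using y' \<sigma>q V p by (simp add: lin_smult)
    qed
  qed
  have qr: "q (\<rho> x) = \<zero>\<^bsub>W\<^esub>" if "x \<in> carrier V" for x using r(2)[OF that] by simp
  show thesis
  proof (rule that[OF r(1) s])
    show "q (\<sigma> y) = y" if y: "y \<in> carrier W" for y
    proof -
      have "q (\<sigma> y) = q (\<tau> y) \<ominus>\<^bsub>W\<^esub> q (\<rho> (\<tau> y))"
        unfolding \<sigma>_def p_def using \<tau>[OF y] r(1) by (intro lin_minus[OF V(1) W q(1)]) auto
      also have "\<dots> = y" using \<tau>[OF y] qr y W by (simp add: vs_minus_eq)
      finally show ?thesis .
    qed
    show "\<rho> x \<oplus>\<^bsub>V\<^esub> \<sigma> (q x) = x" if x: "x \<in> carrier V" for x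
      unfolding \<sigma>q[OF x] p_def using x V lin_closed[OF r(1) x] by (subst vs_add_comm) auto
  qed (use qr r(3) in auto)
qed

lemma fd_quotient:
  assumes V: "vsp V" "fd V" and W: "vsp W" and q: "q \<in> lin V W" "q ` carrier V = carrier W"
  shows "fd W"
proof -
  obtain \<rho> \<sigma> where s: "\<sigma> \<in> lin W V" "\<And>y. y \<in> carrier W \<Longrightarrow> q (\<sigma> y) = y"
    by (rule lin_section[OF assms]) blast
  show ?thesis by (rule fd_retract[OF V W s(1) q(1) s(2)])
qed

text \<open>Additivity of the trace on short exact sequences. Splitting the identity into
  \<open>\<rho>\<close> and \<open>\<sigma> q\<close>, the part \<open>f \<rho>\<close> maps into
  the kernel, and \<open>f \<sigma> q\<close> becomes \<open>q f \<sigma> = g\<close> by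
  cyclicity.\<close>

lemma lin_trace_exact:
  assumes V: "vsp V" "fd V" and W: "vsp W" and q: "q \<in> lin V W" "q ` carrier V = carrier W"
    and f: "f \<in> lin V V" and g: "g \<in> lin W W" and qf: "\<And>x. x \<in> carrier V \<Longrightarrow> q (f x) = g (q x)"
  shows "lin_trace V f = lin_trace (V\<lparr>carrier := {x \<in> carrier V. q x = \<zero>\<^bsub>W\<^esub>}\<rparr>) f + lin_trace W g"
proof -
  let ?K = "{x \<in> carrier V. q x = \<zero>\<^bsub>W\<^esub>}"
  obtain \<rho> \<sigma> where r: "\<rho> \<in> lin V V" "\<And>x. x \<in> carrier V \<Longrightarrow> q (\<rho> x) = \<zero>\<^bsub>W\<^esub>"
      "\<And>x. x \<in> carrier V \<Longrightarrow> q x = \<zero>\<^bsub>W\<^esub> \<Longrightarrow> \<rho> x = x"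
     and s: "\<sigma> \<in> lin W V" "\<And>y. y \<in> carrier W \<Longrightarrow> q (\<sigma> y) = y" "\<And>x. x \<in> carrier V \<Longrightarrow> \<rho> x \<oplus>\<^bsub>V\<^esub> \<sigma> (q x) = x"
    by (rule lin_section[OF V W q]) blast
  have fdW: "fd W" by (rule fd_quotient[OF V W q])
  have K: "subsp V ?K" by (rule subsp_ker[OF V(1) W q(1)])
  note vK = vsp_subsp[OF V(1) K] fd_subsp[OF V K]
  have fr: "(\<lambda>x. f (\<rho> x)) \<in> lin V V" by (rule lin_comp[OF r(1) f])
  have fs: "(\<lambda>x. f (\<sigma> (q x))) \<in> lin V V" by (rule lin_comp[OF lin_comp[OF q(1) s(1)] f])
  have "lin_trace V f = lin_trace V (\<lambda>x. f (\<rho> x) \<oplus>\<^bsub>V\<^esub> f (\<sigma> (q x)))"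
  proof (rule lin_trace_cong[OF V f])
    show "f x = f (\<rho> x) \<oplus>\<^bsub>V\<^esub> f (\<sigma> (q x))" if x: "x \<in> carrier V" for x
      using lin_add[OF f lin_closed[OF r(1) x] lin_closed[OF s(1) lin_closed[OF q(1) x]]] s(3)[OF x] by simp
  qed
  also have "\<dots> = lin_trace V (\<lambda>x. f (\<rho> x)) + lin_trace V (\<lambda>x. f (\<sigma> (q x)))"
    by (rule lin_trace_add[OF V fr fs])
  also have "lin_trace V (\<lambda>x. f (\<rho> x)) = lin_trace (V\<lparr>carrier := ?K\<rparr>) (\<lambda>x. f (\<rho> x))"
  proof (rule lin_trace_image[OF V K fr])
    show "f (\<rho> x) \<in> ?K" if "x \<in> carrier V" for x
      using that qf r(1,2) f V W g by (simp add: lin_zero)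
  qed
  also have "\<dots> = lin_trace (V\<lparr>carrier := ?K\<rparr>) f"
  proof (rule lin_trace_cong[OF vK])
    show "(\<lambda>x. f (\<rho> x)) \<in> lin (V\<lparr>carrier := ?K\<rparr>) (V\<lparr>carrier := ?K\<rparr>)"
      using qf r(1,2) f V W g by (intro lin_restrict fr) (auto simp: lin_zero)
  qed (use r(3) in simp)
  also have "lin_trace V (\<lambda>x. f (\<sigma> (q x))) = lin_trace W (\<lambda>y. q (f (\<sigma> y)))"
    by (rule lin_trace_comm[OF V W fdW q(1) lin_comp[OF s(1) f]])
  also have "\<dots> = lin_trace W g"
    by (rule lin_trace_cong[OF W fdW lin_comp[OF lin_comp[OF s(1) f] q(1)]]) (use qf s in simp)
  finally show ?thesis .
qed

text \<open>The dimension appears only through \<open>of_nat\<close>, that is, modulo the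
  characteristic of the field.\<close>

lemma lin_trace_id:
  assumes "vsp V" "fd V"
  shows "lin_trace V (\<lambda>x. x) = of_nat (vdim V)"
proof -
  interpret V: vectorspace class_ring V by (rule assms(1))
  obtain S where S: "finite S" "V.basis S" using V.finite_basis_exists[OF assms(2)] by blast
  have SV: "S \<subseteq> carrier V" using S(2) by (simp add: V.basis_def)
  have "coords V S s s = 1" if s: "s \<in> S" for s
  proof -
    have sV: "s \<in> carrier V" using s SV by auto
    let ?d = "\<lambda>t\<in>S. if t = s then 1 else 0"
    have "V.lincomb ?d S = finsum V (\<lambda>t. if t = s then t else \<zero>\<^bsub>V\<^esub>) S"
      unfolding V.lincomb_def using SV assms(1) by (intro vs_finsum_cong[OF assms(1)]) auto
    also have "\<dots> = s"
      using V.add.finprod_singleton_swap[of s S "\<lambda>t. t"] s SV S(1) by (auto simp: finsum_def)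
    finally have d: "V.lincomb ?d S = s" .
    have "\<exists>!a. a \<in> S \<rightarrow>\<^sub>E UNIV \<and> V.lincomb a S = s"
      using V.basis_criterion[OF S(1) SV] S(2) sV by simp
    then have "coords V S s = ?d" unfolding coords_def using d by (intro the1_equality) auto
    then show ?thesis using s by simp
  qed
  then have "lin_trace V (\<lambda>x. x) = of_nat (card S)"
    by (simp add: lin_trace_frame[OF assms(1) basis_frame[OF assms(1) S]])
  then show ?thesis using V.dim_basis[OF S] by simp
qed

section \<open>Dimensions of kernels, subspaces and chains of subspaces\<close>

lemma vdim_rank_nullity:
  assumes "vsp V" "fd V" "vsp W" "f \<in> lin V W"
  shows "vdim V = vdim (V\<lparr>carrier := {x \<in> carrier V. f x = \<zero>\<^bsub>W\<^esub>}\<rparr>) + vdim (W\<lparr>carrier := f ` carrier V\<rparr>)"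
proof -
  have l: "linear_map class_ring V W f"
    using assms vsp_module[OF assms(1)] vsp_module[OF assms(3)]
    by (auto simp: linear_map_def mod_hom_def mod_hom_axioms_def)
  interpret linear_map class_ring V W f by (rule l)
  show ?thesis using rank_nullity[OF assms(2)] by (simp add: im_def ker_def)
qed

lemma vdim_0:
  assumes "vsp V" "zero_space V"
  shows "vdim V = 0" "fd V"
proof -
  have "frame V ({} :: 'b set) (\<lambda>s. s) (\<lambda>s x. 0)" using assms vsp_abelian_monoid[OF assms(1)] by (auto simp: frame_def abelian_monoid.finsum_empty)
  then show "fd V" by (rule frame_fd[OF assms(1)])
  interpret V: vectorspace class_ring V by (rule assms(1))
  have "V.gen_set {}" using assms(2) V.span_empty by simp
  then show "vdim V = 0" using V.gen_ge_dim[of "{}"] by simp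
qed

lemma vdim_eq_0:
  assumes "vsp V" "fd V" "vdim V = 0"
  shows "zero_space V"
proof -
  interpret V: vectorspace class_ring V by (rule assms(1))
  obtain S where S: "finite S" "V.basis S" using V.finite_basis_exists[OF assms(2)] by blast
  then have "S = {}" using V.dim_basis[OF S] assms(3) by simp
  then show ?thesis using S V.span_empty by (simp add: V.basis_def)
qed

lemma vdim_kernel:
  assumes V: "vsp V" "fd V" and W: "vsp W" and q: "q \<in> lin V W" "q ` carrier V = carrier W"
  shows "vdim V = vdim (V\<lparr>carrier := {x \<in> carrier V. q x = \<zero>\<^bsub>W\<^esub>}\<rparr>) + vdim W"
  using vdim_rank_nullity[OF V W q(1)] q(2) by simp

lemma vdim_subsp_eq:
  assumes V: "vsp V" "fd V" and U: "subsp V U"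
  shows "vdim (V\<lparr>carrier := U\<rparr>) \<le> vdim V" "vdim (V\<lparr>carrier := U\<rparr>) = vdim V \<Longrightarrow> U = carrier V"
proof -
  have UV: "U \<subseteq> carrier V" by (rule subspD[OF U])
  obtain \<rho> where r: "\<rho> \<in> lin V V" "\<And>x. x \<in> carrier V \<Longrightarrow> \<rho> x \<in> U" "\<And>x. x \<in> U \<Longrightarrow> \<rho> x = x"
    by (rule subsp_retraction[OF V U]) blast
  have im: "\<rho> ` carrier V = U" using r UV by force
  let ?K = "{x \<in> carrier V. \<rho> x = \<zero>\<^bsub>V\<^esub>}"
  have d: "vdim V = vdim (V\<lparr>carrier := ?K\<rparr>) + vdim (V\<lparr>carrier := U\<rparr>)"
    using vdim_rank_nullity[OF V V(1) r(1)] im by simp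
  then show "vdim (V\<lparr>carrier := U\<rparr>) \<le> vdim V" by simp
  have K: "subsp V ?K" by (rule subsp_ker[OF V(1,1) r(1)])
  assume "vdim (V\<lparr>carrier := U\<rparr>) = vdim V"
  with d have "vdim (V\<lparr>carrier := ?K\<rparr>) = 0" by simp
  then have K0: "?K = {\<zero>\<^bsub>V\<^esub>}" using vdim_eq_0[OF vsp_subsp[OF V(1) K] fd_subsp[OF V K]] by simp
  have "x \<in> U" if x: "x \<in> carrier V" for x
  proof -
    have rx: "\<rho> x \<in> carrier V" using r x UV by auto
    have "\<rho> (x \<ominus>\<^bsub>V\<^esub> \<rho> x) = \<zero>\<^bsub>V\<^esub>" using V r x rx by (simp add: lin_minus)
    then have "x \<ominus>\<^bsub>V\<^esub> \<rho> x = \<zero>\<^bsub>V\<^esub>" using K0 V x rx by blast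
    then have "x = \<rho> x" using V x rx by (simp add: vs_minus_zero_iff)
    then show ?thesis using r(2)[OF x] by simp
  qed
  then show "U = carrier V" using UV by auto
qed

lemma subsp_sub: "subsp V U \<Longrightarrow> subsp V U' \<Longrightarrow> U \<subseteq> U' \<Longrightarrow> subsp (V\<lparr>carrier := U'\<rparr>) U"
  by (auto simp: subsp_def)

lemma vdim_subsp_mono:
  assumes V: "vsp V" "fd V" and U: "subsp V U" "subsp V U'" "U \<subseteq> U'"
  shows "vdim (V\<lparr>carrier := U\<rparr>) \<le> vdim (V\<lparr>carrier := U'\<rparr>)"
    "vdim (V\<lparr>carrier := U\<rparr>) = vdim (V\<lparr>carrier := U'\<rparr>) \<Longrightarrow> U = U'"
  using vdim_subsp_eq[OF vsp_subsp[OF V(1) U(2)] fd_subsp[OF V U(2)] subsp_sub[OF U]] by simp_all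

text \<open>A member of least dimension cannot properly contain its successor.\<close>

lemma subsp_chain_stable:
  assumes V: "vsp V" "fd V" and U: "\<And>n. subsp V (U n)" "\<And>n. U (Suc n) \<subseteq> U n"
  shows "\<exists>n. U (Suc n) = U n"
proof -
  obtain n where n: "\<And>m. vdim (V\<lparr>carrier := U n\<rparr>) \<le> vdim (V\<lparr>carrier := U m\<rparr>)"
    using ex_has_least_nat[of "\<lambda>_. True" 0 "\<lambda>n. vdim (V\<lparr>carrier := U n\<rparr>)"] by auto
  have "U (Suc n) = U n"
    using vdim_subsp_mono[OF V U(1,1) U(2), of n] n[of "Suc n"] by auto
  then show ?thesis ..
qed

lemma vdim_iso:
  assumes V: "vsp V" "fd V" and W: "vsp W" and f: "f \<in> lin V W" "bij_betw f (carrier V) (carrier W)"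
  shows "vdim V = vdim W"
proof -
  have inj: "inj_on f (carrier V)" and im: "f ` carrier V = carrier W" using f(2) by (auto simp: bij_betw_def)
  have "{x \<in> carrier V. f x = \<zero>\<^bsub>W\<^esub>} = {\<zero>\<^bsub>V\<^esub>}"
  proof -
    have "x = \<zero>\<^bsub>V\<^esub>" if "x \<in> carrier V" "f x = \<zero>\<^bsub>W\<^esub>" for x
      by (rule inj_onD[OF inj]) (use that lin_zero[OF V(1) W f(1)] V(1) in auto)
    then show ?thesis using lin_zero[OF V(1) W f(1)] V(1) by blast
  qed
  then have "vdim (V\<lparr>carrier := {x \<in> carrier V. f x = \<zero>\<^bsub>W\<^esub>}\<rparr>) = 0"
    using vsp_subsp[OF V(1) subsp_ker[OF V(1) W f(1)]] by (intro vdim_0) auto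
  then show ?thesis using vdim_kernel[OF V W f(1) im] by simp
qed

section \<open>Quotients and subquotients\<close>

text \<open>\<open>Ext\<close> and \<open>Tor\<close> are \<open>ext_space\<close> and
  \<open>tor_space\<close> with actions added, hence records of another type. Facts on the
  underlying spaces are stated up to this relation, so that they apply to both.\<close>

abbreviation same_space :: "('k::field, 'v, 'y) module_scheme \<Rightarrow> ('k, 'v, 'z) module_scheme \<Rightarrow> bool" where
  "same_space X Y \<equiv> carrier X = carrier Y \<and> zero X = zero Y \<and> add X = add Y \<and> smult X = smult Y"

lemma same_space_refl: "same_space X X"
  by simp

lemma vsp_cong:
  assumes "vsp V" "carrier X = carrier V" "zero X = zero V" "add X = add V" "smult X = smult V"
  shows "vsp X"
  by (rule vspI, unfold assms(2-))
     (use assms(1) vs_minus_eq[OF assms(1), symmetric] in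
       \<open>auto simp: vs_add_assoc vs_smult_smult vs_smult_l_distr vs_smult_r_distr intro: vs_add_comm\<close>)

context
  fixes V :: "('k::field, 'v, 'z) module_scheme" and W :: "'v set"
  assumes V: "vsp V" and W: "subsp V W"
begin

lemma mem_coset: "y \<in> W +>\<^bsub>V\<^esub> x \<longleftrightarrow> (\<exists>w\<in>W. y = w \<oplus>\<^bsub>V\<^esub> x)"
  by (auto simp: a_r_coset_def')

lemma coset_add:
  assumes x: "x \<in> carrier V" and y: "y \<in> carrier V"
  shows "(W +>\<^bsub>V\<^esub> x) <+>\<^bsub>V\<^esub> (W +>\<^bsub>V\<^esub> y) = W +>\<^bsub>V\<^esub> (x \<oplus>\<^bsub>V\<^esub> y)"
proof -
  note Wc = subspD[OF W]
  have 1: "(w \<oplus>\<^bsub>V\<^esub> x) \<oplus>\<^bsub>V\<^esub> (w' \<oplus>\<^bsub>V\<^esub> y) = (w \<oplus>\<^bsub>V\<^esub> w') \<oplus>\<^bsub>V\<^esub> (x \<oplus>\<^bsub>V\<^esub> y)"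
    if "w \<in> W" "w' \<in> W" for w w'
    using that x y Wc(1) V by (simp add: vs_ac subset_iff)
  show ?thesis
  proof (intro equalityI subsetI)
    fix z assume "z \<in> (W +>\<^bsub>V\<^esub> x) <+>\<^bsub>V\<^esub> (W +>\<^bsub>V\<^esub> y)"
    then obtain w w' where "w \<in> W" "w' \<in> W" "z = (w \<oplus>\<^bsub>V\<^esub> x) \<oplus>\<^bsub>V\<^esub> (w' \<oplus>\<^bsub>V\<^esub> y)"
      by (auto simp: set_add_def' mem_coset)
    then show "z \<in> W +>\<^bsub>V\<^esub> (x \<oplus>\<^bsub>V\<^esub> y)" using 1 Wc(3) by (auto simp: mem_coset)
  next
    fix z assume "z \<in> W +>\<^bsub>V\<^esub> (x \<oplus>\<^bsub>V\<^esub> y)"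
    then obtain w where w: "w \<in> W" "z = w \<oplus>\<^bsub>V\<^esub> (x \<oplus>\<^bsub>V\<^esub> y)" by (auto simp: mem_coset)
    have "z = (w \<oplus>\<^bsub>V\<^esub> x) \<oplus>\<^bsub>V\<^esub> (\<zero>\<^bsub>V\<^esub> \<oplus>\<^bsub>V\<^esub> y)" using 1[of w "\<zero>\<^bsub>V\<^esub>"] w Wc V by auto
    then show "z \<in> (W +>\<^bsub>V\<^esub> x) <+>\<^bsub>V\<^esub> (W +>\<^bsub>V\<^esub> y)"
      unfolding set_add_def' using w(1) Wc(2) by (auto simp: mem_coset intro!: bexI)
  qed
qed

lemma coset_zero: "W +>\<^bsub>V\<^esub> \<zero>\<^bsub>V\<^esub> = W"
proof -
  note Wc = subspD[OF W]
  show ?thesis unfolding a_r_coset_def' using Wc V by (auto simp: subset_iff)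
qed

lemma coset_eq_iff:
  assumes x: "x \<in> carrier V" and y: "y \<in> carrier V"
  shows "W +>\<^bsub>V\<^esub> x = W +>\<^bsub>V\<^esub> y \<longleftrightarrow> x \<ominus>\<^bsub>V\<^esub> y \<in> W"
proof
  note Wc = subspD[OF W]
  assume "W +>\<^bsub>V\<^esub> x = W +>\<^bsub>V\<^esub> y"
  then have "\<zero>\<^bsub>V\<^esub> \<oplus>\<^bsub>V\<^esub> x \<in> W +>\<^bsub>V\<^esub> y" using Wc(2) mem_coset by blast
  then obtain w where "w \<in> W" "x = w \<oplus>\<^bsub>V\<^esub> y" using x V by (auto simp: mem_coset)
  then show "x \<ominus>\<^bsub>V\<^esub> y \<in> W" using Wc V y by auto
next
  note Wc = subspD[OF W]
  have *: "W +>\<^bsub>V\<^esub> x \<subseteq> W +>\<^bsub>V\<^esub> y" if xy: "x \<in> carrier V" "y \<in> carrier V" "x \<ominus>\<^bsub>V\<^esub> y \<in> W" for x y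
  proof
    fix z assume "z \<in> W +>\<^bsub>V\<^esub> x"
    then obtain w where w: "w \<in> W" "z = w \<oplus>\<^bsub>V\<^esub> x" by (auto simp: mem_coset)
    have "w \<oplus>\<^bsub>V\<^esub> ((x \<ominus>\<^bsub>V\<^esub> y) \<oplus>\<^bsub>V\<^esub> y) = (w \<oplus>\<^bsub>V\<^esub> (x \<ominus>\<^bsub>V\<^esub> y)) \<oplus>\<^bsub>V\<^esub> y"
      using w(1) Wc(1) xy V by (subst vs_add_assoc) auto
    then have "z = (w \<oplus>\<^bsub>V\<^esub> (x \<ominus>\<^bsub>V\<^esub> y)) \<oplus>\<^bsub>V\<^esub> y" using w xy V by simp
    then show "z \<in> W +>\<^bsub>V\<^esub> y" using Wc(3)[OF w(1) xy(3)] by (auto simp: mem_coset)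
  qed
  assume d: "x \<ominus>\<^bsub>V\<^esub> y \<in> W"
  have "(- 1) \<odot>\<^bsub>V\<^esub> (x \<ominus>\<^bsub>V\<^esub> y) = y \<ominus>\<^bsub>V\<^esub> x"
    using x y V by (simp add: vs_minus_eq vs_smult_r_distr vs_add_comm flip: vs_smult_smult)
  then have "y \<ominus>\<^bsub>V\<^esub> x \<in> W" using Wc(4)[OF d, of "- 1"] by simp
  then show "W +>\<^bsub>V\<^esub> x = W +>\<^bsub>V\<^esub> y" using *[OF x y d] *[OF y x] by blast
qed

lemma coset_smult:
  assumes x: "x \<in> carrier V"
  shows "W <+>\<^bsub>V\<^esub> (\<lambda>x. c \<odot>\<^bsub>V\<^esub> x) ` (W +>\<^bsub>V\<^esub> x) = W +>\<^bsub>V\<^esub> (c \<odot>\<^bsub>V\<^esub> x)"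
proof -
  note Wc = subspD[OF W]
  have 1: "w \<oplus>\<^bsub>V\<^esub> c \<odot>\<^bsub>V\<^esub> (w' \<oplus>\<^bsub>V\<^esub> x) = (w \<oplus>\<^bsub>V\<^esub> c \<odot>\<^bsub>V\<^esub> w') \<oplus>\<^bsub>V\<^esub> c \<odot>\<^bsub>V\<^esub> x" if "w \<in> W" "w' \<in> W" for w w'
  proof -
    have "w \<in> carrier V" "w' \<in> carrier V" using that Wc(1) by auto
    then show ?thesis using x V by (simp add: vs_smult_r_distr vs_add_assoc)
  qed
  show ?thesis
  proof (intro equalityI subsetI)
    fix z assume "z \<in> W <+>\<^bsub>V\<^esub> (\<lambda>x. c \<odot>\<^bsub>V\<^esub> x) ` (W +>\<^bsub>V\<^esub> x)"
    then obtain w w' where "w \<in> W" "w' \<in> W" "z = w \<oplus>\<^bsub>V\<^esub> c \<odot>\<^bsub>V\<^esub> (w' \<oplus>\<^bsub>V\<^esub> x)"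
      by (auto simp: set_add_def' mem_coset)
    then show "z \<in> W +>\<^bsub>V\<^esub> (c \<odot>\<^bsub>V\<^esub> x)" using 1 Wc(3,4) unfolding mem_coset by blast
  next
    fix z assume "z \<in> W +>\<^bsub>V\<^esub> (c \<odot>\<^bsub>V\<^esub> x)"
    then obtain w where w: "w \<in> W" "z = w \<oplus>\<^bsub>V\<^esub> c \<odot>\<^bsub>V\<^esub> x" by (auto simp: mem_coset)
    have "z = w \<oplus>\<^bsub>V\<^esub> c \<odot>\<^bsub>V\<^esub> (\<zero>\<^bsub>V\<^esub> \<oplus>\<^bsub>V\<^esub> x)" using w x V by simp
    moreover have "\<zero>\<^bsub>V\<^esub> \<oplus>\<^bsub>V\<^esub> x \<in> W +>\<^bsub>V\<^esub> x" using Wc(2) mem_coset by blast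
    ultimately show "z \<in> W <+>\<^bsub>V\<^esub> (\<lambda>x. c \<odot>\<^bsub>V\<^esub> x) ` (W +>\<^bsub>V\<^esub> x)"
      unfolding set_add_def' using w(1) by blast
  qed
qed

lemma quot_space_simps:
  "carrier (quot_space V W) = (\<lambda>x. W +>\<^bsub>V\<^esub> x) ` carrier V" "zero (quot_space V W) = W"
  "add (quot_space V W) = set_add V"
  "smult (quot_space V W) = (\<lambda>c X. W <+>\<^bsub>V\<^esub> (\<lambda>x. c \<odot>\<^bsub>V\<^esub> x) ` X)"
  by (auto simp: quot_space_def A_RCOSETS_def')

lemma vsp_quot_space: "vsp (quot_space V W)"
proof (rule vspI, unfold quot_space_simps)
  show "W \<in> (+>\<^bsub>V\<^esub>) W ` carrier V" using coset_zero V by (metis imageI vs_zero)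
  show "x <+>\<^bsub>V\<^esub> W = x" if "x \<in> (+>\<^bsub>V\<^esub>) W ` carrier V" for x
    using that coset_add[of _ "\<zero>\<^bsub>V\<^esub>"] V by (auto simp: coset_zero)
  show "x <+>\<^bsub>V\<^esub> (W <+>\<^bsub>V\<^esub> (\<lambda>x. (- 1) \<odot>\<^bsub>V\<^esub> x) ` x) = W" if "x \<in> (+>\<^bsub>V\<^esub>) W ` carrier V" for x
    using that V vs_minus_eq[OF V, symmetric] by (auto simp: coset_add coset_smult coset_zero)
  show "x <+>\<^bsub>V\<^esub> y = y <+>\<^bsub>V\<^esub> x" if "x \<in> (+>\<^bsub>V\<^esub>) W ` carrier V" "y \<in> (+>\<^bsub>V\<^esub>) W ` carrier V" for x y
    using that vs_add_comm[OF V] by (auto simp: coset_add)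
qed (use V in \<open>auto simp: coset_add coset_smult vs_smult_smult vs_smult_l_distr vs_smult_r_distr vs_add_assoc\<close>)

end

text \<open>Homology as an abstract quotient: a surjection \<open>q\<close> from \<open>Z\<close>
  with kernel \<open>B\<close> instead of cosets, which is the form in which trace arguments use
  it.\<close>

definition subquot where
  "subquot V Z B X q \<longleftrightarrow> vsp V \<and> subsp V Z \<and> subsp V B \<and> B \<subseteq> Z \<and> vsp X \<and> q \<in> lin (V\<lparr>carrier := Z\<rparr>) X \<and>
    q ` Z = carrier X \<and> (\<forall>z\<in>Z. q z = \<zero>\<^bsub>X\<^esub> \<longleftrightarrow> z \<in> B)"

lemma subquot_quot_space:
  assumes V: "vsp V" and Z: "subsp V Z" and B: "subsp V B" "B \<subseteq> Z"
    and X: "carrier X = carrier (quot_space (V\<lparr>carrier := Z\<rparr>) B)" "zero X = zero (quot_space (V\<lparr>carrier := Z\<rparr>) B)"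
      "add X = add (quot_space (V\<lparr>carrier := Z\<rparr>) B)" "smult X = smult (quot_space (V\<lparr>carrier := Z\<rparr>) B)"
  shows "subquot V Z B X (\<lambda>z. B +>\<^bsub>V\<^esub> z)"
proof -
  note vZ = vsp_subsp[OF V Z]
  note BZ = subsp_sub[OF B(1) Z B(2)]
  have cs: "B +>\<^bsub>V\<lparr>carrier := Z\<rparr>\<^esub> z = B +>\<^bsub>V\<^esub> z" for z by (simp add: a_r_coset_def')
  note qs = quot_space_simps[OF vZ BZ, unfolded cs]
  have vX: "vsp X" by (rule vsp_cong[OF vsp_quot_space[OF vZ BZ] X])
  show ?thesis unfolding subquot_def
  proof (intro conjI V Z B vX ballI)
    show "(\<lambda>z. B +>\<^bsub>V\<^esub> z) \<in> lin (V\<lparr>carrier := Z\<rparr>) X"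
      by (rule linI) (use coset_add[OF vZ BZ] coset_smult[OF vZ BZ] in \<open>auto simp: X qs cs\<close>)
    show "(\<lambda>z. B +>\<^bsub>V\<^esub> z) ` Z = carrier X" by (simp add: X qs)
    fix z assume z: "z \<in> Z"
    then have zV: "z \<in> carrier V" using Z by (auto simp: subsp_def)
    show "(B +>\<^bsub>V\<^esub> z = \<zero>\<^bsub>X\<^esub>) = (z \<in> B)"
      using coset_eq_iff[OF V B(1) zV, of "\<zero>\<^bsub>V\<^esub>"] zV V by (simp add: X qs coset_zero[OF V B(1)] vs_minus_eq)
  qed
qed

text \<open>The image of a coset of \<open>U\<close> need not fill a coset of \<open>W\<close>;
  adding \<open>W\<close> fills it up, and \<open>f\<close> mapping \<open>U\<close> into
  \<open>W\<close> keeps the result within a single coset.\<close>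

lemma quot_map_coset:
  assumes V: "vsp V" and W: "subsp V W" and V': "vsp V'" and U: "subsp V' U" "U \<subseteq> Z" "Z \<subseteq> carrier V'"
    and f: "f \<in> lin (V'\<lparr>carrier := Z\<rparr>) V" "\<And>u. u \<in> U \<Longrightarrow> f u \<in> W" and x: "x \<in> Z"
  shows "quot_map V W f (U +>\<^bsub>V'\<^esub> x) = W +>\<^bsub>V\<^esub> f x"
proof -
  have fx: "f x \<in> carrier V" using lin_closed[OF f(1)] x by simp
  have fux: "f (u \<oplus>\<^bsub>V'\<^esub> x) = f u \<oplus>\<^bsub>V\<^esub> f x" if "u \<in> U" for u
    using lin_add[OF f(1), of u x] that U x by auto
  have Wc: "W \<subseteq> carrier V" by (rule subspD[OF W])
  show ?thesis unfolding quot_map_def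
  proof (intro equalityI subsetI)
    fix z assume "z \<in> W <+>\<^bsub>V\<^esub> f ` (U +>\<^bsub>V'\<^esub> x)"
    then obtain w u where w: "w \<in> W" "u \<in> U" "z = w \<oplus>\<^bsub>V\<^esub> f (u \<oplus>\<^bsub>V'\<^esub> x)"
      by (auto simp: set_add_def' mem_coset[OF V' U(1)])
    then have "z = (w \<oplus>\<^bsub>V\<^esub> f u) \<oplus>\<^bsub>V\<^esub> f x"
      using fux f(2) Wc V fx by (auto simp: vs_add_assoc subset_iff)
    then show "z \<in> W +>\<^bsub>V\<^esub> f x" using subspD(3)[OF W w(1) f(2)[OF w(2)]] mem_coset[OF V W] by blast
  next
    fix z assume "z \<in> W +>\<^bsub>V\<^esub> f x"
    then obtain w where w: "w \<in> W" "z = w \<oplus>\<^bsub>V\<^esub> f x" by (auto simp: mem_coset[OF V W])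
    have "\<zero>\<^bsub>V'\<^esub> \<oplus>\<^bsub>V'\<^esub> x \<in> U +>\<^bsub>V'\<^esub> x" using subspD(2)[OF U(1)] mem_coset[OF V' U(1)] by blast
    moreover have "\<zero>\<^bsub>V'\<^esub> \<oplus>\<^bsub>V'\<^esub> x = x" using x U V' by auto
    ultimately show "z \<in> W <+>\<^bsub>V\<^esub> f ` (U +>\<^bsub>V'\<^esub> x)" unfolding set_add_def' using w by auto
  qed
qed

context
  fixes V :: "('k::field, 'v, 'y) module_scheme" and Z B and X :: "('k, 'x, 'z) module_scheme" and q
  assumes sq: "subquot V Z B X q"
begin

lemma subquotD: "vsp V" "subsp V Z" "subsp V B" "B \<subseteq> Z" "vsp X" "q \<in> lin (V\<lparr>carrier := Z\<rparr>) X"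
   "q ` Z = carrier X" "z \<in> Z \<Longrightarrow> q z = \<zero>\<^bsub>X\<^esub> \<longleftrightarrow> z \<in> B"
   "vsp (V\<lparr>carrier := Z\<rparr>)" "Z \<subseteq> carrier V" "z \<in> Z \<Longrightarrow> q z \<in> carrier X"
  using sq vsp_subsp[of V Z] subspD(1)[of V Z] by (auto simp: subquot_def)

lemma subquot_cases: "x \<in> carrier X \<Longrightarrow> \<exists>z\<in>Z. x = q z"
  using subquotD(7) by blast

text \<open>The map \<open>F\<close> has to be known on classes only, so a concrete formula for
  \<open>F (q z)\<close> suffices to make it linear on the quotient.\<close>

lemma subquot_lin:
  assumes f: "f \<in> lin (V\<lparr>carrier := Z\<rparr>) Y" and F: "\<And>z. z \<in> Z \<Longrightarrow> F (q z) = f z"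
  shows "F \<in> lin X Y"
proof (rule linI)
  have add: "q z \<oplus>\<^bsub>X\<^esub> q z' = q (z \<oplus>\<^bsub>V\<^esub> z')" if "z \<in> Z" "z' \<in> Z" for z z'
    using lin_add[OF subquotD(6), of z z'] that by simp
  have sm: "c \<odot>\<^bsub>X\<^esub> q z = q (c \<odot>\<^bsub>V\<^esub> z)" if "z \<in> Z" for z c
    using lin_smult[OF subquotD(6), of z c] that by simp
  show "F x \<in> carrier Y" if "x \<in> carrier X" for x
    using subquot_cases[OF that] F lin_closed[OF f] by auto
  show "F (x \<oplus>\<^bsub>X\<^esub> y) = F x \<oplus>\<^bsub>Y\<^esub> F y" if xy: "x \<in> carrier X" "y \<in> carrier X" for x y
  proof -
    obtain z z' where z: "z \<in> Z" "z' \<in> Z" "x = q z" "y = q z'" using subquot_cases xy by meson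
    then show ?thesis using add F lin_add[OF f, of z z'] subspD(3)[OF subquotD(2), of z z'] by simp
  qed
  show "F (c \<odot>\<^bsub>X\<^esub> x) = c \<odot>\<^bsub>Y\<^esub> F x" if x: "x \<in> carrier X" for x c
  proof -
    obtain z where z: "z \<in> Z" "x = q z" using subquot_cases x by meson
    then show ?thesis using sm F lin_smult[OF f, of z] subspD(4)[OF subquotD(2), of z] by simp
  qed
qed

lemma subquot_fd: "fd V \<Longrightarrow> fd X"
  using fd_quotient[OF subquotD(9) fd_subsp[OF subquotD(1) _ subquotD(2)] subquotD(5,6)] subquotD(7) by simp

text \<open>\<open>lin_trace_exact\<close> for the sequence of \<open>B\<close>, \<open>Z\<close>
  and \<open>X\<close>.\<close>

lemma subquot_trace:
  assumes V: "fd V" and f: "f \<in> lin V V" "\<And>z. z \<in> Z \<Longrightarrow> f z \<in> Z" and F: "\<And>z. z \<in> Z \<Longrightarrow> F (q z) = q (f z)"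
  shows "lin_trace (V\<lparr>carrier := Z\<rparr>) f = lin_trace (V\<lparr>carrier := B\<rparr>) f + lin_trace X F"
proof -
  have fZ: "f \<in> lin (V\<lparr>carrier := Z\<rparr>) (V\<lparr>carrier := Z\<rparr>)"
    using f(2) by (intro lin_restrict f(1) subquotD) auto
  have Fl: "F \<in> lin X X" by (rule subquot_lin[OF lin_comp[OF fZ subquotD(6)] F])
  have K: "{x \<in> carrier (V\<lparr>carrier := Z\<rparr>). q x = \<zero>\<^bsub>X\<^esub>} = B" using subquotD(4,8) by auto
  show ?thesis
    using lin_trace_exact[OF subquotD(9) fd_subsp[OF subquotD(1) V subquotD(2)] subquotD(5,6) _ fZ Fl] F subquotD(7)
    unfolding K by simp
qed

lemma subquot_trivial: "Z \<subseteq> B \<Longrightarrow> zero_space X"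
proof -
  assume "Z \<subseteq> B"
  then have "x = \<zero>\<^bsub>X\<^esub>" if "x \<in> carrier X" for x using subquot_cases[OF that] subquotD(8) by auto
  then show ?thesis using subquotD(5) by auto
qed

end

text \<open>This absorbs idempotents: an entry of a trace matrix is a trace on an image
  \<open>E X\<close>, and it is rewritten as a trace on all of \<open>X\<close>. The condition holds
  when \<open>E\<close> is idempotent and commutes with \<open>\<theta>\<close>.\<close>

lemma lin_trace_idempotent_image:
  assumes X: "vsp X" "fd X" and E: "E \<in> lin X X" and \<theta>: "\<theta> \<in> lin X X"
    and U: "U = E ` carrier X" and c: "\<And>x. x \<in> carrier X \<Longrightarrow> E (\<theta> (E x)) = \<theta> (E x)"
  shows "lin_trace (X\<lparr>carrier := U\<rparr>) \<theta> = lin_trace X (\<lambda>x. E (\<theta> x))"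
proof -
  have sU: "subsp X U" unfolding U by (rule subsp_image[OF X(1) X(1) E subsp_self[OF X(1)]])
  note vU = vsp_subsp[OF X(1) sU] fd_subsp[OF X sU]
  note Uc = subspD(1)[OF sU]
  have U2: "\<theta> u \<in> U" if "u \<in> U" for u
  proof -
    obtain x where x: "x \<in> carrier X" "u = E x" using \<open>u \<in> U\<close> unfolding U by blast
    then have "\<theta> u = E (\<theta> (E x))" using c by simp
    then show ?thesis using x E \<theta> U by auto
  qed
  have "lin_trace X (\<lambda>x. E (\<theta> x)) = lin_trace (X\<lparr>carrier := U\<rparr>) (\<lambda>x. E (\<theta> x))"
    using \<theta> E by (intro lin_trace_image[OF X sU lin_comp[OF \<theta> E]]) (auto simp: U)
  also have "\<dots> = lin_trace (X\<lparr>carrier := U\<rparr>) \<theta>"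
    using U2 c by (intro lin_trace_cong[OF vU, symmetric] lin_restrict[OF \<theta> Uc]) (auto simp: U)
  finally show ?thesis by simp
qed

lemma alternating_telescope:
  fixes t b :: "nat \<Rightarrow> 'a::comm_ring_1"
  assumes "\<And>l. l \<le> n \<Longrightarrow> t l = b l + b (Suc l)"
  shows "(\<Sum>l\<le>n. (- 1) ^ l * t l) = b 0 + (- 1) ^ n * b (Suc n)"
  using assms by (induction n) (auto simp: algebra_simps)

text \<open>The principle behind Euler characteristics: \<open>t\<close> stands for traces on the
  terms of a complex, \<open>h\<close> for those on homology, and \<open>b\<close> for those on
  boundaries, which occur once where they lie and once as image of the neighbouring term.
  Telescoping exchanges \<open>h\<close> for \<open>t\<close>.\<close>

lemma alternating_sum_exact:
  fixes t h b :: "nat \<Rightarrow> 'a::comm_ring_1"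
  assumes tb: "\<And>l. t l - h l = b l + b (Suc l)" and b: "b 0 = 0" "b (Suc L) = 0"
    and t: "\<And>l. t l = (\<Sum>j<(n::nat). \<mu> l j * c j)"
  shows "(\<Sum>l\<le>L. (- 1) ^ l * h l) = (\<Sum>j<n. (\<Sum>l\<le>L. (- 1) ^ l * \<mu> l j) * c j)"
proof -
  have "(\<Sum>l\<le>L. (- 1) ^ l * (t l - h l)) = 0" using alternating_telescope[of L "\<lambda>l. t l - h l" b] tb b by simp
  then have "(\<Sum>l\<le>L. (- 1) ^ l * h l) = (\<Sum>l\<le>L. (- 1) ^ l * t l)" by (simp add: right_diff_distrib sum_subtractf)
  also have "\<dots> = (\<Sum>l\<le>L. \<Sum>j<n. (- 1) ^ l * \<mu> l j * c j)" by (simp add: t sum_distrib_left mult.assoc)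
  also have "\<dots> = (\<Sum>j<n. (\<Sum>l\<le>L. (- 1) ^ l * \<mu> l j) * c j)" by (subst sum.swap) (simp add: sum_distrib_right)
  finally show ?thesis .
qed

section \<open>Elementary algebras\<close>

locale fin_alg =
  fixes A :: "('k::field, 'a) module" (structure)
  assumes fd_algebra: "fd_algebra A"

sublocale fin_alg \<subseteq> ring A
  using fd_algebra by (simp add: fd_algebra_def k_algebra_def)

context fin_alg
begin

lemma vspA: "vsp A" and fdA: "fd A"
  using fd_algebra by (auto simp: fd_algebra_def k_algebra_def)

lemmas A_simps [simp] = vs_smult[OF vspA] vs_zero_smult[OF vspA] vs_smult_zero[OF vspA] vs_one_smult[OF vspA]

lemma smult_mult: "x \<in> carrier A \<Longrightarrow> y \<in> carrier A \<Longrightarrow> (c \<odot> x) \<otimes> y = c \<odot> (x \<otimes> y)"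
  and mult_smult: "x \<in> carrier A \<Longrightarrow> y \<in> carrier A \<Longrightarrow> x \<otimes> (c \<odot> y) = c \<odot> (x \<otimes> y)"
  using fd_algebra by (auto simp: fd_algebra_def k_algebra_def)

lemma lin_mult_left: "a \<in> carrier A \<Longrightarrow> (\<lambda>x. a \<otimes> x) \<in> lin A A"
  and lin_mult_right: "a \<in> carrier A \<Longrightarrow> (\<lambda>x. x \<otimes> a) \<in> lin A A"
  by (rule linI; simp add: r_distr l_distr smult_mult mult_smult)+

lemma right_idealI:
  assumes "I \<subseteq> carrier A" "\<zero> \<in> I" "\<And>x y. x \<in> I \<Longrightarrow> y \<in> I \<Longrightarrow> x \<oplus> y \<in> I"
    "\<And>x a. x \<in> I \<Longrightarrow> a \<in> carrier A \<Longrightarrow> x \<otimes> a \<in> I"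
  shows "right_ideal I A"
proof -
  have "\<ominus> x \<in> I" if "x \<in> I" for x
  proof -
    have "x \<otimes> (\<ominus> \<one>) = \<ominus> x" using that assms(1) by (simp add: r_minus subset_iff)
    then show ?thesis using assms(4)[OF that, of "\<ominus> \<one>"] by simp
  qed
  then have "subgroup I (add_monoid A)"
    using assms by (intro subgroup.intro) (auto simp: a_inv_def)
  then show ?thesis unfolding right_ideal_def additive_subgroup_def using assms(4) by auto
qed

lemma right_idealD:
  assumes "right_ideal I A"
  shows "I \<subseteq> carrier A" "\<zero> \<in> I" "\<And>x y. x \<in> I \<Longrightarrow> y \<in> I \<Longrightarrow> x \<oplus> y \<in> I"
    "\<And>x. x \<in> I \<Longrightarrow> \<ominus> x \<in> I" "\<And>x a. x \<in> I \<Longrightarrow> a \<in> carrier A \<Longrightarrow> x \<otimes> a \<in> I"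
  using assms additive_subgroup.a_subset[of I A] additive_subgroup.zero_closed[of I A]
    additive_subgroup.a_closed[of I A] additive_subgroup.a_inv_closed[of I A]
  by (auto simp: right_ideal_def abelian_group_axioms)

lemma right_ideal_one: "right_ideal I A \<Longrightarrow> \<one> \<in> I \<Longrightarrow> I = carrier A"
proof -
  assume I: "right_ideal I A" "\<one> \<in> I"
  then have "\<one> \<otimes> x \<in> I" if "x \<in> carrier A" for x using right_idealD(5) that by blast
  then show ?thesis using right_idealD(1)[OF I(1)] by auto
qed

lemma right_ideal_Union:
  assumes C: "C \<noteq> {}" "\<And>I. I \<in> C \<Longrightarrow> right_ideal I A" and lin: "\<And>I K. I \<in> C \<Longrightarrow> K \<in> C \<Longrightarrow> I \<subseteq> K \<or> K \<subseteq> I"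
  shows "right_ideal (\<Union>C) A"
proof (rule right_idealI)
  note D = right_idealD[OF C(2)]
  show "\<Union>C \<subseteq> carrier A" by (rule Union_least) (rule D(1))
  obtain I where "I \<in> C" using C(1) by auto
  then show "\<zero> \<in> \<Union>C" by (rule UnionI) (rule D(2)[OF \<open>I \<in> C\<close>])
  show "x \<oplus> y \<in> \<Union>C" if xy: "x \<in> \<Union>C" "y \<in> \<Union>C" for x y
  proof -
    obtain I K where IK: "I \<in> C" "K \<in> C" "x \<in> I" "y \<in> K" using xy by (elim UnionE)
    then obtain L where L: "L \<in> C" "x \<in> L" "y \<in> L"
      using lin[OF IK(1,2)] by (auto dest: subsetD)
    show ?thesis by (rule UnionI[OF L(1) D(3)[OF L]])
  qed
  show "x \<otimes> a \<in> \<Union>C" if x: "x \<in> \<Union>C" and a: "a \<in> carrier A" for x a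
  proof -
    obtain I where I: "I \<in> C" "x \<in> I" using x by (elim UnionE)
    show ?thesis by (rule UnionI[OF I(1) D(5)[OF I a]])
  qed
qed

text \<open>Zorn's lemma for the right ideals that contain \<open>J\<close> and avoid
  \<open>\<one>\<close>; avoiding \<open>\<one>\<close> is the same as being proper.\<close>

lemma maximal_right_ideal_exists:
  assumes J: "right_ideal J A" "\<one> \<notin> J"
  shows "\<exists>I. maximal_right_ideal I A \<and> J \<subseteq> I"
proof -
  define S where "S = {I. right_ideal I A \<and> J \<subseteq> I \<and> \<one> \<notin> I}"
  have "\<exists>M\<in>S. \<forall>X\<in>S. M \<subseteq> X \<longrightarrow> X = M"
  proof (rule subset_Zorn_nonempty)
    show "S \<noteq> {}" using J by (auto simp: S_def)
    fix C assume C: "C \<noteq> {}" "subset.chain S C"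
    have CS: "I \<in> S" if "I \<in> C" for I using C(2) that unfolding subset_chain_def by (auto dest: subsetD)
    have lin: "I \<subseteq> K \<or> K \<subseteq> I" if "I \<in> C" "K \<in> C" for I K
      using C(2) that unfolding subset_chain_def by simp
    have "right_ideal (\<Union>C) A" by (rule right_ideal_Union[OF C(1) _ lin]) (use CS in \<open>auto simp: S_def\<close>)
    moreover have "J \<subseteq> \<Union>C" using C(1) CS by (fastforce simp: S_def)
    moreover have "\<one> \<notin> \<Union>C" using CS by (auto simp: S_def)
    ultimately show "\<Union>C \<in> S" by (simp add: S_def)
  qed
  then obtain M where M: "M \<in> S" and mx: "\<And>X. X \<in> S \<Longrightarrow> M \<subseteq> X \<Longrightarrow> X = M" by auto
  have "maximal_right_ideal M A" unfolding maximal_right_ideal_def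
  proof (intro conjI allI impI)
    show "right_ideal M A" "M \<noteq> carrier A" using M by (auto simp: S_def)
    fix K assume K: "right_ideal K A" "M \<subseteq> K"
    show "K = M \<or> K = carrier A"
    proof (cases "\<one> \<in> K")
      case True
      then show ?thesis using right_ideal_one[OF K(1)] by simp
    next
      case False
      then have "K \<in> S" using M K by (auto simp: S_def)
      then show ?thesis using mx K(2) by simp
    qed
  qed
  then show ?thesis using M by (auto simp: S_def)
qed

lemma right_ideal_preimage:
  assumes I: "right_ideal I A" and a: "a \<in> carrier A"
  shows "right_ideal {y \<in> carrier A. a \<otimes> y \<in> I} A"
  by (rule right_idealI) (use right_idealD[OF I] a in \<open>auto simp: r_distr m_assoc[symmetric]\<close>)

text \<open>Left multiplication by \<open>a\<close> induces an isomorphism of the quotient by the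
  preimage with the simple module \<open>A/I\<close>. The lemma is the reason why the radical,
  defined by right ideals, absorbs multiplication from the left.\<close>

lemma maximal_right_ideal_preimage:
  assumes I: "maximal_right_ideal I A" and a: "a \<in> carrier A" and n: "a \<notin> I"
  shows "maximal_right_ideal {y \<in> carrier A. a \<otimes> y \<in> I} A" (is "maximal_right_ideal ?J A")
  unfolding maximal_right_ideal_def
proof (intro conjI allI impI)
  have rI: "right_ideal I A" using I by (simp add: maximal_right_ideal_def)
  show "right_ideal ?J A" by (rule right_ideal_preimage[OF rI a])
  show "?J \<noteq> carrier A"
  proof
    assume "?J = carrier A"
    then have "\<one> \<in> ?J" by simp
    then show False using n a by simp
  qed
  fix K assume K: "right_ideal K A" "?J \<subseteq> K"
  note Kc = right_idealD[OF K(1)] and Ic = right_idealD[OF rI]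
  show "K = ?J \<or> K = carrier A"
  proof (cases "K = ?J")
    case False
    then obtain k where k: "k \<in> K" "k \<in> carrier A" "a \<otimes> k \<notin> I" using K(2) Kc(1) by blast
    \<comment> \<open>\<open>I + a K\<close> is strictly larger than \<open>I\<close>, hence
      everything. Writing \<open>a = i + a u\<close> with \<open>i\<close> in \<open>I\<close> and
      \<open>u\<close> in \<open>K\<close> puts \<open>1 - u\<close> into the preimage and so into
      \<open>K\<close>, and therefore \<open>\<one>\<close> into \<open>K\<close>.\<close>
    let ?L = "{i \<oplus> a \<otimes> y | i y. i \<in> I \<and> y \<in> K}"
    have "right_ideal ?L A"
    proof (rule right_idealI)
      show "?L \<subseteq> carrier A" using Ic(1) Kc(1) a by auto
      show "\<zero> \<in> ?L" using Ic(2) Kc(2) a by force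
      show "x \<oplus> y \<in> ?L" if xy: "x \<in> ?L" "y \<in> ?L" for x y
      proof -
        obtain i j u v where *: "x = i \<oplus> a \<otimes> u" "y = j \<oplus> a \<otimes> v" "i \<in> I" "j \<in> I" "u \<in> K" "v \<in> K"
          using xy by blast
        then have "i \<in> carrier A" "j \<in> carrier A" "u \<in> carrier A" "v \<in> carrier A" using Ic(1) Kc(1) by auto
        then have "x \<oplus> y = (i \<oplus> j) \<oplus> a \<otimes> (u \<oplus> v)" using a * by (simp add: r_distr a_ac)
        then show ?thesis using * Ic(3) Kc(3) by blast
      qed
      show "x \<otimes> b \<in> ?L" if xb: "x \<in> ?L" "b \<in> carrier A" for x b
      proof -
        obtain i u where *: "x = i \<oplus> a \<otimes> u" "i \<in> I" "u \<in> K" using xb by blast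
        then have "i \<in> carrier A" "u \<in> carrier A" using Ic(1) Kc(1) by auto
        then have "x \<otimes> b = (i \<otimes> b) \<oplus> a \<otimes> (u \<otimes> b)" using a xb * by (simp add: l_distr m_assoc)
        then show ?thesis using * Ic(5) Kc(5) xb by blast
      qed
    qed
    moreover have "I \<subseteq> ?L"
    proof
      fix i assume i: "i \<in> I"
      then have "i = i \<oplus> a \<otimes> \<zero>" using Ic(1) a by (auto simp: subset_iff)
      then show "i \<in> ?L" using i Kc(2) by blast
    qed
    moreover have "?L \<noteq> I"
    proof
      assume eq: "?L = I"
      have "a \<otimes> k = \<zero> \<oplus> a \<otimes> k" using a k by simp
      then have "a \<otimes> k \<in> ?L" using Ic(2) k by blast
      then show False using k(3) eq by blast
    qed
    ultimately have "?L = carrier A" using I unfolding maximal_right_ideal_def by blast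
    then have "a \<in> ?L" using a by simp
    then obtain i u where *: "a = i \<oplus> a \<otimes> u" "i \<in> I" "u \<in> K" by blast
    then have c: "i \<in> carrier A" "u \<in> carrier A" using Ic(1) Kc(1) by auto
    have "a \<otimes> (\<one> \<ominus> u) = a \<ominus> a \<otimes> u" using a c by (simp add: a_minus_def r_distr r_minus)
    also have "\<dots> = i" using *(1) a c
      by (metis add.r_cancel_one' a_minus_def add.inv_solve_right m_closed)
    finally have "\<one> \<ominus> u \<in> ?J" using * c by simp
    then have "\<one> \<ominus> u \<in> K" using K(2) by blast
    then have "(\<one> \<ominus> u) \<oplus> u \<in> K" using Kc(3) *(3) by blast
    then have "\<one> \<in> K" using c by (simp add: a_minus_def a_assoc l_neg)
    then show ?thesis using right_ideal_one[OF K(1)] by blast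
  qed simp
qed

lemma ideal_rad: "ideal (rad A) A"
proof -
  have sub: "additive_subgroup (rad A) A"
  proof -
    have mr: "right_ideal I A" if "maximal_right_ideal I A" for I using that by (simp add: maximal_right_ideal_def)
    have "right_ideal (rad A) A"
      by (rule right_idealI) (use right_idealD[OF mr] in \<open>auto simp: rad_def\<close>)
    then show ?thesis by (simp add: right_ideal_def)
  qed
  show ?thesis
  proof (rule idealI[OF ring_axioms])
    show "subgroup (rad A) (add_monoid A)" using sub by (simp add: additive_subgroup_def)
    fix x a assume x: "x \<in> rad A" and a: "a \<in> carrier A"
    have xc: "x \<in> carrier A" using x by (simp add: rad_def)
    show "x \<otimes> a \<in> rad A"
      using x a right_idealD(5) by (auto simp: rad_def maximal_right_ideal_def)
    \<comment> \<open>If \<open>a\<close> lies in \<open>I\<close>, then \<open>a x\<close> does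
      because \<open>I\<close> is a right ideal. Otherwise the preimage of \<open>I\<close> under
      left multiplication by \<open>a\<close> is a maximal right ideal, and \<open>x\<close> belongs
      to it.\<close>
    show "a \<otimes> x \<in> rad A" unfolding rad_def
    proof (intro CollectI conjI allI impI)
      fix I assume I: "maximal_right_ideal I A"
      show "a \<otimes> x \<in> I"
      proof (cases "a \<in> I")
        case True
        then show ?thesis using I right_idealD(5) xc by (auto simp: maximal_right_ideal_def)
      next
        case False
        from maximal_right_ideal_preimage[OF I a this] x show ?thesis by (auto simp: rad_def)
      qed
    qed (use a xc in simp)
  qed
qed

text \<open>If \<open>u\<close> were in the radical, \<open>1 - u\<close> would generate the whole
  algebra as a right ideal; then \<open>1 = (1 - u) b\<close>, and multiplication by
  \<open>u\<close> from the left gives \<open>u = 0\<close>.\<close>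

lemma idempotent_notin_rad:
  assumes u: "idempotent A u" "u \<noteq> \<zero>"
  shows "u \<notin> rad A"
proof
  assume r: "u \<in> rad A"
  have uc: "u \<in> carrier A" and uu: "u \<otimes> u = u" using u by (auto simp: idempotent_def)
  let ?J = "(\<lambda>b. (\<one> \<ominus> u) \<otimes> b) ` carrier A"
  have rJ: "right_ideal ?J A"
  proof (rule right_idealI)
    show "?J \<subseteq> carrier A" using uc by auto
    have "\<zero> = (\<one> \<ominus> u) \<otimes> \<zero>" using uc by simp
    then show "\<zero> \<in> ?J" by (rule image_eqI) simp
    show "x \<oplus> y \<in> ?J" if xy: "x \<in> ?J" "y \<in> ?J" for x y
    proof -
      obtain b c where bc: "x = (\<one> \<ominus> u) \<otimes> b" "b \<in> carrier A" "y = (\<one> \<ominus> u) \<otimes> c" "c \<in> carrier A"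
        using xy by (elim imageE)
      then have "x \<oplus> y = (\<one> \<ominus> u) \<otimes> (b \<oplus> c)" using uc by (simp add: r_distr)
      then show ?thesis by (rule image_eqI) (use bc in simp)
    qed
    show "x \<otimes> a \<in> ?J" if xa: "x \<in> ?J" "a \<in> carrier A" for x a
    proof -
      obtain b where b: "x = (\<one> \<ominus> u) \<otimes> b" "b \<in> carrier A" using xa(1) by (elim imageE)
      then have "x \<otimes> a = (\<one> \<ominus> u) \<otimes> (b \<otimes> a)" using uc xa by (simp add: m_assoc)
      then show ?thesis by (rule image_eqI) (use b xa in simp)
    qed
  qed
  have "\<one> \<in> ?J"
  proof (rule ccontr)
    assume "\<one> \<notin> ?J"
    with maximal_right_ideal_exists[OF rJ] obtain I where I: "maximal_right_ideal I A" "?J \<subseteq> I" by auto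
    have rI: "right_ideal I A" using I(1) by (simp add: maximal_right_ideal_def)
    have "u \<in> I" using r I(1) by (simp add: rad_def)
    have "(\<one> \<ominus> u) \<otimes> \<one> \<in> ?J" by (rule imageI) simp
    then have "\<one> \<ominus> u \<in> I" using subsetD[OF I(2)] uc by simp
    then have "(\<one> \<ominus> u) \<oplus> u \<in> I" using \<open>u \<in> I\<close> by (rule right_idealD(3)[OF rI])
    then have "\<one> \<in> I" using uc by (simp add: a_minus_def a_assoc l_neg)
    then show False using right_ideal_one[OF rI] I(1) by (simp add: maximal_right_ideal_def)
  qed
  then obtain b where b: "\<one> = (\<one> \<ominus> u) \<otimes> b" "b \<in> carrier A" by (elim imageE)
  have "u = u \<otimes> ((\<one> \<ominus> u) \<otimes> b)" using b(1)[symmetric] uc by simp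
  also have "\<dots> = (u \<otimes> (\<one> \<ominus> u)) \<otimes> b" using b(2) uc by (simp add: m_assoc)
  also have "\<dots> = \<zero>"
  proof -
    have "u \<otimes> (\<one> \<ominus> u) = \<zero>" using uc uu by (simp add: a_minus_def r_distr r_minus r_neg)
    then show ?thesis using b(2) by simp
  qed
  finally show False using u(2) by simp
qed

text \<open>The image of \<open>u\<close> in \<open>k \<times> ... \<times> k\<close> is an
  idempotent, and nonzero because \<open>u\<close> is outside the radical. So one of its coordinates
  is 1, and this coordinate function is the character.\<close>

lemma elementary_character:
  assumes el: "elementary A" and u: "idempotent A u" "u \<noteq> \<zero>"
  shows "\<exists>\<chi>\<in>lin A kmod. (\<forall>x\<in>carrier A. \<forall>y\<in>carrier A. \<chi> (x \<otimes> y) = \<chi> x * \<chi> y) \<and> \<chi> u = 1"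
proof -
  interpret I: ideal "rad A" A by (rule ideal_rad)
  obtain r h where h: "h \<in> ring_iso (A Quot (rad A)) (prod_ring r :: (nat \<Rightarrow> 'k) ring)"
    and hs: "\<And>c x. x\<in>carrier A \<Longrightarrow> h (rad A +> (c \<odot> x)) = (\<lambda>i\<in>{..<r}. c * h (rad A +> x) i)"
    using el unfolding elementary_def by blast
  have uc: "u \<in> carrier A" and uu: "u \<otimes> u = u" using u by (auto simp: idempotent_def)
  have qc: "rad A +> x \<in> carrier (A Quot (rad A))" if "x \<in> carrier A" for x
    using that by (auto simp: FactRing_def A_RCOSETS_def')
  have hc: "h (rad A +> x) \<in> {..<r} \<rightarrow>\<^sub>E UNIV" if "x \<in> carrier A" for x
    using ring_iso_memE(1)[OF h qc[OF that]] by (simp add: prod_ring_def)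
  have hm: "h (rad A +> (x \<otimes> y)) = (\<lambda>i\<in>{..<r}. h (rad A +> x) i * h (rad A +> y) i)"
    if "x \<in> carrier A" "y \<in> carrier A" for x y
    using ring_iso_memE(2)[OF h qc[OF that(1)] qc[OF that(2)]] I.rcoset_mult_add[OF that]
    by (simp add: prod_ring_def FactRing_def)
  have ha: "h (rad A +> (x \<oplus> y)) = (\<lambda>i\<in>{..<r}. h (rad A +> x) i + h (rad A +> y) i)"
    if "x \<in> carrier A" "y \<in> carrier A" for x y
    using ring_iso_memE(3)[OF h qc[OF that(1)] qc[OF that(2)]] I.a_rcos_sum[OF that]
    by (simp add: prod_ring_def FactRing_def)
  have "\<exists>s<r. h (rad A +> u) s \<noteq> 0"
  proof (rule ccontr)
    assume "\<not> (\<exists>s<r. h (rad A +> u) s \<noteq> 0)"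
    then have z: "h (rad A +> u) s = 0" if "s < r" for s using that by simp
    have "h (rad A +> u) = (\<lambda>i\<in>{..<r}. 0)"
    proof
      fix s show "h (rad A +> u) s = (\<lambda>i\<in>{..<r}. 0) s"
        using z[of s] PiE_arb[OF hc[OF uc], of s] by (cases "s < r") simp_all
    qed
    \<comment> \<open>Zero is written as \<open>0 \<odot> \<one>\<close> so that the linearity of
      \<open>h\<close> evaluates it.\<close>
    also have "\<dots> = h (rad A +> (0 \<odot> \<one>))" unfolding hs[OF one_closed] by simp
    finally have eq: "h (rad A +> u) = h (rad A +> \<zero>)" by simp
    have inj: "inj_on h (carrier (A Quot (rad A)))" using ring_iso_memE(5)[OF h] by (simp add: bij_betw_def)
    have "rad A +> u = rad A +> \<zero>" by (rule inj_onD[OF inj eq]) (use qc uc in simp_all)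
    then have "u \<in> rad A +> \<zero>" using I.a_rcos_self[OF uc] by simp
    then obtain w where w: "w \<in> rad A" "u = w \<oplus> \<zero>" unfolding a_r_coset_def' by blast
    then have "u = w" using I.a_Hcarr[OF w(1)] by (metis r_zero)
    then have "u \<in> rad A" using w(1) by metis
    with idempotent_notin_rad[OF u] show False by simp
  qed
  then obtain s where s: "s < r" "h (rad A +> u) s \<noteq> 0" by blast
  let ?\<chi> = "\<lambda>x. h (rad A +> x) s"
  have "?\<chi> u * ?\<chi> u = ?\<chi> u" using fun_cong[OF hm[OF uc uc], of s] uu s by simp
  then have "?\<chi> u = 1" using s by simp
  moreover have "?\<chi> \<in> lin A kmod" by (rule linI) (use ha hs s in auto)
  ultimately show ?thesis using hm s by (intro bexI[of _ ?\<chi>]) auto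
qed

text \<open>Fitting's lemma in the corner \<open>e A e\<close>: once the subspaces generated by the
  powers of \<open>y\<close> become stable, they yield an idempotent \<open>u\<close> of the corner.
  By primitivity \<open>u\<close> is \<open>0\<close>, and then \<open>y\<close> is nilpotent, or it
  is \<open>e\<close>, which the character excludes.\<close>

lemma primitive_nilpotent:
  assumes p: "primitive_idempotent A e" and y: "y \<in> carrier A" "e \<otimes> y = y" "y \<otimes> e = y"
    and chi: "\<And>x z. x \<in> carrier A \<Longrightarrow> z \<in> carrier A \<Longrightarrow> \<chi> (x \<otimes> z) = \<chi> x * \<chi> z" "\<chi> e = 1" "\<chi> y = (0::'k)"
  shows "\<exists>n::nat. y [^] n = \<zero>"
proof -
  have e: "e \<in> carrier A" "e \<otimes> e = e" using p by (auto simp: primitive_idempotent_def idempotent_def)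
  \<comment> \<open>The commutant of \<open>y\<close> in the corner. A witness \<open>w\<close> for
    stability taken from it commutes with \<open>y\<close>, so that powers of
    \<open>y \<otimes> w\<close> can be separated.\<close>
  define C where "C = {w \<in> carrier A. e \<otimes> w = w \<and> w \<otimes> e = w \<and> w \<otimes> y = y \<otimes> w}"
  have sC: "subsp A C"
    by (rule subspI) (use e y in \<open>auto simp: C_def r_distr l_distr mult_smult smult_mult\<close>)
  have yw: "y \<otimes> w \<in> C" if "w \<in> C" for w
  proof -
    have w: "w \<in> carrier A" "e \<otimes> w = w" "w \<otimes> e = w" "w \<otimes> y = y \<otimes> w" using that by (auto simp: C_def)
    have "(y \<otimes> w) \<otimes> y = y \<otimes> (y \<otimes> w)" using w y by (simp add: m_assoc)
    moreover have "e \<otimes> (y \<otimes> w) = y \<otimes> w" using w y e by (simp add: m_assoc[symmetric])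
    ultimately show ?thesis using w y e by (simp add: C_def m_assoc)
  qed
  define U where "U n = (\<lambda>w. y [^] (n::nat) \<otimes> w) ` C" for n
  have sU: "subsp A (U n)" for n
    unfolding U_def by (rule subsp_image[OF vspA vspA lin_mult_left sC]) (use y in simp)
  have dec: "U (Suc n) \<subseteq> U n" for n
  proof
    fix z assume "z \<in> U (Suc n)"
    then obtain w where w: "w \<in> C" "z = y [^] Suc n \<otimes> w" by (auto simp: U_def)
    then have "z = y [^] n \<otimes> (y \<otimes> w)" using y by (auto simp: C_def m_assoc)
    then show "z \<in> U n" using yw[OF w(1)] by (auto simp: U_def)
  qed
  have "\<exists>n. U (Suc n) = U n" by (rule subsp_chain_stable[OF vspA fdA]) (rule sU dec)+
  then obtain n where n: "U (Suc n) = U n" by blast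
  have "e \<in> C" using e y by (simp add: C_def)
  then have "y [^] n \<otimes> e \<in> U (Suc n)" unfolding n by (auto simp: U_def)
  then obtain w where w: "w \<in> C" "y [^] n \<otimes> e = y [^] Suc n \<otimes> w" by (auto simp: U_def)
  have wc: "w \<in> carrier A" "e \<otimes> w = w" "w \<otimes> e = w" "w \<otimes> y = y \<otimes> w" using w(1) by (auto simp: C_def)
  \<comment> \<open>One more than the exponent of stability. So \<open>y\<close> is a factor of
    \<open>y [^] N\<close>, which makes \<open>e\<close> act on this power as identity and makes the
    character vanish on \<open>u\<close>.\<close>
  define N where "N = Suc n"
  define q where "q = y \<otimes> w"
  have qc: "q \<in> carrier A" using y wc by (simp add: q_def)
  have "y [^] N = (y [^] n \<otimes> e) \<otimes> y" using y e by (simp add: N_def m_assoc)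
  also have "\<dots> = y [^] N \<otimes> q" unfolding w(2) N_def q_def using y wc by (simp add: m_assoc)
  finally have yq: "y [^] N \<otimes> q = y [^] N" by simp
  have yqm: "y [^] N \<otimes> q [^] (m::nat) = y [^] N" for m
  proof (induction m)
    case (Suc m)
    have "y [^] N \<otimes> q [^] Suc m = (y [^] N \<otimes> q [^] m) \<otimes> q" using y qc by (simp add: m_assoc)
    then show ?case using Suc yq by simp
  qed (use y in simp)
  \<comment> \<open>Since \<open>y [^] N\<close> absorbs \<open>q\<close> on the right, it absorbs
    every power of \<open>q\<close>; with \<open>u = w [^] N \<otimes> y [^] N\<close> this makes
    \<open>u\<close> idempotent.\<close>
  define u where "u = q [^] N"
  have uc: "u \<in> carrier A" using qc by (simp add: u_def)
  have u1: "u = y [^] N \<otimes> w [^] N" unfolding u_def q_def using pow_mult_distrib[of y w N] y wc by simp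
  have u2: "u = w [^] N \<otimes> y [^] N" unfolding u_def q_def
    using pow_mult_distrib[of w y N] y wc by simp
  have "u \<otimes> u = w [^] N \<otimes> (y [^] N \<otimes> q [^] N)" using y wc qc by (subst u2) (simp add: u_def m_assoc)
  then have uu: "u \<otimes> u = u" using yqm u2 by simp
  have ye: "e \<otimes> y [^] N = y [^] N" unfolding N_def nat_pow_Suc2[OF y(1)] using y e by (simp add: m_assoc[symmetric])
  have ye': "y [^] N \<otimes> e = y [^] N" unfolding N_def using y e by (simp add: m_assoc)
  have eu: "e \<otimes> u = u" unfolding u1 using ye e y wc by (simp add: m_assoc[symmetric])
  have ue: "u \<otimes> e = u" unfolding u2 using ye' e y wc by (simp add: m_assoc)
  have "u = \<zero> \<or> e \<ominus> u = \<zero>"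
  proof (rule ccontr)
    assume "\<not> (u = \<zero> \<or> e \<ominus> u = \<zero>)"
    moreover have "idempotent A u" using uc uu by (simp add: idempotent_def)
    moreover have "idempotent A (e \<ominus> u)"
      using uc uu e eu ue by (simp add: idempotent_def a_minus_def r_distr l_distr r_minus l_minus a_ac r_neg)
    moreover have "u \<otimes> (e \<ominus> u) = \<zero>" "(e \<ominus> u) \<otimes> u = \<zero>"
      using uc uu e eu ue by (simp_all add: a_minus_def r_distr l_distr r_minus l_minus r_neg)
    moreover have "e = u \<oplus> (e \<ominus> u)" using uc e by (simp add: a_minus_def a_lcomm r_neg)
    ultimately show False using p unfolding primitive_idempotent_def by blast
  qed
  then show ?thesis
  proof
    assume "u = \<zero>"
    then have "y [^] N = y [^] N \<otimes> \<zero>" using yqm[of N] by (simp add: u_def)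
    then show ?thesis using y by auto
  next
    assume "e \<ominus> u = \<zero>"
    then have "u = e" using e uc by simp
    moreover have "\<chi> u = 0"
    proof -
      have "u = y \<otimes> (y [^] n \<otimes> w [^] N)" unfolding u1 N_def nat_pow_Suc2[OF y(1)] using y wc by (simp add: m_assoc)
      then show ?thesis using chi(1)[of y "y [^] n \<otimes> w [^] N"] chi(3) y wc by simp
    qed
    ultimately show ?thesis using chi(2) by simp
  qed
qed

end

locale elem_alg = fin_alg A for A :: "('k::field, 'a) module" (structure) +
  fixes es :: "'a list"
  assumes elementary: "elementary A" and complete: "complete_idempotents A es"
begin

abbreviation "n \<equiv> length es"
abbreviation "e i \<equiv> es ! i"

lemma e_prim: "i < n \<Longrightarrow> primitive_idempotent A (e i)"
  and e_orth: "i < n \<Longrightarrow> j < n \<Longrightarrow> i \<noteq> j \<Longrightarrow> e i \<otimes> e j = \<zero>"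
  and e_sum: "finsum A (\<lambda>i. e i) {..<n} = \<one>"
  using complete by (auto simp: complete_idempotents_def)

lemma e_closed [simp]: "i < n \<Longrightarrow> e i \<in> carrier A"
  and e_idem: "i < n \<Longrightarrow> e i \<otimes> e i = e i"
  using e_prim by (auto simp: primitive_idempotent_def idempotent_def)

definition chi :: "nat \<Rightarrow> 'a \<Rightarrow> 'k" where
  "chi i = (SOME \<chi>. \<chi> \<in> lin A kmod \<and> (\<forall>x\<in>carrier A. \<forall>y\<in>carrier A. \<chi> (x \<otimes> y) = \<chi> x * \<chi> y) \<and> \<chi> (e i) = 1)"

lemma chi:
  assumes "i < n"
  shows chi_lin: "chi i \<in> lin A kmod"
    and chi_mult: "\<And>x y. x \<in> carrier A \<Longrightarrow> y \<in> carrier A \<Longrightarrow> chi i (x \<otimes> y) = chi i x * chi i y"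
    and chi_e: "chi i (e i) = 1"
proof -
  have "\<exists>\<chi>. \<chi> \<in> lin A kmod \<and> (\<forall>x\<in>carrier A. \<forall>y\<in>carrier A. \<chi> (x \<otimes> y) = \<chi> x * \<chi> y) \<and> \<chi> (e i) = 1"
    using elementary_character[OF elementary, of "e i"] e_prim[OF assms] by (auto simp: primitive_idempotent_def)
  from someI_ex[OF this, folded chi_def] show "chi i \<in> lin A kmod"
    "\<And>x y. x \<in> carrier A \<Longrightarrow> y \<in> carrier A \<Longrightarrow> chi i (x \<otimes> y) = chi i x * chi i y" "chi i (e i) = 1" by auto
qed

text \<open>Multiplicativity turns orthogonality into \<open>chi i (e i) * chi i (e j) = 0\<close>,
  and the first factor is 1.\<close>

lemma chi_e_other: "i < n \<Longrightarrow> j < n \<Longrightarrow> i \<noteq> j \<Longrightarrow> chi i (e j) = 0"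
  using chi_mult[of i "e i" "e j"] chi_e[of i] e_orth[of i j] lin_zero[OF vspA vsp_kmod chi_lin[of i]] by simp

lemma chi_one: "i < n \<Longrightarrow> chi i \<one> = 1"
  using chi_mult[of i "e i" \<one>] chi_e[of i] by simp

lemma corner_nilpotent:
  assumes i: "i < n" and y: "y \<in> carrier A" "e i \<otimes> y = y" "y \<otimes> e i = y" "chi i y = 0"
  shows "\<exists>m::nat. y [^] m = \<zero>"
  by (rule primitive_nilpotent[OF e_prim[OF i] y(1-3), of "chi i"]) (use i y chi_mult chi_e in auto)

text \<open>Peirce decomposition of \<open>a\<close>. The pieces \<open>e_i a e_j\<close> off the
  diagonal have square zero. On the diagonal \<open>e_i a e_i - chi_i(a) e_i\<close> lies in a
  corner and is killed by the character, hence nilpotent. So \<open>T\<close> sees only the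
  multiples \<open>chi_i(a) e_i\<close>.\<close>

lemma trace_form_eq:
  assumes T: "T \<in> lin A kmod" and nil: "\<And>y m. y \<in> carrier A \<Longrightarrow> y [^] (m::nat) = \<zero> \<Longrightarrow> T y = 0"
    and a: "a \<in> carrier A"
  shows "T a = (\<Sum>i<n. chi i a * T (e i))"
proof -
  have off: "T (e i \<otimes> a \<otimes> e j) = 0" if "i < n" "j < n" "i \<noteq> j" for i j
  proof (rule nil[of _ 2])
    let ?y = "e i \<otimes> a \<otimes> e j"
    have "?y [^] (2::nat) = ?y \<otimes> ?y" using that a by (simp add: numeral_2_eq_2)
    also have "\<dots> = e i \<otimes> a \<otimes> ((e j \<otimes> e i) \<otimes> (a \<otimes> e j))" using that a by (simp add: m_assoc)
    finally show "?y [^] (2::nat) = \<zero>" using that a e_orth[of j i] by simp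
  qed (use that a in simp)
  have diag: "T (e i \<otimes> a \<otimes> e i) = chi i a * T (e i)" if i: "i < n" for i
  proof -
    let ?x = "e i \<otimes> a \<otimes> e i"
    let ?y = "?x \<oplus> ((- chi i a) \<odot> e i)"
    have xe: "e i \<otimes> ?x = ?x" "?x \<otimes> e i = ?x"
      using i a e_idem[OF i] by (auto simp: m_assoc) (simp add: m_assoc[symmetric])
    have "chi i ?y = 0"
      using i a lin_add[OF chi_lin[OF i]] lin_smult[OF chi_lin[OF i]] by (simp add: chi_mult chi_e)
    moreover have "e i \<otimes> ?y = ?y" "?y \<otimes> e i = ?y"
      using i a xe e_idem[OF i] by (simp_all add: r_distr l_distr mult_smult smult_mult)
    ultimately obtain m where "?y [^] (m::nat) = \<zero>" using corner_nilpotent[OF i, of ?y] i a by auto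
    then have "T ?y = 0" using i a by (intro nil) auto
    then show ?thesis using lin_add[OF T, of ?x] lin_smult[OF T, of "e i"] i a by simp
  qed
  \<comment> \<open>A name for the unit in expanded form, so that it can be multiplied out once on
    each side of \<open>a\<close>.\<close>
  define S where "S = finsum A (\<lambda>i. e i) {..<n}"
  have l: "S \<otimes> a = finsum A (\<lambda>i. e i \<otimes> a) {..<n}"
    unfolding S_def using a by (intro finsum_ldistr) auto
  have r: "finsum A (\<lambda>i. e i \<otimes> a) {..<n} \<otimes> S = finsum A (\<lambda>i. (e i \<otimes> a) \<otimes> S) {..<n}"
    using a e_sum by (intro finsum_ldistr) (auto simp: S_def)
  have c: "finsum A (\<lambda>i. (e i \<otimes> a) \<otimes> S) {..<n} = finsum A (\<lambda>i. finsum A (\<lambda>j. e i \<otimes> a \<otimes> e j) {..<n}) {..<n}"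
    unfolding S_def using a by (intro finsum_cong' finsum_rdistr) auto
  have "(S \<otimes> a) \<otimes> S = a" using a by (simp add: e_sum S_def)
  then have "T a = T (finsum A (\<lambda>i. finsum A (\<lambda>j. e i \<otimes> a \<otimes> e j) {..<n}) {..<n})"
    using l r c by (metis (lifting))
  also have "\<dots> = (\<Sum>i<n. T (finsum A (\<lambda>j. e i \<otimes> a \<otimes> e j) {..<n}))"
    using a by (intro lin_kmod_finsum[OF vspA T]) auto
  also have "\<dots> = (\<Sum>i<n. \<Sum>j<n. T (e i \<otimes> a \<otimes> e j))"
    using a by (intro sum.cong lin_kmod_finsum[OF vspA T]) auto
  also have "\<dots> = (\<Sum>i<n. \<Sum>j<n. if j = i then chi i a * T (e i) else 0)"
    by (intro sum.cong) (auto simp: off diag)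
  also have "\<dots> = (\<Sum>i<n. chi i a * T (e i))" by simp
  finally show ?thesis .
qed

end

section \<open>Modules, lifting and chain maps\<close>

context fin_alg
begin

lemma right_moduleD:
  assumes "right_module A M"
  shows "vsp M"
    "\<And>x a. x \<in> carrier M \<Longrightarrow> a \<in> carrier A \<Longrightarrow> ract M x a \<in> carrier M"
    "\<And>x y a. x \<in> carrier M \<Longrightarrow> y \<in> carrier M \<Longrightarrow> a \<in> carrier A \<Longrightarrow> ract M (x \<oplus>\<^bsub>M\<^esub> y) a = ract M x a \<oplus>\<^bsub>M\<^esub> ract M y a"
    "\<And>x a b. x \<in> carrier M \<Longrightarrow> a \<in> carrier A \<Longrightarrow> b \<in> carrier A \<Longrightarrow> ract M x (a \<oplus> b) = ract M x a \<oplus>\<^bsub>M\<^esub> ract M x b"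
    "\<And>c x a. x \<in> carrier M \<Longrightarrow> a \<in> carrier A \<Longrightarrow> ract M (c \<odot>\<^bsub>M\<^esub> x) a = c \<odot>\<^bsub>M\<^esub> ract M x a"
    "\<And>c x a. x \<in> carrier M \<Longrightarrow> a \<in> carrier A \<Longrightarrow> ract M x (c \<odot> a) = c \<odot>\<^bsub>M\<^esub> ract M x a"
    "\<And>x a b. x \<in> carrier M \<Longrightarrow> a \<in> carrier A \<Longrightarrow> b \<in> carrier A \<Longrightarrow> ract M x (a \<otimes> b) = ract M (ract M x a) b"
    "\<And>x. x \<in> carrier M \<Longrightarrow> ract M x \<one> = x"
  using assms unfolding right_module_def by blast+

lemma right_moduleI:
  assumes "vsp M"
    "\<And>x a. x \<in> carrier M \<Longrightarrow> a \<in> carrier A \<Longrightarrow> ract M x a \<in> carrier M"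
    "\<And>x y a. x \<in> carrier M \<Longrightarrow> y \<in> carrier M \<Longrightarrow> a \<in> carrier A \<Longrightarrow> ract M (x \<oplus>\<^bsub>M\<^esub> y) a = ract M x a \<oplus>\<^bsub>M\<^esub> ract M y a"
    "\<And>x a b. x \<in> carrier M \<Longrightarrow> a \<in> carrier A \<Longrightarrow> b \<in> carrier A \<Longrightarrow> ract M x (a \<oplus> b) = ract M x a \<oplus>\<^bsub>M\<^esub> ract M x b"
    "\<And>c x a. x \<in> carrier M \<Longrightarrow> a \<in> carrier A \<Longrightarrow> ract M (c \<odot>\<^bsub>M\<^esub> x) a = c \<odot>\<^bsub>M\<^esub> ract M x a"
    "\<And>c x a. x \<in> carrier M \<Longrightarrow> a \<in> carrier A \<Longrightarrow> ract M x (c \<odot> a) = c \<odot>\<^bsub>M\<^esub> ract M x a"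
    "\<And>x a b. x \<in> carrier M \<Longrightarrow> a \<in> carrier A \<Longrightarrow> b \<in> carrier A \<Longrightarrow> ract M x (a \<otimes> b) = ract M (ract M x a) b"
    "\<And>x. x \<in> carrier M \<Longrightarrow> ract M x \<one> = x"
  shows "right_module A M"
  unfolding right_module_def by (intro conjI ballI allI) (simp_all add: assms)

lemma lin_ract: "right_module A M \<Longrightarrow> a \<in> carrier A \<Longrightarrow> (\<lambda>x. ract M x a) \<in> lin M M"
  and lin_ract': "right_module A M \<Longrightarrow> x \<in> carrier M \<Longrightarrow> (\<lambda>a. ract M x a) \<in> lin A M"
  by (rule linI; simp add: right_moduleD)+

lemma ract_zero: "right_module A M \<Longrightarrow> x \<in> carrier M \<Longrightarrow> ract M x \<zero> = \<zero>\<^bsub>M\<^esub>"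
  by (rule lin_zero[OF vspA right_moduleD(1) lin_ract'])
lemma ract_zero': "right_module A M \<Longrightarrow> a \<in> carrier A \<Longrightarrow> ract M \<zero>\<^bsub>M\<^esub> a = \<zero>\<^bsub>M\<^esub>"
  by (rule lin_zero[OF right_moduleD(1) right_moduleD(1) lin_ract])

lemma rmod_homI:
  assumes "\<And>x. x \<in> carrier M \<Longrightarrow> f x \<in> carrier N"
    "\<And>x y. x \<in> carrier M \<Longrightarrow> y \<in> carrier M \<Longrightarrow> f (x \<oplus>\<^bsub>M\<^esub> y) = f x \<oplus>\<^bsub>N\<^esub> f y"
    "\<And>x a. x \<in> carrier M \<Longrightarrow> a \<in> carrier A \<Longrightarrow> f (ract M x a) = ract N (f x) a"
  shows "f \<in> rmod_hom A M N"
  using assms by (auto simp: rmod_hom_def)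

lemma rmod_homD:
  assumes "f \<in> rmod_hom A M N"
  shows "\<And>x. x \<in> carrier M \<Longrightarrow> f x \<in> carrier N"
    "\<And>x y. x \<in> carrier M \<Longrightarrow> y \<in> carrier M \<Longrightarrow> f (x \<oplus>\<^bsub>M\<^esub> y) = f x \<oplus>\<^bsub>N\<^esub> f y"
    "\<And>x a. x \<in> carrier M \<Longrightarrow> a \<in> carrier A \<Longrightarrow> f (ract M x a) = ract N (f x) a"
  using assms unfolding rmod_hom_def by blast+

text \<open>Linearity over \<open>k\<close> is not demanded in \<open>rmod_hom\<close>; it comes
  from the action of \<open>c \<odot> \<one>\<close>.\<close>

lemma rmod_hom_lin:
  assumes "right_module A M" "right_module A N" "f \<in> rmod_hom A M N"
  shows "f \<in> lin M N"
proof (rule linI)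
  fix c x assume x: "x \<in> carrier M"
  have "f (c \<odot>\<^bsub>M\<^esub> x) = f (ract M x (c \<odot> \<one>))"
    using right_moduleD(6)[OF assms(1) x one_closed] right_moduleD(8)[OF assms(1) x] by simp
  also have "\<dots> = ract N (f x) (c \<odot> \<one>)" using rmod_homD(3)[OF assms(3) x] by simp
  also have "\<dots> = c \<odot>\<^bsub>N\<^esub> f x"
    using right_moduleD(6,8)[OF assms(2) rmod_homD(1)[OF assms(3) x]] by simp
  finally show "f (c \<odot>\<^bsub>M\<^esub> x) = c \<odot>\<^bsub>N\<^esub> f x" .
qed (use rmod_homD[OF assms(3)] in auto)

lemma rmod_hom_id: "(\<lambda>x. x) \<in> rmod_hom A M M"
  by (rule rmod_homI) auto
lemma rmod_hom_comp: "f \<in> rmod_hom A M N \<Longrightarrow> g \<in> rmod_hom A N L \<Longrightarrow> (\<lambda>x. g (f x)) \<in> rmod_hom A M L"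
  by (rule rmod_homI) (simp_all add: rmod_homD)
lemma rmod_hom_zero: "right_module A N \<Longrightarrow> (\<lambda>x. \<zero>\<^bsub>N\<^esub>) \<in> rmod_hom A M N"
  by (rule rmod_homI) (simp_all add: right_moduleD ract_zero')
lemma rmod_hom_minus:
  assumes N: "right_module A N" and f: "f \<in> rmod_hom A M N" and g: "g \<in> rmod_hom A M N"
  shows "(\<lambda>x. f x \<ominus>\<^bsub>N\<^esub> g x) \<in> rmod_hom A M N"
proof (rule rmod_homI)
  note v = right_moduleD(1)[OF N]
  show "f (x \<oplus>\<^bsub>M\<^esub> y) \<ominus>\<^bsub>N\<^esub> g (x \<oplus>\<^bsub>M\<^esub> y) = (f x \<ominus>\<^bsub>N\<^esub> g x) \<oplus>\<^bsub>N\<^esub> (f y \<ominus>\<^bsub>N\<^esub> g y)"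
    if "x \<in> carrier M" "y \<in> carrier M" for x y
    using that rmod_homD[OF f] rmod_homD[OF g] v by (simp add: vs_minus_eq vs_smult_r_distr vs_ac)
  show "f (ract M x a) \<ominus>\<^bsub>N\<^esub> g (ract M x a) = ract N (f x \<ominus>\<^bsub>N\<^esub> g x) a" if "x \<in> carrier M" "a \<in> carrier A" for x a
    using that rmod_homD[OF f] rmod_homD[OF g] v by (simp add: vs_minus_eq right_moduleD[OF N])
qed (use rmod_homD[OF f] rmod_homD[OF g] right_moduleD(1)[OF N] in auto)

lemma right_module_sub:
  assumes M: "right_module A M" and U: "subsp M U" "\<And>x a. x \<in> U \<Longrightarrow> a \<in> carrier A \<Longrightarrow> ract M x a \<in> U"
  shows "right_module A (M\<lparr>carrier := U\<rparr>)"
proof -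
  have [simp]: "x \<in> U \<Longrightarrow> x \<in> carrier M" for x using subspD(1)[OF U(1)] by auto
  show ?thesis
    by (rule right_moduleI) (use vsp_subsp[OF right_moduleD(1)[OF M] U(1)] U(2) right_moduleD[OF M] in auto)
qed

lemma right_module_ker:
  assumes M: "right_module A M" and N: "right_module A N" and f: "f \<in> rmod_hom A M N"
  shows "right_module A (M\<lparr>carrier := {x \<in> carrier M. f x = \<zero>\<^bsub>N\<^esub>}\<rparr>)"
  using right_moduleD[OF M] rmod_homD[OF f] ract_zero'[OF N]
  by (intro right_module_sub M subsp_ker right_moduleD(1)[OF M] right_moduleD(1)[OF N] rmod_hom_lin[OF M N f]) auto

lemma subsp_ract_image:
  assumes "right_module A M" "a \<in> carrier A"
  shows "subsp M {ract M x a | x. x \<in> carrier M}"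
proof -
  have "{ract M x a | x. x \<in> carrier M} = (\<lambda>x. ract M x a) ` carrier M" by auto
  then show ?thesis
    using subsp_image[OF right_moduleD(1)[OF assms(1)] right_moduleD(1)[OF assms(1)] lin_ract[OF assms] subsp_self[OF right_moduleD(1)[OF assms(1)]]]
    by simp
qed

subsection \<open>Free modules and dual bases\<close>

lemma free_rmod_simps [simp]: "zero (free_rmod A I) = (\<lambda>i. \<zero>)" "add (free_rmod A I) = (\<lambda>x y i. x i \<oplus> y i)"
  "smult (free_rmod A I) = (\<lambda>c x i. c \<odot> x i)" "ract (free_rmod A I) = (\<lambda>x a i. x i \<otimes> a)"
  by (auto simp: free_rmod_def)

lemma free_rmod_mem: "v \<in> carrier (free_rmod A I) \<longleftrightarrow>
    (\<forall>i. v i \<in> carrier A) \<and> (\<forall>i. i \<notin> I \<longrightarrow> v i = \<zero>) \<and> finite {i. v i \<noteq> \<zero>}"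
  by (auto simp: free_rmod_def)

lemma free_rmod_closed: "v \<in> carrier (free_rmod A I) \<Longrightarrow> v i \<in> carrier A"
  by (simp add: free_rmod_mem)

lemma right_module_free: "right_module A (free_rmod A I)"
proof (rule right_moduleI)
  have fin: "finite {i. v i \<noteq> \<zero> \<or> w i \<noteq> \<zero>}" if "finite {i. v i \<noteq> \<zero>}" "finite {i. w i \<noteq> \<zero>}" for v w :: "'c \<Rightarrow> 'a"
    using finite_UnI[OF that] by (simp only: Collect_disj_eq)
  have add: "(\<lambda>i. v i \<oplus> w i) \<in> carrier (free_rmod A I)" if "v \<in> carrier (free_rmod A I)" "w \<in> carrier (free_rmod A I)" for v w
  proof -
    have "finite {i. v i \<oplus> w i \<noteq> \<zero>}"
      by (rule finite_subset[OF _ fin[of v w]]) (use that in \<open>auto simp: free_rmod_mem\<close>)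
    then show ?thesis using that by (simp add: free_rmod_mem)
  qed
  have sm: "(\<lambda>i. c \<odot> v i) \<in> carrier (free_rmod A I)" if "v \<in> carrier (free_rmod A I)" for v c
  proof -
    have "finite {i. c \<odot> v i \<noteq> \<zero>}"
      by (rule finite_subset[of _ "{i. v i \<noteq> \<zero>}"]) (use that in \<open>auto simp: free_rmod_mem\<close>)
    then show ?thesis using that by (simp add: free_rmod_mem)
  qed
  have neg: "x \<oplus> ((- 1) \<odot> x) = \<zero>" if "x \<in> carrier A" for x
    using vs_minus_eq[OF vspA that that] vs_minus_self[OF vspA that] by (simp only:)
  show "vsp (free_rmod A I)"
  proof (rule vspI)
    show "\<zero>\<^bsub>free_rmod A I\<^esub> \<in> carrier (free_rmod A I)" by (simp add: free_rmod_mem)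
    show "v \<oplus>\<^bsub>free_rmod A I\<^esub> w = w \<oplus>\<^bsub>free_rmod A I\<^esub> v"
      if "v \<in> carrier (free_rmod A I)" "w \<in> carrier (free_rmod A I)" for v w
      using that a_comm by (simp add: fun_eq_iff free_rmod_closed)
  qed (use add sm in \<open>simp_all add: fun_eq_iff free_rmod_closed a_assoc neg vs_smult_smult[OF vspA]
          vs_smult_l_distr[OF vspA] vs_smult_r_distr[OF vspA]\<close>)
  show "ract (free_rmod A I) v a \<in> carrier (free_rmod A I)" if "v \<in> carrier (free_rmod A I)" "a \<in> carrier A" for v a
  proof -
    have "finite {i. v i \<otimes> a \<noteq> \<zero>}"
      by (rule finite_subset[of _ "{i. v i \<noteq> \<zero>}"]) (use that in \<open>auto simp: free_rmod_mem\<close>)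
    then show ?thesis using that by (simp add: free_rmod_mem)
  qed
qed (simp_all add: fun_eq_iff free_rmod_closed l_distr r_distr smult_mult mult_smult m_assoc)

lemmas vsp_free = right_moduleD(1)[OF right_module_free]

lemma free_eval_lin: "(\<lambda>v. v i) \<in> lin (free_rmod A I) A"
  by (rule linI) (auto simp: free_rmod_closed)

text \<open>The homomorphism from a free module with prescribed images \<open>c i\<close> of the
  basis vectors. The sum runs over the support of \<open>v\<close>, because the index set may be
  infinite.\<close>

definition free_ext :: "('k, 'v, 'a, 'z) rmod_scheme \<Rightarrow> ('i \<Rightarrow> 'v) \<Rightarrow> ('i \<Rightarrow> 'a) \<Rightarrow> 'v" where
  "free_ext X c v = finsum X (\<lambda>i. ract X (c i) (v i)) {i. v i \<noteq> \<zero>}"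

lemma free_ext_superset:
  assumes X: "right_module A X" and c: "c \<in> I \<rightarrow> carrier X" and v: "v \<in> carrier (free_rmod A I)"
    and J: "finite J" "J \<subseteq> I" "{i. v i \<noteq> \<zero>} \<subseteq> J"
  shows "free_ext X c v = finsum X (\<lambda>i. ract X (c i) (v i)) J"
  unfolding free_ext_def
proof (rule vs_finsum_mono[OF right_moduleD(1)[OF X] J(1,3)])
  show "(\<lambda>i. ract X (c i) (v i)) \<in> J \<rightarrow> carrier X"
    using c J(2) free_rmod_closed[OF v] right_moduleD(2)[OF X] by blast
  show "ract X (c i) (v i) = \<zero>\<^bsub>X\<^esub>" if "i \<in> J - {i. v i \<noteq> \<zero>}" for i
    using that c J(2) ract_zero[OF X] by auto
qed

lemma free_ext_hom:
  assumes X: "right_module A X" and c: "c \<in> I \<rightarrow> carrier X"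
  shows "free_ext X c \<in> rmod_hom A (free_rmod A I) X"
proof (rule rmod_homI)
  note vX = right_moduleD(1)[OF X]
  have supp: "{i. v i \<noteq> \<zero>} \<subseteq> I" "finite {i. v i \<noteq> \<zero>}" if "v \<in> carrier (free_rmod A I)" for v
    using that by (auto simp: free_rmod_mem)
  have tm: "ract X (c i) (v i) \<in> carrier X" if "v \<in> carrier (free_rmod A I)" "i \<in> I" for v i
    using that(2) c free_rmod_closed[OF that(1)] by (auto intro!: right_moduleD(2)[OF X])
  show "free_ext X c v \<in> carrier X" if "v \<in> carrier (free_rmod A I)" for v
    unfolding free_ext_def using tm[OF that] supp[OF that] by (intro vs_finsum[OF vX]) auto
  show "free_ext X c (v \<oplus>\<^bsub>free_rmod A I\<^esub> w) = free_ext X c v \<oplus>\<^bsub>X\<^esub> free_ext X c w"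
    if v: "v \<in> carrier (free_rmod A I)" and w: "w \<in> carrier (free_rmod A I)" for v w
  proof -
    let ?J = "{i. v i \<noteq> \<zero>} \<union> {i. w i \<noteq> \<zero>}"
    have J: "finite ?J" "?J \<subseteq> I" using supp[OF v] supp[OF w] by auto
    have vw: "v \<oplus>\<^bsub>free_rmod A I\<^esub> w \<in> carrier (free_rmod A I)" by (rule vs_add[OF vsp_free v w])
    have s: "{i. (v \<oplus>\<^bsub>free_rmod A I\<^esub> w) i \<noteq> \<zero>} \<subseteq> ?J" by auto
    have "free_ext X c (v \<oplus>\<^bsub>free_rmod A I\<^esub> w) = finsum X (\<lambda>i. ract X (c i) (v i) \<oplus>\<^bsub>X\<^esub> ract X (c i) (w i)) ?J"
      unfolding free_ext_superset[OF X c vw J s]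
    proof (rule vs_finsum_cong[OF vX refl])
      show "ract X (c i) ((v \<oplus>\<^bsub>free_rmod A I\<^esub> w) i) = ract X (c i) (v i) \<oplus>\<^bsub>X\<^esub> ract X (c i) (w i)" if "i \<in> ?J" for i
      proof -
        have "c i \<in> carrier X" using c J(2) that by (auto simp: Pi_iff)
        then show ?thesis using free_rmod_closed[OF v] free_rmod_closed[OF w] right_moduleD(4)[OF X] by simp
      qed
      show "(\<lambda>i. ract X (c i) (v i) \<oplus>\<^bsub>X\<^esub> ract X (c i) (w i)) \<in> ?J \<rightarrow> carrier X"
        using tm[OF v] tm[OF w] J(2) vX by (auto simp: subset_iff)
    qed
    also have "\<dots> = free_ext X c v \<oplus>\<^bsub>X\<^esub> free_ext X c w"
      unfolding free_ext_superset[OF X c v J Un_upper1] free_ext_superset[OF X c w J Un_upper2]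
      using tm[OF v] tm[OF w] J(2) by (intro vs_finsum_add[OF vX]) auto
    finally show ?thesis .
  qed
  show "free_ext X c (ract (free_rmod A I) v a) = ract X (free_ext X c v) a"
    if v: "v \<in> carrier (free_rmod A I)" and a: "a \<in> carrier A" for v a
  proof -
    let ?J = "{i. v i \<noteq> \<zero>}"
    have va: "ract (free_rmod A I) v a \<in> carrier (free_rmod A I)" by (rule right_moduleD(2)[OF right_module_free v a])
    have s: "{i. (ract (free_rmod A I) v a) i \<noteq> \<zero>} \<subseteq> ?J" using a by auto
    have "free_ext X c (ract (free_rmod A I) v a) = finsum X (\<lambda>i. ract X (ract X (c i) (v i)) a) ?J"
      unfolding free_ext_superset[OF X c va supp(2,1)[OF v] s]
    proof (rule vs_finsum_cong[OF vX refl])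
      show "ract X (c i) (ract (free_rmod A I) v a i) = ract X (ract X (c i) (v i)) a" if "i \<in> ?J" for i
      proof -
        have "c i \<in> carrier X" using c supp(1)[OF v] that by (auto simp: Pi_iff)
        then show ?thesis using free_rmod_closed[OF v] a right_moduleD(7)[OF X] by simp
      qed
      show "(\<lambda>i. ract X (ract X (c i) (v i)) a) \<in> ?J \<rightarrow> carrier X"
        using tm[OF v] supp(1)[OF v] a right_moduleD(2)[OF X] by auto
    qed
    also have "\<dots> = ract X (free_ext X c v) a"
      unfolding free_ext_def using tm[OF v] supp(1)[OF v]
      by (intro lin_finsum[OF vX vX lin_ract[OF X a], symmetric]) auto
    finally show ?thesis .
  qed
qed

lemma free_ext_comp:
  assumes X: "right_module A X" and Y: "right_module A Y" and f: "f \<in> rmod_hom A X Y"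
    and c: "c \<in> I \<rightarrow> carrier X" and v: "v \<in> carrier (free_rmod A I)"
  shows "f (free_ext X c v) = free_ext Y (\<lambda>i. f (c i)) v"
proof -
  note vX = right_moduleD(1)[OF X] and vY = right_moduleD(1)[OF Y]
  have I: "{i. v i \<noteq> \<zero>} \<subseteq> I" using v by (auto simp: free_rmod_mem)
  have ci: "c i \<in> carrier X" if "v i \<noteq> \<zero>" for i using that I c by auto
  have "f (free_ext X c v) = finsum Y (\<lambda>i. f (ract X (c i) (v i))) {i. v i \<noteq> \<zero>}"
    unfolding free_ext_def using ci free_rmod_closed[OF v] right_moduleD(2)[OF X]
    by (intro lin_finsum[OF vX vY rmod_hom_lin[OF X Y f]]) auto
  also have "\<dots> = free_ext Y (\<lambda>i. f (c i)) v" unfolding free_ext_def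
    using ci free_rmod_closed[OF v] right_moduleD(2)[OF Y] rmod_homD(1,3)[OF f]
    by (intro vs_finsum_cong[OF vY refl]) auto
  finally show ?thesis .
qed

lemma free_ext_cong:
  assumes "\<And>i. i \<in> I \<Longrightarrow> c i = d i" "right_module A X" "d \<in> I \<rightarrow> carrier X" "v \<in> carrier (free_rmod A I)"
  shows "free_ext X c v = free_ext X d v"
  unfolding free_ext_def
proof (rule vs_finsum_cong[OF right_moduleD(1)[OF assms(2)] refl])
  have I: "i \<in> I" if "v i \<noteq> \<zero>" for i using assms(4) that by (auto simp: free_rmod_mem)
  then show "ract X (c i) (v i) = ract X (d i) (v i)" if "i \<in> {i. v i \<noteq> \<zero>}" for i using that assms(1) by simp
  show "(\<lambda>i. ract X (d i) (v i)) \<in> {i. v i \<noteq> \<zero>} \<rightarrow> carrier X"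
    using I assms(3) free_rmod_closed[OF assms(4)] right_moduleD(2)[OF assms(2)] by blast
qed

definition unit_vec :: "'i \<Rightarrow> 'i \<Rightarrow> 'a" where
  "unit_vec i = (\<lambda>j. if j = i then \<one> else \<zero>)"

lemma unit_vec_closed: "i \<in> I \<Longrightarrow> unit_vec i \<in> carrier (free_rmod A I)"
  by (auto simp: free_rmod_mem unit_vec_def intro: finite_subset[of _ "{i}"])

lemma free_ext_unit_vec:
  assumes v: "v \<in> carrier (free_rmod A I)"
  shows "free_ext (free_rmod A I) unit_vec v = v"
proof
  fix j
  let ?J = "{i. v i \<noteq> \<zero>}"
  have I: "?J \<subseteq> I" "finite ?J" using v by (auto simp: free_rmod_mem)
  have t: "(\<lambda>i. ract (free_rmod A I) (unit_vec i) (v i)) \<in> ?J \<rightarrow> carrier (free_rmod A I)"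
  proof
    fix i assume "i \<in> ?J"
    then have "i \<in> I" using I by auto
    then show "ract (free_rmod A I) (unit_vec i) (v i) \<in> carrier (free_rmod A I)"
      by (rule right_moduleD(2)[OF right_module_free unit_vec_closed free_rmod_closed[OF v]])
  qed
  have "free_ext (free_rmod A I) unit_vec v j = finsum A (\<lambda>i. ract (free_rmod A I) (unit_vec i) (v i) j) ?J"
    unfolding free_ext_def by (rule lin_finsum[OF vsp_free vspA free_eval_lin t])
  also have "\<dots> = finsum A (\<lambda>i. if j = i then v i else \<zero>) ?J"
    by (rule vs_finsum_cong[OF vspA refl]) (use free_rmod_closed[OF v] in \<open>auto simp: unit_vec_def\<close>)
  also have "\<dots> = v j"
  proof (cases "v j = \<zero>")
    case True
    then have "finsum A (\<lambda>i. if j = i then v i else \<zero>) ?J = finsum A (\<lambda>i. \<zero>) ?J"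
      by (intro vs_finsum_cong[OF vspA refl]) auto
    then show ?thesis using True by simp
  next
    case False
    then show ?thesis using I(2) free_rmod_closed[OF v] by (intro finsum_singleton) auto
  qed
  finally show "free_ext (free_rmod A I) unit_vec v j = v j" .
qed

text \<open>The dual basis lemma turned into a definition of projectivity: \<open>S\<close> collects
  the coordinate functionals and \<open>q\<close> the generators. With a finite index set it
  describes a finitely generated projective and gives explicit formulas for traces.\<close>

definition dual_basis :: "('k, 'v, 'a, 'z) rmod_scheme \<Rightarrow> 'i set \<Rightarrow> ('v \<Rightarrow> 'i \<Rightarrow> 'a) \<Rightarrow> ('i \<Rightarrow> 'v) \<Rightarrow> bool" where
  "dual_basis P I S q \<longleftrightarrow> right_module A P \<and> S \<in> rmod_hom A P (free_rmod A I) \<and> q \<in> I \<rightarrow> carrier P \<and>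
     (\<forall>x\<in>carrier P. free_ext P q (S x) = x)"

lemma dual_basisD:
  assumes "dual_basis P I S q"
  shows "right_module A P" "S \<in> rmod_hom A P (free_rmod A I)" "q \<in> I \<rightarrow> carrier P" "x \<in> carrier P \<Longrightarrow> free_ext P q (S x) = x"
  using assms by (auto simp: dual_basis_def)

lemma dual_basis_free: "dual_basis (free_rmod A I) I (\<lambda>v. v) unit_vec"
  unfolding dual_basis_def
  by (intro conjI ballI right_module_free rmod_hom_id) (simp_all add: unit_vec_closed free_ext_unit_vec)

lemma dual_basis_retract:
  assumes F: "dual_basis F I S q" and P: "right_module A P" and s: "s \<in> rmod_hom A P F" and r: "r \<in> rmod_hom A F P"
    and rs: "\<And>x. x \<in> carrier P \<Longrightarrow> r (s x) = x"
  shows "dual_basis P I (\<lambda>x. S (s x)) (\<lambda>i. r (q i))"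
  unfolding dual_basis_def
proof (intro conjI ballI P)
  note D = dual_basisD[OF F]
  show "(\<lambda>x. S (s x)) \<in> rmod_hom A P (free_rmod A I)" by (rule rmod_hom_comp[OF s D(2)])
  show "(\<lambda>i. r (q i)) \<in> I \<rightarrow> carrier P" using D(3) rmod_homD(1)[OF r] by auto
  fix x assume x: "x \<in> carrier P"
  have sx: "s x \<in> carrier F" by (rule rmod_homD(1)[OF s x])
  have "free_ext P (\<lambda>i. r (q i)) (S (s x)) = r (free_ext F q (S (s x)))"
    by (rule free_ext_comp[OF D(1) P r D(3) rmod_homD(1)[OF D(2) sx], symmetric])
  also have "\<dots> = x" using D(4)[OF sx] rs[OF x] by simp
  finally show "free_ext P (\<lambda>i. r (q i)) (S (s x)) = x" .
qed

lemma projective_dual_basis: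
  fixes P :: "('k, 'p, 'a, 'z) rmod_scheme"
  assumes "projective A P"
  shows "\<exists>(I :: 'p set) S q. dual_basis P I S q"
proof -
  obtain I :: "'p set" and s q where P: "right_module A P" and s: "s\<in>rmod_hom A P (free_rmod A I)"
    and q: "q\<in>rmod_hom A (free_rmod A I) P" and qs: "\<forall>x\<in>carrier P. q (s x) = x"
    using assms unfolding projective_def by blast
  have "dual_basis P I (\<lambda>x. s x) (\<lambda>i. q (unit_vec i))"
    by (rule dual_basis_retract[OF dual_basis_free P s q]) (use qs in simp)
  then show ?thesis by blast
qed

text \<open>Lifting for one fixed triple of modules. The modules of a resolution, its target and its
  source may live in three different types, and no single predicate quantifies over types.\<close>

definition lifts :: "('k, 'p, 'a, 'x) rmod_scheme \<Rightarrow> ('k, 'v, 'a, 'y) rmod_scheme \<Rightarrow> ('k, 'w, 'a, 'z) rmod_scheme \<Rightarrow> bool" where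
  "lifts P X Y \<longleftrightarrow> (\<forall>f\<in>rmod_hom A P Y. \<forall>g\<in>rmod_hom A X Y. f ` carrier P \<subseteq> g ` carrier X \<longrightarrow>
     (\<exists>h\<in>rmod_hom A P X. \<forall>x\<in>carrier P. g (h x) = f x))"

lemma liftsD:
  assumes "lifts P X Y" "f \<in> rmod_hom A P Y" "g \<in> rmod_hom A X Y" "\<And>x. x \<in> carrier P \<Longrightarrow> f x \<in> g ` carrier X"
  obtains h where "h \<in> rmod_hom A P X" "\<And>x. x \<in> carrier P \<Longrightarrow> g (h x) = f x"
proof -
  have "f ` carrier P \<subseteq> g ` carrier X" using assms(4) by (rule image_subsetI)
  then show thesis using assms(1-3) that unfolding lifts_def by meson
qed

text \<open>Lift the generators and extend by the coordinates \<open>S\<close>; both maps then agree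
  on the expansion of \<open>x\<close>.\<close>

lemma dual_basis_lifts:
  assumes P: "dual_basis P I S q" and X: "right_module A X" and Y: "right_module A Y"
  shows "lifts P X Y"
  unfolding lifts_def
proof (intro ballI impI)
  note D = dual_basisD[OF P]
  fix f g assume f: "f \<in> rmod_hom A P Y" and g: "g \<in> rmod_hom A X Y" and im: "f ` carrier P \<subseteq> g ` carrier X"
  have "\<exists>c\<in>carrier X. g c = f (q i)" if "i \<in> I" for i
  proof -
    have "f (q i) \<in> g ` carrier X" using im D(3) that by blast
    then show ?thesis by auto
  qed
  then obtain c where c: "\<And>i. i \<in> I \<Longrightarrow> c i \<in> carrier X" "\<And>i. i \<in> I \<Longrightarrow> g (c i) = f (q i)" by metis
  have cX: "c \<in> I \<rightarrow> carrier X" using c(1) by auto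
  have fq: "(\<lambda>i. f (q i)) \<in> I \<rightarrow> carrier Y" using D(3) rmod_homD(1)[OF f] by auto
  have "g (free_ext X c (S x)) = f x" if x: "x \<in> carrier P" for x
  proof -
    note Sx = rmod_homD(1)[OF D(2) x]
    have "g (free_ext X c (S x)) = free_ext Y (\<lambda>i. g (c i)) (S x)" by (rule free_ext_comp[OF X Y g cX Sx])
    also have "\<dots> = free_ext Y (\<lambda>i. f (q i)) (S x)" by (rule free_ext_cong[OF c(2) Y fq Sx])
    also have "\<dots> = f (free_ext P q (S x))" by (rule free_ext_comp[OF D(1) Y f D(3) Sx, symmetric])
    finally show ?thesis using D(4)[OF x] by simp
  qed
  then show "\<exists>h\<in>rmod_hom A P X. \<forall>x\<in>carrier P. g (h x) = f x"
    by (intro bexI[of _ "\<lambda>x. free_ext X c (S x)"] ballI rmod_hom_comp[OF D(2) free_ext_hom[OF X cX]])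
qed

lemma dual_basis_zero:
  assumes P: "right_module A P" "zero_space P"
  shows "dual_basis P ({} :: nat set) (\<lambda>_ _. \<zero>) (\<lambda>_. \<zero>\<^bsub>P\<^esub>)"
  unfolding dual_basis_def
proof (intro conjI ballI P(1))
  show "(\<lambda>_ _. \<zero>) \<in> rmod_hom A P (free_rmod A ({} :: nat set))"
    using rmod_hom_zero[OF right_module_free[of "{} :: nat set"], of P] by simp
  fix x assume "x \<in> carrier P"
  then show "free_ext P (\<lambda>_. \<zero>\<^bsub>P\<^esub>) (\<lambda>_. \<zero>) = x"
    using P abelian_monoid.finsum_empty[OF vsp_abelian_monoid[OF right_moduleD(1)[OF P(1)]]] by (simp add: free_ext_def)
qed auto

subsection \<open>Chain maps between resolutions\<close>

text \<open>A resolution without projectivity of the terms. It also fits the constructed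
  resolutions, whose terms carry a \<open>dual_basis\<close> with indices in \<open>nat\<close>,
  whereas \<open>projective\<close> asks for indices in the type of the elements.\<close>

definition exact_res :: "('k, 'm, 'a, 'z) rmod_scheme \<Rightarrow> ('k, 'p, 'a, 'm) resolution \<Rightarrow> bool" where
  "exact_res M P \<longleftrightarrow> right_module A M \<and> (\<forall>l. right_module A (obj P l)) \<and>
     (\<forall>l. bd P l \<in> rmod_hom A (obj P (Suc l)) (obj P l)) \<and>
     aug P \<in> rmod_hom A (obj P 0) M \<and>
     aug P ` carrier (obj P 0) = carrier M \<and>
     bd P 0 ` carrier (obj P 1) = {x \<in> carrier (obj P 0). aug P x = \<zero>\<^bsub>M\<^esub>} \<and>
     (\<forall>l. bd P (Suc l) ` carrier (obj P (Suc (Suc l))) =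
        {x \<in> carrier (obj P (Suc l)). bd P l x = \<zero>\<^bsub>obj P l\<^esub>})"

lemma exact_resD:
  assumes "exact_res M P"
  shows "right_module A M" "right_module A (obj P l)" "bd P l \<in> rmod_hom A (obj P (Suc l)) (obj P l)"
     "aug P \<in> rmod_hom A (obj P 0) M" "aug P ` carrier (obj P 0) = carrier M"
     "bd P 0 ` carrier (obj P (Suc 0)) = {x \<in> carrier (obj P 0). aug P x = \<zero>\<^bsub>M\<^esub>}"
     "bd P (Suc l) ` carrier (obj P (Suc (Suc l))) =
        {x \<in> carrier (obj P (Suc l)). bd P l x = \<zero>\<^bsub>obj P l\<^esub>}"
     "x \<in> carrier (obj P (Suc 0)) \<Longrightarrow> aug P (bd P 0 x) = \<zero>\<^bsub>M\<^esub>"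
     "y \<in> carrier (obj P (Suc (Suc l))) \<Longrightarrow> bd P l (bd P (Suc l) y) = \<zero>\<^bsub>obj P l\<^esub>"
     "vsp M" "vsp (obj P l)" "bd P l \<in> lin (obj P (Suc l)) (obj P l)" "aug P \<in> lin (obj P 0) M"
proof -
  show 1: "right_module A M" "right_module A (obj P l)" "bd P l \<in> rmod_hom A (obj P (Suc l)) (obj P l)"
     "aug P \<in> rmod_hom A (obj P 0) M" "aug P ` carrier (obj P 0) = carrier M"
     and ex: "bd P 0 ` carrier (obj P (Suc 0)) = {x \<in> carrier (obj P 0). aug P x = \<zero>\<^bsub>M\<^esub>}"
     "bd P (Suc l) ` carrier (obj P (Suc (Suc l))) =
        {x \<in> carrier (obj P (Suc l)). bd P l x = \<zero>\<^bsub>obj P l\<^esub>}" for l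
    using assms by (simp_all add: exact_res_def)
  show "x \<in> carrier (obj P (Suc 0)) \<Longrightarrow> aug P (bd P 0 x) = \<zero>\<^bsub>M\<^esub>" using ex(1) by blast
  show "y \<in> carrier (obj P (Suc (Suc l))) \<Longrightarrow> bd P l (bd P (Suc l) y) = \<zero>\<^bsub>obj P l\<^esub>" using ex(2)[of l] by blast
  show "vsp M" "vsp (obj P l)" by (rule right_moduleD(1)[OF 1(1)], rule right_moduleD(1)[OF 1(2)])
  show "bd P l \<in> lin (obj P (Suc l)) (obj P l)" "aug P \<in> lin (obj P 0) M"
    by (rule rmod_hom_lin[OF 1(2) 1(2) 1(3)], rule rmod_hom_lin[OF 1(2) 1(1) 1(4)])
qed

definition chain_map :: "('k, 'p, 'a, 'm) resolution \<Rightarrow> ('k, 'q, 'a, 'w) resolution \<Rightarrow> ('m \<Rightarrow> 'w) \<Rightarrow> (nat \<Rightarrow> 'p \<Rightarrow> 'q) \<Rightarrow> bool" where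
  "chain_map P R \<phi> \<Phi> \<longleftrightarrow> (\<forall>l. \<Phi> l \<in> rmod_hom A (obj P l) (obj R l)) \<and>
     (\<forall>x\<in>carrier (obj P 0). aug R (\<Phi> 0 x) = \<phi> (aug P x)) \<and>
     (\<forall>l. \<forall>x\<in>carrier (obj P (Suc l)). bd R l (\<Phi> (Suc l) x) = \<Phi> l (bd P l x))"

lemma chain_mapD:
  assumes "chain_map P R \<phi> \<Phi>"
  shows "\<Phi> l \<in> rmod_hom A (obj P l) (obj R l)" "x \<in> carrier (obj P 0) \<Longrightarrow> aug R (\<Phi> 0 x) = \<phi> (aug P x)"
    "y \<in> carrier (obj P (Suc l)) \<Longrightarrow> bd R l (\<Phi> (Suc l) y) = \<Phi> l (bd P l y)"
  using assms by (auto simp: chain_map_def)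

lemma chain_map_comp:
  assumes f: "chain_map P R \<phi> \<Phi>" and g: "chain_map R T \<psi> \<Psi>" and P: "exact_res M P"
  shows "chain_map P T (\<lambda>x. \<psi> (\<phi> x)) (\<lambda>l x. \<Psi> l (\<Phi> l x))"
  unfolding chain_map_def
  using rmod_hom_comp[OF chain_mapD(1)[OF f] chain_mapD(1)[OF g]] chain_mapD[OF f] chain_mapD[OF g]
    rmod_homD(1)[OF chain_mapD(1)[OF f]] by auto

text \<open>The comparison theorem. Lifting is assumed only for the triples that occur, so that
  given and constructed resolutions can be mixed.\<close>

lemma chain_map_exists:
  assumes P: "exact_res M P" and R: "exact_res W R" and \<phi>: "\<phi> \<in> rmod_hom A M W"
    and l0: "lifts (obj P 0) (obj R 0) W" and l1: "\<And>l. lifts (obj P (Suc l)) (obj R (Suc l)) (obj R l)"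
  shows "\<exists>\<Phi>. chain_map P R \<phi> \<Phi>"
proof -
  note PD = exact_resD[OF P] and RD = exact_resD[OF R]
  \<comment> \<open>The invariant that keeps the recursion going: boundaries are mapped to
    boundaries, so the next square has a solution.\<close>
  define G where "G n \<Phi> \<longleftrightarrow> \<Phi> \<in> rmod_hom A (obj P n) (obj R n) \<and>
      (n = 0 \<longrightarrow> (\<forall>x\<in>carrier (obj P 0). aug R (\<Phi> x) = \<phi> (aug P x))) \<and>
      (\<forall>x\<in>carrier (obj P (Suc n)). \<Phi> (bd P n x) \<in> bd R n ` carrier (obj R (Suc n)))" for n \<Phi>
  have "\<exists>\<Phi>. \<forall>n. G n (\<Phi> n) \<and> (\<forall>x\<in>carrier (obj P (Suc n)). bd R n (\<Phi> (Suc n) x) = \<Phi> n (bd P n x))"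
  proof (rule dependent_nat_choice)
    have pa: "(\<lambda>x. \<phi> (aug P x)) \<in> rmod_hom A (obj P 0) W" by (rule rmod_hom_comp[OF PD(4) \<phi>])
    obtain h where h: "h \<in> rmod_hom A (obj P 0) (obj R 0)" "\<And>x. x \<in> carrier (obj P 0) \<Longrightarrow> aug R (h x) = \<phi> (aug P x)"
      by (rule liftsD[OF l0 pa RD(4)]) (use rmod_homD(1)[OF pa] RD(5) in simp_all)
    have "h (bd P 0 x) \<in> bd R 0 ` carrier (obj R (Suc 0))" if x: "x \<in> carrier (obj P (Suc 0))" for x
    proof -
      have bx: "bd P 0 x \<in> carrier (obj P 0)" by (rule rmod_homD(1)[OF PD(3) x])
      have "aug R (h (bd P 0 x)) = \<phi> \<zero>\<^bsub>M\<^esub>" using h(2)[OF bx] PD(8)[OF x] by simp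
      also have "\<dots> = \<zero>\<^bsub>W\<^esub>" by (rule lin_zero[OF PD(10) RD(10) rmod_hom_lin[OF PD(1) RD(1) \<phi>]])
      finally show ?thesis unfolding RD(6) using rmod_homD(1)[OF h(1) bx] by simp
    qed
    then have "G 0 h" unfolding G_def using h by simp
    then show "\<exists>\<Phi>. G 0 \<Phi>" by (rule exI[of _ h])
  next
    fix \<Phi> n assume G: "G n \<Phi>"
    have \<Phi>: "\<Phi> \<in> rmod_hom A (obj P n) (obj R n)" using G by (simp add: G_def)
    have pb: "(\<lambda>x. \<Phi> (bd P n x)) \<in> rmod_hom A (obj P (Suc n)) (obj R n)" by (rule rmod_hom_comp[OF PD(3) \<Phi>])
    obtain h where h: "h \<in> rmod_hom A (obj P (Suc n)) (obj R (Suc n))"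
      "\<And>x. x \<in> carrier (obj P (Suc n)) \<Longrightarrow> bd R n (h x) = \<Phi> (bd P n x)"
      by (rule liftsD[OF l1 pb RD(3)]) (use G in \<open>simp_all add: G_def\<close>)
    have "h (bd P (Suc n) x) \<in> bd R (Suc n) ` carrier (obj R (Suc (Suc n)))" if x: "x \<in> carrier (obj P (Suc (Suc n)))" for x
    proof -
      have bx: "bd P (Suc n) x \<in> carrier (obj P (Suc n))" by (rule rmod_homD(1)[OF PD(3) x])
      have "bd R n (h (bd P (Suc n) x)) = \<Phi> \<zero>\<^bsub>obj P n\<^esub>" using h(2)[OF bx] PD(9)[OF x] by simp
      also have "\<dots> = \<zero>\<^bsub>obj R n\<^esub>" by (rule lin_zero[OF PD(11) RD(11) rmod_hom_lin[OF PD(2) RD(2) \<Phi>]])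
      finally show ?thesis unfolding RD(7) using rmod_homD(1)[OF h(1) bx] by simp
    qed
    then have "G (Suc n) h" unfolding G_def using h(1) by simp
    then show "\<exists>y. G (Suc n) y \<and> (\<forall>x\<in>carrier (obj P (Suc n)). bd R n (y x) = \<Phi> (bd P n x))"
      using h(2) by (intro exI[of _ h]) simp
  qed
  then obtain \<Phi> where \<Phi>: "\<And>n. G n (\<Phi> n)" "\<And>n. \<forall>x\<in>carrier (obj P (Suc n)). bd R n (\<Phi> (Suc n) x) = \<Phi> n (bd P n x)" by auto
  have "chain_map P R \<phi> \<Phi>" unfolding chain_map_def using \<Phi>(1)[unfolded G_def] \<Phi>(2) by simp
  then show ?thesis by (rule exI[of _ \<Phi>])
qed

text \<open>\<open>D\<close> stands for the difference of two chain maps over the same module map.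
  Such a difference lies over zero and is therefore null-homotopic.\<close>

lemma chain_homotopy:
  assumes P: "exact_res M P" and R: "exact_res W R"
    and ls: "\<And>l. lifts (obj P l) (obj R (Suc l)) (obj R l)"
    and D: "\<And>l. D l \<in> rmod_hom A (obj P l) (obj R l)" "\<And>x. x \<in> carrier (obj P 0) \<Longrightarrow> aug R (D 0 x) = \<zero>\<^bsub>W\<^esub>"
      "\<And>l x. x \<in> carrier (obj P (Suc l)) \<Longrightarrow> bd R l (D (Suc l) x) = D l (bd P l x)"
  shows "\<exists>h. (\<forall>l. h l \<in> rmod_hom A (obj P l) (obj R (Suc l))) \<and>
     (\<forall>x\<in>carrier (obj P 0). bd R 0 (h 0 x) = D 0 x) \<and>
     (\<forall>l. \<forall>x\<in>carrier (obj P (Suc l)). bd R (Suc l) (h (Suc l) x) = D (Suc l) x \<ominus>\<^bsub>obj R (Suc l)\<^esub> h l (bd P l x))"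
proof -
  note PD = exact_resD[OF P] and RD = exact_resD[OF R]
  \<comment> \<open>On boundaries \<open>bd \<circ> h\<close> agrees with \<open>D\<close>, since
    the earlier part of the homotopy vanishes there. This says precisely that the next right hand
    side is a cycle, hence a boundary.\<close>
  define G where "G n h \<longleftrightarrow> h \<in> rmod_hom A (obj P n) (obj R (Suc n)) \<and>
      (n = 0 \<longrightarrow> (\<forall>x\<in>carrier (obj P 0). bd R 0 (h x) = D 0 x)) \<and>
      (\<forall>x\<in>carrier (obj P (Suc n)). bd R n (h (bd P n x)) = D n (bd P n x))" for n h
  have "\<exists>h. \<forall>n. G n (h n) \<and> (\<forall>x\<in>carrier (obj P (Suc n)). bd R (Suc n) (h (Suc n) x) = D (Suc n) x \<ominus>\<^bsub>obj R (Suc n)\<^esub> h n (bd P n x))"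
  proof (rule dependent_nat_choice)
    obtain h where h: "h \<in> rmod_hom A (obj P 0) (obj R (Suc 0))" "\<And>x. x \<in> carrier (obj P 0) \<Longrightarrow> bd R 0 (h x) = D 0 x"
      by (rule liftsD[OF ls[of 0] D(1) RD(3)[of 0]]) (use D(2) rmod_homD(1)[OF D(1)[of 0]] RD(6) in simp_all)
    then have "G 0 h" unfolding G_def using rmod_homD(1)[OF PD(3)[of 0]] by simp
    then show "\<exists>h. G 0 h" by (rule exI[of _ h])
  next
    fix h n assume G: "G n h"
    have h: "h \<in> rmod_hom A (obj P n) (obj R (Suc n))"
      and hb: "\<And>x. x \<in> carrier (obj P (Suc n)) \<Longrightarrow> bd R n (h (bd P n x)) = D n (bd P n x)" using G by (auto simp: G_def)
    let ?E = "\<lambda>x. D (Suc n) x \<ominus>\<^bsub>obj R (Suc n)\<^esub> h (bd P n x)"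
    have hbP: "(\<lambda>x. h (bd P n x)) \<in> rmod_hom A (obj P (Suc n)) (obj R (Suc n))" by (rule rmod_hom_comp[OF PD(3) h])
    have E: "?E \<in> rmod_hom A (obj P (Suc n)) (obj R (Suc n))" by (rule rmod_hom_minus[OF RD(2) D(1) hbP])
    have "?E x \<in> bd R (Suc n) ` carrier (obj R (Suc (Suc n)))" if x: "x \<in> carrier (obj P (Suc n))" for x
    proof -
      have Dx: "D (Suc n) x \<in> carrier (obj R (Suc n))" "h (bd P n x) \<in> carrier (obj R (Suc n))"
        by (rule rmod_homD(1)[OF D(1) x], rule rmod_homD(1)[OF hbP x])
      have bx: "bd P n x \<in> carrier (obj P n)" by (rule rmod_homD(1)[OF PD(3) x])
      have "bd R n (?E x) = bd R n (D (Suc n) x) \<ominus>\<^bsub>obj R n\<^esub> bd R n (h (bd P n x))"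
        by (rule lin_minus[OF RD(11) RD(11) RD(12) Dx])
      also have "\<dots> = \<zero>\<^bsub>obj R n\<^esub>"
        using hb[OF x] D(3)[OF x] vs_minus_self[OF RD(11) rmod_homD(1)[OF D(1) bx]] by simp
      finally show ?thesis unfolding RD(7) using rmod_homD(1)[OF E x] by simp
    qed
    note im = this
    obtain h' where h': "h' \<in> rmod_hom A (obj P (Suc n)) (obj R (Suc (Suc n)))"
      "\<And>x. x \<in> carrier (obj P (Suc n)) \<Longrightarrow> bd R (Suc n) (h' x) = ?E x"
      by (rule liftsD[OF ls E RD(3) im]) auto
    have "bd R (Suc n) (h' (bd P (Suc n) x)) = D (Suc n) (bd P (Suc n) x)" if x: "x \<in> carrier (obj P (Suc (Suc n)))" for x
    proof -
      have bx: "bd P (Suc n) x \<in> carrier (obj P (Suc n))" by (rule rmod_homD(1)[OF PD(3) x])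
      have "h (bd P n (bd P (Suc n) x)) = \<zero>\<^bsub>obj R (Suc n)\<^esub>"
        unfolding PD(9)[OF x] by (rule lin_zero[OF PD(11) RD(11) rmod_hom_lin[OF PD(2) RD(2) h]])
      then show ?thesis using h'(2)[OF bx] RD(11)[of "Suc n"] rmod_homD(1)[OF D(1) bx] by (simp add: vs_minus_eq)
    qed
    then have "G (Suc n) h'" unfolding G_def using h'(1) by simp
    then show "\<exists>y. G (Suc n) y \<and> (\<forall>x\<in>carrier (obj P (Suc n)). bd R (Suc n) (y x) = ?E x)"
      using h'(2) by (intro exI[of _ h']) simp
  qed
  then obtain h where h: "\<And>n. G n (h n)" "\<And>n. \<forall>x\<in>carrier (obj P (Suc n)).
      bd R (Suc n) (h (Suc n) x) = D (Suc n) x \<ominus>\<^bsub>obj R (Suc n)\<^esub> h n (bd P n x)" by auto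
  show ?thesis by (rule exI[of _ h]) (use h(1)[unfolded G_def] h(2) in simp)
qed

end

section \<open>Traces on finitely generated projective modules\<close>

text \<open>The identity of \<open>V\<close> factors through finitely many copies of
  \<open>N\<close>. This pattern serves for \<open>Hom(P, N)\<close>, for
  \<open>P \<otimes> N\<close> and for \<open>P u\<close>, when \<open>P\<close> has a finite dual
  basis.\<close>

lemma partition_fd:
  assumes V: "vsp V" and N: "vsp N" "fd N" and I: "finite I"
    and j: "\<And>i. i \<in> I \<Longrightarrow> j i \<in> lin N V" and p: "\<And>i. i \<in> I \<Longrightarrow> p i \<in> lin V N"
    and id: "\<And>x. x \<in> carrier V \<Longrightarrow> finsum V (\<lambda>i. j i (p i x)) I = x"
  shows "fd V"
proof -
  obtain J \<eta> where F: "frame N J (\<lambda>s. s) \<eta>" by (rule fd_frame[OF N])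
  note FD = frameD[OF F]
  interpret V: vectorspace class_ring V by (rule V)
  define G where "G = (\<lambda>(i, b). j i b) ` (I \<times> J)"
  have G: "finite G" "G \<subseteq> carrier V" using I FD(1,3) lin_closed[OF j] by (auto simp: G_def)
  note sG = subsp_span[OF V G(2)]
  have jG: "j i y \<in> V.span G" if i: "i \<in> I" and y: "y \<in> carrier N" for i y
  proof -
    have m: "j i b \<in> V.span G" if "b \<in> J" for b
    proof -
      have "j i b \<in> G" unfolding G_def using i that by force
      then show ?thesis using V.in_own_span[OF G(2)] by blast
    qed
    have "j i y = j i (finsum N (\<lambda>b. \<eta> b y \<odot>\<^bsub>N\<^esub> b) J)" using FD(5)[OF y] by simp
    also have "\<dots> = finsum V (\<lambda>b. j i (\<eta> b y \<odot>\<^bsub>N\<^esub> b)) J"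
      by (rule lin_finsum[OF N(1) V j[OF i]]) (use FD(3) N in auto)
    also have "\<dots> = finsum V (\<lambda>b. \<eta> b y \<odot>\<^bsub>V\<^esub> j i b) J"
      by (rule vs_finsum_cong[OF V refl]) (use FD(3) lin_smult[OF j[OF i]] lin_closed[OF j[OF i]] V in auto)
    also have "\<dots> \<in> V.span G"
      by (rule subsp_finsum[OF V sG]) (use m subspD(4)[OF sG] in auto)
    finally show ?thesis .
  qed
  have "x \<in> V.span G" if x: "x \<in> carrier V" for x
  proof -
    have "finsum V (\<lambda>i. j i (p i x)) I \<in> V.span G"
      by (rule subsp_finsum[OF V sG]) (use jG lin_closed[OF p _ ] x in auto)
    then show ?thesis using id[OF x] by simp
  qed
  then have "V.gen_set G" using subspD(1)[OF sG] by auto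
  then show ?thesis unfolding V.fin_dim_def using G by blast
qed

lemma lin_trace_sum:
  assumes V: "vsp V" "fd V" and I: "finite I" and f: "\<And>i. i \<in> I \<Longrightarrow> f i \<in> lin V V"
  shows "(\<lambda>x. finsum V (\<lambda>i. f i x) I) \<in> lin V V \<and> lin_trace V (\<lambda>x. finsum V (\<lambda>i. f i x) I) = (\<Sum>i\<in>I. lin_trace V (f i))"
  using I f
proof (induction I rule: finite_induct)
  case empty
  have "finsum V (\<lambda>i. f i x) {} = \<zero>\<^bsub>V\<^esub>" for x
    by (rule abelian_monoid.finsum_empty[OF vsp_abelian_monoid[OF V(1)]])
  then show ?case using lin_zero_map[OF V(1)] lin_trace_zero[OF V, of "\<lambda>x. \<zero>\<^bsub>V\<^esub>"] by simp
next
  case (insert i I)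
  have IH: "(\<lambda>x. finsum V (\<lambda>i. f i x) I) \<in> lin V V" "lin_trace V (\<lambda>x. finsum V (\<lambda>i. f i x) I) = (\<Sum>i\<in>I. lin_trace V (f i))"
    using insert by auto
  have fi: "f i \<in> lin V V" using insert.prems by simp
  have eq: "f i x \<oplus>\<^bsub>V\<^esub> finsum V (\<lambda>i. f i x) I = finsum V (\<lambda>i. f i x) (insert i I)" if "x \<in> carrier V" for x
    by (rule vs_finsum_insert[OF V(1) insert.hyps, symmetric]) (use that lin_closed[OF insert.prems] in auto)
  note l = lin_add_map[OF V(1) fi IH(1)]
  show ?case
    using lin_cong[OF eq V(1) l] lin_trace_cong[OF V l eq] lin_trace_add[OF V fi IH(1)] IH(2) insert.hyps by simp
qed

text \<open>Insert the partition of the identity after \<open>T\<close> and move each summand to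
  \<open>N\<close> by cyclicity. Only the diagonal blocks of \<open>T\<close> survive.\<close>

lemma lin_trace_partition:
  assumes V: "vsp V" and N: "vsp N" "fd N" and I: "finite I"
    and j: "\<And>i. i \<in> I \<Longrightarrow> j i \<in> lin N V" and p: "\<And>i. i \<in> I \<Longrightarrow> p i \<in> lin V N"
    and id: "\<And>x. x \<in> carrier V \<Longrightarrow> finsum V (\<lambda>i. j i (p i x)) I = x"
    and T: "T \<in> lin V V"
  shows "lin_trace V T = (\<Sum>i\<in>I. lin_trace N (\<lambda>y. p i (T (j i y))))"
proof -
  have fV: "fd V" by (rule partition_fd[OF V N I j p id])
  have jp: "(\<lambda>x. j i (p i (T x))) \<in> lin V V" if "i \<in> I" for i
    by (rule lin_comp[OF lin_comp[OF T p[OF that]] j[OF that]])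
  have "lin_trace V T = lin_trace V (\<lambda>x. finsum V (\<lambda>i. j i (p i (T x))) I)"
    by (rule lin_trace_cong[OF V fV T]) (use id lin_closed[OF T] in simp)
  also have "\<dots> = (\<Sum>i\<in>I. lin_trace V (\<lambda>x. j i (p i (T x))))"
    using lin_trace_sum[OF V fV I jp] by simp
  also have "\<dots> = (\<Sum>i\<in>I. lin_trace N (\<lambda>y. p i (T (j i y))))"
    by (rule sum.cong[OF refl], rule lin_trace_comm[OF V fV N]) (auto intro: lin_comp[OF T p] j)
  finally show ?thesis .
qed

section \<open>Traces on homomorphism spaces and on the pieces \<open>P u\<close>\<close>

context fin_alg
begin

lemma hom_space_simps: "zero (hom_space A M N) = (\<lambda>x\<in>carrier M. \<zero>\<^bsub>N\<^esub>)"
  "add (hom_space A M N) = (\<lambda>f g. \<lambda>x\<in>carrier M. f x \<oplus>\<^bsub>N\<^esub> g x)"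
  "smult (hom_space A M N) = (\<lambda>c f. \<lambda>x\<in>carrier M. c \<odot>\<^bsub>N\<^esub> f x)"
  by (auto simp: hom_space_def)

lemma hom_space_mem: "f \<in> carrier (hom_space A M N) \<longleftrightarrow> f \<in> rmod_hom A M N \<and> f \<in> extensional (carrier M)"
  by (auto simp: hom_space_def)

lemma hom_space_closed: "f \<in> carrier (hom_space A M N) \<Longrightarrow> x \<in> carrier M \<Longrightarrow> f x \<in> carrier N"
  using rmod_homD(1) by (auto simp: hom_space_mem)

lemma restrict_rmod_hom: 
  assumes "right_module A M" "f \<in> rmod_hom A M N"
  shows "restrict f (carrier M) \<in> carrier (hom_space A M N)"
  using right_moduleD(1,2)[OF assms(1)] rmod_homD[OF assms(2)] unfolding hom_space_mem
  by (auto intro!: rmod_homI)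

lemma rmod_hom_add:
  assumes N: "right_module A N" and f: "f \<in> rmod_hom A M N" and g: "g \<in> rmod_hom A M N"
  shows "(\<lambda>x. f x \<oplus>\<^bsub>N\<^esub> g x) \<in> rmod_hom A M N"
proof (rule rmod_homI)
  note v = right_moduleD(1)[OF N]
  show "f (x \<oplus>\<^bsub>M\<^esub> y) \<oplus>\<^bsub>N\<^esub> g (x \<oplus>\<^bsub>M\<^esub> y) = (f x \<oplus>\<^bsub>N\<^esub> g x) \<oplus>\<^bsub>N\<^esub> (f y \<oplus>\<^bsub>N\<^esub> g y)"
    if "x \<in> carrier M" "y \<in> carrier M" for x y
    using that rmod_homD[OF f] rmod_homD[OF g] v by (simp add: vs_ac)
qed (use rmod_homD[OF f] rmod_homD[OF g] right_moduleD[OF N] in simp_all)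

lemma rmod_hom_smult:
  assumes N: "right_module A N" and f: "f \<in> rmod_hom A M N"
  shows "(\<lambda>x. c \<odot>\<^bsub>N\<^esub> f x) \<in> rmod_hom A M N"
  by (rule rmod_homI) (use rmod_homD[OF f] right_moduleD[OF N] vs_smult_r_distr[OF right_moduleD(1)[OF N]] in simp_all)

lemma vsp_hom_space:
  assumes M: "right_module A M" and N: "right_module A N"
  shows "vsp (hom_space A M N)"
proof (rule vspI)
  note v = right_moduleD(1)[OF N]
  note cl = hom_space_closed
  have ext: "f = restrict f (carrier M)" if "f \<in> carrier (hom_space A M N)" for f
    using that by (simp add: hom_space_mem extensional_restrict)
  show "\<zero>\<^bsub>hom_space A M N\<^esub> \<in> carrier (hom_space A M N)"
    unfolding hom_space_simps by (rule restrict_rmod_hom[OF M rmod_hom_zero[OF N]])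
  show "f \<oplus>\<^bsub>hom_space A M N\<^esub> g \<in> carrier (hom_space A M N)"
    if "f \<in> carrier (hom_space A M N)" "g \<in> carrier (hom_space A M N)" for f g
    unfolding hom_space_simps by (rule restrict_rmod_hom[OF M rmod_hom_add[OF N]]) (use that in \<open>simp_all add: hom_space_mem\<close>)
  show "c \<odot>\<^bsub>hom_space A M N\<^esub> f \<in> carrier (hom_space A M N)" if "f \<in> carrier (hom_space A M N)" for c f
    unfolding hom_space_simps by (rule restrict_rmod_hom[OF M rmod_hom_smult[OF N]]) (use that in \<open>simp_all add: hom_space_mem\<close>)
  show "f \<oplus>\<^bsub>hom_space A M N\<^esub> g = g \<oplus>\<^bsub>hom_space A M N\<^esub> f"
    if "f \<in> carrier (hom_space A M N)" "g \<in> carrier (hom_space A M N)" for f g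
    unfolding hom_space_simps by (rule restrict_ext) (use cl[OF that(1)] cl[OF that(2)] vs_add_comm[OF v] in simp)
  show "f \<oplus>\<^bsub>hom_space A M N\<^esub> g \<oplus>\<^bsub>hom_space A M N\<^esub> h = f \<oplus>\<^bsub>hom_space A M N\<^esub> (g \<oplus>\<^bsub>hom_space A M N\<^esub> h)"
    if "f \<in> carrier (hom_space A M N)" "g \<in> carrier (hom_space A M N)" "h \<in> carrier (hom_space A M N)" for f g h
    unfolding hom_space_simps by (rule restrict_ext) (use cl[OF that(1)] cl[OF that(2)] cl[OF that(3)] vs_add_assoc[OF v] in simp)
  show "f \<oplus>\<^bsub>hom_space A M N\<^esub> \<zero>\<^bsub>hom_space A M N\<^esub> = f" if "f \<in> carrier (hom_space A M N)" for f
    unfolding hom_space_simps by (subst (2) ext[OF that], rule restrict_ext) (use cl[OF that] v in simp)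
  show "f \<oplus>\<^bsub>hom_space A M N\<^esub> (- 1) \<odot>\<^bsub>hom_space A M N\<^esub> f = \<zero>\<^bsub>hom_space A M N\<^esub>" if "f \<in> carrier (hom_space A M N)" for f
    unfolding hom_space_simps
    by (rule restrict_ext) (use cl[OF that] vs_minus_eq[OF v] vs_minus_self[OF v] in simp)
  show "1 \<odot>\<^bsub>hom_space A M N\<^esub> f = f" if "f \<in> carrier (hom_space A M N)" for f
    unfolding hom_space_simps by (subst (2) ext[OF that], rule restrict_ext) (use cl[OF that] v in simp)
  show "(c * d) \<odot>\<^bsub>hom_space A M N\<^esub> f = c \<odot>\<^bsub>hom_space A M N\<^esub> (d \<odot>\<^bsub>hom_space A M N\<^esub> f)" if "f \<in> carrier (hom_space A M N)" for c d f
    unfolding hom_space_simps by (rule restrict_ext) (use cl[OF that] vs_smult_smult[OF v] in simp)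
  show "(c + d) \<odot>\<^bsub>hom_space A M N\<^esub> f = c \<odot>\<^bsub>hom_space A M N\<^esub> f \<oplus>\<^bsub>hom_space A M N\<^esub> d \<odot>\<^bsub>hom_space A M N\<^esub> f"
    if "f \<in> carrier (hom_space A M N)" for c d f
    unfolding hom_space_simps by (rule restrict_ext) (use cl[OF that] vs_smult_l_distr[OF v] in simp)
  show "c \<odot>\<^bsub>hom_space A M N\<^esub> (f \<oplus>\<^bsub>hom_space A M N\<^esub> g) = c \<odot>\<^bsub>hom_space A M N\<^esub> f \<oplus>\<^bsub>hom_space A M N\<^esub> c \<odot>\<^bsub>hom_space A M N\<^esub> g"
    if "f \<in> carrier (hom_space A M N)" "g \<in> carrier (hom_space A M N)" for c f g
    unfolding hom_space_simps by (rule restrict_ext) (use cl[OF that(1)] cl[OF that(2)] vs_smult_r_distr[OF v] in simp)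
qed

lemma hom_space_eval: "x \<in> carrier M \<Longrightarrow> (\<lambda>f. f x) \<in> lin (hom_space A M N) N"
  by (rule linI) (auto simp: hom_space_simps hom_space_closed)

lemma hom_space_eqI:
  assumes "f \<in> carrier (hom_space A M N)" "g \<in> carrier (hom_space A M N)" "\<And>x. x \<in> carrier M \<Longrightarrow> f x = g x"
  shows "f = g"
  using assms by (auto simp: hom_space_mem intro: extensionalityI)

lemma dual_basis_expand:
  assumes P: "dual_basis P {..<m::nat} S q" and x: "x \<in> carrier P"
  shows "finsum P (\<lambda>i. ract P (q i) (S x i)) {..<m} = x"
proof -
  note D = dual_basisD[OF P]
  have Sx: "S x \<in> carrier (free_rmod A {..<m})" by (rule rmod_homD(1)[OF D(2) x])
  have s: "{i. S x i \<noteq> \<zero>} \<subseteq> {..<m}" using Sx by (auto simp: free_rmod_mem)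
  show ?thesis using free_ext_superset[OF D(1,3) Sx _ _ s] D(4)[OF x] by simp
qed

lemma dual_basis_coord:
  assumes P: "dual_basis P I S q"
  shows "x \<in> carrier P \<Longrightarrow> S x i \<in> carrier A"
    "x \<in> carrier P \<Longrightarrow> y \<in> carrier P \<Longrightarrow> S (x \<oplus>\<^bsub>P\<^esub> y) i = S x i \<oplus> S y i"
    "x \<in> carrier P \<Longrightarrow> a \<in> carrier A \<Longrightarrow> S (ract P x a) i = S x i \<otimes> a"
    "x \<in> carrier P \<Longrightarrow> S (c \<odot>\<^bsub>P\<^esub> x) i = c \<odot> S x i"
    "i \<in> I \<Longrightarrow> q i \<in> carrier P"
  using rmod_homD[OF dual_basisD(2)[OF P]] free_rmod_closed[of "S x" I i] dual_basisD(3)[OF P]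
    lin_smult[OF rmod_hom_lin[OF dual_basisD(1)[OF P] right_module_free dual_basisD(2)[OF P]], of x c]
  by auto

text \<open>A homomorphism is recovered from its values at the generators: \<open>z(x)\<close> is
  the sum of \<open>z(q_i) S_i(x)\<close>.\<close>

lemma hom_partition:
  fixes m :: nat
  assumes P: "dual_basis P {..<m} S q" and N: "right_module A N"
  defines "j \<equiv> \<lambda>i y. \<lambda>x\<in>carrier P. ract N y (S x i)" and "p \<equiv> \<lambda>i z. z (q i)"
  shows "i \<in> {..<m} \<Longrightarrow> j i \<in> lin N (hom_space A P N)" "i \<in> {..<m} \<Longrightarrow> p i \<in> lin (hom_space A P N) N"
    "z \<in> carrier (hom_space A P N) \<Longrightarrow> finsum (hom_space A P N) (\<lambda>i. j i (p i z)) {..<m} = z"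
proof -
  note D = dual_basisD[OF P] and C = dual_basis_coord[OF P] and ND = right_moduleD[OF N]
  note vH = vsp_hom_space[OF D(1) N]
  have jh: "(\<lambda>x. ract N y (S x i)) \<in> rmod_hom A P N" if "y \<in> carrier N" for y i
    by (rule rmod_homI) (use that C ND in simp_all)
  have jc: "j i y \<in> carrier (hom_space A P N)" if "y \<in> carrier N" for y i
    unfolding j_def by (rule restrict_rmod_hom[OF D(1) jh[OF that]])
  show j: "j i \<in> lin N (hom_space A P N)" for i
    by (rule linI[OF jc]) (auto simp: j_def hom_space_simps ND C intro!: restrict_ext)
  show p: "p i \<in> lin (hom_space A P N) N" if "i \<in> {..<m}" for i
    unfolding p_def by (rule hom_space_eval) (use C(5) that in simp)
  assume z: "z \<in> carrier (hom_space A P N)"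
  have zh: "z \<in> rmod_hom A P N" using z by (simp add: hom_space_mem)
  have t: "(\<lambda>i. j i (p i z)) \<in> {..<m} \<rightarrow> carrier (hom_space A P N)"
    using jc lin_closed[OF p z] by auto
  show "finsum (hom_space A P N) (\<lambda>i. j i (p i z)) {..<m} = z"
  proof (rule hom_space_eqI[OF vs_finsum[OF vH t] z])
    fix x assume x: "x \<in> carrier P"
    have "finsum (hom_space A P N) (\<lambda>i. j i (p i z)) {..<m} x = finsum N (\<lambda>i. j i (p i z) x) {..<m}"
      by (rule lin_finsum[OF vH ND(1) hom_space_eval[OF x] t])
    also have "\<dots> = finsum N (\<lambda>i. z (ract P (q i) (S x i))) {..<m}"
    proof (rule vs_finsum_cong[OF ND(1) refl])
      show "j i (p i z) x = z (ract P (q i) (S x i))" if "i \<in> {..<m}" for i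
        using rmod_homD(3)[OF zh C(5)[OF that] C(1)[OF x]] x by (simp add: j_def p_def)
      show "(\<lambda>i. z (ract P (q i) (S x i))) \<in> {..<m} \<rightarrow> carrier N"
        using rmod_homD(1)[OF zh] right_moduleD(2)[OF D(1)] C(1)[OF x] C(5) by auto
    qed
    also have "\<dots> = z (finsum P (\<lambda>i. ract P (q i) (S x i)) {..<m})"
      by (rule lin_finsum[OF right_moduleD(1)[OF D(1)] ND(1) rmod_hom_lin[OF D(1) N zh], symmetric])
         (use right_moduleD(2)[OF D(1)] C(1)[OF x] C(5) in auto)
    also have "\<dots> = z x" using dual_basis_expand[OF P x] by simp
    finally show "finsum (hom_space A P N) (\<lambda>i. j i (p i z)) {..<m} x = z x" .
  qed
qed

lemma fd_hom_space:
  fixes m :: nat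
  assumes P: "dual_basis P {..<m} S q" and N: "right_module A N" "fd N"
  shows "fd (hom_space A P N)"
  by (rule partition_fd[OF vsp_hom_space[OF dual_basisD(1)[OF P] N(1)] right_moduleD(1)[OF N(1)] N(2) _ hom_partition[OF P N(1)]]) simp_all

lemma hom_map_lin:
  assumes P: "right_module A P" and P': "right_module A P'" and N: "right_module A N" and N': "right_module A N'"
    and F: "F \<in> rmod_hom A P P'" and \<psi>: "\<psi> \<in> rmod_hom A N N'"
  shows "(\<lambda>z. \<lambda>x\<in>carrier P. \<psi> (z (F x))) \<in> lin (hom_space A P' N) (hom_space A P N')"
proof (rule linI)
  note FD = rmod_homD[OF F] and pD = rmod_homD[OF \<psi>]
  show "(\<lambda>x\<in>carrier P. \<psi> (z (F x))) \<in> carrier (hom_space A P N')" if "z \<in> carrier (hom_space A P' N)" for z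
    by (rule restrict_rmod_hom[OF P rmod_hom_comp[OF rmod_hom_comp[OF F] \<psi>]]) (use that in \<open>simp add: hom_space_mem\<close>)
  show "(\<lambda>x\<in>carrier P. \<psi> ((z \<oplus>\<^bsub>hom_space A P' N\<^esub> w) (F x))) =
      (\<lambda>x\<in>carrier P. \<psi> (z (F x))) \<oplus>\<^bsub>hom_space A P N'\<^esub> (\<lambda>x\<in>carrier P. \<psi> (w (F x)))"
    if "z \<in> carrier (hom_space A P' N)" "w \<in> carrier (hom_space A P' N)" for z w
    unfolding hom_space_simps
    by (rule restrict_ext) (use FD(1) pD(2) hom_space_closed[OF that(1)] hom_space_closed[OF that(2)] in simp)
  show "(\<lambda>x\<in>carrier P. \<psi> ((c \<odot>\<^bsub>hom_space A P' N\<^esub> z) (F x))) = c \<odot>\<^bsub>hom_space A P N'\<^esub> (\<lambda>x\<in>carrier P. \<psi> (z (F x)))"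
    if "z \<in> carrier (hom_space A P' N)" for c z
    unfolding hom_space_simps
    by (rule restrict_ext) (use FD(1) lin_smult[OF rmod_hom_lin[OF N N' \<psi>]] hom_space_closed[OF that] in simp)
qed

lemma lin_trace_hom:
  fixes m :: nat
  assumes P: "dual_basis P {..<m} S q" and N: "right_module A N" "fd N"
    and F: "F \<in> rmod_hom A P P" and \<psi>: "\<psi> \<in> rmod_hom A N N"
  shows "lin_trace (hom_space A P N) (\<lambda>z. \<lambda>x\<in>carrier P. \<psi> (z (F x))) =
    (\<Sum>i<m. lin_trace N (\<lambda>y. \<psi> (ract N y (S (F (q i)) i))))"
proof -
  note D = dual_basisD[OF P] and C = dual_basis_coord[OF P]
  have "lin_trace (hom_space A P N) (\<lambda>z. \<lambda>x\<in>carrier P. \<psi> (z (F x))) =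
    (\<Sum>i<m. lin_trace N (\<lambda>y. (\<lambda>x\<in>carrier P. \<psi> ((\<lambda>x\<in>carrier P. ract N y (S x i)) (F x))) (q i)))"
    by (rule lin_trace_partition[OF vsp_hom_space[OF D(1) N(1)] right_moduleD(1)[OF N(1)] N(2) _ hom_partition[OF P N(1)]
      hom_map_lin[OF D(1,1) N(1,1) F \<psi>]]) simp_all
  also have "\<dots> = (\<Sum>i<m. lin_trace N (\<lambda>y. \<psi> (ract N y (S (F (q i)) i))))"
    by (rule sum.cong[OF refl]) (use C(5) rmod_homD(1)[OF F] in simp)
  finally show ?thesis .
qed

text \<open>The coordinates of an element of \<open>P u\<close> lie in the left ideal
  \<open>A u\<close>, so here \<open>A u\<close> takes the place of \<open>N\<close>.\<close>

lemma corner_partition: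
  fixes m :: nat
  assumes P: "dual_basis P {..<m} S q" and u: "u \<in> carrier A"
  defines "V \<equiv> P\<lparr>carrier := {ract P x u | x. x \<in> carrier P}\<rparr>" and "N \<equiv> A\<lparr>carrier := {a \<otimes> u | a. a \<in> carrier A}\<rparr>"
    and "j \<equiv> \<lambda>i a. ract P (q i) a" and "p \<equiv> \<lambda>i x. S x i"
  shows "vsp V" "vsp N" "fd N" "i \<in> {..<m} \<Longrightarrow> j i \<in> lin N V" "i \<in> {..<m} \<Longrightarrow> p i \<in> lin V N"
    "x \<in> carrier V \<Longrightarrow> finsum V (\<lambda>i. j i (p i x)) {..<m} = x"
proof -
  note D = dual_basisD[OF P] and C = dual_basis_coord[OF P] and PD = right_moduleD[OF dual_basisD(1)[OF P]]
  have sV: "subsp P {ract P x u | x. x \<in> carrier P}" by (rule subsp_ract_image[OF D(1) u])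
  have sN: "subsp A {a \<otimes> u | a. a \<in> carrier A}"
    using subsp_image[OF vspA vspA lin_mult_right[OF u] subsp_self[OF vspA]] by (simp add: image_def Bex_def conj_commute)
  show vV: "vsp V" and "vsp N" "fd N"
    unfolding V_def N_def by (rule vsp_subsp[OF PD(1) sV], rule vsp_subsp[OF vspA sN], rule fd_subsp[OF vspA fdA sN])
  have jV: "j i a \<in> carrier V" if "i \<in> {..<m}" "a \<in> carrier N" for i a
  proof -
    obtain b where b: "a = b \<otimes> u" "b \<in> carrier A" using \<open>a \<in> carrier N\<close> by (auto simp: N_def)
    have "j i a = ract P (ract P (q i) b) u" unfolding j_def b(1) by (rule PD(7)[OF C(5)[OF that(1)] b(2) u])
    then show ?thesis unfolding V_def using PD(2)[OF C(5)[OF that(1)] b(2)] by auto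
  qed
  have Nc: "a \<in> carrier A" if "a \<in> carrier N" for a using that u by (auto simp: N_def)
  have Vc: "x \<in> carrier P" if "x \<in> carrier V" for x using that subspD(1)[OF sV] by (auto simp: V_def)
  show j: "j i \<in> lin N V" if i: "i \<in> {..<m}" for i
  proof (rule linI[OF jV[OF i]])
    show "j i (a \<oplus>\<^bsub>N\<^esub> b) = j i a \<oplus>\<^bsub>V\<^esub> j i b" if "a \<in> carrier N" "b \<in> carrier N" for a b
      using PD(4)[OF C(5)[OF i] Nc[OF that(1)] Nc[OF that(2)]] by (simp add: j_def N_def V_def)
    show "j i (c \<odot>\<^bsub>N\<^esub> a) = c \<odot>\<^bsub>V\<^esub> j i a" if "a \<in> carrier N" for c a
      using PD(6)[OF C(5)[OF i] Nc[OF that]] by (simp add: j_def N_def V_def)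
  qed
  have pN: "p i x \<in> carrier N" if "x \<in> carrier V" for i x
    using that C(3) C(1) u by (auto simp: V_def N_def p_def)
  show p: "p i \<in> lin V N" for i
  proof (rule linI[OF pN])
    show "p i (x \<oplus>\<^bsub>V\<^esub> y) = p i x \<oplus>\<^bsub>N\<^esub> p i y" if "x \<in> carrier V" "y \<in> carrier V" for x y
      using C(2)[OF Vc[OF that(1)] Vc[OF that(2)]] by (simp add: p_def N_def V_def)
    show "p i (c \<odot>\<^bsub>V\<^esub> x) = c \<odot>\<^bsub>N\<^esub> p i x" if "x \<in> carrier V" for c x
      using C(4)[OF Vc[OF that]] by (simp add: p_def N_def V_def)
  qed
  assume x: "x \<in> carrier V"
  have "finsum V (\<lambda>i. j i (p i x)) {..<m} = finsum P (\<lambda>i. j i (p i x)) {..<m}"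
    unfolding V_def by (rule finsum_subsp[OF PD(1) sV]) (use jV pN[OF x] in \<open>auto simp: V_def\<close>)
  also have "\<dots> = x" unfolding j_def p_def by (rule dual_basis_expand[OF P Vc[OF x]])
  finally show "finsum V (\<lambda>i. j i (p i x)) {..<m} = x" .
qed

lemma fd_dual_basis_corner:
  fixes m :: nat
  assumes P: "dual_basis P {..<m} S q" and u: "u \<in> carrier A"
  shows "fd (P\<lparr>carrier := {ract P x u | x. x \<in> carrier P}\<rparr>)"
  by (rule partition_fd[OF corner_partition(1-3)[OF P u] _ corner_partition(4-6)[OF P u]]) simp_all

lemma fd_dual_basis:
  fixes m :: nat
  assumes P: "dual_basis P {..<m} S q"
  shows "fd P"
proof -
  \<comment> \<open>The unit as idempotent: \<open>P\<close> is its own corner.\<close>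
  have "{ract P x \<one> | x. x \<in> carrier P} = carrier P"
  proof (intro equalityI subsetI)
    fix x assume x: "x \<in> carrier P"
    have "x = ract P x \<one>" using right_moduleD(8)[OF dual_basisD(1)[OF P] x] by simp
    with x show "x \<in> {ract P x \<one> | x. x \<in> carrier P}" by blast
  qed (use right_moduleD(8)[OF dual_basisD(1)[OF P]] in auto)
  then show ?thesis using fd_dual_basis_corner[OF P one_closed] by simp
qed

text \<open>The diagonal block of \<open>F\<close> at the generator \<open>q i\<close> is left
  multiplication on \<open>A u\<close> by the diagonal coordinate of \<open>F (q i)\<close>.\<close>

lemma lin_trace_corner:
  fixes m :: nat
  assumes P: "dual_basis P {..<m} S q" and u: "u \<in> carrier A" and F: "F \<in> rmod_hom A P P"
  shows "lin_trace (P\<lparr>carrier := {ract P x u | x. x \<in> carrier P}\<rparr>) F =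
    (\<Sum>i<m. lin_trace (A\<lparr>carrier := {a \<otimes> u | a. a \<in> carrier A}\<rparr>) (\<lambda>y. S (F (q i)) i \<otimes> y))"
proof -
  note D = dual_basisD[OF P] and C = dual_basis_coord[OF P] and PD = right_moduleD[OF dual_basisD(1)[OF P]]
  note c = corner_partition[OF P u]
  let ?V = "P\<lparr>carrier := {ract P x u | x. x \<in> carrier P}\<rparr>" and ?N = "A\<lparr>carrier := {a \<otimes> u | a. a \<in> carrier A}\<rparr>"
  have sV: "subsp P {ract P x u | x. x \<in> carrier P}" by (rule subsp_ract_image[OF D(1) u])
  have FV: "F \<in> lin ?V ?V"
    by (rule lin_restrict[OF rmod_hom_lin[OF D(1,1) F] subspD(1)[OF sV]]) (use rmod_homD[OF F] u in auto)
  have "lin_trace ?V F = (\<Sum>i<m. lin_trace ?N (\<lambda>y. S (F (ract P (q i) y)) i))"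
    by (rule lin_trace_partition[OF c(1-3) _ c(4-6) FV]) simp_all
  also have "\<dots> = (\<Sum>i<m. lin_trace ?N (\<lambda>y. S (F (q i)) i \<otimes> y))"
  proof (rule sum.cong[OF refl])
    fix i assume i: "i \<in> {..<m}"
    show "lin_trace ?N (\<lambda>y. S (F (ract P (q i) y)) i) = lin_trace ?N (\<lambda>y. S (F (q i)) i \<otimes> y)"
    proof (rule lin_trace_cong[OF c(2,3) lin_comp[OF lin_comp[OF c(4)[OF i] FV] c(5)[OF i]]])
      fix y assume "y \<in> carrier ?N"
      then have y: "y \<in> carrier A" using u by auto
      show "S (F (ract P (q i) y)) i = S (F (q i)) i \<otimes> y"
        using rmod_homD(3)[OF F C(5)[OF i] y] C(3)[OF rmod_homD(1)[OF F C(5)[OF i]] y] by simp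
    qed
  qed
  finally show ?thesis .
qed

end

context elem_alg
begin

text \<open>The trace that \<open>F\<close> induces on \<open>P \<otimes> k\<close>, with
  \<open>A\<close> acting on \<open>k\<close> through \<open>chi j\<close>. For the identity this is
  the multiplicity of the projective of \<open>e j\<close> in \<open>P\<close>, read in the
  field.\<close>

definition mult_trace :: "nat \<Rightarrow> ('v \<Rightarrow> nat \<Rightarrow> 'a) \<Rightarrow> (nat \<Rightarrow> 'v) \<Rightarrow> ('v \<Rightarrow> 'v) \<Rightarrow> nat \<Rightarrow> 'k" where
  "mult_trace m S q F j = (\<Sum>i<m. chi j (S (F (q i)) i))"

text \<open>Common form of the argument for right and left actions: the operator depends linearly on
  \<open>a\<close> and is nilpotent when \<open>a\<close> is, so its trace is a functional for
  \<open>trace_form_eq\<close>.\<close>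

lemma trace_form_operator:
  assumes N: "vsp N" "fd N" and f: "\<And>a. a \<in> carrier A \<Longrightarrow> f a \<in> lin N N"
    and add: "\<And>a b y. a \<in> carrier A \<Longrightarrow> b \<in> carrier A \<Longrightarrow> y \<in> carrier N \<Longrightarrow> f (a \<oplus> b) y = f a y \<oplus>\<^bsub>N\<^esub> f b y"
    and smult: "\<And>c a y. a \<in> carrier A \<Longrightarrow> y \<in> carrier N \<Longrightarrow> f (c \<odot> a) y = c \<odot>\<^bsub>N\<^esub> f a y"
    and nil: "\<And>a r y. a \<in> carrier A \<Longrightarrow> a [^] (r::nat) = \<zero> \<Longrightarrow> y \<in> carrier N \<Longrightarrow> (f a ^^ r) y = \<zero>\<^bsub>N\<^esub>"
    and a: "a \<in> carrier A"
  shows "lin_trace N (f a) = (\<Sum>j<n. chi j a * lin_trace N (f (e j)))"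
proof (rule trace_form_eq[where T = "\<lambda>a. lin_trace N (f a)", OF _ _ a])
  show "(\<lambda>a. lin_trace N (f a)) \<in> lin A kmod"
  proof (rule linI)
    fix a b assume ab: "a \<in> carrier A" "b \<in> carrier A"
    have "lin_trace N (f (a \<oplus> b)) = lin_trace N (\<lambda>y. f a y \<oplus>\<^bsub>N\<^esub> f b y)"
      by (rule lin_trace_cong[OF N f]) (use ab add in simp_all)
    then show "lin_trace N (f (a \<oplus> b)) = lin_trace N (f a) \<oplus>\<^bsub>kmod\<^esub> lin_trace N (f b)"
      using lin_trace_add[OF N f[OF ab(1)] f[OF ab(2)]] by simp
  next
    fix a c assume a: "a \<in> carrier A"
    have "lin_trace N (f (c \<odot> a)) = lin_trace N (\<lambda>y. c \<odot>\<^bsub>N\<^esub> f a y)"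
      by (rule lin_trace_cong[OF N f]) (use a smult in simp_all)
    then show "lin_trace N (f (c \<odot> a)) = c \<odot>\<^bsub>kmod\<^esub> lin_trace N (f a)"
      using lin_trace_smult[OF N f[OF a]] by simp
  qed simp
  show "lin_trace N (f y) = 0" if "y \<in> carrier A" "y [^] r = \<zero>" for y and r :: nat
    by (rule lin_trace_nilpotent[OF N f[OF that(1)] nil[OF that]])
qed

lemma trace_form_right:
  assumes N: "right_module A N" "fd N" and \<psi>: "\<psi> \<in> rmod_hom A N N" and a: "a \<in> carrier A"
  shows "lin_trace N (\<lambda>y. \<psi> (ract N y a)) = (\<Sum>j<n. chi j a * lin_trace N (\<lambda>y. \<psi> (ract N y (e j))))"
proof -
  note ND = right_moduleD[OF N(1)] and pD = rmod_homD[OF \<psi>]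
  have pc: "(\<psi> ^^ k) z \<in> carrier N" if "z \<in> carrier N" for k z
    using that pD(1) by (induction k) auto
  \<comment> \<open>Because \<open>\<psi>\<close> commutes with the action, the powers of the
    operator are powers of \<open>\<psi>\<close> followed by the action of powers of
    \<open>y\<close>. So nilpotency of \<open>y\<close> passes to the operator.\<close>
  have pow: "((\<lambda>z. \<psi> (ract N z y)) ^^ k) x = ract N ((\<psi> ^^ k) x) (y [^] k)" if y: "y \<in> carrier A" and x: "x \<in> carrier N" for x y and k :: nat
  proof (induction k)
    case (Suc k)
    have "((\<lambda>z. \<psi> (ract N z y)) ^^ Suc k) x = \<psi> (ract N (ract N ((\<psi> ^^ k) x) (y [^] k)) y)" using Suc by simp
    also have "\<dots> = \<psi> (ract N ((\<psi> ^^ k) x) (y [^] Suc k))" using ND(7)[OF pc[OF x] _ y, of "y [^] k" k] y by simp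
    also have "\<dots> = ract N ((\<psi> ^^ Suc k) x) (y [^] Suc k)" using pD(3)[OF pc[OF x], of "y [^] Suc k"] y by simp
    finally show ?case .
  qed (use x ND in simp)
  show ?thesis
  proof (rule trace_form_operator[where f = "\<lambda>a y. \<psi> (ract N y a)", OF ND(1) N(2) lin_comp[OF lin_ract[OF N(1)] rmod_hom_lin[OF N(1,1) \<psi>]] _ _ _ a])
    show "((\<lambda>y. \<psi> (ract N y b)) ^^ r) x = \<zero>\<^bsub>N\<^esub>" if "b \<in> carrier A" "b [^] r = \<zero>" "x \<in> carrier N" for b x and r :: nat
      unfolding pow[OF that(1,3)] that(2) by (rule ract_zero[OF N(1) pc[OF that(3)]])
  qed (use ND pD lin_smult[OF rmod_hom_lin[OF N(1,1) \<psi>]] in simp_all)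
qed

lemma lin_trace_hom_eq:
  assumes P: "dual_basis P {..<m} S q" and N: "right_module A N" "fd N"
    and F: "F \<in> rmod_hom A P P" and \<psi>: "\<psi> \<in> rmod_hom A N N"
  shows "lin_trace (hom_space A P N) (\<lambda>z. \<lambda>x\<in>carrier P. \<psi> (z (F x))) =
    (\<Sum>j<n. mult_trace m S q F j * lin_trace N (\<lambda>y. \<psi> (ract N y (e j))))"
proof -
  have "lin_trace (hom_space A P N) (\<lambda>z. \<lambda>x\<in>carrier P. \<psi> (z (F x))) =
    (\<Sum>i<m. \<Sum>j<n. chi j (S (F (q i)) i) * lin_trace N (\<lambda>y. \<psi> (ract N y (e j))))"
    unfolding lin_trace_hom[OF P N F \<psi>]
    by (rule sum.cong[OF refl], rule trace_form_right[OF N \<psi>])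
       (use dual_basis_coord[OF P] rmod_homD(1)[OF F] in simp)
  then show ?thesis by (subst (asm) sum.swap) (simp add: mult_trace_def sum_distrib_right)
qed

end

section \<open>Finite resolutions\<close>

context fin_alg
begin

lemma cover_exists:
  assumes K: "right_module A K" "fd K"
  shows "\<exists>(m::nat) g. g \<in> rmod_hom A (free_rmod A {..<m}) K \<and> g ` carrier (free_rmod A {..<m}) = carrier K"
proof -
  note KD = right_moduleD[OF K(1)]
  obtain J \<xi> where F: "frame K J (\<lambda>s. s) \<xi>" by (rule fd_frame[OF KD(1) K(2)])
  note FD = frameD[OF F]
  obtain c :: "nat \<Rightarrow> _" and m where c: "bij_betw c {..<m} J"
    using ex_bij_betw_nat_finite[OF FD(1)] by (metis atLeast0LessThan)
  have cK: "c \<in> {..<m} \<rightarrow> carrier K" using FD(3) c by (auto simp: bij_betw_def)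
  let ?g = "free_ext K c"
  note g = free_ext_hom[OF K(1) cK]
  have "x \<in> ?g ` carrier (free_rmod A {..<m})" if x: "x \<in> carrier K" for x
  proof -
    \<comment> \<open>The scalars of the expansion of \<open>x\<close> as a vector, viewed in
      \<open>A\<close> as multiples of the unit: vectors that span \<open>K\<close> also generate it
      as a module.\<close>
    let ?v = "\<lambda>i. if i < m then \<xi> (c i) x \<odot> \<one> else \<zero>"
    have v: "?v \<in> carrier (free_rmod A {..<m})"
      by (auto simp: free_rmod_mem intro: finite_subset[of _ "{..<m}"])
    have s: "{i. ?v i \<noteq> \<zero>} \<subseteq> {..<m}" by auto
    have "?g ?v = finsum K (\<lambda>i. ract K (c i) (?v i)) {..<m}"
      by (rule free_ext_superset[OF K(1) cK v _ _ s]) auto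
    also have "\<dots> = finsum K (\<lambda>i. \<xi> (c i) x \<odot>\<^bsub>K\<^esub> c i) {..<m}"
      by (rule vs_finsum_cong[OF KD(1) refl]) (use cK KD in \<open>auto simp: Pi_iff\<close>)
    also have "\<dots> = finsum K (\<lambda>b. \<xi> b x \<odot>\<^bsub>K\<^esub> b) (c ` {..<m})"
      using c cK KD(1) by (intro abelian_monoid.finsum_reindex[OF vsp_abelian_monoid[OF KD(1)], symmetric])
        (auto simp: bij_betw_def Pi_iff)
    also have "\<dots> = x" using FD(5)[OF x] c by (simp add: bij_betw_def)
    finally have "x = ?g ?v" by simp
    then show ?thesis using v by (rule image_eqI)
  qed
  then show ?thesis using g rmod_homD(1)[OF g] by (intro exI[of _ m] exI[of _ ?g]) auto
qed

text \<open>Rank and surjection are chosen together in one pair; by this the free resolution becomes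
  a function of the module.\<close>

definition cover :: "('k, 'v, 'a, 'z) rmod_scheme \<Rightarrow> nat \<times> ((nat \<Rightarrow> 'a) \<Rightarrow> 'v)" where
  "cover K = (SOME c. snd c \<in> rmod_hom A (free_rmod A {..<fst c}) K \<and>
     snd c ` carrier (free_rmod A {..<fst c}) = carrier K)"

definition cover_ker :: "('k, 'v, 'a, 'z) rmod_scheme \<Rightarrow> ('k, nat \<Rightarrow> 'a, 'a) rmod" where
  "cover_ker K = (free_rmod A {..<fst (cover K)})\<lparr>carrier := {x \<in> carrier (free_rmod A {..<fst (cover K)}). snd (cover K) x = \<zero>\<^bsub>K\<^esub>}\<rparr>"

lemma cover:
  assumes K: "right_module A K" "fd K"
  shows "snd (cover K) \<in> rmod_hom A (free_rmod A {..<fst (cover K)}) K"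
    "snd (cover K) ` carrier (free_rmod A {..<fst (cover K)}) = carrier K"
    "right_module A (cover_ker K)" "fd (cover_ker K)"
proof -
  obtain m :: nat and g where "g \<in> rmod_hom A (free_rmod A {..<m}) K \<and> g ` carrier (free_rmod A {..<m}) = carrier K"
    using cover_exists[OF K] by blast
  then have "\<exists>c :: nat \<times> _. snd c \<in> rmod_hom A (free_rmod A {..<fst c}) K \<and> snd c ` carrier (free_rmod A {..<fst c}) = carrier K"
    by (intro exI[of _ "(m, g)"]) simp
  from someI_ex[OF this, folded cover_def]
  show c: "snd (cover K) \<in> rmod_hom A (free_rmod A {..<fst (cover K)}) K"
    "snd (cover K) ` carrier (free_rmod A {..<fst (cover K)}) = carrier K" by auto
  show "right_module A (cover_ker K)" unfolding cover_ker_def by (rule right_module_ker[OF right_module_free K(1) c(1)])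
  show "fd (cover_ker K)" unfolding cover_ker_def
    by (rule fd_subsp[OF vsp_free fd_dual_basis[OF dual_basis_free] subsp_ker[OF vsp_free right_moduleD(1)[OF K(1)] rmod_hom_lin[OF right_module_free K(1) c(1)]]])
qed

text \<open>Index 0 is the kernel of the cover of \<open>M\<close>, usually counted as the first
  syzygy. From there on everything lies in \<open>nat \<Rightarrow> 'a\<close>, whatever the type of
  \<open>M\<close>, so the recursion is well typed and \<open>finite_gldim\<close> becomes
  applicable.\<close>

primrec syzygy :: "('k, 'v, 'a, 'z) rmod_scheme \<Rightarrow> nat \<Rightarrow> ('k, nat \<Rightarrow> 'a, 'a) rmod" where
  "syzygy M 0 = cover_ker M"
| "syzygy M (Suc l) = cover_ker (syzygy M l)"

definition free_rank :: "('k, 'v, 'a, 'z) rmod_scheme \<Rightarrow> nat \<Rightarrow> nat" where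
  "free_rank M l = (case l of 0 \<Rightarrow> fst (cover M) | Suc l \<Rightarrow> fst (cover (syzygy M l)))"

definition free_res :: "('k, 'v, 'a, 'z) rmod_scheme \<Rightarrow> ('k, nat \<Rightarrow> 'a, 'a, 'v) resolution" where
  "free_res M = \<lparr>obj = (\<lambda>l. free_rmod A {..<free_rank M l}), bd = (\<lambda>l. snd (cover (syzygy M l))), aug = snd (cover M)\<rparr>"

lemma free_res_simps [simp]: "obj (free_res M) l = free_rmod A {..<free_rank M l}"
  "bd (free_res M) l = snd (cover (syzygy M l))" "aug (free_res M) = snd (cover M)"
  by (auto simp: free_res_def)

context
  fixes M :: "('k, 'v, 'a, 'z) rmod_scheme"
  assumes M: "right_module A M" "fd M"
begin

lemma syzygy: "right_module A (syzygy M l)" "fd (syzygy M l)"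
proof (induction l)
  case 0
  show "right_module A (syzygy M 0)" "fd (syzygy M 0)" using cover(3,4)[OF M] by simp_all
next
  case (Suc l)
  show "right_module A (syzygy M (Suc l))" "fd (syzygy M (Suc l))" using cover(3,4)[OF Suc] by simp_all
qed

lemma syzygy_simps:
  "carrier (syzygy M 0) = {x \<in> carrier (obj (free_res M) 0). aug (free_res M) x = \<zero>\<^bsub>M\<^esub>}"
  "carrier (syzygy M (Suc l)) = {x \<in> carrier (obj (free_res M) (Suc l)). bd (free_res M) l x = \<zero>\<^bsub>obj (free_res M) l\<^esub>}"
  "zero (syzygy M l) = zero (obj (free_res M) l)" "add (syzygy M l) = add (obj (free_res M) l)"
  "smult (syzygy M l) = smult (obj (free_res M) l)" "ract (syzygy M l) = ract (obj (free_res M) l)"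
proof -
  have z: "zero (syzygy M l) = (\<lambda>i. \<zero>)" "add (syzygy M l) = (\<lambda>x y i. x i \<oplus> y i)"
      "smult (syzygy M l) = (\<lambda>c x i. c \<odot> x i)" "ract (syzygy M l) = (\<lambda>x a i. x i \<otimes> a)" for l
    by (cases l; simp add: cover_ker_def)+
  then show "zero (syzygy M l) = zero (obj (free_res M) l)" "add (syzygy M l) = add (obj (free_res M) l)"
    "smult (syzygy M l) = smult (obj (free_res M) l)" "ract (syzygy M l) = ract (obj (free_res M) l)" by simp_all
  show "carrier (syzygy M 0) = {x \<in> carrier (obj (free_res M) 0). aug (free_res M) x = \<zero>\<^bsub>M\<^esub>}"
    by (simp add: cover_ker_def free_rank_def)
  show "carrier (syzygy M (Suc l)) = {x \<in> carrier (obj (free_res M) (Suc l)). bd (free_res M) l x = \<zero>\<^bsub>obj (free_res M) l\<^esub>}"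
    using z(1) by (simp add: cover_ker_def[of "syzygy M l"] free_rank_def)
qed

lemma syzygy_carrier: "x \<in> carrier (syzygy M l) \<Longrightarrow> x \<in> carrier (obj (free_res M) l)"
  using syzygy_simps(1,2) by (cases l) auto

lemma syzygy_incl: "(\<lambda>x. x) \<in> rmod_hom A (syzygy M l) (obj (free_res M) l)"
  by (rule rmod_homI) (use syzygy_carrier syzygy_simps in auto)

lemma bd_syzygy: "bd (free_res M) l \<in> rmod_hom A (obj (free_res M) (Suc l)) (syzygy M l)"
    "bd (free_res M) l ` carrier (obj (free_res M) (Suc l)) = carrier (syzygy M l)"
  using cover[OF syzygy, of l] by (simp_all add: free_rank_def)

lemma exact_free_res: "exact_res M (free_res M)"
  unfolding exact_res_def
proof (intro conjI allI)
  show "right_module A M" by (rule M)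
  show "right_module A (obj (free_res M) l)" for l by (simp add: right_module_free)
  show "bd (free_res M) l \<in> rmod_hom A (obj (free_res M) (Suc l)) (obj (free_res M) l)" for l
    using rmod_hom_comp[OF bd_syzygy(1) syzygy_incl] by simp
  show "aug (free_res M) \<in> rmod_hom A (obj (free_res M) 0) M" "aug (free_res M) ` carrier (obj (free_res M) 0) = carrier M"
    using cover[OF M] by (simp_all add: free_rank_def)
  show "bd (free_res M) 0 ` carrier (obj (free_res M) 1) = {x \<in> carrier (obj (free_res M) 0). aug (free_res M) x = \<zero>\<^bsub>M\<^esub>}"
    using bd_syzygy(2)[of 0] syzygy_simps(1) by simp
  show "bd (free_res M) (Suc l) ` carrier (obj (free_res M) (Suc (Suc l))) =
        {x \<in> carrier (obj (free_res M) (Suc l)). bd (free_res M) l x = \<zero>\<^bsub>obj (free_res M) l\<^esub>}" for l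
    using bd_syzygy(2)[of "Suc l"] syzygy_simps(2)[of l] by simp
qed

text \<open>Once the finite resolution supplied by the global dimension has died out, the identity of the
  free resolution is homotopic to zero; this splits the syzygies off.\<close>
lemma syzygy_retract:
  assumes gl: "finite_gldim A"
  shows "\<exists>d. \<exists>\<rho>\<in>rmod_hom A (obj (free_res M) d) (syzygy M d). \<forall>y\<in>carrier (syzygy M d). \<rho> y = y"
proof -
  \<comment> \<open>The global dimension is invoked for \<open>K\<close> and not for
    \<open>M\<close>, whose elements may have the wrong type. \<open>F\<close> is the free
    resolution without its first term, now a resolution of \<open>K\<close>; its indices are shifted
    by one.\<close>
  define K where "K = syzygy M 0"
  define F where "F = \<lparr>obj = (\<lambda>l. obj (free_res M) (Suc l)), bd = (\<lambda>l. bd (free_res M) (Suc l)), aug = bd (free_res M) 0\<rparr>"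
  note E = exact_resD[OF exact_free_res]
  have FK: "exact_res K F" unfolding exact_res_def
  proof (intro conjI allI)
    show "right_module A K" unfolding K_def by (rule syzygy)
    show "right_module A (obj F l)" "bd F l \<in> rmod_hom A (obj F (Suc l)) (obj F l)" for l
      unfolding F_def using E(2,3)[of "Suc l"] by (simp_all only: resolution.simps)
    show "aug F \<in> rmod_hom A (obj F 0) K" "aug F ` carrier (obj F 0) = carrier K"
      unfolding F_def K_def using bd_syzygy[of 0] by (simp_all only: resolution.simps)
    show "bd F 0 ` carrier (obj F 1) = {x \<in> carrier (obj F 0). aug F x = \<zero>\<^bsub>K\<^esub>}"
      unfolding F_def K_def using E(7)[of 0] syzygy_simps(3)[of 0] by (simp only: resolution.simps One_nat_def)
    show "bd F (Suc l) ` carrier (obj F (Suc (Suc l))) = {x \<in> carrier (obj F (Suc l)). bd F l x = \<zero>\<^bsub>obj F l\<^esub>}" for l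
      unfolding F_def using E(7)[of "Suc l"] by (simp only: resolution.simps)
  qed
  obtain d where d: "\<forall>(M :: ('k, nat \<Rightarrow> 'a, 'a) rmod). right_module A M \<longrightarrow>
     (\<exists>(P :: ('k, nat \<Rightarrow> 'a, 'a, nat \<Rightarrow> 'a) resolution). projective_resolution A M P \<and>
        (\<forall>l>d. zero_space (obj P l)))"
    using gl unfolding finite_gldim_def by auto
  have rK: "right_module A K" unfolding K_def by (rule syzygy)
  obtain R :: "('k, nat \<Rightarrow> 'a, 'a, nat \<Rightarrow> 'a) resolution"
    where R: "projective_resolution A K R" and Rd: "\<And>l. l > d \<Longrightarrow> zero_space (obj R l)"
    using d rK by blast
  have Rm: "right_module A (obj R l)" and Rp: "projective A (obj R l)" for l
    using R by (auto simp: projective_resolution_def projective_def)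
  have RK: "exact_res K R" using R rK Rm unfolding projective_resolution_def exact_res_def by auto
  note FD = exact_resD[OF FK] and RD = exact_resD[OF RK]
  have lF: "lifts (obj F l) X Y" if "right_module A X" "right_module A Y" for l and X :: "('k, nat \<Rightarrow> 'a, 'a) rmod" and Y :: "('k, nat \<Rightarrow> 'a, 'a) rmod"
    using dual_basis_lifts[OF dual_basis_free that] by (simp add: F_def)
  have lR: "lifts (obj R l) X Y" if "right_module A X" "right_module A Y" for l and X :: "('k, nat \<Rightarrow> 'a, 'a) rmod" and Y :: "('k, nat \<Rightarrow> 'a, 'a) rmod"
    using projective_dual_basis[OF Rp[of l]] dual_basis_lifts[OF _ that] by blast
  obtain \<alpha> where \<alpha>: "chain_map F R (\<lambda>x. x) \<alpha>"
    using chain_map_exists[OF FK RK rmod_hom_id lF[OF Rm rK] lF[OF Rm Rm]] by auto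
  obtain \<beta> where \<beta>: "chain_map R F (\<lambda>x. x) \<beta>"
    using chain_map_exists[OF RK FK rmod_hom_id lR[OF FD(2) rK] lR[OF FD(2) FD(2)]] by auto
  have \<beta>\<alpha>: "chain_map F F (\<lambda>x. x) (\<lambda>l x. \<beta> l (\<alpha> l x))" by (rule chain_map_comp[OF \<alpha> \<beta> FK])
  note C = chain_mapD[OF \<beta>\<alpha>]
  define D where "D l x = x \<ominus>\<^bsub>obj F l\<^esub> \<beta> l (\<alpha> l x)" for l x
  have Dh: "D l \<in> rmod_hom A (obj F l) (obj F l)" for l
    unfolding D_def by (rule rmod_hom_minus[OF FD(2) rmod_hom_id C(1)])
  have D0: "aug F (D 0 x) = \<zero>\<^bsub>K\<^esub>" if "x \<in> carrier (obj F 0)" for x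
    unfolding D_def
    using lin_minus[OF FD(11,10,13) that rmod_homD(1)[OF C(1) that]] C(2)[OF that] vs_minus_self[OF FD(10) lin_closed[OF FD(13) that]]
    by simp
  have Dl: "bd F l (D (Suc l) x) = D l (bd F l x)" if "x \<in> carrier (obj F (Suc l))" for l x
    unfolding D_def using lin_minus[OF FD(11,11,12) that rmod_homD(1)[OF C(1) that]] C(3)[OF that] by simp
  obtain h where h: "\<And>l. h l \<in> rmod_hom A (obj F l) (obj F (Suc l))"
    "\<And>l x. x \<in> carrier (obj F (Suc l)) \<Longrightarrow> bd F (Suc l) (h (Suc l) x) = D (Suc l) x \<ominus>\<^bsub>obj F (Suc l)\<^esub> h l (bd F l x)"
  proof -
    have "\<exists>h. (\<forall>l. h l \<in> rmod_hom A (obj F l) (obj F (Suc l))) \<and> (\<forall>x\<in>carrier (obj F 0). bd F 0 (h 0 x) = D 0 x) \<and>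
       (\<forall>l. \<forall>x\<in>carrier (obj F (Suc l)). bd F (Suc l) (h (Suc l) x) = D (Suc l) x \<ominus>\<^bsub>obj F (Suc l)\<^esub> h l (bd F l x))"
      by (rule chain_homotopy[OF FK FK]) (simp_all add: lF FD Dh D0 Dl del: One_nat_def)
    then show thesis by (elim exE conjE) (rule that, blast+)
  qed
  have FS: "obj F l = obj (free_res M) (Suc l)" "bd F l = bd (free_res M) (Suc l)" for l by (simp_all add: F_def)
  \<comment> \<open>In degree \<open>Suc d\<close> of \<open>F\<close> the detour through
    \<open>R\<close> is zero, so there \<open>x = bd (h x) + h (bd x)\<close>. Applying
    \<open>bd\<close> gives \<open>bd x = bd (h (bd x))\<close>: the map \<open>bd \<circ> h\<close>
    fixes the boundaries, which form the syzygy.\<close>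
  define \<rho> where "\<rho> y = bd F d (h d y)" for y
  have "\<rho> \<in> rmod_hom A (obj (free_res M) (Suc d)) (syzygy M (Suc d))"
    using rmod_hom_comp[OF h(1)[of d, unfolded FS] bd_syzygy(1)[of "Suc d"]] unfolding \<rho>_def[abs_def] FS .
  moreover have "\<rho> y = y" if y: "y \<in> carrier (syzygy M (Suc d))" for y
  proof -
    obtain x where x: "x \<in> carrier (obj F (Suc d))" "y = bd F d x"
      using y unfolding bd_syzygy(2)[symmetric] FS by blast
    have hx: "h d y \<in> carrier (obj F (Suc d))"
      unfolding x(2) by (rule rmod_homD(1)[OF h(1) rmod_homD(1)[OF FD(3) x(1)]])
    have ax: "\<alpha> (Suc d) x = \<zero>\<^bsub>obj R (Suc d)\<^esub>" using rmod_homD(1)[OF chain_mapD(1)[OF \<alpha>] x(1)] Rd[of "Suc d"] by simp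
    have "\<beta> (Suc d) (\<alpha> (Suc d) x) = \<zero>\<^bsub>obj F (Suc d)\<^esub>"
      unfolding ax by (rule lin_zero[OF RD(11) FD(11) rmod_hom_lin[OF RD(2) FD(2) chain_mapD(1)[OF \<beta>]]])
    then have "D (Suc d) x = x" unfolding D_def using x(1) FD(11)[of "Suc d"] by (simp add: vs_minus_eq)
    then have e: "bd F (Suc d) (h (Suc d) x) = x \<ominus>\<^bsub>obj F (Suc d)\<^esub> h d y" using h(2)[OF x(1)] x(2) by simp
    have "bd F d (bd F (Suc d) (h (Suc d) x)) = \<zero>\<^bsub>obj F d\<^esub>"
      by (rule FD(9)[OF rmod_homD(1)[OF h(1) x(1)]])
    then have "bd F d x \<ominus>\<^bsub>obj F d\<^esub> bd F d (h d y) = \<zero>\<^bsub>obj F d\<^esub>"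
      unfolding e using lin_minus[OF FD(11,11,12) x(1) hx] by simp
    then have "bd F d x = bd F d (h d y)"
      using vs_minus_zero_iff[OF FD(11) lin_closed[OF FD(12) x(1)] lin_closed[OF FD(12) hx]] by simp
    then show ?thesis unfolding \<rho>_def using x(2) by simp
  qed
  ultimately show ?thesis by blast
qed

text \<open>The free resolution is cut off at the syzygy that is a retract of a free module of
  finite rank; this syzygy inherits a finite dual basis and becomes the last nonzero term.\<close>

lemma finite_resolution:
  assumes gl: "finite_gldim A"
  shows "\<exists>(Q :: ('k, nat \<Rightarrow> 'a, 'a, 'v) resolution) L. exact_res M Q \<and>
    (\<forall>l. \<exists>(m::nat) S q. dual_basis (obj Q l) {..<m} S q) \<and> (\<forall>l>L. zero_space (obj Q l))"
proof -
  note E = exact_resD[OF exact_free_res]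
  obtain d \<rho> where r: "\<rho>\<in>rmod_hom A (obj (free_res M) d) (syzygy M d)" "\<And>y. y\<in>carrier (syzygy M d) \<Longrightarrow> \<rho> y = y"
    using syzygy_retract[OF gl] by blast
  define Z :: "('k, nat \<Rightarrow> 'a, 'a) rmod" where "Z = (free_rmod A {})\<lparr>carrier := {\<lambda>i. \<zero>}\<rparr>"
  have sZ: "subsp (free_rmod A {}) {\<lambda>i. \<zero>}" by (rule subspI) (auto simp: free_rmod_mem)
  have Z: "right_module A Z" unfolding Z_def by (rule right_module_sub[OF right_module_free sZ]) auto
  have Z0: "zero_space Z" "\<zero>\<^bsub>Z\<^esub> = (\<lambda>i. \<zero>)" by (simp_all add: Z_def)
  \<comment> \<open>Free up to degree \<open>d\<close>, then the split syzygy with its inclusion as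
    differential, then zero modules. The zero map is written as a constant function, because all
    these terms share the zero of \<open>nat \<Rightarrow> 'a\<close>.\<close>
  define Q :: "('k, nat \<Rightarrow> 'a, 'a, 'v) resolution" where
    "Q = \<lparr>obj = (\<lambda>l. if l \<le> d then obj (free_res M) l else if l = Suc d then syzygy M d else Z),
      bd = (\<lambda>l. if l < d then bd (free_res M) l else if l = d then (\<lambda>x. x) else (\<lambda>x i. \<zero>)), aug = aug (free_res M)\<rparr>"
  have Qo: "obj Q l = (if l \<le> d then obj (free_res M) l else if l = Suc d then syzygy M d else Z)"
    "bd Q l = (if l < d then bd (free_res M) l else if l = d then (\<lambda>x. x) else (\<lambda>x i. \<zero>))"
    "aug Q = aug (free_res M)" for l by (simp_all add: Q_def)
  have zs: "zero (syzygy M d) = (\<lambda>i. \<zero>)" using syzygy_simps(3)[of d] by simp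
  have Qm: "right_module A (obj Q l)" for l
    unfolding Qo using E(2)[of l] syzygy(1)[of d] Z by simp
  have z0: "(\<lambda>x i. \<zero>) \<in> rmod_hom A X (obj Q l)" if "l > d" for l and X :: "('k, nat \<Rightarrow> 'a, 'a) rmod"
  proof -
    have "\<zero>\<^bsub>obj Q l\<^esub> = (\<lambda>i. \<zero>)" using that zs Z0 by (simp add: Qo)
    then show ?thesis using rmod_hom_zero[OF Qm[of l], of X] by simp
  qed
  have ex: "exact_res M Q" unfolding exact_res_def
  proof (intro conjI allI M(1) Qm)
    show "bd Q l \<in> rmod_hom A (obj Q (Suc l)) (obj Q l)" for l
    proof -
      consider "l < d" | "l = d" | "l > d" by linarith
      then show ?thesis
      proof cases
        case 1 then show ?thesis using E(3)[of l] unfolding Qo by simp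
      next
        case 2 then show ?thesis using syzygy_incl[of d] unfolding Qo by simp
      next
        case 3
        have "bd Q l = (\<lambda>x i. \<zero>)" using 3 unfolding Qo by simp
        then show ?thesis using z0[OF 3] by simp
      qed
    qed
    show "aug Q \<in> rmod_hom A (obj Q 0) M" "aug Q ` carrier (obj Q 0) = carrier M"
      using E(4,5) unfolding Qo by simp_all
    show "bd Q 0 ` carrier (obj Q 1) = {x \<in> carrier (obj Q 0). aug Q x = \<zero>\<^bsub>M\<^esub>}"
    proof (cases "d = 0")
      case True
      then have "bd Q 0 ` carrier (obj Q 1) = carrier (syzygy M 0)" unfolding Qo by simp
      then show ?thesis unfolding syzygy_simps(1) Qo by simp
    next
      case False
      then show ?thesis using E(6) unfolding Qo by simp
    qed
    show "bd Q (Suc l) ` carrier (obj Q (Suc (Suc l))) = {x \<in> carrier (obj Q (Suc l)). bd Q l x = \<zero>\<^bsub>obj Q l\<^esub>}" for l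
    proof -
      consider "Suc l < d" | "Suc l = d" | "l = d" | "l > d" by linarith
      then show ?thesis
      proof cases
        case 1 then show ?thesis using E(7)[of l] unfolding Qo by simp
      next
        case 2
        then have "bd Q (Suc l) ` carrier (obj Q (Suc (Suc l))) = carrier (syzygy M (Suc l))" unfolding Qo by simp
        then show ?thesis using 2 unfolding syzygy_simps(2) Qo by simp
      next
        case 3
        have "bd Q (Suc l) ` carrier (obj Q (Suc (Suc l))) = {\<lambda>i. \<zero>}" using 3 Z0 unfolding Qo by simp
        moreover have "{x \<in> carrier (obj Q (Suc l)). bd Q l x = \<zero>\<^bsub>obj Q l\<^esub>} = {x \<in> carrier (syzygy M d). x = (\<lambda>i. \<zero>)}"
          using 3 unfolding Qo by simp
        ultimately show ?thesis using vs_zero[OF right_moduleD(1)[OF syzygy(1)], of d] zs by auto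
      next
        case 4
        have "bd Q (Suc l) ` carrier (obj Q (Suc (Suc l))) = {\<lambda>i. \<zero>}" using 4 Z0 unfolding Qo by simp
        moreover have "\<zero>\<^bsub>obj Q l\<^esub> = (\<lambda>i. \<zero>)" using 4 zs Z0 by (simp add: Qo)
        then have "{x \<in> carrier (obj Q (Suc l)). bd Q l x = \<zero>\<^bsub>obj Q l\<^esub>} = carrier Z" using 4 unfolding Qo by simp
        ultimately show ?thesis using Z0 by simp
      qed
    qed
  qed
  have db: "\<exists>(m::nat) S q. dual_basis (obj Q l) {..<m} S q" for l
  proof -
    consider "l \<le> d" | "l = Suc d" | "l > Suc d" by linarith
    then show ?thesis
    proof cases
      case 1 then show ?thesis using dual_basis_free[of "{..<free_rank M l}"] unfolding Qo by auto
    next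
      case 2
      have "dual_basis (syzygy M d) {..<free_rank M d} (\<lambda>x. x) (\<lambda>i. \<rho> (unit_vec i))"
        by (rule dual_basis_retract[OF dual_basis_free syzygy(1) syzygy_incl[unfolded free_res_simps]
            r(1)[unfolded free_res_simps]]) (rule r(2))
      then show ?thesis using 2 unfolding Qo by auto
    next
      case 3
      have "dual_basis Z {..<0::nat} (\<lambda>_ _. \<zero>) (\<lambda>_. \<zero>\<^bsub>Z\<^esub>)" using dual_basis_zero[OF Z Z0(1)] by simp
      then have "\<exists>(m::nat) S q. dual_basis Z {..<m} S q" by blast
      then show ?thesis using 3 unfolding Qo by simp
    qed
  qed
  have "zero_space (obj Q l)" if "l > Suc d" for l using that Z0 unfolding Qo by simp
  then show ?thesis using ex db by blast
qed

end

end

section \<open>Cartan matrix\<close>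

text \<open>For an idempotent \<open>u\<close> this is a copy of \<open>Hom(u A, X)\<close>; passing
  from \<open>X\<close> to \<open>X u\<close> preserves the exactness of resolutions.\<close>

abbreviation corner :: "('k::field, 'v, 'a, 'z) rmod_scheme \<Rightarrow> 'a \<Rightarrow> ('k, 'v, 'a, 'z) rmod_scheme" where
  "corner X u \<equiv> X\<lparr>carrier := {ract X x u | x. x \<in> carrier X}\<rparr>"

context fin_alg
begin

lemma corner_fixed:
  assumes "right_module A X" "u \<in> carrier A" "u \<otimes> u = u" "x \<in> carrier (corner X u)"
  shows "x \<in> carrier X" "ract X x u = x"
proof -
  note XD = right_moduleD[OF assms(1)]
  obtain z where z: "z \<in> carrier X" "x = ract X z u" using assms(4) by auto
  then show "x \<in> carrier X" using XD(2) assms(2) by simp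
  show "ract X x u = x" using XD(7)[OF z(1) assms(2,2)] assms(3) z(2) by simp
qed

lemma corner_memI:
  assumes "x \<in> carrier X" "ract X x u = x"
  shows "x \<in> carrier (corner X u)"
proof -
  have "\<exists>z. x = ract X z u \<and> z \<in> carrier X" by (rule exI[of _ x]) (use assms in simp)
  then show ?thesis by simp
qed

lemma corner_vsp:
  assumes "right_module A X" "u \<in> carrier A"
  shows "vsp (corner X u)" "fd X \<Longrightarrow> fd (corner X u)" "subsp X (carrier (corner X u))"
  using vsp_subsp[OF right_moduleD(1)[OF assms(1)] subsp_ract_image[OF assms]]
    fd_subsp[OF right_moduleD(1)[OF assms(1)] _ subsp_ract_image[OF assms]] subsp_ract_image[OF assms] by simp_all

lemma corner_hom:
  assumes X: "right_module A X" and Y: "right_module A Y" and u: "u \<in> carrier A" and f: "f \<in> rmod_hom A X Y"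
  shows "f \<in> lin (corner X u) (corner Y u)"
  by (rule lin_restrict[OF rmod_hom_lin[OF X Y f]])
     (use right_moduleD(2)[OF X] rmod_homD[OF f] u in auto)

lemma lin_trace_corner_right:
  assumes X: "right_module A X" "fd X" and u: "u \<in> carrier A" "u \<otimes> u = u" and f: "f \<in> rmod_hom A X X"
  shows "lin_trace (corner X u) f = lin_trace X (\<lambda>x. f (ract X x u))"
proof -
  note XD = right_moduleD[OF X(1)] and fD = rmod_homD[OF f]
  have "lin_trace (corner X u) f = lin_trace X (\<lambda>x. ract X (f x) u)"
  proof (rule lin_trace_idempotent_image[OF XD(1) X(2) lin_ract[OF X(1) u(1)] rmod_hom_lin[OF X(1,1) f]])
    show "ract X (f (ract X x u)) u = f (ract X x u)" if "x \<in> carrier X" for x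
      using that XD(2) XD(7)[of "f x" u u] fD u by simp
  qed auto
  also have "\<dots> = lin_trace X (\<lambda>x. f (ract X x u))"
    by (rule lin_trace_cong[OF XD(1) X(2) lin_comp[OF rmod_hom_lin[OF X(1,1) f] lin_ract[OF X(1) u(1)]]])
       (use fD(3) u in simp)
  finally show ?thesis .
qed

text \<open>The cycles of the resolution cut by \<open>u\<close>, where the augmentation serves as
  the differential in degree 0.\<close>

definition cyc :: "('k, 'p, 'a, 'm) resolution \<Rightarrow> ('k, 'm, 'a, 'z) rmod_scheme \<Rightarrow> 'a \<Rightarrow> nat \<Rightarrow> 'p set" where
  "cyc Q M u l = {x \<in> carrier (corner (obj Q l) u). case l of 0 \<Rightarrow> aug Q x = \<zero>\<^bsub>M\<^esub> | Suc k \<Rightarrow> bd Q k x = \<zero>\<^bsub>obj Q k\<^esub>}"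

context
  fixes M :: "('k, 'm, 'a, 'z) rmod_scheme" and Q :: "('k, 'p, 'a, 'm) resolution" and u L
  assumes Q: "exact_res M Q" and u: "u \<in> carrier A" "u \<otimes> u = u"
    and fdQ: "\<And>l. fd (obj Q l)" and L: "zero_space (obj Q (Suc L))"
begin

private lemmas E = exact_resD[OF Q]

lemma subsp_cyc: "subsp (obj Q l) (cyc Q M u l)" "subsp (corner (obj Q l) u) (cyc Q M u l)"
proof -
  have "subsp (corner (obj Q l) u) (cyc Q M u l)"
  proof (cases l)
    case 0
    show ?thesis unfolding 0 cyc_def nat.case
      using subsp_ker[OF corner_vsp(1)[OF E(2) u(1)] corner_vsp(1)[OF E(1) u(1)] corner_hom[OF E(2,1) u(1) E(4)]] by simp
  next
    case (Suc k)
    show ?thesis unfolding Suc cyc_def nat.case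
      using subsp_ker[OF corner_vsp(1)[OF E(2) u(1)] corner_vsp(1)[OF E(2) u(1)] corner_hom[OF E(2,2) u(1) E(3)]] by simp
  qed
  then show "subsp (corner (obj Q l) u) (cyc Q M u l)" .
  note s = subspD[OF this]
  have "x \<in> carrier (obj Q l)" if "x \<in> cyc Q M u l" for x
    using that by (intro corner_fixed(1)[OF E(2) u]) (simp add: cyc_def)
  then show "subsp (obj Q l) (cyc Q M u l)" using s(2-4) by (intro subspI subsetI) simp_all
qed

text \<open>Surjectivity survives the passage to \<open>X u\<close>: a preimage \<open>x\<close> of
  an element with \<open>y = y u\<close> may be replaced by \<open>x u\<close>.\<close>

lemma corner_exact_aug:
  "aug Q \<in> lin (corner (obj Q 0) u) (corner M u)" "aug Q ` carrier (corner (obj Q 0) u) = carrier (corner M u)"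
  "{x \<in> carrier (corner (obj Q 0) u). aug Q x = \<zero>\<^bsub>corner M u\<^esub>} = cyc Q M u 0"
proof -
  show l: "aug Q \<in> lin (corner (obj Q 0) u) (corner M u)" by (rule corner_hom[OF E(2,1) u(1) E(4)])
  show "aug Q ` carrier (corner (obj Q 0) u) = carrier (corner M u)"
  proof (intro equalityI subsetI)
    fix y assume y: "y \<in> carrier (corner M u)"
    note yM = corner_fixed[OF E(1) u y]
    then obtain x where x: "x \<in> carrier (obj Q 0)" "y = aug Q x" using E(5) by blast
    have "y = aug Q (ract (obj Q 0) x u)" using rmod_homD(3)[OF E(4) x(1) u(1)] yM(2) x(2) by simp
    moreover have "ract (obj Q 0) x u \<in> carrier (corner (obj Q 0) u)" using x by auto
    ultimately show "y \<in> aug Q ` carrier (corner (obj Q 0) u)" by (rule image_eqI)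
  qed (use lin_closed[OF l] in auto)
  show "{x \<in> carrier (corner (obj Q 0) u). aug Q x = \<zero>\<^bsub>corner M u\<^esub>} = cyc Q M u 0" by (simp add: cyc_def)
qed

lemma corner_exact_bd:
  defines "K \<equiv> \<lambda>l. (obj Q l)\<lparr>carrier := cyc Q M u l\<rparr>"
  shows "bd Q l \<in> lin (corner (obj Q (Suc l)) u) (K l)" "bd Q l ` carrier (corner (obj Q (Suc l)) u) = carrier (K l)"
  "{x \<in> carrier (corner (obj Q (Suc l)) u). bd Q l x = \<zero>\<^bsub>K l\<^esub>} = cyc Q M u (Suc l)"
proof -
  have im: "bd Q l ` carrier (corner (obj Q (Suc l)) u) = cyc Q M u l"
  proof (intro equalityI subsetI)
    fix y assume "y \<in> bd Q l ` carrier (corner (obj Q (Suc l)) u)"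
    then obtain x where x: "x \<in> carrier (corner (obj Q (Suc l)) u)" "y = bd Q l x" by blast
    note xc = corner_fixed(1)[OF E(2) u x(1)]
    have "y \<in> carrier (corner (obj Q l) u)" unfolding x(2) by (rule lin_closed[OF corner_hom[OF E(2,2) u(1) E(3)] x(1)])
    then show "y \<in> cyc Q M u l" unfolding cyc_def using E(8)[of y] E(9) xc x(2) E(8) by (cases l) auto
  next
    fix y assume y: "y \<in> cyc Q M u l"
    then have yc: "y \<in> carrier (corner (obj Q l) u)" by (simp add: cyc_def)
    note yM = corner_fixed[OF E(2) u yc]
    have "y \<in> bd Q l ` carrier (obj Q (Suc l))"
      using y yM(1) E(6) E(7) unfolding cyc_def by (cases l) auto
    then obtain x where x: "x \<in> carrier (obj Q (Suc l))" "y = bd Q l x" by blast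
    have "y = bd Q l (ract (obj Q (Suc l)) x u)" using rmod_homD(3)[OF E(3) x(1) u(1)] yM(2) x(2) by simp
    moreover have "ract (obj Q (Suc l)) x u \<in> carrier (corner (obj Q (Suc l)) u)" using x by auto
    ultimately show "y \<in> bd Q l ` carrier (corner (obj Q (Suc l)) u)" by (rule image_eqI)
  qed
  then show "bd Q l ` carrier (corner (obj Q (Suc l)) u) = carrier (K l)" by (simp add: K_def)
  show "bd Q l \<in> lin (corner (obj Q (Suc l)) u) (K l)" unfolding K_def
    by (rule lin_restrict[OF E(12) subspD(1)[OF corner_vsp(3)[OF E(2) u(1)], simplified]]) (use im in simp)
  show "{x \<in> carrier (corner (obj Q (Suc l)) u). bd Q l x = \<zero>\<^bsub>K l\<^esub>} = cyc Q M u (Suc l)"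
    by (simp add: cyc_def K_def)
qed

text \<open>Cycles in degree \<open>L\<close> are images from degree \<open>Suc L\<close>, where the
  resolution is zero.\<close>

lemma cyc_top: "cyc Q M u L = {\<zero>\<^bsub>obj Q L\<^esub>}"
proof -
  have "carrier (corner (obj Q (Suc L)) u) \<subseteq> {\<zero>\<^bsub>obj Q (Suc L)\<^esub>}" using corner_fixed(1)[OF E(2) u] L by blast
  then have "bd Q L ` carrier (corner (obj Q (Suc L)) u) \<subseteq> bd Q L ` {\<zero>\<^bsub>obj Q (Suc L)\<^esub>}" by (rule image_mono)
  then have "cyc Q M u L \<subseteq> {bd Q L \<zero>\<^bsub>obj Q (Suc L)\<^esub>}"
    unfolding corner_exact_bd(2)[of L] by simp
  then have "cyc Q M u L \<subseteq> {\<zero>\<^bsub>obj Q L\<^esub>}" using lin_zero[OF E(11,11,12)] by simp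
  then show ?thesis using subspD(2)[OF subsp_cyc(1)] by blast
qed

lemma resolution_vdim:
  "(\<Sum>l\<le>L. (- 1) ^ l * int (vdim (corner (obj Q l) u))) = int (vdim (corner M u))"
proof -
  \<comment> \<open>Shifted by one: \<open>b (Suc k)\<close> belongs to the cycles in degree
    \<open>k\<close>, and \<open>b 0\<close> to the resolved module. Then term \<open>l\<close> is
    an extension of the space of \<open>b l\<close> by that of \<open>b (Suc l)\<close>.\<close>
  define b where "b l = (case l of 0 \<Rightarrow> int (vdim (corner M u)) | Suc k \<Rightarrow> int (vdim ((obj Q k)\<lparr>carrier := cyc Q M u k\<rparr>)))" for l
  note vq = corner_vsp(1)[OF E(2) u(1)] corner_vsp(2)[OF E(2) u(1) fdQ]
  have "int (vdim (corner (obj Q l) u)) = b l + b (Suc l)" for l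
  proof (cases l)
    case 0
    show ?thesis using vdim_kernel[OF vq corner_vsp(1)[OF E(1) u(1)] corner_exact_aug(1,2)]
      unfolding corner_exact_aug(3) by (simp add: b_def 0)
  next
    case (Suc k)
    show ?thesis using vdim_kernel[OF vq vsp_subsp[OF E(11) subsp_cyc(1)] corner_exact_bd(1,2)[of k]]
      unfolding corner_exact_bd(3) by (simp add: b_def Suc)
  qed
  then have "(\<Sum>l\<le>L. (- 1) ^ l * int (vdim (corner (obj Q l) u))) = b 0 + (- 1) ^ L * b (Suc L)"
    by (intro alternating_telescope)
  moreover have "b (Suc L) = 0"
    using vdim_0(1)[OF vsp_subsp[OF E(11) subsp_cyc(1), of L]] cyc_top by (simp add: b_def)
  ultimately show ?thesis by (simp add: b_def)
qed

text \<open>The same telescoping as for dimensions, with the trace additive along the short exact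
  sequences of cycles; the lift of \<open>\<phi>\<close> respects these sequences.\<close>

lemma resolution_trace:
  assumes \<Phi>: "chain_map Q Q \<phi> \<Phi>" and \<phi>: "\<phi> \<in> rmod_hom A M M"
  shows "(\<Sum>l\<le>L. (- 1) ^ l * lin_trace (corner (obj Q l) u) (\<Phi> l)) = lin_trace (corner M u) \<phi>"
proof -
  note C = chain_mapD[OF \<Phi>]
  define b where "b l = (case l of 0 \<Rightarrow> lin_trace (corner M u) \<phi> | Suc k \<Rightarrow> lin_trace ((obj Q k)\<lparr>carrier := cyc Q M u k\<rparr>) (\<Phi> k))" for l
  note vq = corner_vsp(1)[OF E(2) u(1)] corner_vsp(2)[OF E(2) u(1) fdQ]
  have ch: "\<Phi> l \<in> lin (corner (obj Q l) u) (corner (obj Q l) u)" for l by (rule corner_hom[OF E(2,2) u(1) C(1)])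
  have cycle: "\<Phi> l x \<in> cyc Q M u l" if x: "x \<in> cyc Q M u l" for l x
  proof -
    have xc: "x \<in> carrier (corner (obj Q l) u)" using x by (simp add: cyc_def)
    note xo = corner_fixed(1)[OF E(2) u xc]
    have c: "\<Phi> l x \<in> carrier (corner (obj Q l) u)" by (rule lin_closed[OF ch xc])
    show ?thesis
    proof (cases l)
      case 0
      then have "aug Q (\<Phi> 0 x) = \<phi> \<zero>\<^bsub>M\<^esub>" using C(2)[of x] xo x by (simp add: cyc_def)
      then show ?thesis using 0 c lin_zero[OF E(10,10) rmod_hom_lin[OF E(1,1) \<phi>]] by (simp add: cyc_def)
    next
      case (Suc k)
      then have "bd Q k (\<Phi> (Suc k) x) = \<Phi> k \<zero>\<^bsub>obj Q k\<^esub>" using C(3)[of x k] xo x by (simp add: cyc_def)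
      then show ?thesis using Suc c lin_zero[OF E(11,11) rmod_hom_lin[OF E(2,2) C(1)]] by (simp add: cyc_def)
    qed
  qed
  have "lin_trace (corner (obj Q l) u) (\<Phi> l) = b l + b (Suc l)" for l
  proof (cases l)
    case 0
    have "lin_trace (corner (obj Q 0) u) (\<Phi> 0) =
       lin_trace ((corner (obj Q 0) u)\<lparr>carrier := {x \<in> carrier (corner (obj Q 0) u). aug Q x = \<zero>\<^bsub>corner M u\<^esub>}\<rparr>) (\<Phi> 0)
         + lin_trace (corner M u) \<phi>"
      by (rule lin_trace_exact[OF vq corner_vsp(1)[OF E(1) u(1)] corner_exact_aug(1,2) ch corner_hom[OF E(1,1) u(1) \<phi>]])
         (rule C(2)[OF corner_fixed(1)[OF E(2) u]])
    then show ?thesis unfolding corner_exact_aug(3) by (simp add: b_def 0)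
  next
    case (Suc k)
    let ?K = "(obj Q k)\<lparr>carrier := cyc Q M u k\<rparr>"
    have cK: "\<Phi> k \<in> lin ?K ?K"
      by (rule lin_restrict[OF rmod_hom_lin[OF E(2,2) C(1)] subspD(1)[OF subsp_cyc(1)]]) (use cycle in auto)
    have "lin_trace (corner (obj Q (Suc k)) u) (\<Phi> (Suc k)) =
       lin_trace ((corner (obj Q (Suc k)) u)\<lparr>carrier := {x \<in> carrier (corner (obj Q (Suc k)) u). bd Q k x = \<zero>\<^bsub>?K\<^esub>}\<rparr>) (\<Phi> (Suc k))
         + lin_trace ?K (\<Phi> k)"
      by (rule lin_trace_exact[OF vq vsp_subsp[OF E(11) subsp_cyc(1)] corner_exact_bd(1,2)[of k] ch cK])
         (rule C(3)[OF corner_fixed(1)[OF E(2) u]])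
    then show ?thesis unfolding corner_exact_bd(3) by (simp add: b_def Suc)
  qed
  then have "(\<Sum>l\<le>L. (- 1) ^ l * lin_trace (corner (obj Q l) u) (\<Phi> l)) = b 0 + (- 1) ^ L * b (Suc L)"
    by (intro alternating_telescope)
  moreover have "b (Suc L) = 0"
  proof -
    have "lin_trace ((obj Q L)\<lparr>carrier := cyc Q M u L\<rparr>) (\<Phi> L) = 0"
    proof (rule lin_trace_zero)
      show "vsp ((obj Q L)\<lparr>carrier := cyc Q M u L\<rparr>)" "fd ((obj Q L)\<lparr>carrier := cyc Q M u L\<rparr>)"
        by (rule vsp_subsp[OF E(11) subsp_cyc(1)], rule fd_subsp[OF E(11) fdQ subsp_cyc(1)])
      show "\<Phi> L x = \<zero>\<^bsub>(obj Q L)\<lparr>carrier := cyc Q M u L\<rparr>\<^esub>" if "x \<in> carrier ((obj Q L)\<lparr>carrier := cyc Q M u L\<rparr>)" for x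
        using cycle[of x L] that cyc_top by simp
    qed
    then show ?thesis by (simp add: b_def)
  qed
  ultimately show ?thesis by (simp add: b_def)
qed

end

end

section \<open>Left ideals filtered by one-dimensional factors, and the Cartan matrix\<close>

context elem_alg
begin

definition left_ideal :: "'a set \<Rightarrow> bool" where
  "left_ideal N \<longleftrightarrow> subsp A N \<and> (\<forall>a\<in>carrier A. \<forall>y\<in>N. a \<otimes> y \<in> N)"

lemma left_ideal_add:
  assumes N: "left_ideal N" and x: "x \<in> carrier A"
  shows "left_ideal {y \<oplus> a \<otimes> x | y a. y \<in> N \<and> a \<in> carrier A}" (is "left_ideal ?L")
    "N \<subseteq> {y \<oplus> a \<otimes> x | y a. y \<in> N \<and> a \<in> carrier A}" "x \<in> {y \<oplus> a \<otimes> x | y a. y \<in> N \<and> a \<in> carrier A}"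
proof -
  have Ns: "subsp A N" and Nl: "\<And>a y. a \<in> carrier A \<Longrightarrow> y \<in> N \<Longrightarrow> a \<otimes> y \<in> N" using N by (auto simp: left_ideal_def)
  note ND = subspD[OF Ns]
  have Nc: "y \<in> carrier A" if "y \<in> N" for y using that ND(1) by auto
  have I: "z \<in> ?L" if "z = y \<oplus> a \<otimes> x" "y \<in> N" "a \<in> carrier A" for z y a using that by blast
  show sub: "N \<subseteq> ?L"
  proof
    fix y assume "y \<in> N"
    then show "y \<in> ?L" by (intro I[of y y \<zero>]) (use Nc x in simp_all)
  qed
  show "x \<in> ?L" by (rule I[of x \<zero> \<one>]) (use ND(2) x in simp_all)
  have "subsp A ?L"
  proof (rule subspI)
    show "?L \<subseteq> carrier A" using Nc x by auto
    show "\<zero> \<in> ?L" using sub ND(2) by blast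
    show "v \<oplus> w \<in> ?L" if vw: "v \<in> ?L" "w \<in> ?L" for v w
    proof -
      obtain y a z b where *: "v = y \<oplus> a \<otimes> x" "w = z \<oplus> b \<otimes> x" "y \<in> N" "z \<in> N" "a \<in> carrier A" "b \<in> carrier A"
        using vw by blast
      show ?thesis by (rule I[of _ "y \<oplus> z" "a \<oplus> b"]) (use * Nc x ND(3) in \<open>simp_all add: l_distr a_ac\<close>)
    qed
    show "c \<odot> v \<in> ?L" if v: "v \<in> ?L" for c v
    proof -
      obtain y a where *: "v = y \<oplus> a \<otimes> x" "y \<in> N" "a \<in> carrier A" using v by blast
      show ?thesis by (rule I[of _ "c \<odot> y" "c \<odot> a"]) (use * Nc x ND(4) in \<open>simp_all add: vs_smult_r_distr[OF vspA] smult_mult\<close>)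
    qed
  qed
  moreover have "b \<otimes> v \<in> ?L" if b: "b \<in> carrier A" and v: "v \<in> ?L" for b v
  proof -
    obtain y a where *: "v = y \<oplus> a \<otimes> x" "y \<in> N" "a \<in> carrier A" using v by blast
    show ?thesis by (rule I[of _ "b \<otimes> y" "b \<otimes> a"]) (use * Nc x b Nl in \<open>simp_all add: r_distr m_assoc\<close>)
  qed
  ultimately show "left_ideal ?L" by (simp add: left_ideal_def)
qed

text \<open>The maximal left subideals have codimension one, because the simple modules of an elementary
  algebra are one-dimensional.\<close>
lemma left_ideal_step:
  assumes N: "left_ideal N" and nz: "N \<noteq> {\<zero>}"
  obtains N' j \<xi> where "left_ideal N'" "N' \<subseteq> N" "N' \<noteq> N" "j < n" "\<xi> \<in> lin (A\<lparr>carrier := N\<rparr>) kmod"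
    "\<And>z. z \<in> N \<Longrightarrow> \<xi> z = 0 \<longleftrightarrow> z \<in> N'" "\<exists>z\<in>N. \<xi> z = 1"
    "\<And>a z. a \<in> carrier A \<Longrightarrow> z \<in> N \<Longrightarrow> \<xi> (a \<otimes> z) = chi j a * \<xi> z"
proof -
  have Ns: "subsp A N" and Nl: "\<And>a y. a \<in> carrier A \<Longrightarrow> y \<in> N \<Longrightarrow> a \<otimes> y \<in> N" using N by (auto simp: left_ideal_def)
  note ND = subspD[OF Ns]
  have Nc: "y \<in> carrier A" if "y \<in> N" for y using that ND(1) by auto
  let ?P = "\<lambda>K. left_ideal K \<and> K \<subseteq> N \<and> K \<noteq> N"
  have "?P {\<zero>}" using ND(2) nz by (auto simp: left_ideal_def subsp_def)
  moreover have "\<forall>K. ?P K \<longrightarrow> vdim (A\<lparr>carrier := K\<rparr>) < Suc (vdim A)"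
    using vdim_subsp_eq(1)[OF vspA fdA] by (auto simp: left_ideal_def less_Suc_eq_le)
  \<comment> \<open>A proper left subideal of largest dimension, hence a maximal one.\<close>
  ultimately obtain N' where N': "?P N'" and mx: "\<And>K. ?P K \<Longrightarrow> vdim (A\<lparr>carrier := K\<rparr>) \<le> vdim (A\<lparr>carrier := N'\<rparr>)"
    using ex_has_greatest_nat[of ?P "{\<zero>}" "\<lambda>K. vdim (A\<lparr>carrier := K\<rparr>)" "Suc (vdim A)"] by blast
  have N's: "subsp A N'" and N'l: "\<And>a y. a \<in> carrier A \<Longrightarrow> y \<in> N' \<Longrightarrow> a \<otimes> y \<in> N'" using N' by (auto simp: left_ideal_def)
  note N'D = subspD[OF N's]
  have N'c: "y \<in> carrier A" if "y \<in> N'" for y using that N'D(1) by auto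
  have N'minus: "y \<ominus> z \<in> N'" if "y \<in> N'" "z \<in> N'" for y z
    using N'D(3)[OF that(1) N'D(4)[OF that(2), of "- 1"]] vs_minus_eq[OF vspA N'c[OF that(1)] N'c[OF that(2)]] by simp
  have gen: "\<exists>y\<in>N'. \<exists>a\<in>carrier A. z = y \<oplus> a \<otimes> x" if x: "x \<in> N" "x \<notin> N'" and z: "z \<in> N" for x z
  proof -
    let ?L = "{y \<oplus> a \<otimes> x | y a. y \<in> N' \<and> a \<in> carrier A}"
    note La = left_ideal_add[OF conjunct1[OF N'] Nc[OF x(1)]]
    have LN: "?L \<subseteq> N" using N' ND(3) Nl x(1) by blast
    have "?L = N"
    proof (rule ccontr)
      assume "?L \<noteq> N"
      then have "vdim (A\<lparr>carrier := ?L\<rparr>) \<le> vdim (A\<lparr>carrier := N'\<rparr>)" using mx La(1) LN by blast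
      moreover have sL: "subsp A ?L" using La(1) by (simp add: left_ideal_def)
      ultimately have "N' = ?L"
        using vdim_subsp_mono[OF vspA fdA N's sL La(2)] by linarith
      then show False using La(3) x(2) by blast
    qed
    then have "z \<in> ?L" using z by simp
    then show ?thesis by blast
  qed
  obtain x0 where x0: "x0 \<in> N" "x0 \<notin> N'" using N' by blast
  \<comment> \<open>The \<open>e j\<close> sum to the unit, so one of them keeps \<open>x0\<close>
    outside \<open>N'\<close>. The index \<open>j\<close> found here names the simple factor
    \<open>N/N'\<close>.\<close>
  have "\<exists>j<n. e j \<otimes> x0 \<notin> N'"
  proof (rule ccontr)
    assume *: "\<not> (\<exists>j<n. e j \<otimes> x0 \<notin> N')"
    have "x0 = finsum A (\<lambda>i. e i) {..<n} \<otimes> x0" using Nc[OF x0(1)] by (simp add: e_sum)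
    also have "\<dots> = finsum A (\<lambda>i. e i \<otimes> x0) {..<n}" using Nc[OF x0(1)] by (intro finsum_ldistr) auto
    also have "\<dots> \<in> N'" by (rule subsp_finsum[OF vspA N's]) (use * in auto)
    finally show False using x0(2) by simp
  qed
  then obtain j where j: "j < n" "e j \<otimes> x0 \<notin> N'" by blast
  define x where "x = e j \<otimes> x0"
  have xN: "x \<in> N" unfolding x_def by (rule Nl) (use j x0 in auto)
  have x: "x \<in> carrier A" "x \<notin> N'" "e j \<otimes> x = x"
    using Nc[OF xN] j e_idem[OF j(1)] Nc[OF x0(1)] by (simp_all add: x_def m_assoc[symmetric])
  \<comment> \<open>If \<open>a x\<close> were outside \<open>N'\<close>, maximality would give
    \<open>x = b a x\<close> modulo \<open>N'\<close>, hence \<open>x = w x\<close> modulo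
    \<open>N'\<close> with \<open>w = e_j b a e_j\<close>. The character kills \<open>w\<close>, so
    \<open>w\<close> is nilpotent, and iteration puts \<open>x\<close> into \<open>N'\<close>. Thus
    \<open>A\<close> acts on the class of \<open>x\<close> through \<open>chi j\<close>.\<close>
  have kill: "a \<otimes> x \<in> N'" if a: "a \<in> carrier A" "chi j a = 0" for a
  proof (rule ccontr)
    assume n: "a \<otimes> x \<notin> N'"
    obtain y b where yb: "y \<in> N'" "b \<in> carrier A" "x = y \<oplus> b \<otimes> (a \<otimes> x)" using gen[OF Nl[OF a(1) xN] n xN] by blast
    define w where "w = e j \<otimes> (b \<otimes> a) \<otimes> e j"
    have wc: "w \<in> carrier A" using yb a j by (simp add: w_def)
    have "chi j w = 0" unfolding w_def using chi_mult[OF j(1)] yb a j by simp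
    moreover have "e j \<otimes> w = w" "w \<otimes> e j = w"
      using yb a j e_idem[OF j(1)] by (simp_all add: w_def m_assoc) (simp_all add: m_assoc[symmetric])
    ultimately obtain r where r: "w [^] (r::nat) = \<zero>" using corner_nilpotent[OF j(1) wc] by blast
    have "e j \<otimes> x = e j \<otimes> (y \<oplus> b \<otimes> (a \<otimes> x))" by (rule arg_cong[OF yb(3)])
    also have "\<dots> = e j \<otimes> y \<oplus> e j \<otimes> (b \<otimes> (a \<otimes> x))"
      using yb(2) N'c[OF yb(1)] a j(1) x(1) by (simp add: r_distr)
    also have "\<dots> = e j \<otimes> y \<oplus> w \<otimes> x"
      using yb(2) a j(1) x(1,3) by (simp add: w_def m_assoc)
    finally have xw: "x = e j \<otimes> y \<oplus> w \<otimes> x" using x(3) by simp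
    have ey: "e j \<otimes> y \<in> N'" using N'l yb j by simp
    have "\<exists>v\<in>N'. x = v \<oplus> w [^] k \<otimes> x" for k :: nat
    proof (induction k)
      case 0
      show ?case by (rule bexI[of _ \<zero>]) (use x N'D in simp_all)
    next
      case (Suc k)
      then obtain v where v: "v \<in> N'" "x = v \<oplus> w [^] k \<otimes> x" by blast
      have "w [^] k \<otimes> x = w [^] k \<otimes> (e j \<otimes> y \<oplus> w \<otimes> x)" using xw by simp
      also have "\<dots> = w [^] k \<otimes> (e j \<otimes> y) \<oplus> w [^] Suc k \<otimes> x"
        using N'c[OF ey] wc x by (simp add: r_distr m_assoc)
      finally have "v \<oplus> w [^] k \<otimes> x = v \<oplus> (w [^] k \<otimes> (e j \<otimes> y) \<oplus> w [^] Suc k \<otimes> x)" by simp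
      then have "x = (v \<oplus> w [^] k \<otimes> (e j \<otimes> y)) \<oplus> w [^] Suc k \<otimes> x"
        using v(2) N'c[OF v(1)] N'c[OF ey] wc x by (simp add: a_assoc)
      moreover have "v \<oplus> w [^] k \<otimes> (e j \<otimes> y) \<in> N'" using N'D(3)[OF v(1) N'l[OF _ ey]] wc by simp
      ultimately show ?case by blast
    qed
    from this[of r] have "x \<in> N'" unfolding r using N'c x by auto
    then show False using x(2) by simp
  qed
  have ax: "a \<otimes> x \<ominus> chi j a \<odot> x \<in> N'" if a: "a \<in> carrier A" for a
  proof -
    have "chi j (a \<oplus> (- chi j a) \<odot> \<one>) = 0"
      using lin_add[OF chi_lin[OF j(1)]] lin_smult[OF chi_lin[OF j(1)]] a chi_one[OF j(1)] by simp
    then have "(a \<oplus> (- chi j a) \<odot> \<one>) \<otimes> x \<in> N'" using a by (intro kill) simp_all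
    moreover have "(a \<oplus> (- chi j a) \<odot> \<one>) \<otimes> x = a \<otimes> x \<ominus> chi j a \<odot> x"
      using a x vs_minus_eq[OF vspA] vs_smult_smult[OF vspA, of x "- 1" "chi j a"] by (simp add: l_distr smult_mult)
    ultimately show ?thesis by simp
  qed
  have ex: "\<exists>c. z \<ominus> c \<odot> x \<in> N'" if z: "z \<in> N" for z
  proof -
    obtain y a where ya: "y \<in> N'" "a \<in> carrier A" "z = y \<oplus> a \<otimes> x" using gen[OF xN x(2) z] by blast
    have "z \<ominus> chi j a \<odot> x = y \<oplus> (a \<otimes> x \<ominus> chi j a \<odot> x)"
      using ya N'c[OF ya(1)] x by (simp add: a_minus_def a_assoc)
    then have "z \<ominus> chi j a \<odot> x \<in> N'" using N'D(3)[OF ya(1) ax[OF ya(2)]] by simp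
    then show ?thesis by blast
  qed
  have un: "c = d" if z: "z \<in> carrier A" and cd: "z \<ominus> c \<odot> x \<in> N'" "z \<ominus> d \<odot> x \<in> N'" for z c d
  proof (rule ccontr)
    assume ne: "c \<noteq> d"
    have "(z \<ominus> c \<odot> x) \<ominus> (z \<ominus> d \<odot> x) = (d - c) \<odot> x"
    proof -
      have "(z \<ominus> c \<odot> x) \<ominus> (z \<ominus> d \<odot> x) = d \<odot> x \<ominus> c \<odot> x"
        using z x by (simp add: a_minus_def minus_add a_ac r_neg r_neg1 r_neg2)
      also have "\<dots> = (d - c) \<odot> x"
        using x vs_minus_eq[OF vspA] vs_smult_l_distr[OF vspA x(1), of d "- c"] vs_smult_smult[OF vspA x(1), of "- 1" c] by simp
      finally show ?thesis .
    qed
    then have "(d - c) \<odot> x \<in> N'" using N'minus[OF cd] by simp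
    then have "inverse (d - c) \<odot> ((d - c) \<odot> x) \<in> N'" by (rule N'D(4))
    then show False using x ne vs_smult_smult[OF vspA x(1), of "inverse (d - c)" "d - c"] by simp
  qed
  \<comment> \<open>The coordinate of \<open>z\<close> on the line \<open>N/N'\<close>, which is
    spanned by the class of \<open>x\<close>.\<close>
  define \<xi> where "\<xi> z = (SOME c. z \<ominus> c \<odot> x \<in> N')" for z
  have \<xi>1: "z \<ominus> \<xi> z \<odot> x \<in> N'" if "z \<in> N" for z unfolding \<xi>_def by (rule someI_ex[OF ex[OF that]])
  have \<xi>2: "\<xi> z = c" if "z \<in> N" "z \<ominus> c \<odot> x \<in> N'" for z c by (rule un[OF Nc[OF that(1)] \<xi>1[OF that(1)] that(2)])
  show thesis
  proof (rule that[of N' j \<xi>])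
    show "left_ideal N'" "N' \<subseteq> N" "N' \<noteq> N" "j < n" using N' j by auto
    show "\<xi> \<in> lin (A\<lparr>carrier := N\<rparr>) kmod"
    proof (rule linI)
      fix y z assume "y \<in> carrier (A\<lparr>carrier := N\<rparr>)" "z \<in> carrier (A\<lparr>carrier := N\<rparr>)"
      then have yz: "y \<in> N" "z \<in> N" by auto
      have "(y \<oplus> z) \<ominus> (\<xi> y + \<xi> z) \<odot> x = (y \<ominus> \<xi> y \<odot> x) \<oplus> (z \<ominus> \<xi> z \<odot> x)"
        using Nc[OF yz(1)] Nc[OF yz(2)] x by (simp add: vs_smult_l_distr[OF vspA] a_minus_def minus_add a_ac)
      then have "\<xi> (y \<oplus> z) = \<xi> y + \<xi> z"
        using N'D(3)[OF \<xi>1[OF yz(1)] \<xi>1[OF yz(2)]] ND(3)[OF yz] by (intro \<xi>2) simp_all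
      then show "\<xi> (y \<oplus>\<^bsub>A\<lparr>carrier := N\<rparr>\<^esub> z) = \<xi> y \<oplus>\<^bsub>kmod\<^esub> \<xi> z" by simp
    next
      fix c z assume "z \<in> carrier (A\<lparr>carrier := N\<rparr>)"
      then have z: "z \<in> N" by simp
      have "c \<odot> (z \<ominus> \<xi> z \<odot> x) = c \<odot> z \<ominus> (c * \<xi> z) \<odot> x"
        using lin_minus[OF vspA vspA lin_smult_map[OF vspA lin_id], of z "\<xi> z \<odot> x" c] Nc[OF z] x
        by (simp add: vs_smult_smult[OF vspA])
      then have "\<xi> (c \<odot> z) = c * \<xi> z" using N'D(4)[OF \<xi>1[OF z], of c] ND(4)[OF z] by (intro \<xi>2) simp_all
      then show "\<xi> (c \<odot>\<^bsub>A\<lparr>carrier := N\<rparr>\<^esub> z) = c \<odot>\<^bsub>kmod\<^esub> \<xi> z" by simp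
    qed simp
    have z0: "z \<ominus> 0 \<odot> x = z" if "z \<in> N" for z using Nc[OF that] x vs_minus_eq[OF vspA, of z \<zero>] by simp
    show "\<xi> z = 0 \<longleftrightarrow> z \<in> N'" if z: "z \<in> N" for z
      using \<xi>1[OF z] \<xi>2[OF z, of 0] z0[OF z] by auto
    show "\<exists>z\<in>N. \<xi> z = 1"
    proof (intro bexI[of _ x] \<xi>2 xN)
      have "x \<ominus> 1 \<odot> x = \<zero>" using vs_minus_self[OF vspA x(1)] by (simp only: vs_one_smult[OF vspA x(1)])
      then show "x \<ominus> 1 \<odot> x \<in> N'" using N'D(2) by simp
    qed
    show "\<xi> (a \<otimes> z) = chi j a * \<xi> z" if a: "a \<in> carrier A" and z: "z \<in> N" for a z
    proof (rule \<xi>2[OF Nl[OF a z]])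
      \<comment> \<open>The difference of \<open>a z\<close> and \<open>chi_j(a) \<xi>(z) x\<close>
        is \<open>a\<close> times \<open>z - \<xi>(z) x\<close> plus \<open>\<xi>(z)\<close> times
        \<open>a x - chi_j(a) x\<close>, and both terms are in \<open>N'\<close>.\<close>
      have "a \<otimes> (z \<ominus> \<xi> z \<odot> x) \<oplus> \<xi> z \<odot> (a \<otimes> x \<ominus> chi j a \<odot> x) \<in> N'"
        by (rule N'D(3)[OF N'l[OF a \<xi>1[OF z]] N'D(4)[OF ax[OF a]]])
      moreover have "\<xi> z \<odot> (a \<otimes> x \<ominus> chi j a \<odot> x) = \<xi> z \<odot> (a \<otimes> x) \<ominus> (chi j a * \<xi> z) \<odot> x"
        using lin_minus[OF vspA vspA lin_smult_map[OF vspA lin_id], of "a \<otimes> x" "chi j a \<odot> x" "\<xi> z"] a x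
        by (simp add: vs_smult_smult[OF vspA, symmetric] mult.commute)
      moreover have "a \<otimes> (z \<ominus> \<xi> z \<odot> x) = a \<otimes> z \<ominus> \<xi> z \<odot> (a \<otimes> x)"
        using a Nc[OF z] x by (simp add: a_minus_def r_distr r_minus mult_smult)
      moreover have "(a \<otimes> z \<ominus> \<xi> z \<odot> (a \<otimes> x)) \<oplus> (\<xi> z \<odot> (a \<otimes> x) \<ominus> (chi j a * \<xi> z) \<odot> x) = a \<otimes> z \<ominus> (chi j a * \<xi> z) \<odot> x"
        using a Nc[OF z] x by (simp add: a_minus_def a_assoc l_neg r_neg1 r_neg2)
      ultimately show "a \<otimes> z \<ominus> (chi j a * \<xi> z) \<odot> x \<in> N'" by simp
    qed
  qed
qed

end

lemma vdim_kmod: "vdim (kmod :: ('k::field, 'k) module) = 1"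
proof -
  have "vectorspace.basis class_ring (kmod :: ('k, 'k) module) {1}"
  proof -
    interpret V: vectorspace class_ring "kmod :: ('k, 'k) module" by (rule vsp_kmod)
    show ?thesis
    proof (subst V.basis_criterion)
      show "\<forall>v. v \<in> carrier (kmod :: ('k, 'k) module) \<longrightarrow> (\<exists>!a. a \<in> {1} \<rightarrow>\<^sub>E carrier class_ring \<and> V.lincomb a {1} = v)"
      proof (intro allI impI)
        fix v :: 'k
        have l: "V.lincomb a {1} = a 1" for a :: "'k \<Rightarrow> 'k" by (simp add: V.lincomb_def)
        show "\<exists>!a. a \<in> {1} \<rightarrow>\<^sub>E carrier class_ring \<and> V.lincomb a {1} = v"
        proof (rule ex1I[of _ "\<lambda>x\<in>{1}. v"])
          fix a assume a: "a \<in> {1} \<rightarrow>\<^sub>E carrier class_ring \<and> V.lincomb a {1} = v"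
          then have "a \<in> extensional {1}" "a 1 = v" by (auto simp: l PiE_def)
          then show "a = (\<lambda>x\<in>{1}. v)" by (intro extensionalityI[of _ "{1}"]) auto
        qed (simp add: l)
      qed
    qed auto
  qed
  then show ?thesis using vectorspace.dim_basis[OF vsp_kmod, of "{1}"] by simp
qed

lemma fd_kmod: "fd kmod"
proof -
  have "frame kmod {()} (\<lambda>_. 1) (\<lambda>_ x. x)" by (simp add: frame_def)
  then show ?thesis by (rule frame_fd[OF vsp_kmod])
qed

text \<open>One space that holds tuples of every length, padded by zero, so that the rank of a
  projective need not enter a type.\<close>

definition kfun :: "('k::field, nat \<Rightarrow> 'k) module" where
  "kfun = \<lparr>carrier = UNIV, mult = undefined, one = undefined, zero = (\<lambda>_. 0), add = (\<lambda>f g i. f i + g i),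
     smult = (\<lambda>c f i. c * f i)\<rparr>"

lemma kfun_simps [simp]: "carrier kfun = UNIV" "zero kfun = (\<lambda>_. 0)" "add kfun = (\<lambda>f g i. f i + g i)"
  "smult kfun = (\<lambda>c f i. c * f i)"
  by (auto simp: kfun_def)

lemma vsp_kfun: "vsp kfun"
  by (rule vspI) (auto simp: algebra_simps)

lemma vdim_same:
  assumes "vsp V" "fd V" "vsp W" "carrier W = carrier V" "add W = add V" "smult W = smult V"
  shows "vdim W = vdim V"
proof -
  have "(\<lambda>x. x) \<in> lin V W" by (rule linI) (use assms in auto)
  moreover have "bij_betw (\<lambda>x. x) (carrier V) (carrier W)" using assms(4) by (simp add: bij_betw_def)
  ultimately show ?thesis using vdim_iso[OF assms(1-3)] by simp
qed

context elem_alg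
begin

text \<open>For a dual basis this is \<open>P N\<close>, the subspace spanned by products of
  \<open>P\<close> with \<open>N\<close>, described through coordinates.\<close>

definition ideal_sub :: "('k, 'v, 'a, 'z) rmod_scheme \<Rightarrow> nat \<Rightarrow> ('v \<Rightarrow> nat \<Rightarrow> 'a) \<Rightarrow> 'a set \<Rightarrow> 'v set" where
  "ideal_sub P m S N = {x \<in> carrier P. \<forall>i<m. S x i \<in> N}"

text \<open>Inverting the integral Cartan matrix needs honest dimensions: traces of identities only see them
  modulo the characteristic of \<open>k\<close>.\<close>
definition rank_at :: "('k, 'v, 'a, 'z) rmod_scheme \<Rightarrow> nat \<Rightarrow> ('v \<Rightarrow> nat \<Rightarrow> 'a) \<Rightarrow> nat \<Rightarrow> nat" where
  "rank_at P m S j = vdim (kfun\<lparr>carrier := (\<lambda>x i. if i < m then chi j (S x i) else 0) ` carrier P\<rparr>)"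

lemma left_idealD:
  assumes "left_ideal N"
  shows "subsp A N" "a \<in> carrier A \<Longrightarrow> y \<in> N \<Longrightarrow> a \<otimes> y \<in> N" "y \<in> N \<Longrightarrow> y \<in> carrier A" "\<zero> \<in> N"
  using assms subspD[of A N] by (auto simp: left_ideal_def)

lemma subsp_left_image: "subsp A N \<Longrightarrow> j < n \<Longrightarrow> subsp A ((\<lambda>y. e j \<otimes> y) ` N)"
  by (rule subsp_image[OF vspA vspA lin_mult_left]) simp_all

text \<open>On the line \<open>N/N'\<close> the idempotent \<open>e i\<close> acts by
  \<open>chi j (e i)\<close>, which is 1 for \<open>i = j\<close> and 0 otherwise; this is the
  dimension by which \<open>e_i N\<close> exceeds \<open>e_i N'\<close>.\<close>

lemma vdim_left_image_step:
  assumes N: "left_ideal N" and N': "left_ideal N'" "N' \<subseteq> N" and j: "j < n" and i: "i < n"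
    and \<xi>: "\<xi> \<in> lin (A\<lparr>carrier := N\<rparr>) kmod" "\<And>z. z \<in> N \<Longrightarrow> \<xi> z = 0 \<longleftrightarrow> z \<in> N'" "\<exists>z\<in>N. \<xi> z = 1"
    "\<And>a z. a \<in> carrier A \<Longrightarrow> z \<in> N \<Longrightarrow> \<xi> (a \<otimes> z) = chi j a * \<xi> z"
  shows "vdim (A\<lparr>carrier := (\<lambda>y. e i \<otimes> y) ` N\<rparr>) = vdim (A\<lparr>carrier := (\<lambda>y. e i \<otimes> y) ` N'\<rparr>) + (if i = j then 1 else 0)"
proof -
  let ?V = "A\<lparr>carrier := (\<lambda>y. e i \<otimes> y) ` N\<rparr>"
  note ND = left_idealD[OF N] and N'D = left_idealD[OF N'(1)]
  have sV: "subsp A ((\<lambda>y. e i \<otimes> y) ` N)" by (rule subsp_left_image[OF ND(1) i])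
  note V = vsp_subsp[OF vspA sV] fd_subsp[OF vspA fdA sV]
  have VN: "(\<lambda>y. e i \<otimes> y) ` N \<subseteq> N" using ND(2) i by auto
  have \<xi>V: "\<xi> \<in> lin ?V kmod" using lin_restrict_dom[OF \<xi>(1), of "(\<lambda>y. e i \<otimes> y) ` N"] VN by simp
  have ker: "{x \<in> carrier ?V. \<xi> x = \<zero>\<^bsub>kmod\<^esub>} = (\<lambda>y. e i \<otimes> y) ` N'"
  proof (intro equalityI subsetI)
    fix x assume x: "x \<in> {x \<in> carrier ?V. \<xi> x = \<zero>\<^bsub>kmod\<^esub>}"
    then obtain y where y: "y \<in> N" "x = e i \<otimes> y" by auto
    have "x \<in> N" using x VN by auto
    then have "x \<in> N'" using x \<xi>(2) by simp
    moreover have "x = e i \<otimes> x" using y i ND(3)[OF y(1)] e_idem[OF i] by (simp add: m_assoc[symmetric])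
    ultimately show "x \<in> (\<lambda>y. e i \<otimes> y) ` N'" by (intro image_eqI)
  next
    fix x assume "x \<in> (\<lambda>y. e i \<otimes> y) ` N'"
    then obtain y where y: "y \<in> N'" "x = e i \<otimes> y" by auto
    then have xN: "x \<in> N'" using N'D(2) i by simp
    then show "x \<in> {x \<in> carrier ?V. \<xi> x = \<zero>\<^bsub>kmod\<^esub>}" using y N'(2) \<xi>(2)[of x] by auto
  qed
  have "vdim (kmod\<lparr>carrier := \<xi> ` carrier ?V\<rparr>) = (if i = j then 1 else 0)"
  proof (cases "i = j")
    case True
    obtain z where z: "z \<in> N" "\<xi> z = 1" using \<xi>(3) by blast
    have "c \<in> \<xi> ` carrier ?V" for c
    proof (rule image_eqI)
      show "c = \<xi> (c \<odot> (e i \<otimes> z))"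
        using lin_smult[OF \<xi>V, of "e i \<otimes> z" c] \<xi>(4)[of "e i" z] z i True chi_e[OF j] by simp
      show "c \<odot> (e i \<otimes> z) \<in> carrier ?V" using subspD(4)[OF sV] z by simp
    qed
    then have im: "\<xi> ` carrier ?V = UNIV" by blast
    have "kmod\<lparr>carrier := \<xi> ` carrier ?V\<rparr> = kmod" unfolding im by (simp add: kmod_def)
    then show ?thesis using vdim_kmod[where 'k = 'k] by (simp only: if_P[OF True])
  next
    case False
    have z: "\<xi> x = 0" if x: "x \<in> carrier ?V" for x
    proof -
      obtain y where y: "y \<in> N" "x = e i \<otimes> y" using x by auto
      then show ?thesis using \<xi>(4)[of "e i" y] i chi_e_other[OF j i] False by simp
    qed
    have sI: "subsp kmod (\<xi> ` carrier ?V)" by (rule subsp_image[OF V(1) vsp_kmod \<xi>V subsp_self[OF V(1)]])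
    have "\<xi> ` carrier ?V = {0}" using z vs_zero[OF V(1)] by force
    then show ?thesis using vdim_0(1)[OF vsp_subsp[OF vsp_kmod sI]] False by simp
  qed
  then show ?thesis using vdim_rank_nullity[OF V vsp_kmod \<xi>V] unfolding ker by simp
qed

lemma subsp_ideal_sub:
  assumes P: "dual_basis P {..<m} S q" and N: "left_ideal N"
  shows "subsp P (ideal_sub P m S N)"
proof (rule subspI)
  note D = dual_basisD[OF P] and C = dual_basis_coord[OF P] and vP = right_moduleD(1)[OF dual_basisD(1)[OF P]]
  note ND = left_idealD[OF N] and Ns = subspD[OF left_idealD(1)[OF N]]
  show "ideal_sub P m S N \<subseteq> carrier P" by (auto simp: ideal_sub_def)
  have "S \<zero>\<^bsub>P\<^esub> i = \<zero>" for i using C(4)[OF vs_zero[OF vP], of 0 i] C(1)[OF vs_zero[OF vP]] vP by simp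
  then show "\<zero>\<^bsub>P\<^esub> \<in> ideal_sub P m S N" using vP ND(4) by (simp add: ideal_sub_def)
  show "x \<oplus>\<^bsub>P\<^esub> y \<in> ideal_sub P m S N" if "x \<in> ideal_sub P m S N" "y \<in> ideal_sub P m S N" for x y
    using that vP C(2) Ns(3) by (simp add: ideal_sub_def)
  show "c \<odot>\<^bsub>P\<^esub> x \<in> ideal_sub P m S N" if "x \<in> ideal_sub P m S N" for c x
    using that vP C(4) Ns(4) by (simp add: ideal_sub_def)
qed

text \<open>Tensoring with \<open>P\<close> is exact, and \<open>N/N'\<close> is simple at
  \<open>j\<close>. In coordinates: \<open>\<xi>\<close> applied entrywise maps \<open>P N\<close>
  to tuples with kernel \<open>P N'\<close>, and its image is the very space whose dimension defines
  \<open>rank_at\<close>.\<close>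

lemma vdim_ideal_sub_step:
  assumes P: "dual_basis P {..<m} S q" and N: "left_ideal N" and N': "left_ideal N'" "N' \<subseteq> N" and j: "j < n"
    and \<xi>: "\<xi> \<in> lin (A\<lparr>carrier := N\<rparr>) kmod" "\<And>z. z \<in> N \<Longrightarrow> \<xi> z = 0 \<longleftrightarrow> z \<in> N'" "\<exists>z\<in>N. \<xi> z = 1"
    "\<And>a z. a \<in> carrier A \<Longrightarrow> z \<in> N \<Longrightarrow> \<xi> (a \<otimes> z) = chi j a * \<xi> z"
  shows "vdim (P\<lparr>carrier := ideal_sub P m S N\<rparr>) = vdim (P\<lparr>carrier := ideal_sub P m S N'\<rparr>) + rank_at P m S j"
proof -
  note D = dual_basisD[OF P] and C = dual_basis_coord[OF P] and PD = right_moduleD[OF dual_basisD(1)[OF P]]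
  note ND = left_idealD[OF N] and N'D = left_idealD[OF N'(1)]
  let ?V = "P\<lparr>carrier := ideal_sub P m S N\<rparr>"
  have sV: "subsp P (ideal_sub P m S N)" by (rule subsp_ideal_sub[OF P N])
  note V = vsp_subsp[OF PD(1) sV] fd_subsp[OF PD(1) fd_dual_basis[OF P] sV]
  define \<Xi> where "\<Xi> x = (\<lambda>i. if i < m then \<xi> (S x i) else 0)" for x
  have \<Xi>: "\<Xi> \<in> lin ?V kfun"
  proof (rule linI)
    fix x y assume "x \<in> carrier ?V" "y \<in> carrier ?V"
    then show "\<Xi> (x \<oplus>\<^bsub>?V\<^esub> y) = \<Xi> x \<oplus>\<^bsub>kfun\<^esub> \<Xi> y"
      using C(2) lin_add[OF \<xi>(1)] by (auto simp: \<Xi>_def ideal_sub_def fun_eq_iff)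
  next
    fix c x assume "x \<in> carrier ?V"
    then show "\<Xi> (c \<odot>\<^bsub>?V\<^esub> x) = c \<odot>\<^bsub>kfun\<^esub> \<Xi> x"
      using C(4) lin_smult[OF \<xi>(1)] by (auto simp: \<Xi>_def ideal_sub_def fun_eq_iff)
  qed simp
  have ker: "{x \<in> carrier ?V. \<Xi> x = \<zero>\<^bsub>kfun\<^esub>} = ideal_sub P m S N'"
    using \<xi>(2) N'(2) by (auto simp: \<Xi>_def ideal_sub_def fun_eq_iff)
  have im: "\<Xi> ` carrier ?V = (\<lambda>x i. if i < m then chi j (S x i) else 0) ` carrier P"
  proof (intro equalityI subsetI)
    fix f assume "f \<in> \<Xi> ` carrier ?V"
    then obtain x where x: "x \<in> carrier P" "\<And>i. i < m \<Longrightarrow> S x i \<in> N" "f = \<Xi> x" by (auto simp: ideal_sub_def)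
    \<comment> \<open>Every coordinate of \<open>x\<close> is replaced by its value under
      \<open>\<xi>\<close>. Since \<open>\<xi>\<close> turns left multiplication into
      \<open>chi j\<close>, the characters of the coordinates of \<open>?y\<close> equal
      \<open>\<xi>\<close> of the coordinates of \<open>x\<close>.\<close>
    let ?t = "\<lambda>l. ract P (q l) (\<xi> (S x l) \<odot> \<one>)"
    let ?y = "finsum P ?t {..<m}"
    have t: "?t \<in> {..<m} \<rightarrow> carrier P" using C(5) PD(2) by auto
    have ev: "(\<lambda>x. S x i) \<in> lin P A" for i by (rule linI) (simp_all add: C)
    have "chi j (S ?y i) = \<xi> (S x i)" if i: "i < m" for i
    proof -
      have ci: "(\<lambda>x. chi j (S x i)) \<in> lin P kmod" by (rule lin_comp[OF ev chi_lin[OF j]])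
      have "chi j (S ?y i) = (\<Sum>l<m. chi j (S (?t l) i))" by (rule lin_kmod_finsum[OF PD(1) ci t])
      also have "\<dots> = (\<Sum>l<m. \<xi> (S (q l) i \<otimes> S x l))"
      proof (rule sum.cong[OF refl])
        fix l assume l: "l \<in> {..<m}"
        have "chi j (S (?t l) i) = chi j (S (q l) i) * \<xi> (S x l)"
          using C(3)[OF C(5)[OF l], of "\<xi> (S x l) \<odot> \<one>" i] C(1)[OF C(5)[OF l], of i] chi_mult[OF j]
            lin_smult[OF chi_lin[OF j], of \<one>] chi_one[OF j] by simp
        also have "\<dots> = \<xi> (S (q l) i \<otimes> S x l)" using \<xi>(4)[OF C(1)[OF C(5)[OF l], of i] x(2)] l by simp
        finally show "chi j (S (?t l) i) = \<xi> (S (q l) i \<otimes> S x l)" .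
      qed
      also have "\<dots> = \<xi> (finsum (A\<lparr>carrier := N\<rparr>) (\<lambda>l. S (q l) i \<otimes> S x l) {..<m})"
        by (rule lin_kmod_finsum[OF vsp_subsp[OF vspA ND(1)] \<xi>(1), symmetric])
           (use ND(2) C(1)[OF C(5)] x(2) in auto)
      also have "\<dots> = \<xi> (S x i)"
      proof -
        have "finsum (A\<lparr>carrier := N\<rparr>) (\<lambda>l. S (q l) i \<otimes> S x l) {..<m} = finsum A (\<lambda>l. S (q l) i \<otimes> S x l) {..<m}"
          by (rule finsum_subsp[OF vspA ND(1)]) (use ND(2) C(1)[OF C(5)] x(2) in auto)
        also have "\<dots> = finsum A (\<lambda>l. S (ract P (q l) (S x l)) i) {..<m}"
          by (rule vs_finsum_cong[OF vspA refl]) (use C(1)[OF x(1)] C(3) C(5) C(1) PD(2) in auto)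
        also have "\<dots> = S (finsum P (\<lambda>l. ract P (q l) (S x l)) {..<m}) i"
          by (rule lin_finsum[OF PD(1) vspA ev, symmetric]) (use C(1)[OF x(1)] C(5) PD(2) in auto)
        also have "\<dots> = S x i" by (simp only: dual_basis_expand[OF P x(1)])
        finally show ?thesis by (rule arg_cong)
      qed
      finally show ?thesis .
    qed
    then have "f = (\<lambda>i. if i < m then chi j (S ?y i) else 0)" by (simp add: x(3) \<Xi>_def fun_eq_iff)
    then show "f \<in> (\<lambda>x i. if i < m then chi j (S x i) else 0) ` carrier P"
      using vs_finsum[OF PD(1) t] by (rule image_eqI)
  next
    fix f assume "f \<in> (\<lambda>x i. if i < m then chi j (S x i) else 0) ` carrier P"
    then obtain x where x: "x \<in> carrier P" "f = (\<lambda>i. if i < m then chi j (S x i) else 0)" by auto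
    \<comment> \<open>Multiplying by an element with \<open>\<xi> z = 1\<close> converts
      \<open>chi j\<close> of a coordinate of \<open>x\<close> into \<open>\<xi>\<close> of the
      coordinate of \<open>x z\<close>.\<close>
    obtain z where z: "z \<in> N" "\<xi> z = 1" using \<xi>(3) by blast
    have zc: "z \<in> carrier A" using ND(3) z by simp
    have "f = \<Xi> (ract P x z)" using x z C(3)[OF x(1) zc] \<xi>(4)[OF C(1)[OF x(1)] z(1)] by (simp add: \<Xi>_def fun_eq_iff)
    moreover have "ract P x z \<in> carrier ?V"
      using PD(2)[OF x(1) zc] C(3)[OF x(1) zc] ND(2)[OF C(1)[OF x(1)] z(1)] by (simp add: ideal_sub_def)
    ultimately show "f \<in> \<Xi> ` carrier ?V" by (rule image_eqI)
  qed
  show ?thesis using vdim_rank_nullity[OF V vsp_kfun \<Xi>] unfolding ker im rank_at_def by simp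
qed

text \<open>Induction along a composition series of \<open>N\<close>: a simple factor at
  \<open>j\<close> raises the dimension of \<open>P N\<close> by \<open>rank_at P m S j\<close> and,
  among the spaces \<open>e_i N\<close>, only that of \<open>e_j N\<close>, by one.\<close>

lemma vdim_ideal_sub:
  assumes P: "dual_basis P {..<m} S q" and N: "left_ideal N"
  shows "vdim (P\<lparr>carrier := ideal_sub P m S N\<rparr>) = (\<Sum>i<n. rank_at P m S i * vdim (A\<lparr>carrier := (\<lambda>y. e i \<otimes> y) ` N\<rparr>))"
  using N
proof (induction "vdim (A\<lparr>carrier := N\<rparr>)" arbitrary: N rule: less_induct)
  case less
  note D = dual_basisD[OF P] and C = dual_basis_coord[OF P] and PD = right_moduleD[OF dual_basisD(1)[OF P]]
  note ND = left_idealD[OF less.prems]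
  show ?case
  proof (cases "N = {\<zero>}")
    case True
    have "x = \<zero>\<^bsub>P\<^esub>" if x: "x \<in> ideal_sub P m S N" for x
    proof -
      have xP: "x \<in> carrier P" "\<And>i. i < m \<Longrightarrow> S x i = \<zero>" using x True by (auto simp: ideal_sub_def)
      have "x = finsum P (\<lambda>i. ract P (q i) (S x i)) {..<m}" using dual_basis_expand[OF P xP(1)] by simp
      also have "\<dots> = finsum P (\<lambda>i. \<zero>\<^bsub>P\<^esub>) {..<m}"
        by (rule vs_finsum_cong[OF PD(1) refl]) (use xP(2) C(5) ract_zero[OF D(1)] PD(1) in auto)
      finally show ?thesis using PD(1) by simp
    qed
    then have "ideal_sub P m S N = {\<zero>\<^bsub>P\<^esub>}" using subspD(2)[OF subsp_ideal_sub[OF P less.prems]] by blast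
    then have "vdim (P\<lparr>carrier := ideal_sub P m S N\<rparr>) = 0"
      using vdim_0(1)[OF vsp_subsp[OF PD(1) subsp_ideal_sub[OF P less.prems]]] by simp
    moreover have "vdim (A\<lparr>carrier := (\<lambda>y. e i \<otimes> y) ` N\<rparr>) = 0" if "i < n" for i
      using vdim_0(1)[OF vsp_subsp[OF vspA subsp_left_image[OF ND(1) that]]] that True by simp
    ultimately show ?thesis by simp
  next
    case False
    obtain N' j \<xi> where N': "left_ideal N'" "N' \<subseteq> N" "N' \<noteq> N" and j: "j < n" and \<xi>: "\<xi> \<in> lin (A\<lparr>carrier := N\<rparr>) kmod"
      "\<And>z. z \<in> N \<Longrightarrow> \<xi> z = 0 \<longleftrightarrow> z \<in> N'" "\<exists>z\<in>N. \<xi> z = 1"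
      "\<And>a z. a \<in> carrier A \<Longrightarrow> z \<in> N \<Longrightarrow> \<xi> (a \<otimes> z) = chi j a * \<xi> z"
      by (rule left_ideal_step[OF less.prems False]) blast
    have lt: "vdim (A\<lparr>carrier := N'\<rparr>) < vdim (A\<lparr>carrier := N\<rparr>)"
      using vdim_subsp_mono[OF vspA fdA left_idealD(1)[OF N'(1)] ND(1) N'(2)] N'(3) by linarith
    have "(\<Sum>i<n. rank_at P m S i * vdim (A\<lparr>carrier := (\<lambda>y. e i \<otimes> y) ` N\<rparr>)) =
      (\<Sum>i<n. rank_at P m S i * vdim (A\<lparr>carrier := (\<lambda>y. e i \<otimes> y) ` N'\<rparr>) + (if i = j then rank_at P m S i else 0))"
      by (rule sum.cong[OF refl])
         (simp add: vdim_left_image_step[OF less.prems N'(1,2) j _ \<xi>] algebra_simps)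
    also have "\<dots> = (\<Sum>i<n. rank_at P m S i * vdim (A\<lparr>carrier := (\<lambda>y. e i \<otimes> y) ` N'\<rparr>)) + rank_at P m S j"
      using j by (simp add: sum.distrib)
    also have "\<dots> = vdim (P\<lparr>carrier := ideal_sub P m S N\<rparr>)"
      using less.hyps[OF lt N'(1)] vdim_ideal_sub_step[OF P less.prems N'(1,2) j \<xi>] by simp
    finally show ?thesis by simp
  qed
qed

text \<open>The dimension of \<open>e_j A e_i\<close>; the indices stand in the order of the Cartan
  matrix.\<close>

definition cdim :: "nat \<Rightarrow> nat \<Rightarrow> nat" where
  "cdim i j = vdim (A\<lparr>carrier := (\<lambda>y. e j \<otimes> y) ` {a \<otimes> e i | a. a \<in> carrier A}\<rparr>)"

lemma left_ideal_principal: "i < n \<Longrightarrow> left_ideal {a \<otimes> e i | a. a \<in> carrier A}"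
proof -
  assume i: "i < n"
  have "{a \<otimes> e i | a. a \<in> carrier A} = (\<lambda>a. a \<otimes> e i) ` carrier A" by auto
  then have "subsp A {a \<otimes> e i | a. a \<in> carrier A}"
    using subsp_image[OF vspA vspA lin_mult_right[OF e_closed[OF i]] subsp_self[OF vspA]] by simp
  moreover have "b \<otimes> y \<in> {a \<otimes> e i | a. a \<in> carrier A}" if b: "b \<in> carrier A" and y: "y \<in> {a \<otimes> e i | a. a \<in> carrier A}" for b y
  proof -
    obtain a where a: "y = a \<otimes> e i" "a \<in> carrier A" using y by blast
    have "b \<otimes> y = (b \<otimes> a) \<otimes> e i" using a b i by (simp add: m_assoc)
    then show ?thesis using a b by blast
  qed
  ultimately show ?thesis unfolding left_ideal_def by blast
qed

text \<open>The general formula for \<open>P N\<close>, taken for \<open>N = A e_i\<close>, where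
  \<open>P N\<close> is \<open>P e_i\<close>.\<close>

lemma vdim_corner:
  assumes P: "dual_basis P {..<m} S q" and i: "i < n"
  shows "vdim (corner P (e i)) = (\<Sum>j<n. rank_at P m S j * cdim i j)"
proof -
  note D = dual_basisD[OF P] and C = dual_basis_coord[OF P] and PD = right_moduleD[OF dual_basisD(1)[OF P]]
  have "ideal_sub P m S {a \<otimes> e i | a. a \<in> carrier A} = {ract P x (e i) | x. x \<in> carrier P}"
  proof (intro equalityI subsetI)
    fix x assume x: "x \<in> ideal_sub P m S {a \<otimes> e i | a. a \<in> carrier A}"
    then have xP: "x \<in> carrier P" by (simp add: ideal_sub_def)
    have Se: "S x l \<otimes> e i = S x l" if l: "l < m" for l
    proof -
      obtain a where a: "S x l = a \<otimes> e i" "a \<in> carrier A" using x l by (auto simp: ideal_sub_def)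
      then show ?thesis using i e_idem[OF i] by (simp add: m_assoc)
    qed
    have "ract P x (e i) = ract P (finsum P (\<lambda>l. ract P (q l) (S x l)) {..<m}) (e i)"
      by (simp only: dual_basis_expand[OF P xP])
    also have "\<dots> = finsum P (\<lambda>l. ract P (ract P (q l) (S x l)) (e i)) {..<m}"
      by (rule lin_finsum[OF PD(1,1) lin_ract[OF D(1) e_closed[OF i]]]) (use C(1)[OF xP] C(5) PD(2) in auto)
    also have "\<dots> = finsum P (\<lambda>l. ract P (q l) (S x l)) {..<m}"
    proof (rule vs_finsum_cong[OF PD(1) refl])
      show "ract P (ract P (q l) (S x l)) (e i) = ract P (q l) (S x l)" if l: "l \<in> {..<m}" for l
        using PD(7)[OF C(5)[OF l] C(1)[OF xP] e_closed[OF i], of l] Se l by simp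
      show "(\<lambda>l. ract P (q l) (S x l)) \<in> {..<m} \<rightarrow> carrier P" using C(1)[OF xP] C(5) PD(2) by auto
    qed
    also have "\<dots> = x" by (rule dual_basis_expand[OF P xP])
    finally have "x = ract P x (e i)" by simp
    then show "x \<in> {ract P x (e i) | x. x \<in> carrier P}" using xP by blast
  next
    fix x assume "x \<in> {ract P x (e i) | x. x \<in> carrier P}"
    then obtain y where y: "x = ract P y (e i)" "y \<in> carrier P" by blast
    have "S x l = S y l \<otimes> e i" for l using C(3)[OF y(2) e_closed[OF i]] y(1) by simp
    moreover have "x \<in> carrier P" using y PD(2) i by simp
    ultimately show "x \<in> ideal_sub P m S {a \<otimes> e i | a. a \<in> carrier A}"
      unfolding ideal_sub_def using C(1)[OF y(2)] by blast
  qed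
  then show ?thesis using vdim_ideal_sub[OF P left_ideal_principal[OF i]] by (simp add: cdim_def)
qed

lemma principal_simps: "ract (principal A u) = mult A" "add (principal A u) = add A"
    "smult (principal A u) = smult A" "zero (principal A u) = \<zero>"
  by (simp_all add: principal_def)

lemma right_module_principal:
  assumes u: "u \<in> carrier A" shows "right_module A (principal A u)"
proof -
  have c: "x \<in> carrier A" if "x \<in> carrier (principal A u)" for x using that u by (auto simp: principal_def)
  have s: "subsp A {u \<otimes> a | a. a \<in> carrier A}"
    using subsp_image[OF vspA vspA lin_mult_left[OF u] subsp_self[OF vspA]] by (simp add: image_def Bex_def conj_commute)
  show ?thesis
  proof (rule right_moduleI)
    show "vsp (principal A u)" by (rule vsp_cong[OF vsp_subsp[OF vspA s]]) (simp_all add: principal_def)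
    show "ract (principal A u) x a \<in> carrier (principal A u)" if x: "x \<in> carrier (principal A u)" and a: "a \<in> carrier A" for x a
    proof -
      obtain b where b: "x = u \<otimes> b" "b \<in> carrier A" using x by (auto simp: principal_def)
      have "x \<otimes> a = u \<otimes> (b \<otimes> a)" "b \<otimes> a \<in> carrier A" using a b u by (simp_all add: m_assoc)
      then show ?thesis unfolding principal_simps by (auto simp: principal_def)
    qed
  qed (simp_all add: principal_simps c l_distr r_distr smult_mult mult_smult m_assoc)
qed

text \<open>A homomorphism from \<open>u A\<close> is determined by the image of \<open>u\<close>,
  and every element of \<open>X u\<close> occurs as such an image.\<close>

lemma vdim_hom_principal:
  assumes X: "right_module A X" "fd X" and u: "u \<in> carrier A" "u \<otimes> u = u"
  shows "vdim (hom_space A (principal A u) X) = vdim (corner X u)"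
proof -
  let ?P = "principal A u" and ?H = "hom_space A (principal A u) X"
  note XD = right_moduleD[OF X(1)] and rP = right_module_principal[OF u(1)]
  have uP: "u \<in> carrier ?P" unfolding principal_def using u by force
  note pa = principal_simps(1,2)[of u]
  have cP: "x \<in> carrier A" "x = u \<otimes> x" if x: "x \<in> carrier ?P" for x
  proof -
    obtain b where b: "x = u \<otimes> b" "b \<in> carrier A" using x by (auto simp: principal_def)
    then show "x \<in> carrier A" "x = u \<otimes> x" using u by (simp_all add: m_assoc[symmetric])
  qed
  have zx: "z x = ract X (z u) x" if z: "z \<in> carrier ?H" and x: "x \<in> carrier ?P" for z x
  proof -
    have "z (ract ?P u x) = ract X (z u) x"
      using rmod_homD(3)[of z ?P X u x] z uP cP(1)[OF x] by (simp add: hom_space_mem)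
    then show ?thesis using cP(2)[OF x] by (simp add: pa)
  qed
  have inv: "(\<lambda>x\<in>carrier ?P. ract X y x) \<in> carrier ?H" if y: "y \<in> carrier X" for y
    by (rule restrict_rmod_hom[OF rP], rule rmod_homI) (use y cP XD in \<open>simp_all add: pa\<close>)
  have vC: "vsp (corner X u)" "fd (corner X u)" using corner_vsp[OF X(1) u(1)] X(2) by auto
  have f: "(\<lambda>y. \<lambda>x\<in>carrier ?P. ract X y x) \<in> lin (corner X u) ?H"
  proof (rule linI)
    fix y z assume "y \<in> carrier (corner X u)" "z \<in> carrier (corner X u)"
    then have yz: "y \<in> carrier X" "z \<in> carrier X" using corner_fixed(1)[OF X(1) u] by blast+
    show "(\<lambda>x\<in>carrier ?P. ract X (y \<oplus>\<^bsub>corner X u\<^esub> z) x) = (\<lambda>x\<in>carrier ?P. ract X y x) \<oplus>\<^bsub>?H\<^esub> (\<lambda>x\<in>carrier ?P. ract X z x)"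
      unfolding hom_space_simps by (rule restrict_ext) (use yz cP XD(3) in simp)
  next
    fix c y assume "y \<in> carrier (corner X u)"
    then have y: "y \<in> carrier X" using corner_fixed(1)[OF X(1) u] by blast
    show "(\<lambda>x\<in>carrier ?P. ract X (c \<odot>\<^bsub>corner X u\<^esub> y) x) = c \<odot>\<^bsub>?H\<^esub> (\<lambda>x\<in>carrier ?P. ract X y x)"
      unfolding hom_space_simps by (rule restrict_ext) (use y cP XD(5) in simp)
  next
    fix y assume "y \<in> carrier (corner X u)"
    then show "(\<lambda>x\<in>carrier ?P. ract X y x) \<in> carrier ?H" using inv corner_fixed(1)[OF X(1) u] by blast
  qed
  have "bij_betw (\<lambda>y. \<lambda>x\<in>carrier ?P. ract X y x) (carrier (corner X u)) (carrier ?H)"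
  proof (rule bij_betw_byWitness[where f' = "\<lambda>z. z u"])
    show "\<forall>y\<in>carrier (corner X u). (\<lambda>x\<in>carrier ?P. ract X y x) u = y"
      using corner_fixed(2)[OF X(1) u] uP by simp
    show "\<forall>z\<in>carrier ?H. (\<lambda>x\<in>carrier ?P. ract X (z u) x) = z"
    proof
      fix z assume z: "z \<in> carrier ?H"
      show "(\<lambda>x\<in>carrier ?P. ract X (z u) x) = z"
        by (rule hom_space_eqI[OF inv[OF hom_space_closed[OF z uP]] z]) (use zx[OF z] in simp)
    qed
    show "(\<lambda>y. \<lambda>x\<in>carrier ?P. ract X y x) ` carrier (corner X u) \<subseteq> carrier ?H" using lin_closed[OF f] by blast
    show "(\<lambda>z. z u) ` carrier ?H \<subseteq> carrier (corner X u)"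
    proof
      fix y assume "y \<in> (\<lambda>z. z u) ` carrier ?H"
      then obtain z where z: "z \<in> carrier ?H" "y = z u" by blast
      show "y \<in> carrier (corner X u)"
        by (rule corner_memI) (use z hom_space_closed[OF z(1) uP] zx[OF z(1) uP] in simp_all)
    qed
  qed
  from vdim_iso[OF vC vsp_hom_space[OF rP X(1)] f this] show ?thesis by simp
qed

lemma cartan_index:
  assumes i: "i < n" and j: "j < n"
  shows "cartan A es $$ (i, j) = int (cdim i j)"
proof -
  let ?X = "principal A (e j)"
  have rX: "right_module A ?X" by (rule right_module_principal[OF e_closed[OF j]])
  have s: "subsp A {e j \<otimes> a | a. a \<in> carrier A}"
    using subsp_image[OF vspA vspA lin_mult_left[OF e_closed[OF j]] subsp_self[OF vspA]] by (simp add: image_def Bex_def conj_commute)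
  have fX: "fd ?X"
    by (rule fd_retract[OF vsp_subsp[OF vspA s] fd_subsp[OF vspA fdA s] right_moduleD(1)[OF rX], of "\<lambda>x. x" "\<lambda>x. x"])
       (auto intro!: linI simp: principal_def)
  let ?N = "{a \<otimes> e i | a. a \<in> carrier A}"
  have sN: "subsp A ((\<lambda>y. e j \<otimes> y) ` ?N)" by (rule subsp_left_image[OF left_idealD(1)[OF left_ideal_principal[OF i]] j])
  have c: "carrier (corner ?X (e i)) = (\<lambda>y. e j \<otimes> y) ` ?N"
  proof (intro equalityI subsetI)
    fix x assume "x \<in> carrier (corner ?X (e i))"
    then obtain a where a: "a \<in> carrier A" "x = (e j \<otimes> a) \<otimes> e i" by (auto simp: principal_def)
    then have "x = e j \<otimes> (a \<otimes> e i)" using i j by (simp add: m_assoc)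
    then show "x \<in> (\<lambda>y. e j \<otimes> y) ` ?N" using a by blast
  next
    fix x assume "x \<in> (\<lambda>y. e j \<otimes> y) ` ?N"
    then obtain a where a: "a \<in> carrier A" "x = e j \<otimes> (a \<otimes> e i)" by blast
    then have "x = (e j \<otimes> a) \<otimes> e i" using i j by (simp add: m_assoc)
    then show "x \<in> carrier (corner ?X (e i))" using a by (auto simp: principal_def)
  qed
  have "vdim (corner ?X (e i)) = cdim i j" unfolding cdim_def
    by (rule vdim_same[OF vsp_subsp[OF vspA sN] fd_subsp[OF vspA fdA sN] corner_vsp(1)[OF rX e_closed[OF i]]])
       (use c in \<open>simp_all add: principal_def\<close>)
  then show ?thesis using i j vdim_hom_principal[OF rX fX e_closed[OF i] e_idem[OF i]] by (simp add: cartan_def)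
qed

text \<open>The simple right module at \<open>e i\<close>: the field with \<open>A\<close> acting
  through the character. Among the chosen idempotents only \<open>e i\<close> acts on it as
  nonzero.\<close>

definition simple_mod :: "nat \<Rightarrow> ('k, 'k, 'a) rmod" where
  "simple_mod i = \<lparr>carrier = UNIV, mult = undefined, one = undefined, zero = 0, add = (+), smult = (*), ract = (\<lambda>x a. x * chi i a)\<rparr>"

lemma simple_mod:
  assumes i: "i < n"
  shows "right_module A (simple_mod i)" "fd (simple_mod i)"
    "j < n \<Longrightarrow> vdim (corner (simple_mod i) (e j)) = (if i = j then 1 else 0)"
proof -
  note cl = lin_add[OF chi_lin[OF i]] lin_smult[OF chi_lin[OF i]]
  have v: "vsp (simple_mod i)" by (rule vsp_cong[OF vsp_kmod]) (simp_all add: simple_mod_def)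
  show r: "right_module A (simple_mod i)"
    by (rule right_moduleI[OF v]) (simp_all add: simple_mod_def cl chi_mult[OF i] chi_one[OF i] algebra_simps)
  show "fd (simple_mod i)"
    by (rule fd_retract[OF vsp_kmod fd_kmod v, of "\<lambda>x. x" "\<lambda>x. x"]) (auto intro!: linI simp: simple_mod_def)
  assume j: "j < n"
  show "vdim (corner (simple_mod i) (e j)) = (if i = j then 1 else 0)"
  proof (cases "i = j")
    case True
    have "carrier (corner (simple_mod i) (e j)) = UNIV" using chi_e[OF i] True by (simp add: simple_mod_def)
    then have "vdim (corner (simple_mod i) (e j)) = vdim (kmod :: ('k, 'k) module)"
      by (intro vdim_same[OF vsp_kmod fd_kmod corner_vsp(1)[OF r e_closed[OF j]]]) (simp_all add: simple_mod_def)
    then show ?thesis using True vdim_kmod by simp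
  next
    case False
    have "zero_space (corner (simple_mod i) (e j))"
      using chi_e_other[OF i j False] by (simp add: simple_mod_def)
    then show ?thesis using vdim_0(1)[OF corner_vsp(1)[OF r e_closed[OF j]]] False by simp
  qed
qed

text \<open>The inverse is read off finite resolutions of the simple modules.\<close>
lemma cartan_right_inverse:
  assumes gl: "finite_gldim A"
  shows "\<exists>X\<in>carrier_mat n n. cartan A es * X = 1\<^sub>m n"
proof -
  have "\<exists>x :: nat \<Rightarrow> int. \<forall>a<n. (\<Sum>j<n. int (cdim a j) * x j) = (if i = a then 1 else 0)" if i: "i < n" for i
  proof -
    note sm = simple_mod[OF i]
    obtain Q :: "('k, nat \<Rightarrow> 'a, 'a, 'k) resolution" and L where Q: "exact_res (simple_mod i) Q"
      "\<And>l. \<exists>(m::nat) S q. dual_basis (obj Q l) {..<m} S q" "\<And>l. l > L \<Longrightarrow> zero_space (obj Q l)"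
      using finite_resolution[OF sm(1,2) gl] by blast
    obtain m S q where db: "\<And>l. dual_basis (obj Q l) {..<m l::nat} (S l) (q l)" using Q(2) by metis
    \<comment> \<open>The class of the simple module written in terms of indecomposable projectives:
      the alternating sum of the multiplicities in a finite resolution. These numbers form column
      \<open>i\<close> of the inverse.\<close>
    let ?x = "\<lambda>j. \<Sum>l\<le>L. (- 1) ^ l * int (rank_at (obj Q l) (m l) (S l) j)"
    have "(\<Sum>j<n. int (cdim a j) * ?x j) = (if i = a then 1 else 0)" if a: "a < n" for a
    proof -
      have "(\<Sum>j<n. int (cdim a j) * ?x j) = (\<Sum>j<n. \<Sum>l\<le>L. (- 1) ^ l * int (rank_at (obj Q l) (m l) (S l) j * cdim a j))"
        unfolding sum_distrib_left by (intro sum.cong refl) (simp add: mult_ac)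
      also have "\<dots> = (\<Sum>l\<le>L. \<Sum>j<n. (- 1) ^ l * int (rank_at (obj Q l) (m l) (S l) j * cdim a j))"
        by (rule sum.swap)
      also have "\<dots> = (\<Sum>l\<le>L. (- 1) ^ l * int (vdim (corner (obj Q l) (e a))))"
        by (intro sum.cong refl) (simp add: vdim_corner[OF db a] sum_distrib_left)
      also have "\<dots> = int (vdim (corner (simple_mod i) (e a)))"
        by (rule resolution_vdim[OF Q(1) e_closed[OF a] e_idem[OF a] fd_dual_basis[OF db] Q(3)]) simp
      finally show ?thesis using sm(3)[OF a] by simp
    qed
    then show ?thesis by (intro exI[of _ ?x] allI impI)
  qed
  then obtain x where x: "\<And>i a. i < n \<Longrightarrow> a < n \<Longrightarrow> (\<Sum>j<n. int (cdim a j) * x i j) = (if i = a then 1 else 0)" by metis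
  let ?X = "mat n n (\<lambda>(j, i). x i j)"
  have "cartan A es * ?X = 1\<^sub>m n"
  proof (rule eq_matI)
    show "dim_row (cartan A es * ?X) = dim_row (1\<^sub>m n)" "dim_col (cartan A es * ?X) = dim_col (1\<^sub>m n)" by (simp_all add: cartan_def)
    fix a i assume ai: "a < dim_row (1\<^sub>m n)" "i < dim_col (1\<^sub>m n)"
    then have "(cartan A es * ?X) $$ (a, i) = (\<Sum>j<n. cartan A es $$ (a, j) * ?X $$ (j, i))"
      by (simp add: cartan_def scalar_prod_def atLeast0LessThan)
    also have "\<dots> = (\<Sum>j<n. int (cdim a j) * x i j)" using ai by (intro sum.cong refl) (simp add: cartan_index)
    finally show "(cartan A es * ?X) $$ (a, i) = 1\<^sub>m n $$ (a, i)" using ai x[of i a] by auto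
  qed
  then show ?thesis by (intro bexI[of _ ?X]) simp_all
qed

end

lemma int_mat_left_inverse:
  fixes C X :: "int mat"
  assumes C: "C \<in> carrier_mat n n" and X: "X \<in> carrier_mat n n" and CX: "C * X = 1\<^sub>m n"
  shows "X * C = 1\<^sub>m n"
proof -
  have a: "adj_mat C \<in> carrier_mat n n" "adj_mat C * C = det C \<cdot>\<^sub>m 1\<^sub>m n" using adj_mat[OF C] by auto
  have d: "det X * det C = 1" using det_mult[OF C X] CX by (simp add: mult.commute)
  define Y where "Y = det X \<cdot>\<^sub>m adj_mat C"
  have Y: "Y \<in> carrier_mat n n" using a by (simp add: Y_def)
  have "Y * C = det X \<cdot>\<^sub>m (adj_mat C * C)" unfolding Y_def by (rule mult_smult_assoc_mat[OF a(1) C])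
  also have "\<dots> = (det X * det C) \<cdot>\<^sub>m 1\<^sub>m n" unfolding a(2) by (rule eq_matI) auto
  also have "\<dots> = 1\<^sub>m n" unfolding d by (rule eq_matI) auto
  finally have YC: "Y * C = 1\<^sub>m n" .
  have "Y = Y * (C * X)" using Y unfolding CX by simp
  also have "\<dots> = (Y * C) * X" by (rule assoc_mult_mat[OF Y C X, symmetric])
  also have "\<dots> = X" using X unfolding YC by simp
  finally show ?thesis using YC by simp
qed

context elem_alg
begin

lemma cartan_inverse:
  assumes gl: "finite_gldim A"
  shows "cartan_inv A es \<in> carrier_mat n n"
    "i < n \<Longrightarrow> k < n \<Longrightarrow> (\<Sum>a<n. cartan_inv A es $$ (i, a) * of_nat (cdim a k)) = (if i = k then 1 else 0)"
proof -
  let ?C = "cartan A es"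
  have C: "?C \<in> carrier_mat n n" by (simp add: cartan_def)
  obtain X where X: "X \<in> carrier_mat n n" "?C * X = 1\<^sub>m n" using cartan_right_inverse[OF gl] by blast
  have XC: "X * ?C = 1\<^sub>m n" by (rule int_mat_left_inverse[OF C X])
  have "mat_inv ?C = X" unfolding mat_inv_def
  proof (rule the_equality)
    show "X \<in> carrier_mat (dim_row ?C) (dim_row ?C) \<and> inverts_mat ?C X \<and> inverts_mat X ?C"
      using X XC C by (simp add: inverts_mat_def)
    fix Y assume Y: "Y \<in> carrier_mat (dim_row ?C) (dim_row ?C) \<and> inverts_mat ?C Y \<and> inverts_mat Y ?C"
    then have Yc: "Y \<in> carrier_mat n n" and YC: "Y * ?C = 1\<^sub>m n" using C by (auto simp: inverts_mat_def)
    have "Y = Y * (?C * X)" using Yc unfolding X(2) by simp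
    also have "\<dots> = (Y * ?C) * X" by (rule assoc_mult_mat[OF Yc C X(1), symmetric])
    also have "\<dots> = X" using X(1) unfolding YC by simp
    finally show "Y = X" .
  qed
  then have ci: "cartan_inv A es = map_mat of_int X" by (simp add: cartan_inv_def)
  then show "cartan_inv A es \<in> carrier_mat n n" using X by simp
  assume ik: "i < n" "k < n"
  have "(if i = k then 1 else 0) = (X * ?C) $$ (i, k)" unfolding XC using ik by simp
  also have "\<dots> = (\<Sum>a<n. X $$ (i, a) * ?C $$ (a, k))"
    using ik X C by (simp add: scalar_prod_def atLeast0LessThan)
  also have "\<dots> = (\<Sum>a<n. X $$ (i, a) * int (cdim a k))" using ik by (intro sum.cong refl) (simp add: cartan_index)
  finally have *: "(\<Sum>a<n. X $$ (i, a) * int (cdim a k)) = (if i = k then 1 else 0)" by simp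
  \<comment> \<open>Only now are the entries mapped to \<open>k\<close>; the identity over the
    integers passes through the ring homomorphism \<open>of_int\<close>.\<close>
  have "(\<Sum>a<n. cartan_inv A es $$ (i, a) * of_nat (cdim a k)) = of_int (\<Sum>a<n. X $$ (i, a) * int (cdim a k))"
    unfolding ci of_int_sum using ik X by (intro sum.cong refl) simp
  then show "(\<Sum>a<n. cartan_inv A es $$ (i, a) * of_nat (cdim a k)) = (if i = k then 1 else 0)" unfolding * by simp
qed

text \<open>The trace of left multiplication on \<open>A e_i\<close> kills nilpotent elements, so
  its values at the \<open>e j\<close> determine it. There it is the trace of a projection with
  image \<open>e_j A e_i\<close>, which is a Cartan entry in the field.\<close>

lemma lin_trace_left_mult:
  assumes i: "i < n" and a: "a \<in> carrier A"
  shows "lin_trace (A\<lparr>carrier := {b \<otimes> e i | b. b \<in> carrier A}\<rparr>) (\<lambda>y. a \<otimes> y) = (\<Sum>j<n. chi j a * of_nat (cdim i j))"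
proof -
  let ?N = "{b \<otimes> e i | b. b \<in> carrier A}"
  let ?V = "A\<lparr>carrier := ?N\<rparr>"
  note ND = left_idealD[OF left_ideal_principal[OF i]]
  note V = vsp_subsp[OF vspA ND(1)] fd_subsp[OF vspA fdA ND(1)]
  have l: "(\<lambda>y. a \<otimes> y) \<in> lin ?V ?V" if "a \<in> carrier A" for a
    by (rule lin_restrict[OF lin_mult_left[OF that] subspD(1)[OF ND(1)]]) (use ND(2)[OF that] in blast)
  have VA: "y \<in> carrier A" if "y \<in> carrier ?V" for y using that by (intro ND(3)) simp
  have "lin_trace ?V (\<lambda>y. a \<otimes> y) = (\<Sum>j<n. chi j a * lin_trace ?V (\<lambda>y. e j \<otimes> y))"
  proof (rule trace_form_eq[where T = "\<lambda>a. lin_trace ?V (\<lambda>y. a \<otimes> y)", OF _ _ a])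
    show "(\<lambda>a. lin_trace ?V (\<lambda>y. a \<otimes> y)) \<in> lin A kmod"
    proof (rule linI)
      fix a b assume ab: "a \<in> carrier A" "b \<in> carrier A"
      have "lin_trace ?V (\<lambda>y. (a \<oplus> b) \<otimes> y) = lin_trace ?V (\<lambda>y. a \<otimes> y \<oplus>\<^bsub>?V\<^esub> b \<otimes> y)"
        by (rule lin_trace_cong[OF V l]) (use ab l_distr[OF ab VA] in simp_all)
      then show "lin_trace ?V (\<lambda>y. (a \<oplus> b) \<otimes> y) = lin_trace ?V (\<lambda>y. a \<otimes> y) \<oplus>\<^bsub>kmod\<^esub> lin_trace ?V (\<lambda>y. b \<otimes> y)"
        using lin_trace_add[OF V l[OF ab(1)] l[OF ab(2)]] by simp
    next
      fix c a assume a: "a \<in> carrier A"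
      have "lin_trace ?V (\<lambda>y. (c \<odot> a) \<otimes> y) = lin_trace ?V (\<lambda>y. c \<odot>\<^bsub>?V\<^esub> (a \<otimes> y))"
        by (rule lin_trace_cong[OF V l]) (use a smult_mult[OF a VA] in simp_all)
      then show "lin_trace ?V (\<lambda>y. (c \<odot> a) \<otimes> y) = c \<odot>\<^bsub>kmod\<^esub> lin_trace ?V (\<lambda>y. a \<otimes> y)"
        using lin_trace_smult[OF V l[OF a]] by simp
    qed simp
    fix y and r :: nat assume y: "y \<in> carrier A" "y [^] r = \<zero>"
    show "lin_trace ?V (\<lambda>z. y \<otimes> z) = 0"
    proof (rule lin_trace_nilpotent[OF V l[OF y(1)]])
      fix x assume "x \<in> carrier ?V"
      then have x: "x \<in> carrier A" by (rule VA)
      have "((\<lambda>z. y \<otimes> z) ^^ k) x = y [^] k \<otimes> x" for k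
      proof (induction k)
        case (Suc k)
        then show ?case using nat_pow_Suc2[OF y(1), of k] x y(1) by (simp add: m_assoc)
      qed (use x in simp)
      from this[of r] show "((\<lambda>z. y \<otimes> z) ^^ r) x = \<zero>\<^bsub>?V\<^esub>" using y x by simp
    qed
  qed
  also have "\<dots> = (\<Sum>j<n. chi j a * of_nat (cdim i j))"
  proof (rule sum.cong[OF refl])
    fix j assume "j \<in> {..<n}"
    then have j: "j < n" by simp
    let ?U = "(\<lambda>y. e j \<otimes> y) ` ?N"
    have sU: "subsp A ?U" by (rule subsp_left_image[OF ND(1) j])
    have UN: "?U \<subseteq> ?N" using ND(2)[OF e_closed[OF j]] by blast
    note vU = vsp_subsp[OF vspA sU] fd_subsp[OF vspA fdA sU]
    have "lin_trace ?V (\<lambda>y. e j \<otimes> y) = lin_trace (?V\<lparr>carrier := ?U\<rparr>) (\<lambda>y. e j \<otimes> y)"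
      by (rule lin_trace_image[OF V subsp_sub[OF sU ND(1) UN] l[OF e_closed[OF j]]]) simp
    also have "\<dots> = lin_trace (A\<lparr>carrier := ?U\<rparr>) (\<lambda>y. y)"
    proof -
      have "lin_trace (A\<lparr>carrier := ?U\<rparr>) (\<lambda>y. y) = lin_trace (A\<lparr>carrier := ?U\<rparr>) (\<lambda>y. e j \<otimes> y)"
      proof (rule lin_trace_cong[OF vU lin_id])
        fix x assume "x \<in> carrier (A\<lparr>carrier := ?U\<rparr>)"
        then obtain y where y: "y \<in> ?N" "x = e j \<otimes> y" by auto
        have yc: "y \<in> carrier A" by (rule ND(3)[OF y(1)])
        have "e j \<otimes> (e j \<otimes> y) = e j \<otimes> y" using yc j e_idem[OF j] by (simp add: m_assoc[symmetric])
        then show "x = e j \<otimes> x" using y(2) by simp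
      qed
      then show ?thesis by simp
    qed
    also have "\<dots> = of_nat (cdim i j)" unfolding lin_trace_id[OF vU] cdim_def ..
    finally show "chi j a * lin_trace ?V (\<lambda>y. e j \<otimes> y) = chi j a * of_nat (cdim i j)" by simp
  qed
  finally show ?thesis .
qed

lemma lin_trace_corner_eq:
  assumes P: "dual_basis P {..<m} S q" and i: "i < n" and F: "F \<in> rmod_hom A P P"
  shows "lin_trace (corner P (e i)) F = (\<Sum>j<n. of_nat (cdim i j) * mult_trace m S q F j)"
proof -
  have "lin_trace (corner P (e i)) F = (\<Sum>l<m. \<Sum>j<n. chi j (S (F (q l)) l) * of_nat (cdim i j))"
    unfolding lin_trace_corner[OF P e_closed[OF i] F]
    by (intro sum.cong refl lin_trace_left_mult[OF i] dual_basis_coord(1)[OF P] rmod_homD(1)[OF F] dual_basis_coord(5)[OF P])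
  also have "\<dots> = (\<Sum>j<n. \<Sum>l<m. chi j (S (F (q l)) l) * of_nat (cdim i j))" by (rule sum.swap)
  also have "\<dots> = (\<Sum>j<n. of_nat (cdim i j) * mult_trace m S q F j)"
    by (simp add: mult_trace_def sum_distrib_left mult.commute)
  finally show ?thesis .
qed

text \<open>The right hand side does not mention \<open>Q\<close>: the alternating sums of
  multiplicities depend on \<open>\<phi>\<close> alone.\<close>

lemma multiplicity_formula:
  assumes gl: "finite_gldim A" and Q: "exact_res M Q" and db: "\<And>l. dual_basis (obj Q l) {..<m l} (S l) (q l)"
    and L: "\<And>l. l > L \<Longrightarrow> zero_space (obj Q l)"
    and \<phi>: "\<phi> \<in> rmod_hom A M M" and \<Phi>: "chain_map Q Q \<phi> \<Phi>" and j: "j < n"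
  shows "(\<Sum>l\<le>L. (- 1) ^ l * mult_trace (m l) (S l) (q l) (\<Phi> l) j) =
    (\<Sum>a<n. cartan_inv A es $$ (j, a) * lin_trace (corner M (e a)) \<phi>)"
proof -
  let ?t = "\<lambda>j. \<Sum>l\<le>L. (- 1) ^ l * mult_trace (m l) (S l) (q l) (\<Phi> l) j"
  have tr: "lin_trace (corner M (e a)) \<phi> = (\<Sum>k<n. of_nat (cdim a k) * ?t k)" if a: "a < n" for a
  proof -
    have "lin_trace (corner M (e a)) \<phi> = (\<Sum>l\<le>L. (- 1) ^ l * lin_trace (corner (obj Q l) (e a)) (\<Phi> l))"
      by (rule resolution_trace[OF Q e_closed[OF a] e_idem[OF a] fd_dual_basis[OF db] L \<Phi> \<phi>, symmetric]) simp
    also have "\<dots> = (\<Sum>l\<le>L. \<Sum>k<n. of_nat (cdim a k) * ((- 1) ^ l * mult_trace (m l) (S l) (q l) (\<Phi> l) k))"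
      unfolding lin_trace_corner_eq[OF db a chain_mapD(1)[OF \<Phi>]] sum_distrib_left
      by (intro sum.cong refl) (simp add: mult_ac)
    also have "\<dots> = (\<Sum>k<n. \<Sum>l\<le>L. of_nat (cdim a k) * ((- 1) ^ l * mult_trace (m l) (S l) (q l) (\<Phi> l) k))" by (rule sum.swap)
    also have "\<dots> = (\<Sum>k<n. of_nat (cdim a k) * ?t k)" by (simp only: sum_distrib_left)
    finally show ?thesis .
  qed
  have "(\<Sum>a<n. cartan_inv A es $$ (j, a) * lin_trace (corner M (e a)) \<phi>) =
    (\<Sum>a<n. \<Sum>k<n. (cartan_inv A es $$ (j, a) * of_nat (cdim a k)) * ?t k)"
    by (intro sum.cong refl) (simp only: tr lessThan_iff sum_distrib_left mult.assoc)
  also have "\<dots> = (\<Sum>k<n. \<Sum>a<n. (cartan_inv A es $$ (j, a) * of_nat (cdim a k)) * ?t k)" by (rule sum.swap)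
  also have "\<dots> = (\<Sum>k<n. (\<Sum>a<n. cartan_inv A es $$ (j, a) * of_nat (cdim a k)) * ?t k)" by (simp only: sum_distrib_right)
  also have "\<dots> = (\<Sum>k<n. if j = k then ?t k else 0)"
    by (intro sum.cong refl) (simp add: cartan_inverse(2)[OF gl j])
  also have "\<dots> = ?t j" using j by simp
  finally show ?thesis by simp
qed

end

section \<open>Ext\<close>

text \<open>For \<open>X\<close> computed from the given resolution and \<open>Y\<close> from the
  finite one, \<open>a\<close> and \<open>b\<close> are the comparison maps. That \<open>X\<close>
  is a retract of \<open>Y\<close> already yields finite dimension and moves the trace to
  \<open>Y\<close>.\<close>

lemma lin_trace_transfer:
  assumes X: "vsp X" and Y: "vsp Y" "fd Y" and a: "a \<in> lin X Y" and b: "b \<in> lin Y X"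
    and ba: "\<And>x. x \<in> carrier X \<Longrightarrow> b (a x) = x"
    and E: "E \<in> lin X X" and \<theta>: "\<theta> \<in> lin X X"
    and U: "U = E ` carrier X" and c: "\<And>x. x \<in> carrier X \<Longrightarrow> E (\<theta> (E x)) = \<theta> (E x)"
  shows "fd X" "lin_trace (X\<lparr>carrier := U\<rparr>) \<theta> = lin_trace Y (\<lambda>y. a (E (\<theta> (b y))))"
    "zero_space Y \<Longrightarrow> zero_space X"
proof -
  show fX: "fd X" by (rule fd_retract[OF Y X a b ba])
  have e: "(\<lambda>x. E (\<theta> x)) \<in> lin X X" by (rule lin_comp[OF \<theta> E])
  have "lin_trace (X\<lparr>carrier := U\<rparr>) \<theta> = lin_trace X (\<lambda>x. E (\<theta> x))"
    by (rule lin_trace_idempotent_image[OF X fX E \<theta> U c])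
  also have "\<dots> = lin_trace X (\<lambda>x. b (a (E (\<theta> x))))"
    by (rule lin_trace_cong[OF X fX e]) (use ba lin_closed[OF e] in simp)
  also have "\<dots> = lin_trace Y (\<lambda>y. a (E (\<theta> (b y))))"
    by (rule lin_trace_comm[OF X fX Y lin_comp[OF e a] b])
  finally show "lin_trace (X\<lparr>carrier := U\<rparr>) \<theta> = lin_trace Y (\<lambda>y. a (E (\<theta> (b y))))" .
  assume Y0: "zero_space Y"
  have "x = \<zero>\<^bsub>X\<^esub>" if x: "x \<in> carrier X" for x
  proof -
    have "a x = \<zero>\<^bsub>Y\<^esub>" using lin_closed[OF a x] Y0 by simp
    then show ?thesis using ba[OF x] lin_zero[OF Y(1) X b] by simp
  qed
  then show "zero_space X" using X by auto
qed

context fin_alg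
begin

lemma projective_lifts: "projective A P \<Longrightarrow> right_module A X \<Longrightarrow> right_module A Y \<Longrightarrow> lifts P X Y"
  using projective_dual_basis[of P] dual_basis_lifts by blast

lemma exact_res_projective:
  assumes "right_module A M" "projective_resolution A M P"
  shows "exact_res M P" "projective A (obj P l)"
  using assms by (auto simp: projective_resolution_def exact_res_def projective_def)

lemma chain_lift:
  assumes M: "right_module A M" and P: "projective_resolution A M P" and \<phi>: "\<phi> \<in> rmod_hom A M M"
  shows "chain_map P P \<phi> (chain_lift A P \<phi>)"
proof -
  note E = exact_res_projective[OF M P]
  have "\<exists>\<Phi>. chain_map P P \<phi> \<Phi>"
    by (rule chain_map_exists[OF E(1,1) \<phi>]) (intro projective_lifts E exact_resD(1,2)[OF E(1)])+
  then show ?thesis unfolding chain_lift_def chain_map_def by (rule someI_ex)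
qed

lemma chain_map_id: "chain_map P P (\<lambda>x. x) (\<lambda>l x. x)"
  by (simp add: chain_map_def rmod_hom_id)

text \<open>The two module maps are compared on the carrier of \<open>M\<close> only. Maps such as
  \<open>u\<close> and \<open>u \<circ> u\<close> agree there for the action of an idempotent,
  though they may differ as functions.\<close>

lemma chain_map_homotopic:
  assumes Q: "exact_res M Q" and P: "exact_res W P" and ls: "\<And>l. lifts (obj Q l) (obj P (Suc l)) (obj P l)"
    and F: "chain_map Q P \<phi> F" and G: "chain_map Q P \<phi>' G" and eq: "\<And>x. x \<in> carrier M \<Longrightarrow> \<phi> x = \<phi>' x"
  obtains h where "\<And>l. h l \<in> rmod_hom A (obj Q l) (obj P (Suc l))"
    "\<And>x. x \<in> carrier (obj Q 0) \<Longrightarrow> F 0 x \<ominus>\<^bsub>obj P 0\<^esub> G 0 x = bd P 0 (h 0 x)"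
    "\<And>l x. x \<in> carrier (obj Q (Suc l)) \<Longrightarrow>
       F (Suc l) x \<ominus>\<^bsub>obj P (Suc l)\<^esub> G (Suc l) x = bd P (Suc l) (h (Suc l) x) \<oplus>\<^bsub>obj P (Suc l)\<^esub> h l (bd Q l x)"
proof -
  note QD = exact_resD[OF Q] and PD = exact_resD[OF P] and FD = chain_mapD[OF F] and GD = chain_mapD[OF G]
  define D where "D l x = F l x \<ominus>\<^bsub>obj P l\<^esub> G l x" for l x
  have Dh: "D l \<in> rmod_hom A (obj Q l) (obj P l)" for l
    unfolding D_def by (rule rmod_hom_minus[OF PD(2) FD(1) GD(1)])
  have D0: "aug P (D 0 x) = \<zero>\<^bsub>W\<^esub>" if x: "x \<in> carrier (obj Q 0)" for x
  proof -
    note c = rmod_homD(1)[OF FD(1) x] rmod_homD(1)[OF GD(1) x]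
    have "aug P (D 0 x) = aug P (F 0 x) \<ominus>\<^bsub>W\<^esub> aug P (G 0 x)"
      unfolding D_def by (rule lin_minus[OF PD(11,10,13) c])
    also have "aug P (F 0 x) = aug P (G 0 x)"
      using FD(2)[OF x] GD(2)[OF x] eq[OF rmod_homD(1)[OF QD(4) x]] by simp
    finally show ?thesis using vs_minus_self[OF PD(10) lin_closed[OF PD(13) c(2)]] by simp
  qed
  have Dl: "bd P l (D (Suc l) x) = D l (bd Q l x)" if x: "x \<in> carrier (obj Q (Suc l))" for l x
    unfolding D_def using lin_minus[OF PD(11,11,12) rmod_homD(1)[OF FD(1) x] rmod_homD(1)[OF GD(1) x]] FD(3)[OF x] GD(3)[OF x] by simp
  have "\<exists>h. (\<forall>l. h l \<in> rmod_hom A (obj Q l) (obj P (Suc l))) \<and> (\<forall>x\<in>carrier (obj Q 0). bd P 0 (h 0 x) = D 0 x) \<and>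
       (\<forall>l. \<forall>x\<in>carrier (obj Q (Suc l)). bd P (Suc l) (h (Suc l) x) = D (Suc l) x \<ominus>\<^bsub>obj P (Suc l)\<^esub> h l (bd Q l x))"
    by (rule chain_homotopy[OF Q P]) (simp_all add: ls Dh D0 Dl del: One_nat_def)
  then obtain h where h: "\<And>l. h l \<in> rmod_hom A (obj Q l) (obj P (Suc l))"
    "\<And>x. x \<in> carrier (obj Q 0) \<Longrightarrow> bd P 0 (h 0 x) = D 0 x"
    "\<And>l x. x \<in> carrier (obj Q (Suc l)) \<Longrightarrow> bd P (Suc l) (h (Suc l) x) = D (Suc l) x \<ominus>\<^bsub>obj P (Suc l)\<^esub> h l (bd Q l x)"
    by (elim exE conjE) (rule that, blast+)
  show thesis
  proof (rule that[OF h(1)])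
    show "F 0 x \<ominus>\<^bsub>obj P 0\<^esub> G 0 x = bd P 0 (h 0 x)" if "x \<in> carrier (obj Q 0)" for x
      using h(2)[OF that] by (simp add: D_def)
    show "F (Suc l) x \<ominus>\<^bsub>obj P (Suc l)\<^esub> G (Suc l) x = bd P (Suc l) (h (Suc l) x) \<oplus>\<^bsub>obj P (Suc l)\<^esub> h l (bd Q l x)"
      if x: "x \<in> carrier (obj Q (Suc l))" for l x
      using h(3)[OF x] vs_minus_add_cancel[OF PD(11) rmod_homD(1)[OF Dh x] rmod_homD(1)[OF h(1) rmod_homD(1)[OF QD(3) x]]]
      by (simp add: D_def)
  qed
qed

abbreviation ext_class where
  "ext_class P N l z \<equiv> ext_coboundaries A P N l +>\<^bsub>hom_space A (obj P l) N\<^esub> z"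

text \<open>\<open>ext_map\<close> for an arbitrary chain map, possibly between two resolutions, in
  place of the lift chosen by \<open>chain_lift\<close>. In this form lifts and comparison maps can
  be composed with each other.\<close>

definition ext_ind where
  "ext_ind N Q F \<psi> l = quot_map (hom_space A (obj Q l) N) (ext_coboundaries A Q N l) (\<lambda>z. \<lambda>x\<in>carrier (obj Q l). \<psi> (z (F l x)))"

context
  fixes N :: "('k, 'n, 'a, 'z) rmod_scheme"
  assumes N: "right_module A N"
begin

lemma hom_precomp_lin:
  assumes "right_module A X" "right_module A Y" "F \<in> rmod_hom A X Y"
  shows "(\<lambda>z. \<lambda>x\<in>carrier X. z (F x)) \<in> lin (hom_space A Y N) (hom_space A X N)"
  using hom_map_lin[OF assms(1,2) N N assms(3) rmod_hom_id] by simp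

lemma ext_subsp:
  assumes P: "exact_res M P"
  shows "subsp (hom_space A (obj P l) N) (ext_cocycles A P N l)" (is ?Z)
    "subsp (hom_space A (obj P l) N) (ext_coboundaries A P N l)" (is ?B)
    "ext_coboundaries A P N l \<subseteq> ext_cocycles A P N l" (is ?BZ)
proof -
  note PD = exact_resD[OF P] and ND = right_moduleD[OF N]
  note vH = vsp_hom_space[OF PD(2)[of l] N]
  have bc: "bd P l x \<in> carrier (obj P l)" if "x \<in> carrier (obj P (Suc l))" for l x by (rule rmod_homD(1)[OF PD(3) that])
  show ?Z
  proof (rule subspI)
    show "\<zero>\<^bsub>hom_space A (obj P l) N\<^esub> \<in> ext_cocycles A P N l"
      unfolding ext_cocycles_def using vs_zero[OF vH] bc by (simp add: hom_space_simps)
    show "z \<oplus>\<^bsub>hom_space A (obj P l) N\<^esub> w \<in> ext_cocycles A P N l" if "z \<in> ext_cocycles A P N l" "w \<in> ext_cocycles A P N l" for z w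
      using that vs_add[OF vH, of z w] bc ND(1) by (simp add: ext_cocycles_def hom_space_simps)
    show "c \<odot>\<^bsub>hom_space A (obj P l) N\<^esub> z \<in> ext_cocycles A P N l" if "z \<in> ext_cocycles A P N l" for c z
      using that vs_smult[OF vH, of z c] bc ND(1) by (simp add: ext_cocycles_def hom_space_simps)
  qed (auto simp: ext_cocycles_def)
  show ?B
  proof (cases l)
    case 0
    show ?thesis unfolding 0 ext_coboundaries_def nat.case using vsp_hom_space[OF PD(2) N, of 0]
      by (intro subspI) auto
  next
    case (Suc j)
    show ?thesis unfolding Suc ext_coboundaries_def nat.case
      by (rule subsp_image[OF vsp_hom_space[OF PD(2) N] vsp_hom_space[OF PD(2) N] hom_precomp_lin[OF PD(2,2,3)] subsp_self[OF vsp_hom_space[OF PD(2) N]]])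
  qed
  show ?BZ
  proof (cases l)
    case 0
    show ?thesis unfolding 0 ext_coboundaries_def nat.case using subspD(2)[OF \<open>?Z\<close>] 0 by simp
  next
    case (Suc j)
    show ?thesis
    proof
      fix w assume "w \<in> ext_coboundaries A P N l"
      then obtain z where z: "z \<in> carrier (hom_space A (obj P j) N)" "w = (\<lambda>x\<in>carrier (obj P (Suc j)). z (bd P j x))"
        by (auto simp: Suc ext_coboundaries_def)
      have "w \<in> carrier (hom_space A (obj P l) N)" unfolding z(2) Suc by (rule lin_closed[OF hom_precomp_lin[OF PD(2,2,3)] z(1)])
      moreover have "w (bd P l x) = \<zero>\<^bsub>N\<^esub>" if x: "x \<in> carrier (obj P (Suc l))" for x
      proof -
        have "z \<in> lin (obj P j) N" using z(1) by (intro rmod_hom_lin[OF PD(2) N]) (simp add: hom_space_mem)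
        then show ?thesis unfolding z(2) Suc using bc[OF x] x PD(9)[of x j] lin_zero[OF PD(11) ND(1)] by (simp add: Suc)
      qed
      ultimately show "w \<in> ext_cocycles A P N l" by (simp add: ext_cocycles_def)
    qed
  qed
qed

lemma ext_subquot:
  assumes P: "exact_res M P"
    and X: "same_space X (ext_space A P N l)"
  shows "subquot (hom_space A (obj P l) N) (ext_cocycles A P N l) (ext_coboundaries A P N l) X (\<lambda>z. ext_class P N l z)"
  by (rule subquot_quot_space[OF vsp_hom_space[OF exact_resD(2)[OF P] N] ext_subsp[OF P]]) (use X in \<open>simp_all add: ext_space_def\<close>)

context
  fixes Q P M W F \<phi> \<psi>
  assumes Q: "exact_res M Q" and P: "exact_res W P" and F: "chain_map Q P \<phi> F" and \<psi>: "\<psi> \<in> rmod_hom A N N"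
begin

lemma ext_pull:
  shows "(\<lambda>z. \<lambda>x\<in>carrier (obj Q l). \<psi> (z (F l x))) \<in> lin (hom_space A (obj P l) N) (hom_space A (obj Q l) N)"
    "z \<in> ext_cocycles A P N l \<Longrightarrow> (\<lambda>x\<in>carrier (obj Q l). \<psi> (z (F l x))) \<in> ext_cocycles A Q N l"
    "z \<in> ext_coboundaries A P N l \<Longrightarrow> (\<lambda>x\<in>carrier (obj Q l). \<psi> (z (F l x))) \<in> ext_coboundaries A Q N l"
proof -
  note QD = exact_resD[OF Q] and PD = exact_resD[OF P] and FD = chain_mapD[OF F] and ND = right_moduleD[OF N]
  have l: "(\<lambda>z. \<lambda>x\<in>carrier (obj Q l). \<psi> (z (F l x))) \<in> lin (hom_space A (obj P l) N) (hom_space A (obj Q l) N)" for l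
    by (rule hom_map_lin[OF QD(2) PD(2) N N FD(1) \<psi>])
  then show "(\<lambda>z. \<lambda>x\<in>carrier (obj Q l). \<psi> (z (F l x))) \<in> lin (hom_space A (obj P l) N) (hom_space A (obj Q l) N)" .
  have \<psi>0: "\<psi> \<zero>\<^bsub>N\<^esub> = \<zero>\<^bsub>N\<^esub>" by (rule lin_zero[OF ND(1,1) rmod_hom_lin[OF N N \<psi>]])
  have bc: "bd Q l x \<in> carrier (obj Q l)" if "x \<in> carrier (obj Q (Suc l))" for l x by (rule rmod_homD(1)[OF QD(3) that])
  show "(\<lambda>x\<in>carrier (obj Q l). \<psi> (z (F l x))) \<in> ext_cocycles A Q N l" if z: "z \<in> ext_cocycles A P N l"
  proof -
    have zc: "z \<in> carrier (hom_space A (obj P l) N)" "\<And>y. y \<in> carrier (obj P (Suc l)) \<Longrightarrow> z (bd P l y) = \<zero>\<^bsub>N\<^esub>"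
      using z by (auto simp: ext_cocycles_def)
    have "\<psi> (z (F l (bd Q l x))) = \<zero>\<^bsub>N\<^esub>" if x: "x \<in> carrier (obj Q (Suc l))" for x
      using zc(2)[OF rmod_homD(1)[OF FD(1) x]] FD(3)[OF x] \<psi>0 by simp
    then show ?thesis using lin_closed[OF l zc(1)] bc by (simp add: ext_cocycles_def)
  qed
  show "(\<lambda>x\<in>carrier (obj Q l). \<psi> (z (F l x))) \<in> ext_coboundaries A Q N l" if z: "z \<in> ext_coboundaries A P N l"
  proof (cases l)
    case 0
    have "z = \<zero>\<^bsub>hom_space A (obj P 0) N\<^esub>" using z by (simp add: 0 ext_coboundaries_def)
    then have "(\<lambda>x\<in>carrier (obj Q 0). \<psi> (z (F 0 x))) = \<zero>\<^bsub>hom_space A (obj Q 0) N\<^esub>"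
      using lin_zero[OF vsp_hom_space[OF PD(2) N] vsp_hom_space[OF QD(2) N] l, of 0] by simp
    then show ?thesis by (simp add: 0 ext_coboundaries_def)
  next
    case (Suc j)
    obtain w where w: "w \<in> carrier (hom_space A (obj P j) N)" "z = (\<lambda>x\<in>carrier (obj P (Suc j)). w (bd P j x))"
      using z by (auto simp: Suc ext_coboundaries_def)
    have "(\<lambda>x\<in>carrier (obj Q (Suc j)). \<psi> (z (F (Suc j) x))) =
       (\<lambda>x\<in>carrier (obj Q (Suc j)). (\<lambda>x\<in>carrier (obj Q j). \<psi> (w (F j x))) (bd Q j x))"
      by (rule restrict_ext) (use w(2) rmod_homD(1)[OF FD(1)] FD(3) bc in simp)
    then show ?thesis unfolding Suc ext_coboundaries_def nat.case using lin_closed[OF l w(1)] by (rule image_eqI)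
  qed
qed

lemma ext_ind_class:
  assumes z: "z \<in> ext_cocycles A P N l"
  shows "ext_ind N Q F \<psi> l (ext_class P N l z) = ext_class Q N l (\<lambda>x\<in>carrier (obj Q l). \<psi> (z (F l x)))"
  unfolding ext_ind_def
proof (rule quot_map_coset[OF _ _ _ _ _ _ _ _ z])
  show "vsp (hom_space A (obj Q l) N)" "vsp (hom_space A (obj P l) N)"
    using vsp_hom_space exact_resD(2)[OF Q] exact_resD(2)[OF P] N by auto
  show "(\<lambda>z. \<lambda>x\<in>carrier (obj Q l). \<psi> (z (F l x))) \<in> lin ((hom_space A (obj P l) N)\<lparr>carrier := ext_cocycles A P N l\<rparr>) (hom_space A (obj Q l) N)"
    by (rule lin_restrict_dom[OF ext_pull(1) subspD(1)[OF ext_subsp(1)[OF P]]])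
qed (use ext_subsp[OF P] ext_subsp[OF Q] ext_pull(3) subspD(1)[OF ext_subsp(1)[OF P]] in auto)

lemma ext_ind_lin:
  assumes X: "same_space X (ext_space A P N l)"
    and Y: "same_space Y (ext_space A Q N l)"
  shows "ext_ind N Q F \<psi> l \<in> lin X Y"
proof -
  have f: "(\<lambda>z. \<lambda>x\<in>carrier (obj Q l). \<psi> (z (F l x))) \<in>
      lin ((hom_space A (obj P l) N)\<lparr>carrier := ext_cocycles A P N l\<rparr>) ((hom_space A (obj Q l) N)\<lparr>carrier := ext_cocycles A Q N l\<rparr>)"
    by (rule lin_restrict[OF ext_pull(1) subspD(1)[OF ext_subsp(1)[OF P]]]) (use ext_pull(2) in auto)
  have g: "(\<lambda>z. ext_class Q N l (\<lambda>x\<in>carrier (obj Q l). \<psi> (z (F l x)))) \<in> lin ((hom_space A (obj P l) N)\<lparr>carrier := ext_cocycles A P N l\<rparr>) Y"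
    by (rule lin_comp[OF f subquotD(6)[OF ext_subquot[OF Q Y]]])
  show ?thesis by (rule subquot_lin[OF ext_subquot[OF P X] g ext_ind_class])
qed

end

lemma ext_space_cases:
  assumes "exact_res M P" "X \<in> carrier (ext_space A P N l)"
  obtains z where "z \<in> ext_cocycles A P N l" "X = ext_class P N l z"
  using subquot_cases[OF ext_subquot[OF assms(1) same_space_refl] assms(2)] that by blast

text \<open>Homotopic chain maps induce the same map on cohomology. In degree 0 the images of a
  cocycle even coincide, because the homotopy has no second summand there.\<close>

lemma ext_ind_cong:
  assumes Q: "exact_res M Q" and P: "exact_res W P" and ls: "\<And>l. lifts (obj Q l) (obj P (Suc l)) (obj P l)"
    and F: "chain_map Q P \<phi> F" and G: "chain_map Q P \<phi>' G" and eq: "\<And>x. x \<in> carrier M \<Longrightarrow> \<phi> x = \<phi>' x"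
    and \<psi>: "\<psi> \<in> rmod_hom A N N" and \<psi>': "\<psi>' \<in> rmod_hom A N N" and eq': "\<And>y. y \<in> carrier N \<Longrightarrow> \<psi> y = \<psi>' y"
    and X: "X \<in> carrier (ext_space A P N l)"
  shows "ext_ind N Q F \<psi> l X = ext_ind N Q G \<psi>' l X"
proof -
  note QD = exact_resD[OF Q] and PD = exact_resD[OF P] and FD = chain_mapD[OF F] and GD = chain_mapD[OF G] and ND = right_moduleD[OF N]
  obtain h where h: "\<And>l. h l \<in> rmod_hom A (obj Q l) (obj P (Suc l))"
    "\<And>x. x \<in> carrier (obj Q 0) \<Longrightarrow> F 0 x \<ominus>\<^bsub>obj P 0\<^esub> G 0 x = bd P 0 (h 0 x)"
    "\<And>l x. x \<in> carrier (obj Q (Suc l)) \<Longrightarrow>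
       F (Suc l) x \<ominus>\<^bsub>obj P (Suc l)\<^esub> G (Suc l) x = bd P (Suc l) (h (Suc l) x) \<oplus>\<^bsub>obj P (Suc l)\<^esub> h l (bd Q l x)"
    by (rule chain_map_homotopic[OF Q P ls F G eq], assumption) (rule that, assumption+)
  obtain z where z: "z \<in> ext_cocycles A P N l" and Xz: "X = ext_class P N l z" by (rule ext_space_cases[OF P X])
  have zc: "z \<in> carrier (hom_space A (obj P l) N)" "\<And>y. y \<in> carrier (obj P (Suc l)) \<Longrightarrow> z (bd P l y) = \<zero>\<^bsub>N\<^esub>"
    using z by (auto simp: ext_cocycles_def)
  have zh: "z \<in> rmod_hom A (obj P l) N" using zc(1) by (simp add: hom_space_mem)
  have zl: "z \<in> lin (obj P l) N" by (rule rmod_hom_lin[OF PD(2) N zh])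
  have \<psi>l: "\<psi> \<in> lin N N" by (rule rmod_hom_lin[OF N N \<psi>])
  have \<psi>0: "\<psi> \<zero>\<^bsub>N\<^esub> = \<zero>\<^bsub>N\<^esub>" by (rule lin_zero[OF ND(1,1) \<psi>l])
  let ?H = "hom_space A (obj Q l) N"
  let ?f = "\<lambda>x\<in>carrier (obj Q l). \<psi> (z (F l x))" and ?g = "\<lambda>x\<in>carrier (obj Q l). \<psi> (z (G l x))"
  have g': "(\<lambda>x\<in>carrier (obj Q l). \<psi>' (z (G l x))) = ?g"
    by (rule restrict_ext) (use eq' rmod_homD(1)[OF zh rmod_homD(1)[OF GD(1)]] in simp)
  have fc: "?f \<in> carrier ?H" "?g \<in> carrier ?H"
    by (rule lin_closed[OF ext_pull(1)[OF Q P F \<psi>] zc(1)], rule lin_closed[OF ext_pull(1)[OF Q P G \<psi>] zc(1)])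
  note vH = vsp_hom_space[OF QD(2) N]
  have m: "(?f \<ominus>\<^bsub>?H\<^esub> ?g) x = \<psi> (z (F l x \<ominus>\<^bsub>obj P l\<^esub> G l x))" if x: "x \<in> carrier (obj Q l)" for x
  proof -
    have "(?f \<ominus>\<^bsub>?H\<^esub> ?g) x = ?f x \<ominus>\<^bsub>N\<^esub> ?g x"
      by (rule lin_minus[OF vH ND(1) hom_space_eval[OF x] fc])
    also have "\<dots> = \<psi> (z (F l x)) \<ominus>\<^bsub>N\<^esub> \<psi> (z (G l x))" using x by simp
    also have "\<dots> = \<psi> (z (F l x \<ominus>\<^bsub>obj P l\<^esub> G l x))"
      using lin_minus[OF PD(11) ND(1) lin_comp[OF zl \<psi>l] rmod_homD(1)[OF FD(1) x] rmod_homD(1)[OF GD(1) x]] by simp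
    finally show ?thesis .
  qed
  have "?f \<ominus>\<^bsub>?H\<^esub> ?g \<in> ext_coboundaries A Q N l"
  proof (cases l)
    case 0
    have "?f \<ominus>\<^bsub>?H\<^esub> ?g = \<zero>\<^bsub>?H\<^esub>"
    proof (rule hom_space_eqI[OF vs_minus[OF vH fc] vs_zero[OF vH]])
      fix x assume x: "x \<in> carrier (obj Q l)"
      have x0: "x \<in> carrier (obj Q 0)" using x 0 by simp
      have "z (F l x \<ominus>\<^bsub>obj P l\<^esub> G l x) = \<zero>\<^bsub>N\<^esub>"
        using h(2)[OF x0] zc(2)[unfolded 0, OF rmod_homD(1)[OF h(1) x0]] 0 by simp
      then show "(?f \<ominus>\<^bsub>?H\<^esub> ?g) x = \<zero>\<^bsub>?H\<^esub> x" unfolding m[OF x] using \<psi>0 x by (simp add: hom_space_simps)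
    qed
    then show ?thesis using 0 by (simp add: ext_coboundaries_def)
  next
    case (Suc j)
    \<comment> \<open>The cochain whose coboundary is the difference: of the two summands of the
      homotopy relation, \<open>z\<close> kills the one that is a boundary in
      \<open>P\<close>.\<close>
    define w where "w = (\<lambda>x\<in>carrier (obj Q j). \<psi> (z (h j x)))"
    have hj: "h j \<in> rmod_hom A (obj Q j) (obj P l)" using h(1)[of j] Suc by simp
    have wc: "w \<in> carrier (hom_space A (obj Q j) N)"
      unfolding w_def by (rule lin_closed[OF hom_map_lin[OF QD(2) PD(2) N N hj \<psi>] zc(1)])
    have wb: "(\<lambda>x\<in>carrier (obj Q (Suc j)). w (bd Q j x)) \<in> carrier ?H"
      unfolding Suc by (rule lin_closed[OF hom_precomp_lin[OF QD(2,2,3)] wc])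
    have "?f \<ominus>\<^bsub>?H\<^esub> ?g = (\<lambda>x\<in>carrier (obj Q (Suc j)). w (bd Q j x))"
    proof (rule hom_space_eqI[OF vs_minus[OF vH fc] wb])
      fix x assume x: "x \<in> carrier (obj Q l)"
      have x': "x \<in> carrier (obj Q (Suc j))" using x Suc by simp
      have bx: "bd Q j x \<in> carrier (obj Q j)" by (rule rmod_homD(1)[OF QD(3) x'])
      have hx: "h l x \<in> carrier (obj P (Suc l))" "h j (bd Q j x) \<in> carrier (obj P l)"
        by (rule rmod_homD(1)[OF h(1) x], rule rmod_homD(1)[OF hj bx])
      have "z (F l x \<ominus>\<^bsub>obj P l\<^esub> G l x) = z (bd P l (h l x) \<oplus>\<^bsub>obj P l\<^esub> h j (bd Q j x))"
        using h(3)[OF x'] Suc by simp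
      also have "\<dots> = z (bd P l (h l x)) \<oplus>\<^bsub>N\<^esub> z (h j (bd Q j x))"
        by (rule lin_add[OF zl rmod_homD(1)[OF PD(3) hx(1)] hx(2)])
      also have "\<dots> = z (h j (bd Q j x))" using zc(2)[OF hx(1)] rmod_homD(1)[OF zh hx(2)] ND(1) by simp
      finally show "(?f \<ominus>\<^bsub>?H\<^esub> ?g) x = (\<lambda>x\<in>carrier (obj Q (Suc j)). w (bd Q j x)) x"
        unfolding m[OF x] using x' bx by (simp add: w_def)
    qed
    then show ?thesis unfolding Suc ext_coboundaries_def nat.case using wc by (rule image_eqI)
  qed
  then have "ext_class Q N l ?f = ext_class Q N l ?g" by (subst coset_eq_iff[OF vH ext_subsp(2)[OF Q] fc])
  then show ?thesis unfolding Xz ext_ind_class[OF Q P F \<psi> z] ext_ind_class[OF Q P G \<psi>' z] g' .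
qed

end

end

context elem_alg
begin

text \<open>For the finite complex of finite-dimensional spaces \<open>Hom(Q, N)\<close> the
  alternating trace may be computed on the terms instead of the cohomology, and there dual bases
  evaluate it.\<close>

lemma ext_euler:
  assumes N: "right_module A N" "fd N" and Q: "exact_res M Q" and db: "\<And>l. dual_basis (obj Q l) {..<m l} (S l) (q l)"
    and L: "\<And>l. l > L \<Longrightarrow> zero_space (obj Q l)"
    and \<Phi>: "chain_map Q Q \<phi> \<Phi>" and \<psi>: "\<psi> \<in> rmod_hom A N N"
  shows "(\<Sum>l\<le>L. (- 1) ^ l * lin_trace (ext_space A Q N l) (ext_ind N Q \<Phi> \<psi> l)) =
    (\<Sum>j<n. (\<Sum>l\<le>L. (- 1) ^ l * mult_trace (m l) (S l) (q l) (\<Phi> l) j) * lin_trace N (\<lambda>y. \<psi> (ract N y (e j))))"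
    "l > L \<Longrightarrow> zero_space (ext_space A Q N l)" "fd (ext_space A Q N l)"
proof -
  note QD = exact_resD[OF Q] and \<Phi>D = chain_mapD[OF \<Phi>] and ND = right_moduleD[OF N(1)]
  let ?H = "\<lambda>l. hom_space A (obj Q l) N"
  let ?T = "\<lambda>l z. \<lambda>x\<in>carrier (obj Q l). \<psi> (z (\<Phi> l x))"
  note sq = ext_subquot[OF N(1) Q same_space_refl]
  note vH = vsp_hom_space[OF QD(2) N(1)] and fH = fd_hom_space[OF db N]
  note p = ext_pull[OF N(1) Q Q \<Phi> \<psi>]
  show "fd (ext_space A Q N l)" by (rule subquot_fd[OF sq fH])
  have H0: "zero_space (?H l)" if l: "l > L" for l
  proof -
    have "z = \<zero>\<^bsub>?H l\<^esub>" if z: "z \<in> carrier (?H l)" for z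
    proof (rule hom_space_eqI[OF z vs_zero[OF vH]])
      fix x assume x: "x \<in> carrier (obj Q l)"
      have x0: "x = \<zero>\<^bsub>obj Q l\<^esub>" using x L[OF l] by simp
      have "z x = \<zero>\<^bsub>N\<^esub>" unfolding x0
        by (rule lin_zero[OF QD(11) ND(1) rmod_hom_lin[OF QD(2) N(1)]]) (use z in \<open>simp add: hom_space_mem\<close>)
      then show "z x = \<zero>\<^bsub>?H l\<^esub> x" using x by (simp add: hom_space_simps)
    qed
    then show ?thesis using vs_zero[OF vH] by blast
  qed
  show "zero_space (ext_space A Q N l)" if l: "l > L"
  proof (rule subquot_trivial[OF sq])
    show "ext_cocycles A Q N l \<subseteq> ext_coboundaries A Q N l"
      using H0[OF l] subspD(1)[OF ext_subsp(1)[OF N(1) Q, of l]] subspD(2)[OF ext_subsp(2)[OF N(1) Q, of l]] by auto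
  qed
  \<comment> \<open>Traces on coboundaries. The telescope closes because degree 0 has only the zero
    coboundary and the cochains in degree \<open>Suc L\<close> are zero.\<close>
  define b where "b l = lin_trace ((?H l)\<lparr>carrier := ext_coboundaries A Q N l\<rparr>) (?T l)" for l
  have bl: "lin_trace (?H l) (?T l) - lin_trace (ext_space A Q N l) (ext_ind N Q \<Phi> \<psi> l) = b l + b (Suc l)" for l
  proof -
    let ?B = "(?H (Suc l))\<lparr>carrier := ext_coboundaries A Q N (Suc l)\<rparr>"
    let ?d = "\<lambda>z. \<lambda>x\<in>carrier (obj Q (Suc l)). z (bd Q l x)"
    note sB = ext_subsp(2)[OF N(1) Q, of "Suc l"]
    have d: "?d \<in> lin (?H l) ?B"
      using lin_restrict[OF hom_precomp_lin[OF N(1) QD(2,2,3)], of "carrier (?H l)" l "ext_coboundaries A Q N (Suc l)"]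
      by (simp add: ext_coboundaries_def)
    have dc: "?d ` carrier (?H l) = carrier ?B" by (simp add: ext_coboundaries_def)
    have TB: "?T (Suc l) \<in> lin ?B ?B"
      by (rule lin_restrict[OF p(1) subspD(1)[OF sB]]) (use p(3) in auto)
    have "lin_trace (?H l) (?T l) = lin_trace ((?H l)\<lparr>carrier := {z \<in> carrier (?H l). ?d z = \<zero>\<^bsub>?B\<^esub>}\<rparr>) (?T l) + lin_trace ?B (?T (Suc l))"
    proof (rule lin_trace_exact[OF vH fH vsp_subsp[OF vH sB] d dc p(1) TB])
      fix z assume z: "z \<in> carrier (?H l)"
      show "?d (?T l z) = ?T (Suc l) (?d z)"
        by (rule restrict_ext) (use rmod_homD(1)[OF QD(3)[of l]] rmod_homD(1)[OF \<Phi>D(1)[of "Suc l"]] \<Phi>D(3) in simp)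
    qed
    moreover have "{z \<in> carrier (?H l). ?d z = \<zero>\<^bsub>?B\<^esub>} = ext_cocycles A Q N l"
    proof -
      have "?d z = \<zero>\<^bsub>?B\<^esub> \<longleftrightarrow> (\<forall>x\<in>carrier (obj Q (Suc l)). z (bd Q l x) = \<zero>\<^bsub>N\<^esub>)" for z
        by (auto simp: hom_space_simps fun_eq_iff restrict_def)
      then show ?thesis by (simp add: ext_cocycles_def)
    qed
    moreover have "lin_trace ((?H l)\<lparr>carrier := ext_cocycles A Q N l\<rparr>) (?T l) = b l + lin_trace (ext_space A Q N l) (ext_ind N Q \<Phi> \<psi> l)"
      unfolding b_def by (rule subquot_trace[OF sq fH p(1)]; elim p(2) ext_ind_class[OF N(1) Q Q \<Phi> \<psi>])
    ultimately show ?thesis by (simp add: b_def)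
  qed
  have b0: "b l = 0" if B: "ext_coboundaries A Q N l \<subseteq> {\<zero>\<^bsub>?H l\<^esub>}" for l
  proof -
    define T where "T = ?T l"
    have T0: "T \<zero>\<^bsub>?H l\<^esub> = \<zero>\<^bsub>?H l\<^esub>" unfolding T_def by (rule lin_zero[OF vH vH p(1)])
    note B' = ext_subsp(2)[OF N(1) Q, of l]
    have "lin_trace ((?H l)\<lparr>carrier := ext_coboundaries A Q N l\<rparr>) T = 0"
      by (rule lin_trace_zero[OF vsp_subsp[OF vH B'] fd_subsp[OF vH fH B']]) (use B T0 in auto)
    then show ?thesis unfolding T_def b_def .
  qed
  have "b 0 = 0" by (rule b0) (simp only: ext_coboundaries_def nat.case)
  moreover have "b (Suc L) = 0"
    by (rule b0) (use subspD(1)[OF ext_subsp(2)[OF N(1) Q, of "Suc L"]] in \<open>simp only: H0[OF lessI]\<close>)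
  ultimately show "(\<Sum>l\<le>L. (- 1) ^ l * lin_trace (ext_space A Q N l) (ext_ind N Q \<Phi> \<psi> l)) =
    (\<Sum>j<n. (\<Sum>l\<le>L. (- 1) ^ l * mult_trace (m l) (S l) (q l) (\<Phi> l) j) * lin_trace N (\<lambda>y. \<psi> (ract N y (e j))))"
    by (intro alternating_sum_exact[of "\<lambda>l. lin_trace (?H l) (?T l)" "\<lambda>l. lin_trace (ext_space A Q N l) (ext_ind N Q \<Phi> \<psi> l)" b, OF bl]
      lin_trace_hom_eq[OF db N \<Phi>D(1) \<psi>])
qed

end

text \<open>\<open>alt_trace_matrix\<close> runs over the nonzero terms; this lemma allows the zero
  terms to be included.\<close>

lemma lin_trace_trivial_image:
  assumes X: "vsp X" "fd X" "zero_space X" and E: "E \<in> lin X X" and \<theta>: "\<theta> \<in> lin X X"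
    and U: "U = E ` carrier X"
  shows "lin_trace (X\<lparr>carrier := U\<rparr>) \<theta> = 0"
proof -
  have u: "U = carrier X" unfolding U X(3) using lin_zero[OF X(1,1) E] by simp
  have "X\<lparr>carrier := U\<rparr> = X" unfolding u by simp
  moreover have "lin_trace X \<theta> = 0" using lin_closed[OF \<theta>] X(3) by (intro lin_trace_zero X(1,2)) simp
  ultimately show ?thesis by simp
qed

context fin_alg
begin

lemma ext_map_eq_ind: "ext_map A P N \<phi> \<psi> l = ext_ind N P (chain_lift A P \<phi>) \<psi> l"
  by (simp add: ext_map_def ext_ind_def)

text \<open>Contravariant in the chain map and covariant in the endomorphism of \<open>N\<close>:
  the chain map of the outer factor is applied first.\<close>

lemma ext_ind_comp:
  assumes N: "right_module A N" and P: "exact_res W P" and Q: "exact_res V Q" and R: "exact_res M R"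
    and F: "chain_map Q P \<phi> F" and G: "chain_map R Q \<phi>' G"
    and \<psi>: "\<psi> \<in> rmod_hom A N N" and \<psi>': "\<psi>' \<in> rmod_hom A N N" and X: "X \<in> carrier (ext_space A P N l)"
  shows "ext_ind N R G \<psi>' l (ext_ind N Q F \<psi> l X) = ext_ind N R (\<lambda>l x. F l (G l x)) (\<lambda>y. \<psi>' (\<psi> y)) l X"
proof -
  obtain z where z: "z \<in> ext_cocycles A P N l" and Xz: "X = ext_class P N l z" by (rule ext_space_cases[OF N P X])
  define w where "w = (\<lambda>x\<in>carrier (obj Q l). \<psi> (z (F l x)))"
  have w: "w \<in> ext_cocycles A Q N l" unfolding w_def by (rule ext_pull(2)[OF N Q P F \<psi> z])
  have 1: "ext_ind N Q F \<psi> l X = ext_class Q N l w" unfolding Xz w_def by (rule ext_ind_class[OF N Q P F \<psi> z])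
  have 2: "ext_ind N R G \<psi>' l (ext_class Q N l w) = ext_class R N l (\<lambda>x\<in>carrier (obj R l). \<psi>' (w (G l x)))"
    by (rule ext_ind_class[OF N R Q G \<psi>' w])
  have 3: "ext_ind N R (\<lambda>l x. F l (G l x)) (\<lambda>y. \<psi>' (\<psi> y)) l X = ext_class R N l (\<lambda>x\<in>carrier (obj R l). \<psi>' (\<psi> (z (F l (G l x)))))"
    unfolding Xz by (rule ext_ind_class[OF N R P chain_map_comp[OF G F R] rmod_hom_comp[OF \<psi> \<psi>'] z])
  have 4: "(\<lambda>x\<in>carrier (obj R l). \<psi>' (w (G l x))) = (\<lambda>x\<in>carrier (obj R l). \<psi>' (\<psi> (z (F l (G l x)))))"
    by (rule restrict_ext) (use rmod_homD(1)[OF chain_mapD(1)[OF G]] in \<open>simp add: w_def\<close>)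
  show ?thesis unfolding 1 2 3 4 ..
qed

lemma ext_ind_id:
  assumes N: "right_module A N" and P: "exact_res M P" and X: "X \<in> carrier (ext_space A P N l)"
  shows "ext_ind N P (\<lambda>l x. x) (\<lambda>y. y) l X = X"
proof -
  obtain z where z: "z \<in> ext_cocycles A P N l" and Xz: "X = ext_class P N l z" by (rule ext_space_cases[OF N P X])
  have "(\<lambda>x\<in>carrier (obj P l). z x) = z"
    by (rule extensional_restrict) (use z in \<open>simp add: ext_cocycles_def hom_space_mem\<close>)
  then show ?thesis using ext_ind_class[OF N P P chain_map_id rmod_hom_id z] unfolding Xz by simp
qed

text \<open>One entry of the trace matrix, moved to the finite resolution. The maps \<open>u\<close>
  and \<open>v\<close> are the actions of two idempotents, and \<open>\<Phi>\<close> collects the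
  chain maps in the order in which they compose. The lift chosen for the identity is only homotopic
  to the identity, so it remains in \<open>\<Phi>\<close>.\<close>

lemma ext_transfer:
  fixes N :: "('k, 'n, 'a, 'z) rmod_scheme" and X :: "('k, ('p \<Rightarrow> 'n) set, 'x) module_scheme"
    and P :: "('k, 'p, 'a, 'm) resolution"
  assumes M: "right_module A M" and N: "right_module A N" and fN: "fd N" and P: "projective_resolution A M P"
    and Q: "exact_res M Q" and db: "dual_basis (obj Q l) {..<m::nat} S q"
    and \<alpha>: "chain_map P Q (\<lambda>x. x) \<alpha>" and \<beta>: "chain_map Q P (\<lambda>x. x) \<beta>"
    and \<phi>: "\<phi> \<in> rmod_hom A M M" and u: "u \<in> rmod_hom A M M"
    and uu: "\<And>x. x \<in> carrier M \<Longrightarrow> u (u x) = u x" "\<And>x. x \<in> carrier M \<Longrightarrow> u (\<phi> x) = \<phi> (u x)"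
    and \<psi>: "\<psi> \<in> rmod_hom A N N" and v: "v \<in> rmod_hom A N N"
    and vv: "\<And>y. y \<in> carrier N \<Longrightarrow> v (v y) = v y" "\<And>y. y \<in> carrier N \<Longrightarrow> v (\<psi> y) = \<psi> (v y)"
    and X: "same_space X (ext_space A P N l)"
  defines "\<Phi> \<equiv> \<lambda>l x. \<alpha> l (chain_lift A P \<phi> l (chain_lift A P u l (chain_lift A P (\<lambda>x. x) l (\<beta> l x))))"
  shows "fd X" "zero_space (ext_space A Q N l) \<Longrightarrow> zero_space X"
    "lin_trace (X\<lparr>carrier := {ext_map A P N (\<lambda>x. x) v l (ext_map A P N u (\<lambda>y. y) l x) | x. x \<in> carrier X}\<rparr>) (ext_map A P N \<phi> \<psi> l)
      = lin_trace (ext_space A Q N l) (ext_ind N Q \<Phi> (\<lambda>y. v (\<psi> y)) l)" (is "lin_trace (X\<lparr>carrier := ?U\<rparr>) _ = _")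
    "zero_space X \<Longrightarrow>
      lin_trace (X\<lparr>carrier := {ext_map A P N (\<lambda>x. x) v l (ext_map A P N u (\<lambda>y. y) l x) | x. x \<in> carrier X}\<rparr>) (ext_map A P N \<phi> \<psi> l) = 0"
    "chain_map Q Q (\<lambda>x. \<phi> (u x)) \<Phi>"
proof -
  note EP = exact_res_projective[OF M P] and i = rmod_hom_id
  note lP = projective_lifts[OF EP(2) exact_resD(2)[OF EP(1)] exact_resD(2)[OF EP(1)]]
  let ?Y = "ext_space A Q N l" and ?a = "ext_ind N Q \<beta> (\<lambda>y. y) l" and ?b = "ext_ind N P \<alpha> (\<lambda>y. y) l"
  note sqQ = ext_subquot[OF N Q same_space_refl] and sqP = ext_subquot[OF N EP(1) X]
  have fY: "fd ?Y" by (rule subquot_fd[OF sqQ fd_hom_space[OF db N fN]])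
  define \<theta> where "\<theta> = ext_ind N P (chain_lift A P \<phi>) \<psi> l"
  define E1 where "E1 = ext_ind N P (chain_lift A P u) (\<lambda>y. y) l"
  define E2 where "E2 = ext_ind N P (chain_lift A P (\<lambda>x. x)) v l"
  note c\<phi> = chain_lift[OF M P \<phi>] and cu = chain_lift[OF M P u] and ci = chain_lift[OF M P i]
  note lin = ext_ind_lin[OF N EP(1) EP(1) _ _ X X]
  have lE1: "E1 \<in> lin X X" unfolding E1_def by (rule lin[OF cu i])
  have lE2: "E2 \<in> lin X X" unfolding E2_def by (rule lin[OF ci v])
  have l\<theta>: "\<theta> \<in> lin X X" unfolding \<theta>_def by (rule lin[OF c\<phi> \<psi>])
  have a: "?a \<in> lin X ?Y" by (rule ext_ind_lin[OF N Q EP(1) \<beta> i X same_space_refl])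
  have b: "?b \<in> lin ?Y X" by (rule ext_ind_lin[OF N EP(1) Q \<alpha> i same_space_refl X])
  have ba: "?b (?a x) = x" if x: "x \<in> carrier X" for x
  proof -
    have xP: "x \<in> carrier (ext_space A P N l)" using x X(1) by simp
    have "?b (?a x) = ext_ind N P (\<lambda>l x. \<beta> l (\<alpha> l x)) (\<lambda>y. y) l x"
      by (rule ext_ind_comp[OF N EP(1) Q EP(1) \<beta> \<alpha> i i xP])
    also have "\<dots> = ext_ind N P (\<lambda>l x. x) (\<lambda>y. y) l x"
      by (rule ext_ind_cong[OF N EP(1) EP(1) lP chain_map_comp[OF \<alpha> \<beta> EP(1)] chain_map_id refl i i refl xP])
    also have "\<dots> = x" by (rule ext_ind_id[OF N EP(1) xP])
    finally show ?thesis .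
  qed
  let ?E = "\<lambda>x. E2 (E1 x)"
  have lE: "?E \<in> lin X X" by (rule lin_comp[OF lE1 lE2])
  note cp = chain_map_comp[OF _ _ EP(1)] and vp = rmod_hom_comp
  note comp = ext_ind_comp[OF N EP(1) EP(1) EP(1)]
  have E12: "?E x = ext_ind N P (\<lambda>l x. chain_lift A P u l (chain_lift A P (\<lambda>x. x) l x)) v l x" (is "_ = ext_ind N P ?F v l x")
    if x: "x \<in> carrier (ext_space A P N l)" for x
    unfolding E1_def E2_def by (rule comp[OF cu ci i v x])
  have cF: "chain_map P P u ?F" by (rule cp[OF ci cu])
  have \<theta>E: "\<theta> (?E x) = ext_ind N P (\<lambda>l x. ?F l (chain_lift A P \<phi> l x)) (\<lambda>y. \<psi> (v y)) l x"
    if x: "x \<in> carrier (ext_space A P N l)" for x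
    unfolding E12[OF x] \<theta>_def by (rule comp[OF cF c\<phi> v \<psi> x])
  have E\<theta>: "?E (\<theta> x) = ext_ind N P (\<lambda>l x. chain_lift A P \<phi> l (?F l x)) (\<lambda>y. v (\<psi> y)) l x"
    if x: "x \<in> carrier (ext_space A P N l)" for x
  proof -
    have t: "\<theta> x \<in> carrier (ext_space A P N l)" using lin_closed[OF l\<theta>, of x] x X(1) by simp
    show ?thesis unfolding E12[OF t] unfolding \<theta>_def by (rule comp[OF c\<phi> cF \<psi> v x])
  qed
  \<comment> \<open>Both sides are induced by lifts of module maps that agree on \<open>M\<close>,
    since \<open>u\<close> is idempotent and commutes with \<open>\<phi>\<close>, and likewise on
    \<open>N\<close>; uniqueness up to homotopy does the rest.\<close>
  have c: "?E (\<theta> (?E x)) = \<theta> (?E x)" if x: "x \<in> carrier X" for x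
  proof -
    have xP: "x \<in> carrier (ext_space A P N l)" using x X(1) by simp
    have t: "\<theta> (?E x) \<in> carrier (ext_space A P N l)" using lin_closed[OF l\<theta> lin_closed[OF lE x]] X(1) by simp
    have "?E (\<theta> (?E x)) = ext_ind N P (\<lambda>l x. ?F l (chain_lift A P \<phi> l (?F l x))) (\<lambda>y. v (\<psi> (v y))) l x"
      unfolding E12[OF t] unfolding \<theta>E[OF xP] by (rule comp[OF cp[OF c\<phi> cF] cF vp[OF v \<psi>] v xP])
    also have "\<dots> = ext_ind N P (\<lambda>l x. ?F l (chain_lift A P \<phi> l x)) (\<lambda>y. \<psi> (v y)) l x"
      by (rule ext_ind_cong[OF N EP(1) EP(1) lP cp[OF cF cp[OF c\<phi> cF]] cp[OF c\<phi> cF] _ vp[OF vp[OF v \<psi>] v] vp[OF v \<psi>] _ xP])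
        (use uu vv rmod_homD(1)[OF \<phi>] rmod_homD(1)[OF u] rmod_homD(1)[OF v] in simp_all)
    also have "\<dots> = \<theta> (?E x)" by (rule \<theta>E[OF xP, symmetric])
    finally show ?thesis .
  qed
  have U: "?U = ?E ` carrier X" unfolding ext_map_eq_ind E1_def E2_def by blast
  note tr = lin_trace_transfer[OF subquotD(5)[OF sqP] subquotD(5)[OF sqQ] fY a b ba lE l\<theta> U c]
  show "fd X" by (rule tr(1))
  show "zero_space X" if "zero_space ?Y" by (rule tr(3)[OF _ _ that])
  have "lin_trace (X\<lparr>carrier := ?U\<rparr>) \<theta> = lin_trace ?Y (\<lambda>y. ?a (?E (\<theta> (?b y))))" by (rule tr(2))
  also have "\<dots> = lin_trace ?Y (ext_ind N Q \<Phi> (\<lambda>y. v (\<psi> y)) l)"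
  proof (rule lin_trace_cong[OF subquotD(5)[OF sqQ] fY lin_comp[OF lin_comp[OF lin_comp[OF b l\<theta>] lE] a]])
    fix y assume y: "y \<in> carrier ?Y"
    have by': "?b y \<in> carrier (ext_space A P N l)" using lin_closed[OF b y] X(1) by simp
    have "?a (?E (\<theta> (?b y))) = ?a (ext_ind N P (\<lambda>l x. chain_lift A P \<phi> l (?F l x)) (\<lambda>y. v (\<psi> y)) l (?b y))"
      unfolding E\<theta>[OF by'] ..
    also have "\<dots> = ?a (ext_ind N P (\<lambda>l x. \<alpha> l (chain_lift A P \<phi> l (?F l x))) (\<lambda>y. v (\<psi> y)) l y)"
      unfolding ext_ind_comp[OF N Q EP(1) EP(1) \<alpha> cp[OF cF c\<phi>] i vp[OF \<psi> v] y] ..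
    also have "\<dots> = ext_ind N Q \<Phi> (\<lambda>y. v (\<psi> y)) l y"
      unfolding \<Phi>_def by (rule ext_ind_comp[OF N Q EP(1) Q cp[OF cp[OF cF c\<phi>] \<alpha>] \<beta> vp[OF \<psi> v] i y])
    finally show "?a (?E (\<theta> (?b y))) = ext_ind N Q \<Phi> (\<lambda>y. v (\<psi> y)) l y" .
  qed
  finally show "lin_trace (X\<lparr>carrier := ?U\<rparr>) (ext_map A P N \<phi> \<psi> l) = lin_trace ?Y (ext_ind N Q \<Phi> (\<lambda>y. v (\<psi> y)) l)"
    by (simp only: ext_map_eq_ind \<theta>_def)
  show "lin_trace (X\<lparr>carrier := ?U\<rparr>) (ext_map A P N \<phi> \<psi> l) = 0" if "zero_space X"
    using lin_trace_trivial_image[OF subquotD(5)[OF sqP] tr(1) that lE l\<theta> U] by (simp only: ext_map_eq_ind \<theta>_def)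
  show "chain_map Q Q (\<lambda>x. \<phi> (u x)) \<Phi>"
    unfolding \<Phi>_def by (rule chain_map_comp[OF \<beta> cp[OF cp[OF cF c\<phi>] \<alpha>] Q])
qed

end


text \<open>Replaces the set of nonzero degrees, which is not known explicitly, by the initial
  segment up to \<open>L\<close>.\<close>

lemma alt_trace_matrix_eqI:
  assumes L: "\<And>l. l > L \<Longrightarrow> zero_space (X l)"
    and z: "\<And>l i j. zero_space (X l) \<Longrightarrow> i < length rs \<Longrightarrow> j < length ss \<Longrightarrow> trace_matrix rs ss (X l) (\<theta> l) $$ (i, j) = 0"
    and R: "R \<in> carrier_mat (length rs) (length ss)"
    and s: "\<And>i j. i < length rs \<Longrightarrow> j < length ss \<Longrightarrow> (\<Sum>l\<le>L. (- 1) ^ l * trace_matrix rs ss (X l) (\<theta> l) $$ (i, j)) = R $$ (i, j)"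
  shows "alt_trace_matrix rs ss X \<theta> = R"
proof (rule eq_matI)
  fix i j assume "i < dim_row R" "j < dim_col R"
  then have ij: "i < length rs" "j < length ss" using R by auto
  have "(\<Sum>l | carrier (X l) \<noteq> {\<zero>\<^bsub>X l\<^esub>}. (- 1) ^ l * trace_matrix rs ss (X l) (\<theta> l) $$ (i, j)) =
      (\<Sum>l\<le>L. (- 1) ^ l * trace_matrix rs ss (X l) (\<theta> l) $$ (i, j))"
  proof (rule sum.mono_neutral_left)
    show "{l. carrier (X l) \<noteq> {\<zero>\<^bsub>X l\<^esub>}} \<subseteq> {..L}" using L not_le by auto
  qed (use z ij in auto)
  then show "alt_trace_matrix rs ss X \<theta> $$ (i, j) = R $$ (i, j)" using ij s by (simp add: alt_trace_matrix_def)
qed (use R in \<open>auto simp: alt_trace_matrix_def\<close>)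

lemma fd_totalI:
  assumes "\<And>l. fd (X l)" "\<And>l. l > (L::nat) \<Longrightarrow> zero_space (X l)"
  shows "fd_total X"
proof -
  have "{l. carrier (X l) \<noteq> {\<zero>\<^bsub>X l\<^esub>}} \<subseteq> {..L}" using assms(2) not_le by auto
  then show ?thesis using assms(1) finite_subset[OF _ finite_atMost] by (simp add: fd_total_def)
qed

lemma trace_matrix_index:
  "i < length rs \<Longrightarrow> j < length ss \<Longrightarrow> trace_matrix rs ss X \<theta> $$ (i, j) =
    lin_trace (X\<lparr>carrier := {lact X (ss ! j) (ract X x (rs ! i)) | x. x \<in> carrier X}\<rparr>) \<theta>"
  by (simp add: trace_matrix_def)

lemma trace_matrix_carrier: "trace_matrix rs ss X \<theta> \<in> carrier_mat (length rs) (length ss)"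
  by (simp add: trace_matrix_def)

context fin_alg
begin

lemma bimod_right: "fd_bimodule B A M \<Longrightarrow> right_module A M" and bimod_fd: "fd_bimodule B A M \<Longrightarrow> fd M"
  by (auto simp: fd_bimodule_def bimodule_def)

lemma bimod_end_hom: "\<theta> \<in> bimod_end B A M \<Longrightarrow> \<theta> \<in> rmod_hom A M M"
  by (simp add: bimod_end_def)

lemma bimod_lact_hom: "fd_bimodule B A M \<Longrightarrow> idempotent B b \<Longrightarrow> lact M b \<in> rmod_hom A M M"
  by (rule rmod_homI) (auto simp: fd_bimodule_def bimodule_def left_module_def idempotent_def)

lemma bimod_lact_idem:
  assumes "fd_bimodule B A M" and b: "idempotent B b" and "x \<in> carrier M"
  shows "lact M b (lact M b x) = lact M b x"
proof -
  have "lact M (b \<otimes>\<^bsub>B\<^esub> b) x = lact M b (lact M b x)"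
    using assms unfolding fd_bimodule_def bimodule_def left_module_def idempotent_def by blast
  then show ?thesis using b by (simp add: idempotent_def)
qed

lemma bimod_end_lact:
  "\<theta> \<in> bimod_end B A M \<Longrightarrow> idempotent B b \<Longrightarrow> x \<in> carrier M \<Longrightarrow> lact M b (\<theta> x) = \<theta> (lact M b x)"
  by (simp add: bimod_end_def idempotent_def)

text \<open>A trace matrix entry in the two shapes in which it occurs: as a trace on the whole
  bimodule, and with the left idempotent absorbed into the endomorphism while the right one cuts out
  \<open>M u\<close>.\<close>

lemma bimod_trace:
  assumes M: "fd_bimodule B A M" and \<theta>: "\<theta> \<in> bimod_end B A M" and b: "idempotent B b" and u: "idempotent A u"
  shows "lin_trace (M\<lparr>carrier := {lact M b (ract M x u) | x. x \<in> carrier M}\<rparr>) \<theta> = lin_trace M (\<lambda>x. lact M b (\<theta> (ract M x u)))"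
    "lin_trace (corner M u) (\<lambda>x. \<theta> (lact M b x)) = lin_trace (M\<lparr>carrier := {lact M b (ract M x u) | x. x \<in> carrier M}\<rparr>) \<theta>"
proof -
  note R = bimod_right[OF M] and bh' = bimod_lact_hom[OF M b] and th = bimod_end_hom[OF \<theta>]
  note RD = right_moduleD[OF R] and t = rmod_homD[OF th] and bh = rmod_homD[OF bh'] and fM = bimod_fd[OF M]
  have uA: "u \<in> carrier A" "u \<otimes> u = u" using u by (auto simp: idempotent_def)
  have uu: "ract M (ract M x u) u = ract M x u" if "x \<in> carrier M" for x using RD(7)[OF that uA(1,1)] uA(2) by simp
  let ?E = "\<lambda>x. lact M b (ract M x u)"
  have E: "?E \<in> lin M M" by (rule lin_comp[OF lin_ract[OF R uA(1)] rmod_hom_lin[OF R R bh']])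
  have \<theta>l: "\<theta> \<in> lin M M" by (rule rmod_hom_lin[OF R R th])
  have "lin_trace (M\<lparr>carrier := {lact M b (ract M x u) | x. x \<in> carrier M}\<rparr>) \<theta> = lin_trace M (\<lambda>x. ?E (\<theta> x))"
  proof (rule lin_trace_idempotent_image[OF RD(1) fM E \<theta>l])
    show "?E (\<theta> (?E x)) = \<theta> (?E x)" if x: "x \<in> carrier M" for x
      using x RD(2)[OF x uA(1)] t bh uA bimod_lact_idem[OF M b] bimod_end_lact[OF \<theta> b] uu by simp
  qed auto
  also have "\<dots> = lin_trace M (\<lambda>x. lact M b (\<theta> (ract M x u)))"
    by (rule lin_trace_cong[OF RD(1) fM lin_comp[OF \<theta>l E]]) (use t(3) uA in simp)
  finally show 1: "lin_trace (M\<lparr>carrier := {lact M b (ract M x u) | x. x \<in> carrier M}\<rparr>) \<theta> = lin_trace M (\<lambda>x. lact M b (\<theta> (ract M x u)))" .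
  have "lin_trace (corner M u) (\<lambda>x. \<theta> (lact M b x)) = lin_trace M (\<lambda>x. \<theta> (lact M b (ract M x u)))"
    by (rule lin_trace_corner_right[OF R fM uA rmod_hom_comp[OF bh' th]])
  also have "\<dots> = lin_trace M (\<lambda>x. lact M b (\<theta> (ract M x u)))"
    by (rule lin_trace_cong[OF RD(1) fM lin_comp[OF E \<theta>l]]) (use bimod_end_lact[OF \<theta> b] RD(2) uA in simp)
  finally show "lin_trace (corner M u) (\<lambda>x. \<theta> (lact M b x)) = lin_trace (M\<lparr>carrier := {lact M b (ract M x u) | x. x \<in> carrier M}\<rparr>) \<theta>"
    using 1 by simp
qed

end

context elem_alg
begin

lemma e_idempotent: "i < n \<Longrightarrow> idempotent A (e i)"
  using e_closed e_idem by (simp add: idempotent_def)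

text \<open>The inner sum is arranged exactly as in \<open>multiplicity_formula\<close>, where it
  arises.\<close>

lemma euler_form_index:
  assumes gl: "finite_gldim A" and x: "x \<in> carrier_mat n r" and y: "y \<in> carrier_mat n s" and i: "i < r" and k: "k < s"
  shows "euler_form A es x y $$ (i, k) = (\<Sum>j<n. (\<Sum>a<n. cartan_inv A es $$ (j, a) * x $$ (a, i)) * y $$ (j, k))"
proof -
  note C = cartan_inverse(1)[OF gl]
  have prod: "(X * Y) $$ (i, k) = (\<Sum>j<n. X $$ (i, j) * Y $$ (j, k))"
    if "X \<in> carrier_mat r n" "Y \<in> carrier_mat n s" for X Y :: "'k mat"
    using that i k by (simp add: scalar_prod_def atLeast0LessThan)
  have D: "transpose_mat x * transpose_mat (cartan_inv A es) \<in> carrier_mat r n" using x C by auto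
  have 1: "(transpose_mat x * transpose_mat (cartan_inv A es)) $$ (i, j) = (\<Sum>a<n. cartan_inv A es $$ (j, a) * x $$ (a, i))" if "j < n" for j
    using x C i that by (simp add: scalar_prod_def atLeast0LessThan mult.commute)
  have "euler_form A es x y $$ (i, k) = (\<Sum>j<n. (transpose_mat x * transpose_mat (cartan_inv A es)) $$ (i, j) * y $$ (j, k))"
    unfolding euler_form_def by (rule prod[OF D y])
  then show ?thesis using 1 by simp
qed

lemma euler_form_op_index:
  assumes gl: "finite_gldim A" and x: "x \<in> carrier_mat n r" and y: "y \<in> carrier_mat s n" and i: "i < r" and k: "k < s"
  shows "euler_form_op A es (transpose_mat y) x $$ (k, i) = (\<Sum>j<n. (\<Sum>a<n. cartan_inv A es $$ (j, a) * x $$ (a, i)) * y $$ (k, j))"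
proof -
  note C = cartan_inverse(1)[OF gl]
  have prod: "(X * Y) $$ (k, i) = (\<Sum>j<n. X $$ (k, j) * Y $$ (j, i))"
    if "X \<in> carrier_mat s n" "Y \<in> carrier_mat n r" for X Y :: "'k mat"
    using that i k by (simp add: scalar_prod_def atLeast0LessThan)
  have D: "y * (cartan_inv A es * x) = y * cartan_inv A es * x" using assoc_mult_mat[OF y C x] by simp
  have E: "cartan_inv A es * x \<in> carrier_mat n r" using x C by auto
  have 1: "(cartan_inv A es * x) $$ (j, i) = (\<Sum>a<n. cartan_inv A es $$ (j, a) * x $$ (a, i))" if "j < n" for j
    using x C i that by (simp add: scalar_prod_def atLeast0LessThan)
  have "euler_form_op A es (transpose_mat y) x $$ (k, i) = (y * (cartan_inv A es * x)) $$ (k, i)"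
    unfolding euler_form_op_def D by simp
  also have "\<dots> = (\<Sum>j<n. y $$ (k, j) * (cartan_inv A es * x) $$ (j, i))"
    by (rule prod[OF y E])
  finally show ?thesis using 1 by (simp add: mult.commute)
qed

text \<open>\<open>\<alpha>\<close> and \<open>\<beta>\<close> lift the identity of \<open>M\<close>
  in both directions. That \<open>\<beta> \<circ> \<alpha>\<close> is homotopic to the identity is
  left to the lemmas on induced maps.\<close>

lemma finite_comparison:
  fixes M :: "('k, 'm, 'a, 'z) rmod_scheme" and P :: "('k, 'p, 'a, 'm) resolution"
  assumes M: "right_module A M" "fd M" and gl: "finite_gldim A" and P: "projective_resolution A M P"
  obtains Q :: "('k, nat \<Rightarrow> 'a, 'a, 'm) resolution" and L m S q \<alpha> \<beta> where "exact_res M Q"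
    "\<And>l. dual_basis (obj Q l) {..<m l :: nat} (S l) (q l)" "\<And>l. l > L \<Longrightarrow> zero_space (obj Q l)"
    "chain_map P Q (\<lambda>x. x) \<alpha>" "chain_map Q P (\<lambda>x. x) \<beta>"
proof -
  obtain Q :: "('k, nat \<Rightarrow> 'a, 'a, 'm) resolution" and L where Q: "exact_res M Q"
    and db: "\<forall>l. \<exists>(m::nat) S q. dual_basis (obj Q l) {..<m} S q" and L: "\<forall>l>L. zero_space (obj Q l)"
    using finite_resolution[OF M gl] by blast
  obtain m S q where db: "\<And>l. dual_basis (obj Q l) {..<m l :: nat} (S l) (q l)" using db by metis
  note EP = exact_res_projective[OF M(1) P]
  obtain \<alpha> where \<alpha>: "chain_map P Q (\<lambda>x. x) \<alpha>"
    using chain_map_exists[OF EP(1) Q rmod_hom_id projective_lifts[OF EP(2) exact_resD(2)[OF Q] M(1)]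
      projective_lifts[OF EP(2) exact_resD(2)[OF Q] exact_resD(2)[OF Q]]] by blast
  obtain \<beta> where \<beta>: "chain_map Q P (\<lambda>x. x) \<beta>"
    using chain_map_exists[OF Q EP(1) rmod_hom_id dual_basis_lifts[OF db exact_resD(2)[OF EP(1)] M(1)]
      dual_basis_lifts[OF db exact_resD(2)[OF EP(1)] exact_resD(2)[OF EP(1)]]] by blast
  show thesis by (rule that[OF Q db L[rule_format] \<alpha> \<beta>])
qed

theorem ext_trace_formula:
  fixes B :: "('k, 'b) module" and C :: "('k, 'c) module" and f :: "'b list" and g :: "'c list"
    and M :: "('k, 'm, 'a, 'b) bimod" and N :: "('k, 'n, 'a, 'c) bimod" and P :: "('k, 'p, 'a, 'm) resolution"
  assumes gl: "finite_gldim A" and M: "fd_bimodule B A M" and \<phi>: "\<phi> \<in> bimod_end B A M"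
    and N: "fd_bimodule C A N" and \<psi>: "\<psi> \<in> bimod_end C A N" and P: "projective_resolution A M P"
    and f: "\<And>i. i < length f \<Longrightarrow> idempotent B (f ! i)" and g: "\<And>i. i < length g \<Longrightarrow> idempotent C (g ! i)"
  shows "fd_total (Ext A P M N)" (is ?fd)
    "alt_trace_matrix f g (Ext A P M N) (ext_map A P N \<phi> \<psi>) =
      euler_form A es (trace_matrix es f M \<phi>) (trace_matrix es g N \<psi>)" (is ?tr)
proof -
  note RM = bimod_right[OF M] and RN = bimod_right[OF N] bimod_fd[OF N]
  note hom = bimod_end_hom[OF \<phi>] bimod_end_hom[OF \<psi>]
  obtain Q :: "('k, nat \<Rightarrow> 'a, 'a, 'm) resolution" and L m S q \<alpha> \<beta> where Q: "exact_res M Q"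
    and db: "\<And>l. dual_basis (obj Q l) {..<m l :: nat} (S l) (q l)" and L: "\<And>l. l > L \<Longrightarrow> zero_space (obj Q l)"
    and \<alpha>: "chain_map P Q (\<lambda>x. x) \<alpha>" and \<beta>: "chain_map Q P (\<lambda>x. x) \<beta>"
    by (rule finite_comparison[OF RM bimod_fd[OF M] gl P]) (rule that)
  have X: "same_space (Ext A P M N l) (ext_space A P N l)" for l
    by (simp add: Ext_def)
  note idh = rmod_hom_id[of M] rmod_hom_id[of N]
  \<comment> \<open>Taken for identities throughout, the transfer gives finite dimension and
    vanishing, before any entry is considered.\<close>
  note t0 = ext_transfer[OF RM RN P Q db \<alpha> \<beta> idh(1,1) refl refl idh(2,2) refl refl X]
  have triv: "zero_space (ext_space A Q N l)" if "l > L" for l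
    by (rule ext_euler(2)[OF RN Q db L chain_map_id idh(2) that])
  have XL: "zero_space (Ext A P M N l)" if "l > L" for l
    by (rule t0(2)[OF triv[OF that]])
  show ?fd by (rule fd_totalI[OF t0(1) XL])
  show ?tr
  proof (rule alt_trace_matrix_eqI[OF XL])
    have cM: "trace_matrix es f M \<phi> \<in> carrier_mat n (length f)" and cN: "trace_matrix es g N \<psi> \<in> carrier_mat n (length g)"
      by (rule trace_matrix_carrier)+
    then show "euler_form A es (trace_matrix es f M \<phi>) (trace_matrix es g N \<psi>) \<in> carrier_mat (length f) (length g)"
      by (intro carrier_matI) (simp_all add: euler_form_def trace_matrix_def)
    fix i k assume i: "i < length f" and k: "k < length g"
    define \<Phi> where "\<Phi> = (\<lambda>l x. \<alpha> l (chain_lift A P \<phi> l (chain_lift A P (lact M (f ! i)) l (chain_lift A P (\<lambda>x. x) l (\<beta> l x)))))"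
    note t = ext_transfer[OF RM RN P Q db \<alpha> \<beta> hom(1) bimod_lact_hom[OF M f[OF i]] bimod_lact_idem[OF M f[OF i]]
      bimod_end_lact[OF \<phi> f[OF i]] hom(2) bimod_lact_hom[OF N g[OF k]] bimod_lact_idem[OF N g[OF k]]
      bimod_end_lact[OF \<psi> g[OF k]] X, folded \<Phi>_def]
    have ti: "trace_matrix f g (Ext A P M N l) (ext_map A P N \<phi> \<psi> l) $$ (i, k) =
      lin_trace ((Ext A P M N l)\<lparr>carrier := {ext_map A P N (\<lambda>x. x) (lact N (g ! k)) l
        (ext_map A P N (lact M (f ! i)) (\<lambda>y. y) l x) | x. x \<in> carrier (Ext A P M N l)}\<rparr>) (ext_map A P N \<phi> \<psi> l)" for l
      unfolding trace_matrix_index[OF i k] by (simp add: Ext_def)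
    show "trace_matrix f g (Ext A P M N l) (ext_map A P N \<phi> \<psi> l) $$ (i, k) = 0"
      if "zero_space (Ext A P M N l)" for l
      unfolding ti by (rule t(4)[OF _ _ _ _ that])
    have c\<Phi>: "chain_map Q Q (\<lambda>x. \<phi> (lact M (f ! i) x)) \<Phi>" by (rule t(5))
    have h\<psi>: "(\<lambda>y. lact N (g ! k) (\<psi> y)) \<in> rmod_hom A N N" by (rule rmod_hom_comp[OF hom(2) bimod_lact_hom[OF N g[OF k]]])
    have h\<phi>: "(\<lambda>x. \<phi> (lact M (f ! i) x)) \<in> rmod_hom A M M" by (rule rmod_hom_comp[OF bimod_lact_hom[OF M f[OF i]] hom(1)])
    have tM: "lin_trace (corner M (e a)) (\<lambda>x. \<phi> (lact M (f ! i) x)) = trace_matrix es f M \<phi> $$ (a, i)" if a: "a < n" for a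
      unfolding trace_matrix_index[OF a i] by (rule bimod_trace(2)[OF M \<phi> f[OF i] e_idempotent[OF a]])
    have tN: "lin_trace N (\<lambda>y. lact N (g ! k) (\<psi> (ract N y (e j)))) = trace_matrix es g N \<psi> $$ (j, k)" if j: "j < n" for j
      unfolding trace_matrix_index[OF j k] by (rule bimod_trace(1)[OF N \<psi> g[OF k] e_idempotent[OF j], symmetric])
    have "(\<Sum>l\<le>L. (- 1) ^ l * trace_matrix f g (Ext A P M N l) (ext_map A P N \<phi> \<psi> l) $$ (i, k)) =
      (\<Sum>l\<le>L. (- 1) ^ l * lin_trace (ext_space A Q N l) (ext_ind N Q \<Phi> (\<lambda>y. lact N (g ! k) (\<psi> y)) l))"
      unfolding ti by (intro sum.cong refl arg_cong2[of _ _ _ _ times] t(3))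
    also have "\<dots> = (\<Sum>j<n. (\<Sum>l\<le>L. (- 1) ^ l * mult_trace (m l) (S l) (q l) (\<Phi> l) j) * lin_trace N (\<lambda>y. lact N (g ! k) (\<psi> (ract N y (e j)))))"
      by (rule ext_euler(1)[OF RN Q db L c\<Phi> h\<psi>])
    also have "\<dots> = (\<Sum>j<n. (\<Sum>a<n. cartan_inv A es $$ (j, a) * trace_matrix es f M \<phi> $$ (a, i)) * trace_matrix es g N \<psi> $$ (j, k))"
      by (rule sum.cong[OF refl]) (simp add: multiplicity_formula[OF gl Q db L h\<phi> c\<Phi>] tM tN)
    also have "\<dots> = euler_form A es (trace_matrix es f M \<phi>) (trace_matrix es g N \<psi>) $$ (i, k)"
      by (rule euler_form_index[OF gl cM cN i k, symmetric])
    finally show "(\<Sum>l\<le>L. (- 1) ^ l * trace_matrix f g (Ext A P M N l) (ext_map A P N \<phi> \<psi> l) $$ (i, k)) =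
      euler_form A es (trace_matrix es f M \<phi>) (trace_matrix es g N \<psi>) $$ (i, k)" .
  qed
qed

end

section \<open>Tensor products\<close>

lemma span_least:
  assumes V: "vsp V" and U: "subsp V U" "S \<subseteq> U"
  shows "LinearCombinations.module.span class_ring V S \<subseteq> U"
proof
  interpret V: vectorspace class_ring V by (rule V)
  fix x assume "x \<in> V.span S"
  then obtain a F where F: "F \<subseteq> S" "x = finsum V (\<lambda>v. a v \<odot>\<^bsub>V\<^esub> v) F"
    by (auto simp: V.span_def V.lincomb_def)
  show "x \<in> U" unfolding F(2) by (rule subsp_finsum[OF V U(1)]) (use F(1) U(2) subspD(4)[OF U(1)] in auto)
qed

lemma subsp_equalizer:
  assumes "vsp V" "vsp W" "f \<in> lin V W" "g \<in> lin V W"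
  shows "subsp V {x \<in> carrier V. f x = g x}"
  by (rule subspI) (use assms in \<open>auto simp: lin_zero[of V W] lin_add lin_smult\<close>)

lemma free_pairs_simps:
  "h \<in> carrier (free_pairs P N) \<longleftrightarrow> finite {t. h t \<noteq> 0} \<and> {t. h t \<noteq> 0} \<subseteq> carrier P \<times> carrier N"
  "zero (free_pairs P N) = (\<lambda>t. 0)" "add (free_pairs P N) h h' = (\<lambda>t. h t + h' t)"
  "smult (free_pairs P N) c h = (\<lambda>t. c * h t)"
  by (simp_all add: free_pairs_def)

lemma vsp_free_pairs: "vsp (free_pairs P N)"
proof (rule vspI)
  show "h \<oplus>\<^bsub>free_pairs P N\<^esub> h' \<in> carrier (free_pairs P N)" if "h \<in> carrier (free_pairs P N)" "h' \<in> carrier (free_pairs P N)" for h h'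
  proof -
    have "{t. h t + h' t \<noteq> 0} \<subseteq> {t. h t \<noteq> 0} \<union> {t. h' t \<noteq> 0}" by auto
    then show ?thesis using that finite_subset[of "{t. h t + h' t \<noteq> 0}" "{t. h t \<noteq> 0} \<union> {t. h' t \<noteq> 0}"]
      unfolding free_pairs_simps by blast
  qed
  show "c \<odot>\<^bsub>free_pairs P N\<^esub> h \<in> carrier (free_pairs P N)" if "h \<in> carrier (free_pairs P N)" for c h
  proof -
    have "{t. c * h t \<noteq> 0} \<subseteq> {t. h t \<noteq> 0}" by auto
    then show ?thesis using that finite_subset[of "{t. c * h t \<noteq> 0}" "{t. h t \<noteq> 0}"] unfolding free_pairs_simps by blast
  qed
qed (auto simp: free_pairs_simps algebra_simps)

lemma pair_vec_closed: "x \<in> carrier P \<Longrightarrow> y \<in> carrier N \<Longrightarrow> pair_vec x y \<in> carrier (free_pairs P N)"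
  by (auto simp: free_pairs_simps pair_vec_def)

lemma free_pairs_minus:
  assumes "h \<in> carrier (free_pairs P N)" "h' \<in> carrier (free_pairs P N)"
  shows "h \<ominus>\<^bsub>free_pairs P N\<^esub> h' = (\<lambda>t. h t - h' t)"
  unfolding vs_minus_eq[OF vsp_free_pairs assms] by (simp add: free_pairs_simps)

text \<open>Induction on a finite set that contains the support; removing one pair subtracts a
  multiple of a basis vector.\<close>

lemma free_pairs_induct:
  assumes U: "subsp (free_pairs P N) U" and pv: "\<And>x y. x \<in> carrier P \<Longrightarrow> y \<in> carrier N \<Longrightarrow> pair_vec x y \<in> U"
    and h: "h \<in> carrier (free_pairs P N)"
  shows "h \<in> U"
proof -
  have main: "\<forall>h\<in>carrier (free_pairs P N). {t. h t \<noteq> 0} \<subseteq> F \<longrightarrow> h \<in> U" if "finite F" for F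
    using that
  proof (induction F)
    case empty
    have "h = (\<lambda>t. 0)" if "{t. h t \<noteq> 0} \<subseteq> {}" for h :: "'a \<times> 'b \<Rightarrow> 'c" using that by auto
    then show ?case using subspD(2)[OF U] unfolding free_pairs_simps by blast
  next
    case (insert t F)
    show ?case
    proof (intro ballI impI)
      fix h :: "'a \<times> 'b \<Rightarrow> 'c" assume h: "h \<in> carrier (free_pairs P N)" and s: "{s. h s \<noteq> 0} \<subseteq> insert t F"
      show "h \<in> U"
      proof (cases "h t = 0")
        case True
        then have "{s. h s \<noteq> 0} \<subseteq> F" using s by auto
        then show ?thesis using insert.IH h by blast
      next
        case False
        define h' where "h' = h(t := 0)"
        have s': "{s. h' s \<noteq> 0} \<subseteq> {s. h s \<noteq> 0}" "{s. h' s \<noteq> 0} \<subseteq> F" using s by (auto simp: h'_def)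
        have "h' \<in> carrier (free_pairs P N)" using h finite_subset[OF s'(1)] s'(1) unfolding free_pairs_simps by blast
        then have h'U: "h' \<in> U" using insert.IH s'(2) by blast
        obtain x y where xy: "t = (x, y)" "x \<in> carrier P" "y \<in> carrier N" using False h unfolding free_pairs_simps by blast
        have eq: "h = h' \<oplus>\<^bsub>free_pairs P N\<^esub> (h t \<odot>\<^bsub>free_pairs P N\<^esub> pair_vec x y)"
          by (rule ext) (simp add: free_pairs_simps h'_def pair_vec_def xy(1)[symmetric])
        show ?thesis by (subst eq) (rule subspD(3)[OF U h'U subspD(4)[OF U pv[OF xy(2,3)]]])
      qed
    qed
  qed
  have "finite {t. h t \<noteq> 0}" using h by (simp add: free_pairs_simps)
  then show ?thesis using main h by blast
qed

text \<open>In the definition the range of summation depends on \<open>h\<close>; a common finite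
  range is what makes additivity provable.\<close>

lemma free_pairs_map_superset:
  assumes "finite F" "{t. h t \<noteq> 0} \<subseteq> F"
  shows "free_pairs_map f g h t = (\<Sum>s\<in>{s \<in> F. map_prod f g s = t}. h s)"
  unfolding free_pairs_map_def by (rule sum.mono_neutral_left) (use assms in auto)

lemma free_pairs_map_lin:
  fixes P :: "('k::field, 'p, 'y) module_scheme" and N :: "('k, 'n, 'z) module_scheme"
    and Q :: "('k, 'q, 'y1) module_scheme" and N' :: "('k, 'r, 'z1) module_scheme"
  assumes f: "f \<in> carrier P \<rightarrow> carrier Q" and g: "g \<in> carrier N \<rightarrow> carrier N'"
  shows "free_pairs_map f g \<in> lin (free_pairs P N) (free_pairs Q N')"
proof (rule linI)
  fix h :: "'p \<times> 'n \<Rightarrow> 'k" assume h: "h \<in> carrier (free_pairs P N)"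
  then have hf: "finite {t. h t \<noteq> 0}" "{t. h t \<noteq> 0} \<subseteq> carrier P \<times> carrier N" by (auto simp: free_pairs_simps)
  have s: "{t. free_pairs_map f g h t \<noteq> 0} \<subseteq> map_prod f g ` {t. h t \<noteq> 0}"
  proof
    fix t assume "t \<in> {t. free_pairs_map f g h t \<noteq> 0}"
    then have "{s. h s \<noteq> 0 \<and> map_prod f g s = t} \<noteq> {}" unfolding free_pairs_map_def by (metis (mono_tags, lifting) mem_Collect_eq sum.empty)
    then show "t \<in> map_prod f g ` {t. h t \<noteq> 0}" by auto
  qed
  have "map_prod f g ` {t. h t \<noteq> 0} \<subseteq> carrier Q \<times> carrier N'" using hf(2) f g by fastforce
  then show "free_pairs_map f g h \<in> carrier (free_pairs Q N')"
    unfolding free_pairs_simps using finite_subset[OF s finite_imageI[OF hf(1)]] s by (auto intro: subset_trans)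
  show "free_pairs_map f g (c \<odot>\<^bsub>free_pairs P N\<^esub> h) = c \<odot>\<^bsub>free_pairs Q N'\<^esub> free_pairs_map f g h" for c
  proof -
    have "{t. (c \<odot>\<^bsub>free_pairs P N\<^esub> h) t \<noteq> 0} \<subseteq> {t. h t \<noteq> 0}" by (auto simp: free_pairs_simps)
    then show ?thesis using free_pairs_map_superset[OF hf(1), of "c \<odot>\<^bsub>free_pairs P N\<^esub> h" f g] free_pairs_map_superset[OF hf(1) subset_refl, of f g]
      by (auto simp: free_pairs_simps sum_distrib_left fun_eq_iff)
  qed
  fix h' :: "'p \<times> 'n \<Rightarrow> 'k" assume h': "h' \<in> carrier (free_pairs P N)"
  then have hf': "finite {t. h' t \<noteq> 0}" by (simp add: free_pairs_simps)
  let ?F = "{t. h t \<noteq> 0} \<union> {t. h' t \<noteq> 0}"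
  have F: "finite ?F" using hf hf' by simp
  have s: "{t. h t \<noteq> 0} \<subseteq> ?F" "{t. h' t \<noteq> 0} \<subseteq> ?F" "{t. (h \<oplus>\<^bsub>free_pairs P N\<^esub> h') t \<noteq> 0} \<subseteq> ?F" by (auto simp: free_pairs_simps)
  show "free_pairs_map f g (h \<oplus>\<^bsub>free_pairs P N\<^esub> h') = free_pairs_map f g h \<oplus>\<^bsub>free_pairs Q N'\<^esub> free_pairs_map f g h'"
    using free_pairs_map_superset[OF F s(1), of f g] free_pairs_map_superset[OF F s(2), of f g] free_pairs_map_superset[OF F s(3), of f g]
    by (auto simp: free_pairs_simps sum.distrib fun_eq_iff)
qed

lemma free_pairs_map_pair_vec: "free_pairs_map f g (pair_vec x y) = pair_vec (f x) (g y)"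
proof
  fix t
  have "free_pairs_map f g (pair_vec x y) t = (\<Sum>s\<in>{s \<in> {(x, y)}. map_prod f g s = t}. pair_vec x y s)"
    by (rule free_pairs_map_superset) (auto simp: pair_vec_def)
  also have "{s \<in> {(x, y)}. map_prod f g s = t} = (if (f x, g y) = t then {(x, y)} else {})" by auto
  finally show "free_pairs_map f g (pair_vec x y) t = pair_vec (f x) (g y) t" by (auto simp: pair_vec_def)
qed

lemma free_pairs_lift:
  fixes P :: "('k::field, 'p, 'y) module_scheme" and N :: "('k, 'n, 'z) module_scheme" and W :: "('k, 'w, 'x) module_scheme"
  assumes W: "vsp W" and \<beta>: "\<And>x y. x \<in> carrier P \<Longrightarrow> y \<in> carrier N \<Longrightarrow> \<beta> x y \<in> carrier W"
  shows "\<exists>F\<in>lin (free_pairs P N) W. \<forall>x\<in>carrier P. \<forall>y\<in>carrier N. F (pair_vec x y) = \<beta> x y"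
proof
  define F where "F h = finsum W (\<lambda>t. h t \<odot>\<^bsub>W\<^esub> \<beta> (fst t) (snd t)) {t. h t \<noteq> 0}" for h
  have \<beta>': "\<beta> (fst t) (snd t) \<in> carrier W" if "t \<in> carrier P \<times> carrier N" for t using \<beta> that by auto
  have sup: "F h = finsum W (\<lambda>t. h t \<odot>\<^bsub>W\<^esub> \<beta> (fst t) (snd t)) G" if "finite G" "{t. h t \<noteq> 0} \<subseteq> G" "G \<subseteq> carrier P \<times> carrier N" for G h
    unfolding F_def by (rule vs_finsum_mono[OF W that(1,2)]) (use that(3) \<beta>' W in auto)
  show "F \<in> lin (free_pairs P N) W"
  proof (rule linI)
    fix h :: "'p \<times> 'n \<Rightarrow> 'k" assume h: "h \<in> carrier (free_pairs P N)"
    then have hf: "finite {t. h t \<noteq> 0}" "{t. h t \<noteq> 0} \<subseteq> carrier P \<times> carrier N" by (auto simp: free_pairs_simps)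
    show "F h \<in> carrier W" unfolding F_def by (rule vs_finsum[OF W]) (use hf(2) \<beta>' W in auto)
    show "F (c \<odot>\<^bsub>free_pairs P N\<^esub> h) = c \<odot>\<^bsub>W\<^esub> F h" for c
    proof -
      have s: "{t. (c \<odot>\<^bsub>free_pairs P N\<^esub> h) t \<noteq> 0} \<subseteq> {t. h t \<noteq> 0}" by (auto simp: free_pairs_simps)
      have l: "(\<lambda>v. c \<odot>\<^bsub>W\<^esub> v) \<in> lin W W" by (rule lin_smult_map[OF W lin_id])
      have "F (c \<odot>\<^bsub>free_pairs P N\<^esub> h) = finsum W (\<lambda>t. c \<odot>\<^bsub>W\<^esub> (h t \<odot>\<^bsub>W\<^esub> \<beta> (fst t) (snd t))) {t. h t \<noteq> 0}"
        unfolding sup[OF hf(1) s hf(2)]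
        by (rule vs_finsum_cong[OF W refl]) (use hf(2) \<beta>' W in \<open>auto simp: free_pairs_simps vs_smult_smult\<close>)
      also have "\<dots> = c \<odot>\<^bsub>W\<^esub> F h" unfolding F_def
        by (rule lin_finsum[OF W W l, symmetric]) (use hf(2) \<beta>' W in auto)
      finally show ?thesis .
    qed
    fix h' :: "'p \<times> 'n \<Rightarrow> 'k" assume h': "h' \<in> carrier (free_pairs P N)"
    then have hf': "finite {t. h' t \<noteq> 0}" "{t. h' t \<noteq> 0} \<subseteq> carrier P \<times> carrier N" by (auto simp: free_pairs_simps)
    let ?G = "{t. h t \<noteq> 0} \<union> {t. h' t \<noteq> 0}"
    have G: "finite ?G" "?G \<subseteq> carrier P \<times> carrier N" using hf hf' by auto
    have s: "{t. h t \<noteq> 0} \<subseteq> ?G" "{t. h' t \<noteq> 0} \<subseteq> ?G" "{t. (h \<oplus>\<^bsub>free_pairs P N\<^esub> h') t \<noteq> 0} \<subseteq> ?G" by (auto simp: free_pairs_simps)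
    have "F (h \<oplus>\<^bsub>free_pairs P N\<^esub> h') = finsum W (\<lambda>t. (h t \<odot>\<^bsub>W\<^esub> \<beta> (fst t) (snd t)) \<oplus>\<^bsub>W\<^esub> (h' t \<odot>\<^bsub>W\<^esub> \<beta> (fst t) (snd t))) ?G"
      unfolding sup[OF G(1) s(3) G(2)]
      by (rule vs_finsum_cong[OF W refl]) (use G(2) \<beta>' W in \<open>auto simp: free_pairs_simps vs_smult_l_distr\<close>)
    also have "\<dots> = F h \<oplus>\<^bsub>W\<^esub> F h'"
      unfolding sup[OF G(1) s(1) G(2)] sup[OF G(1) s(2) G(2)]
      by (rule vs_finsum_add[OF W]) (use G(2) \<beta>' W in auto)
    finally show "F (h \<oplus>\<^bsub>free_pairs P N\<^esub> h') = F h \<oplus>\<^bsub>W\<^esub> F h'" .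
  qed
  show "\<forall>x\<in>carrier P. \<forall>y\<in>carrier N. F (pair_vec x y) = \<beta> x y"
  proof (intro ballI)
    fix x y assume xy: "x \<in> carrier P" "y \<in> carrier N"
    have "F (pair_vec x y) = finsum W (\<lambda>t. pair_vec x y t \<odot>\<^bsub>W\<^esub> \<beta> (fst t) (snd t)) {(x, y)}"
      by (rule sup) (use xy in \<open>auto simp: pair_vec_def\<close>)
    also have "\<dots> = pair_vec x y (x, y) \<odot>\<^bsub>W\<^esub> \<beta> x y \<oplus>\<^bsub>W\<^esub> finsum W (\<lambda>t. pair_vec x y t \<odot>\<^bsub>W\<^esub> \<beta> (fst t) (snd t)) {}"
      by (subst vs_finsum_insert[OF W]) (use xy \<beta> W in auto)
    also have "\<dots> = \<beta> x y" using \<beta>[OF xy] W by (simp add: pair_vec_def abelian_monoid.finsum_empty[OF vsp_abelian_monoid[OF W]])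
    finally show "F (pair_vec x y) = \<beta> x y" .
  qed
qed

context fin_alg
begin

lemma left_moduleD:
  assumes "left_module A M"
  shows "vsp M"
    "\<And>x a. x \<in> carrier M \<Longrightarrow> a \<in> carrier A \<Longrightarrow> lact M a x \<in> carrier M"
    "\<And>x y a. x \<in> carrier M \<Longrightarrow> y \<in> carrier M \<Longrightarrow> a \<in> carrier A \<Longrightarrow> lact M a (x \<oplus>\<^bsub>M\<^esub> y) = lact M a x \<oplus>\<^bsub>M\<^esub> lact M a y"
    "\<And>x a b. x \<in> carrier M \<Longrightarrow> a \<in> carrier A \<Longrightarrow> b \<in> carrier A \<Longrightarrow> lact M (a \<oplus> b) x = lact M a x \<oplus>\<^bsub>M\<^esub> lact M b x"
    "\<And>c x a. x \<in> carrier M \<Longrightarrow> a \<in> carrier A \<Longrightarrow> lact M a (c \<odot>\<^bsub>M\<^esub> x) = c \<odot>\<^bsub>M\<^esub> lact M a x"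
    "\<And>c x a. x \<in> carrier M \<Longrightarrow> a \<in> carrier A \<Longrightarrow> lact M (c \<odot> a) x = c \<odot>\<^bsub>M\<^esub> lact M a x"
    "\<And>x a b. x \<in> carrier M \<Longrightarrow> a \<in> carrier A \<Longrightarrow> b \<in> carrier A \<Longrightarrow> lact M (a \<otimes> b) x = lact M a (lact M b x)"
    "\<And>x. x \<in> carrier M \<Longrightarrow> lact M \<one> x = x"
  using assms unfolding left_module_def by auto

text \<open>The second algebra enters the tensor product only through such maps: its right action on
  \<open>N\<close> commutes with \<open>A\<close> from the left.\<close>

definition lmod_end where
  "lmod_end N = {g \<in> lin N N. \<forall>a\<in>carrier A. \<forall>y\<in>carrier N. g (lact N a y) = lact N a (g y)}"

lemma lmod_end_id: "(\<lambda>y. y) \<in> lmod_end N"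
  and lmod_end_comp: "f \<in> lmod_end N \<Longrightarrow> g \<in> lmod_end N \<Longrightarrow> (\<lambda>y. g (f y)) \<in> lmod_end N"
  and lmod_end_lin: "f \<in> lmod_end N \<Longrightarrow> f \<in> lin N N"
  by (auto simp: lmod_end_def intro: lin_comp)

text \<open>The elementary tensor of \<open>x\<close> and \<open>y\<close>.\<close>

definition pure where
  "pure P N x y = tensor_null A P N +>\<^bsub>free_pairs P N\<^esub> pair_vec x y"

context
  fixes P :: "('k, 'p, 'a, 'y) rmod_scheme" and N :: "('k, 'n, 'c, 'a, 'z) bimod_scheme"
  assumes P: "right_module A P" and N: "left_module A N"
begin

private abbreviation "V \<equiv> free_pairs P N"
private abbreviation "K \<equiv> tensor_null A P N"
private abbreviation "T \<equiv> tensor A P N"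

private lemmas PD = right_moduleD[OF P] and ND = left_moduleD[OF N]

text \<open>The relations are defined pointwise as functions; as differences in the space of pairs
  they fit the criterion for equal cosets and can be evaluated by linear maps.\<close>

lemma tensor_rel_eqs:
  assumes "x \<in> carrier P" "x' \<in> carrier P" "y \<in> carrier N" "y' \<in> carrier N" "a \<in> carrier A"
  shows
    "(\<lambda>t. pair_vec (x \<oplus>\<^bsub>P\<^esub> x') y t - pair_vec x y t - pair_vec x' y t) =
       pair_vec (x \<oplus>\<^bsub>P\<^esub> x') y \<ominus>\<^bsub>V\<^esub> (pair_vec x y \<oplus>\<^bsub>V\<^esub> pair_vec x' y)"
    "(\<lambda>t. pair_vec x (y \<oplus>\<^bsub>N\<^esub> y') t - pair_vec x y t - pair_vec x y' t) =
       pair_vec x (y \<oplus>\<^bsub>N\<^esub> y') \<ominus>\<^bsub>V\<^esub> (pair_vec x y \<oplus>\<^bsub>V\<^esub> pair_vec x y')"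
    "(\<lambda>t. pair_vec (ract P x a) y t - pair_vec x (lact N a y) t) =
       pair_vec (ract P x a) y \<ominus>\<^bsub>V\<^esub> pair_vec x (lact N a y)"
    "(\<lambda>t. pair_vec (c \<odot>\<^bsub>P\<^esub> x) y t - c * pair_vec x y t) =
       pair_vec (c \<odot>\<^bsub>P\<^esub> x) y \<ominus>\<^bsub>V\<^esub> (c \<odot>\<^bsub>V\<^esub> pair_vec x y)"
proof -
  note pv = pair_vec_closed[of _ P _ N] and V = vsp_free_pairs[of P N]
  show "(\<lambda>t. pair_vec (x \<oplus>\<^bsub>P\<^esub> x') y t - pair_vec x y t - pair_vec x' y t) =
       pair_vec (x \<oplus>\<^bsub>P\<^esub> x') y \<ominus>\<^bsub>V\<^esub> (pair_vec x y \<oplus>\<^bsub>V\<^esub> pair_vec x' y)"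
    by (subst free_pairs_minus) (use assms pv V PD(1) in \<open>simp_all add: vs_add\<close>, simp add: free_pairs_simps algebra_simps)
  show "(\<lambda>t. pair_vec x (y \<oplus>\<^bsub>N\<^esub> y') t - pair_vec x y t - pair_vec x y' t) =
       pair_vec x (y \<oplus>\<^bsub>N\<^esub> y') \<ominus>\<^bsub>V\<^esub> (pair_vec x y \<oplus>\<^bsub>V\<^esub> pair_vec x y')"
    by (subst free_pairs_minus) (use assms pv V ND(1) in \<open>simp_all add: vs_add\<close>, simp add: free_pairs_simps algebra_simps)
  show "(\<lambda>t. pair_vec (ract P x a) y t - pair_vec x (lact N a y) t) =
       pair_vec (ract P x a) y \<ominus>\<^bsub>V\<^esub> pair_vec x (lact N a y)"
    by (subst free_pairs_minus) (use assms pv PD(2) ND(2) in simp_all)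
  show "(\<lambda>t. pair_vec (c \<odot>\<^bsub>P\<^esub> x) y t - c * pair_vec x y t) =
       pair_vec (c \<odot>\<^bsub>P\<^esub> x) y \<ominus>\<^bsub>V\<^esub> (c \<odot>\<^bsub>V\<^esub> pair_vec x y)"
    by (subst free_pairs_minus) (use assms pv V PD(1) in \<open>simp_all add: vs_smult\<close>, simp add: free_pairs_simps)
qed

lemma tensor_rels_cases:
  assumes "r \<in> tensor_rels A P N"
  obtains
    x x' y where "x \<in> carrier P" "x' \<in> carrier P" "y \<in> carrier N"
      "r = pair_vec (x \<oplus>\<^bsub>P\<^esub> x') y \<ominus>\<^bsub>V\<^esub> (pair_vec x y \<oplus>\<^bsub>V\<^esub> pair_vec x' y)"
  | x y y' where "x \<in> carrier P" "y \<in> carrier N" "y' \<in> carrier N"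
      "r = pair_vec x (y \<oplus>\<^bsub>N\<^esub> y') \<ominus>\<^bsub>V\<^esub> (pair_vec x y \<oplus>\<^bsub>V\<^esub> pair_vec x y')"
  | x y a where "x \<in> carrier P" "y \<in> carrier N" "a \<in> carrier A"
      "r = pair_vec (ract P x a) y \<ominus>\<^bsub>V\<^esub> pair_vec x (lact N a y)"
  | c x y where "x \<in> carrier P" "y \<in> carrier N"
      "r = pair_vec (c \<odot>\<^bsub>P\<^esub> x) y \<ominus>\<^bsub>V\<^esub> (c \<odot>\<^bsub>V\<^esub> pair_vec x y)"
proof -
  note z = vs_zero[OF PD(1)] vs_zero[OF ND(1)] zero_closed
  show ?thesis using assms unfolding tensor_rels_def
  proof (elim UnE CollectE exE conjE)
    fix x x' y assume r: "r = (\<lambda>t. pair_vec (x \<oplus>\<^bsub>P\<^esub> x') y t - pair_vec x y t - pair_vec x' y t)"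
      and c: "x \<in> carrier P" "x' \<in> carrier P" "y \<in> carrier N"
    show thesis by (rule that(1)[OF c]) (unfold r, rule tensor_rel_eqs(1)[OF c z(2,3)])
  next
    fix x y y' assume r: "r = (\<lambda>t. pair_vec x (y \<oplus>\<^bsub>N\<^esub> y') t - pair_vec x y t - pair_vec x y' t)"
      and c: "x \<in> carrier P" "y \<in> carrier N" "y' \<in> carrier N"
    show thesis by (rule that(2)[OF c]) (unfold r, rule tensor_rel_eqs(2)[OF c(1) z(1) c(2,3) z(3)])
  next
    fix x a y assume r: "r = (\<lambda>t. pair_vec (ract P x a) y t - pair_vec x (lact N a y) t)"
      and c: "x \<in> carrier P" "a \<in> carrier A" "y \<in> carrier N"
    show thesis by (rule that(3)[OF c(1,3,2)]) (unfold r, rule tensor_rel_eqs(3)[OF c(1) z(1) c(3) z(2) c(2)])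
  next
    fix c x y assume r: "r = (\<lambda>t. pair_vec (c \<odot>\<^bsub>P\<^esub> x) y t - c * pair_vec x y t)"
      and c: "x \<in> carrier P" "y \<in> carrier N"
    show thesis by (rule that(4)[OF c]) (unfold r, rule tensor_rel_eqs(4)[OF c(1) z(1) c(2) z(2,3)])
  qed
qed

lemma tensor_rels_closed: "tensor_rels A P N \<subseteq> carrier V"
proof
  fix r assume "r \<in> tensor_rels A P N"
  then show "r \<in> carrier V"
    by (cases rule: tensor_rels_cases)
      (simp_all add: vs_minus[OF vsp_free_pairs] vs_add[OF vsp_free_pairs] vs_smult[OF vsp_free_pairs] pair_vec_closed PD ND vs_add[OF PD(1)] vs_add[OF ND(1)] vs_smult[OF PD(1)])
qed

lemma tensor_null_subsp: "subsp V K"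
  unfolding tensor_null_def by (rule subsp_span[OF vsp_free_pairs tensor_rels_closed])

lemma tensor_rels_null: "tensor_rels A P N \<subseteq> K"
proof -
  interpret V: vectorspace class_ring "V" by (rule vsp_free_pairs)
  show ?thesis unfolding tensor_null_def by (rule V.in_own_span[OF tensor_rels_closed])
qed

lemma tensor_subquot:
  "subquot V (carrier V) K T (\<lambda>h. K +>\<^bsub>V\<^esub> h)"
  by (rule subquot_quot_space[OF vsp_free_pairs subsp_self[OF vsp_free_pairs] tensor_null_subsp subspD(1)[OF tensor_null_subsp]])
    (simp_all add: tensor_def)

lemma vsp_tensor: "vsp T"
  by (rule subquotD(5)[OF tensor_subquot])

lemma tensor_proj: "(\<lambda>h. K +>\<^bsub>V\<^esub> h) \<in> lin V T"
  using subquotD(6)[OF tensor_subquot] by simp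

lemma pure_closed: "x \<in> carrier P \<Longrightarrow> y \<in> carrier N \<Longrightarrow> pure P N x y \<in> carrier T"
  unfolding pure_def by (rule lin_closed[OF tensor_proj pair_vec_closed])

lemma tensor_class_eq:
  assumes "h \<in> carrier V" "h' \<in> carrier V" "h \<ominus>\<^bsub>V\<^esub> h' \<in> tensor_rels A P N"
  shows "K +>\<^bsub>V\<^esub> h = K +>\<^bsub>V\<^esub> h'"
  using assms(3) tensor_rels_null by (subst coset_eq_iff[OF vsp_free_pairs tensor_null_subsp assms(1,2)]) blast

lemma pure_add_left:
  assumes "x \<in> carrier P" "x' \<in> carrier P" "y \<in> carrier N"
  shows "pure P N (x \<oplus>\<^bsub>P\<^esub> x') y = pure P N x y \<oplus>\<^bsub>T\<^esub> pure P N x' y"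
proof -
  note p = pair_vec_closed[OF assms(1,3)] pair_vec_closed[OF assms(2,3)] pair_vec_closed[OF vs_add[OF PD(1) assms(1,2)] assms(3)]
  have "pure P N (x \<oplus>\<^bsub>P\<^esub> x') y = K +>\<^bsub>V\<^esub> (pair_vec x y \<oplus>\<^bsub>V\<^esub> pair_vec x' y)"
    unfolding pure_def
  proof (rule tensor_class_eq[OF p(3) vs_add[OF vsp_free_pairs p(1,2)]])
    show "pair_vec (x \<oplus>\<^bsub>P\<^esub> x') y \<ominus>\<^bsub>V\<^esub> (pair_vec x y \<oplus>\<^bsub>V\<^esub> pair_vec x' y) \<in> tensor_rels A P N"
      unfolding tensor_rel_eqs(1)[OF assms vs_zero[OF ND(1)] zero_closed, symmetric] tensor_rels_def using assms by blast
  qed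
  also have "\<dots> = pure P N x y \<oplus>\<^bsub>T\<^esub> pure P N x' y"
    unfolding pure_def by (rule lin_add[OF tensor_proj p(1,2)])
  finally show ?thesis .
qed

lemma pure_add_right:
  assumes "x \<in> carrier P" "y \<in> carrier N" "y' \<in> carrier N"
  shows "pure P N x (y \<oplus>\<^bsub>N\<^esub> y') = pure P N x y \<oplus>\<^bsub>T\<^esub> pure P N x y'"
proof -
  note p = pair_vec_closed[OF assms(1,2)] pair_vec_closed[OF assms(1,3)] pair_vec_closed[OF assms(1) vs_add[OF ND(1) assms(2,3)]]
  have "pure P N x (y \<oplus>\<^bsub>N\<^esub> y') = K +>\<^bsub>V\<^esub> (pair_vec x y \<oplus>\<^bsub>V\<^esub> pair_vec x y')"
    unfolding pure_def
  proof (rule tensor_class_eq[OF p(3) vs_add[OF vsp_free_pairs p(1,2)]])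
    show "pair_vec x (y \<oplus>\<^bsub>N\<^esub> y') \<ominus>\<^bsub>V\<^esub> (pair_vec x y \<oplus>\<^bsub>V\<^esub> pair_vec x y') \<in> tensor_rels A P N"
      unfolding tensor_rel_eqs(2)[OF assms(1) vs_zero[OF PD(1)] assms(2,3) zero_closed, symmetric] tensor_rels_def using assms by blast
  qed
  also have "\<dots> = pure P N x y \<oplus>\<^bsub>T\<^esub> pure P N x y'"
    unfolding pure_def by (rule lin_add[OF tensor_proj p(1,2)])
  finally show ?thesis .
qed

lemma pure_ract:
  assumes "x \<in> carrier P" "a \<in> carrier A" "y \<in> carrier N"
  shows "pure P N (ract P x a) y = pure P N x (lact N a y)"
  unfolding pure_def
proof (rule tensor_class_eq[OF pair_vec_closed[OF PD(2)[OF assms(1,2)] assms(3)] pair_vec_closed[OF assms(1) ND(2)[OF assms(3,2)]]])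
  show "pair_vec (ract P x a) y \<ominus>\<^bsub>V\<^esub> pair_vec x (lact N a y) \<in> tensor_rels A P N"
    unfolding tensor_rel_eqs(3)[OF assms(1) vs_zero[OF PD(1)] assms(3) vs_zero[OF ND(1)] assms(2), symmetric] tensor_rels_def
    using assms by blast
qed

lemma pure_smult_left:
  assumes "x \<in> carrier P" "y \<in> carrier N"
  shows "pure P N (c \<odot>\<^bsub>P\<^esub> x) y = c \<odot>\<^bsub>T\<^esub> pure P N x y"
proof -
  note p = pair_vec_closed[OF assms] pair_vec_closed[OF vs_smult[OF PD(1) assms(1), of c] assms(2)]
  have "pure P N (c \<odot>\<^bsub>P\<^esub> x) y = K +>\<^bsub>V\<^esub> (c \<odot>\<^bsub>V\<^esub> pair_vec x y)"
    unfolding pure_def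
  proof (rule tensor_class_eq[OF p(2) vs_smult[OF vsp_free_pairs p(1)]])
    show "pair_vec (c \<odot>\<^bsub>P\<^esub> x) y \<ominus>\<^bsub>V\<^esub> (c \<odot>\<^bsub>V\<^esub> pair_vec x y) \<in> tensor_rels A P N"
      unfolding tensor_rel_eqs(4)[OF assms(1) vs_zero[OF PD(1)] assms(2) vs_zero[OF ND(1)] zero_closed, symmetric] tensor_rels_def
      using assms by blast
  qed
  also have "\<dots> = c \<odot>\<^bsub>T\<^esub> pure P N x y" unfolding pure_def by (rule lin_smult[OF tensor_proj p(1)])
  finally show ?thesis .
qed

text \<open>The relations move scalars only on the left factor. On the right they cross over by way
  of \<open>c \<odot> \<one>\<close>, which acts from both sides.\<close>

lemma pure_smult_right:
  assumes "x \<in> carrier P" "y \<in> carrier N"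
  shows "pure P N x (c \<odot>\<^bsub>N\<^esub> y) = c \<odot>\<^bsub>T\<^esub> pure P N x y"
proof -
  have c: "c \<odot> \<one> \<in> carrier A" by simp
  have "lact N (c \<odot> \<one>) y = c \<odot>\<^bsub>N\<^esub> y" using assms(2) ND(6,8) by simp
  moreover have "ract P x (c \<odot> \<one>) = c \<odot>\<^bsub>P\<^esub> x" using assms(1) PD(6,8) by simp
  ultimately show ?thesis using pure_ract[OF assms(1) c assms(2)] pure_smult_left[OF assms] by simp
qed

lemma tensor_induct:
  assumes U: "subsp T U" and p: "\<And>x y. x \<in> carrier P \<Longrightarrow> y \<in> carrier N \<Longrightarrow> pure P N x y \<in> U"
    and X: "X \<in> carrier T"
  shows "X \<in> U"
proof -
  let ?q = "\<lambda>h. K +>\<^bsub>V\<^esub> h"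
  let ?U = "{h \<in> carrier V. ?q h \<in> U}"
  have sU: "subsp V ?U"
    by (rule subspI) (use vsp_free_pairs subspD[OF U] lin_zero[OF vsp_free_pairs vsp_tensor tensor_proj] in
      \<open>auto simp: lin_add[OF tensor_proj] lin_smult[OF tensor_proj]\<close>)
  obtain h where h: "h \<in> carrier V" "X = ?q h" using subquot_cases[OF tensor_subquot X] by blast
  have "h \<in> ?U"
    by (rule free_pairs_induct[OF sU _ h(1)]) (use p pair_vec_closed in \<open>auto simp: pure_def\<close>)
  then show ?thesis using h(2) by simp
qed

text \<open>The equalizer of two linear maps is a subspace, and one that contains all elementary
  tensors is everything.\<close>

lemma tensor_lin_eqI:
  assumes W: "vsp W" and F: "F \<in> lin T W" and G: "G \<in> lin T W"
    and eq: "\<And>x y. x \<in> carrier P \<Longrightarrow> y \<in> carrier N \<Longrightarrow> F (pure P N x y) = G (pure P N x y)"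
    and X: "X \<in> carrier T"
  shows "F X = G X"
  using tensor_induct[OF subsp_equalizer[OF vsp_tensor W F G] _ X] eq pure_closed by blast

lemma tensor_null_least:
  assumes W: "vsp W" and F: "F \<in> lin V W"
    and 1: "\<And>x x' y. x \<in> carrier P \<Longrightarrow> x' \<in> carrier P \<Longrightarrow> y \<in> carrier N \<Longrightarrow>
      F (pair_vec (x \<oplus>\<^bsub>P\<^esub> x') y) = F (pair_vec x y) \<oplus>\<^bsub>W\<^esub> F (pair_vec x' y)"
    and 2: "\<And>x y y'. x \<in> carrier P \<Longrightarrow> y \<in> carrier N \<Longrightarrow> y' \<in> carrier N \<Longrightarrow>
      F (pair_vec x (y \<oplus>\<^bsub>N\<^esub> y')) = F (pair_vec x y) \<oplus>\<^bsub>W\<^esub> F (pair_vec x y')"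
    and 3: "\<And>x y a. x \<in> carrier P \<Longrightarrow> y \<in> carrier N \<Longrightarrow> a \<in> carrier A \<Longrightarrow>
      F (pair_vec (ract P x a) y) = F (pair_vec x (lact N a y))"
    and 4: "\<And>c x y. x \<in> carrier P \<Longrightarrow> y \<in> carrier N \<Longrightarrow> F (pair_vec (c \<odot>\<^bsub>P\<^esub> x) y) = c \<odot>\<^bsub>W\<^esub> F (pair_vec x y)"
    and h: "h \<in> K"
  shows "F h = \<zero>\<^bsub>W\<^esub>"
proof -
  let ?K = "{h \<in> carrier V. F h = \<zero>\<^bsub>W\<^esub>}"
  note V = vsp_free_pairs[of P N] and pv = pair_vec_closed[of _ P _ N]
  have m: "F (h \<ominus>\<^bsub>V\<^esub> h') = \<zero>\<^bsub>W\<^esub>" if "h \<in> carrier V" "h' \<in> carrier V" "F h = F h'" for h h'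
    using that lin_minus[OF V W F] lin_closed[OF F] vs_minus_self[OF W] by simp
  have "r \<in> ?K" if r: "r \<in> tensor_rels A P N" for r
  proof -
    have "F r = \<zero>\<^bsub>W\<^esub>" using r
    proof (cases rule: tensor_rels_cases)
      case (1 x x' y)
      show ?thesis unfolding 1(4)
        by (rule m) (use 1 assms(3) V pv PD(1) in \<open>simp_all add: vs_add lin_add[OF F]\<close>)
    next
      case (2 x y y')
      show ?thesis unfolding 2(4)
        by (rule m) (use 2 assms(4) V pv ND(1) in \<open>simp_all add: vs_add lin_add[OF F]\<close>)
    next
      case (3 x y a)
      show ?thesis unfolding 3(4)
        by (rule m) (use 3 assms(5) pv PD(2) ND(2) in simp_all)
    next
      case (4 c x y)
      show ?thesis unfolding 4(3)
        by (rule m) (use 4 assms(6) V pv PD(1) in \<open>simp_all add: vs_smult lin_smult[OF F]\<close>)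
    qed
    then show ?thesis using r tensor_rels_closed by auto
  qed
  then have "tensor_rels A P N \<subseteq> ?K" by blast
  then have "K \<subseteq> ?K" unfolding tensor_null_def by (rule span_least[OF V subsp_ker[OF V W F]])
  then show ?thesis using h by blast
qed

lemma tensor_universal:
  assumes W: "vsp W" and c: "\<And>x y. x \<in> carrier P \<Longrightarrow> y \<in> carrier N \<Longrightarrow> \<beta> x y \<in> carrier W"
    and 1: "\<And>x x' y. x \<in> carrier P \<Longrightarrow> x' \<in> carrier P \<Longrightarrow> y \<in> carrier N \<Longrightarrow> \<beta> (x \<oplus>\<^bsub>P\<^esub> x') y = \<beta> x y \<oplus>\<^bsub>W\<^esub> \<beta> x' y"
    and 2: "\<And>x y y'. x \<in> carrier P \<Longrightarrow> y \<in> carrier N \<Longrightarrow> y' \<in> carrier N \<Longrightarrow> \<beta> x (y \<oplus>\<^bsub>N\<^esub> y') = \<beta> x y \<oplus>\<^bsub>W\<^esub> \<beta> x y'"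
    and 3: "\<And>x y a. x \<in> carrier P \<Longrightarrow> y \<in> carrier N \<Longrightarrow> a \<in> carrier A \<Longrightarrow> \<beta> (ract P x a) y = \<beta> x (lact N a y)"
    and 4: "\<And>c x y. x \<in> carrier P \<Longrightarrow> y \<in> carrier N \<Longrightarrow> \<beta> (c \<odot>\<^bsub>P\<^esub> x) y = c \<odot>\<^bsub>W\<^esub> \<beta> x y"
  shows "\<exists>F\<in>lin T W. \<forall>x\<in>carrier P. \<forall>y\<in>carrier N. F (pure P N x y) = \<beta> x y"
proof -
  let ?q = "\<lambda>h. K +>\<^bsub>V\<^esub> h"
  note V = vsp_free_pairs[of P N]
  obtain F where F: "F \<in> lin V W" and Fp: "\<And>x y. x \<in> carrier P \<Longrightarrow> y \<in> carrier N \<Longrightarrow> F (pair_vec x y) = \<beta> x y"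
    using free_pairs_lift[OF W, of P N \<beta>] c by blast
  have null: "F h = \<zero>\<^bsub>W\<^esub>" if "h \<in> K" for h
    by (rule tensor_null_least[OF W F _ _ _ _ that])
      (use 1 2 3 4 PD(2) ND(2) vs_add[OF PD(1)] vs_add[OF ND(1)] vs_smult[OF PD(1)] in \<open>simp_all add: Fp\<close>)
  \<comment> \<open>The value at some representative; by \<open>null\<close> the choice is
    immaterial.\<close>
  define G where "G X = F (SOME h. h \<in> carrier V \<and> X = ?q h)" for X
  have G: "G (?q h) = F h" if h: "h \<in> carrier V" for h
  proof -
    let ?h = "SOME h'. h' \<in> carrier V \<and> ?q h = ?q h'"
    have s: "?h \<in> carrier V \<and> ?q h = ?q ?h" by (rule someI[of _ h]) (use h in simp)
    then have "h \<ominus>\<^bsub>V\<^esub> ?h \<in> K" using coset_eq_iff[OF V tensor_null_subsp h, of ?h] by blast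
    then have "F (h \<ominus>\<^bsub>V\<^esub> ?h) = \<zero>\<^bsub>W\<^esub>" by (rule null)
    then have "F h = F ?h" using lin_minus[OF V W F h, of ?h] vs_minus_zero_iff[OF W] lin_closed[OF F] s h by simp
    then show ?thesis by (simp add: G_def)
  qed
  have Gl: "G \<in> lin T W"
    by (rule subquot_lin[OF tensor_subquot, of F]) (use F G in simp_all)
  show ?thesis by (rule bexI[OF _ Gl]) (use G Fp in \<open>auto simp: pure_def pair_vec_closed\<close>)
qed

end

lemma tensor_map:
  assumes P: "right_module A P" and Q: "right_module A Q" and N: "left_module A N"
    and f: "f \<in> rmod_hom A P Q" and g: "g \<in> lmod_end N"
  shows "tensor_map A Q N f g \<in> lin (tensor A P N) (tensor A Q N)"
    "x \<in> carrier P \<Longrightarrow> y \<in> carrier N \<Longrightarrow> tensor_map A Q N f g (pure P N x y) = pure Q N (f x) (g y)"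
proof -
  note PD = right_moduleD[OF P] and QD = right_moduleD[OF Q] and ND = left_moduleD[OF N]
  note fD = rmod_homD[OF f] and gl = lmod_end_lin[OF g] and fl = rmod_hom_lin[OF P Q f]
  have gA: "g (lact N a y) = lact N a (g y)" if "a \<in> carrier A" "y \<in> carrier N" for a y using g that by (simp add: lmod_end_def)
  let ?q = "\<lambda>h. tensor_null A Q N +>\<^bsub>free_pairs Q N\<^esub> h" and ?p = "\<lambda>h. tensor_null A P N +>\<^bsub>free_pairs P N\<^esub> h"
  have m: "free_pairs_map f g \<in> lin (free_pairs P N) (free_pairs Q N)"
    by (rule free_pairs_map_lin) (use fD(1) lin_closed[OF gl] in auto)
  have qm: "(\<lambda>h. ?q (free_pairs_map f g h)) \<in> lin (free_pairs P N) (tensor A Q N)" by (rule lin_comp[OF m tensor_proj[OF Q N]])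
  have qp: "?q (free_pairs_map f g (pair_vec x y)) = pure Q N (f x) (g y)" for x y by (simp add: free_pairs_map_pair_vec pure_def)
  have n: "free_pairs_map f g h \<in> tensor_null A Q N" if h: "h \<in> tensor_null A P N" for h
  proof -
    have hc: "h \<in> carrier (free_pairs P N)" using h subspD(1)[OF tensor_null_subsp[OF P N]] by blast
    have "?q (free_pairs_map f g h) = \<zero>\<^bsub>tensor A Q N\<^esub>"
      by (rule tensor_null_least[OF P N vsp_tensor[OF Q N] qm _ _ _ _ h])
        (use fD gl gA lin_smult[OF fl] pure_add_left[OF Q N] pure_add_right[OF Q N] pure_ract[OF Q N] pure_smult_left[OF Q N]
          in \<open>simp_all add: qp lin_add[OF gl]\<close>)
    then show ?thesis using subquotD(8)[OF tensor_subquot[OF Q N] lin_closed[OF m hc]] by blast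
  qed
  have cl: "tensor_map A Q N f g (?p h) = ?q (free_pairs_map f g h)" if "h \<in> carrier (free_pairs P N)" for h
    unfolding tensor_map_def
    by (rule quot_map_coset[OF vsp_free_pairs tensor_null_subsp[OF Q N] vsp_free_pairs tensor_null_subsp[OF P N]
      subspD(1)[OF tensor_null_subsp[OF P N]] subset_refl _ n that]) (use m in simp_all)
  show "tensor_map A Q N f g \<in> lin (tensor A P N) (tensor A Q N)"
    by (rule subquot_lin[OF tensor_subquot[OF P N], of "\<lambda>h. ?q (free_pairs_map f g h)"]) (use qm cl in simp_all)
  show "tensor_map A Q N f g (pure P N x y) = pure Q N (f x) (g y)" if "x \<in> carrier P" "y \<in> carrier N"
    using cl[OF pair_vec_closed[OF that]] qp[of x y] by (simp only: pure_def)
qed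

end

section \<open>Tor\<close>

lemma lin_finsum_map:
  assumes V: "vsp V" and W: "vsp W" and f: "\<And>i. i \<in> I \<Longrightarrow> f i \<in> lin V W"
  shows "(\<lambda>x. finsum W (\<lambda>i. f i x) I) \<in> lin V W"
proof (rule linI)
  have c: "(\<lambda>i. f i x) \<in> I \<rightarrow> carrier W" if "x \<in> carrier V" for x using lin_closed[OF f that] by blast
  show "finsum W (\<lambda>i. f i x) I \<in> carrier W" if "x \<in> carrier V" for x by (rule vs_finsum[OF W c[OF that]])
  show "finsum W (\<lambda>i. f i (x \<oplus>\<^bsub>V\<^esub> y)) I = finsum W (\<lambda>i. f i x) I \<oplus>\<^bsub>W\<^esub> finsum W (\<lambda>i. f i y) I"
    if xy: "x \<in> carrier V" "y \<in> carrier V" for x y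
  proof -
    have "finsum W (\<lambda>i. f i (x \<oplus>\<^bsub>V\<^esub> y)) I = finsum W (\<lambda>i. f i x \<oplus>\<^bsub>W\<^esub> f i y) I"
      by (rule vs_finsum_cong[OF W refl]) (use xy f c W in \<open>auto simp: lin_add[OF f] intro!: vs_add[OF W]\<close>)
    then show ?thesis using vs_finsum_add[OF W c[OF xy(1)] c[OF xy(2)]] by simp
  qed
  show "finsum W (\<lambda>i. f i (a \<odot>\<^bsub>V\<^esub> x)) I = a \<odot>\<^bsub>W\<^esub> finsum W (\<lambda>i. f i x) I" if x: "x \<in> carrier V" for a x
  proof -
    have "finsum W (\<lambda>i. f i (a \<odot>\<^bsub>V\<^esub> x)) I = finsum W (\<lambda>i. a \<odot>\<^bsub>W\<^esub> f i x) I"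
      by (rule vs_finsum_cong[OF W refl]) (use x f c W in \<open>auto simp: lin_smult[OF f] intro!: vs_smult[OF W]\<close>)
    also have "\<dots> = a \<odot>\<^bsub>W\<^esub> finsum W (\<lambda>i. f i x) I"
      by (rule lin_finsum[OF W W lin_smult_map[OF W lin_id] c[OF x], symmetric])
    finally show ?thesis .
  qed
qed

context fin_alg
begin

lemma chain_map_cong:
  assumes "chain_map P R \<phi> \<Phi>" "exact_res M P" "\<And>x. x \<in> carrier M \<Longrightarrow> \<phi> x = \<phi>' x"
  shows "chain_map P R \<phi>' \<Phi>"
  using assms(1) assms(3)[OF rmod_homD(1)[OF exact_resD(4)[OF assms(2)]]] by (simp add: chain_map_def)

abbreviation tor_class where
  "tor_class P N l X \<equiv> tor_boundaries A P N l +>\<^bsub>tensor A (obj P l) N\<^esub> X"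

text \<open>The counterpart of \<open>ext_ind\<close>, now covariant in the chain map.\<close>

definition tor_ind where
  "tor_ind N Q F \<psi> l = quot_map (tensor A (obj Q l) N) (tor_boundaries A Q N l) (tensor_map A (obj Q l) N (F l) \<psi>)"

lemma tor_map_eq_ind: "tor_map A P N \<phi> \<psi> l = tor_ind N P (chain_lift A P \<phi>) \<psi> l"
  by (simp add: tor_map_def tor_ind_def)

context
  fixes N :: "('k, 'n, 'c, 'a, 'z) bimod_scheme"
  assumes N: "left_module A N"
begin

lemma tensor_map_comp:
  assumes P: "right_module A P" and Q: "right_module A Q" and R: "right_module A R"
    and f: "f \<in> rmod_hom A P Q" and f': "f' \<in> rmod_hom A Q R" and g: "g \<in> lmod_end N" and g': "g' \<in> lmod_end N"
    and X: "X \<in> carrier (tensor A P N)"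
  shows "tensor_map A R N f' g' (tensor_map A Q N f g X) = tensor_map A R N (\<lambda>x. f' (f x)) (\<lambda>y. g' (g y)) X"
proof (rule tensor_lin_eqI[OF P N vsp_tensor[OF R N] lin_comp[OF tensor_map(1)[OF P Q N f g] tensor_map(1)[OF Q R N f' g']]
    tensor_map(1)[OF P R N rmod_hom_comp[OF f f'] lmod_end_comp[OF g g']] _ X])
  fix x y assume xy: "x \<in> carrier P" "y \<in> carrier N"
  show "tensor_map A R N f' g' (tensor_map A Q N f g (pure P N x y)) = tensor_map A R N (\<lambda>x. f' (f x)) (\<lambda>y. g' (g y)) (pure P N x y)"
    unfolding tensor_map(2)[OF P Q N f g xy] tensor_map(2)[OF P R N rmod_hom_comp[OF f f'] lmod_end_comp[OF g g'] xy]
    by (rule tensor_map(2)[OF Q R N f' g' rmod_homD(1)[OF f xy(1)] lin_closed[OF lmod_end_lin[OF g] xy(2)]])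
qed

lemma tensor_map_cong:
  assumes P: "right_module A P" and Q: "right_module A Q"
    and f: "f \<in> rmod_hom A P Q" and f': "f' \<in> rmod_hom A P Q" and g: "g \<in> lmod_end N" and g': "g' \<in> lmod_end N"
    and eq: "\<And>x. x \<in> carrier P \<Longrightarrow> f x = f' x" "\<And>y. y \<in> carrier N \<Longrightarrow> g y = g' y"
    and X: "X \<in> carrier (tensor A P N)"
  shows "tensor_map A Q N f g X = tensor_map A Q N f' g' X"
proof (rule tensor_lin_eqI[OF P N vsp_tensor[OF Q N] tensor_map(1)[OF P Q N f g] tensor_map(1)[OF P Q N f' g'] _ X])
  fix x y assume xy: "x \<in> carrier P" "y \<in> carrier N"
  show "tensor_map A Q N f g (pure P N x y) = tensor_map A Q N f' g' (pure P N x y)"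
    unfolding tensor_map(2)[OF P Q N f g xy] tensor_map(2)[OF P Q N f' g' xy] eq(1)[OF xy(1)] eq(2)[OF xy(2)] ..
qed

lemma tensor_map_id:
  assumes P: "right_module A P" and X: "X \<in> carrier (tensor A P N)"
  shows "tensor_map A P N (\<lambda>x. x) (\<lambda>y. y) X = X"
  by (rule tensor_lin_eqI[OF P N vsp_tensor[OF P N] tensor_map(1)[OF P P N rmod_hom_id lmod_end_id] lin_id _ X])
    (rule tensor_map(2)[OF P P N rmod_hom_id lmod_end_id])

lemma pure_zero_left: "right_module A P \<Longrightarrow> y \<in> carrier N \<Longrightarrow> pure P N \<zero>\<^bsub>P\<^esub> y = \<zero>\<^bsub>tensor A P N\<^esub>"
proof -
  assume P: "right_module A P" and y: "y \<in> carrier N"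
  note z = vs_zero[OF right_moduleD(1)[OF P]] and pc = pure_closed[OF P N vs_zero[OF right_moduleD(1)[OF P]] y]
  have "pure P N (0 \<odot>\<^bsub>P\<^esub> \<zero>\<^bsub>P\<^esub>) y = 0 \<odot>\<^bsub>tensor A P N\<^esub> pure P N \<zero>\<^bsub>P\<^esub> y" by (rule pure_smult_left[OF P N z y])
  then show ?thesis using vs_smult_zero[OF right_moduleD(1)[OF P]] vs_zero_smult[OF vsp_tensor[OF P N] pc] by simp
qed

lemma tensor_map_zero:
  assumes P: "right_module A P" and Q: "right_module A Q"
    and f: "f \<in> rmod_hom A P Q" and g: "g \<in> lmod_end N" and z: "\<And>x. x \<in> carrier P \<Longrightarrow> f x = \<zero>\<^bsub>Q\<^esub>"
    and X: "X \<in> carrier (tensor A P N)"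
  shows "tensor_map A Q N f g X = \<zero>\<^bsub>tensor A Q N\<^esub>"
proof (rule tensor_lin_eqI[OF P N vsp_tensor[OF Q N] tensor_map(1)[OF P Q N f g] lin_zero_map[OF vsp_tensor[OF Q N]] _ X])
  fix x y assume xy: "x \<in> carrier P" "y \<in> carrier N"
  show "tensor_map A Q N f g (pure P N x y) = \<zero>\<^bsub>tensor A Q N\<^esub>"
    unfolding tensor_map(2)[OF P Q N f g xy] z[OF xy(1)] by (rule pure_zero_left[OF Q lin_closed[OF lmod_end_lin[OF g] xy(2)]])
qed

lemma tensor_map_add:
  assumes P: "right_module A P" and Q: "right_module A Q"
    and f: "f \<in> rmod_hom A P Q" and f1: "f1 \<in> rmod_hom A P Q" and f2: "f2 \<in> rmod_hom A P Q" and g: "g \<in> lmod_end N"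
    and eq: "\<And>x. x \<in> carrier P \<Longrightarrow> f x = f1 x \<oplus>\<^bsub>Q\<^esub> f2 x" and X: "X \<in> carrier (tensor A P N)"
  shows "tensor_map A Q N f g X = tensor_map A Q N f1 g X \<oplus>\<^bsub>tensor A Q N\<^esub> tensor_map A Q N f2 g X"
proof (rule tensor_lin_eqI[OF P N vsp_tensor[OF Q N] tensor_map(1)[OF P Q N f g]
    lin_add_map[OF vsp_tensor[OF Q N] tensor_map(1)[OF P Q N f1 g] tensor_map(1)[OF P Q N f2 g]] _ X])
  fix x y assume xy: "x \<in> carrier P" "y \<in> carrier N"
  show "tensor_map A Q N f g (pure P N x y) = tensor_map A Q N f1 g (pure P N x y) \<oplus>\<^bsub>tensor A Q N\<^esub> tensor_map A Q N f2 g (pure P N x y)"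
    unfolding tensor_map(2)[OF P Q N f g xy] tensor_map(2)[OF P Q N f1 g xy] tensor_map(2)[OF P Q N f2 g xy] eq[OF xy(1)]
    by (rule pure_add_left[OF Q N rmod_homD(1)[OF f1 xy(1)] rmod_homD(1)[OF f2 xy(1)] lin_closed[OF lmod_end_lin[OF g] xy(2)]])
qed

lemma tensor_bd_lin:
  assumes "exact_res M P"
  shows "tensor_map A (obj P l) N (bd P l) (\<lambda>y. y) \<in> lin (tensor A (obj P (Suc l)) N) (tensor A (obj P l) N)"
  by (rule tensor_map(1)[OF exact_resD(2,2)[OF assms] N exact_resD(3)[OF assms] lmod_end_id])

lemma tor_subsp:
  assumes P: "exact_res M P"
  shows "subsp (tensor A (obj P l) N) (tor_cycles A P N l)" (is ?Z)
    "subsp (tensor A (obj P l) N) (tor_boundaries A P N l)" (is ?B)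
    "tor_boundaries A P N l \<subseteq> tor_cycles A P N l" (is ?BZ)
proof -
  note PD = exact_resD[OF P]
  note vT = vsp_tensor[OF PD(2) N]
  note d = tensor_bd_lin[OF P]
  show ?Z
  proof (cases l)
    case 0
    show ?thesis unfolding 0 tor_cycles_def nat.case by (rule subsp_self[OF vT])
  next
    case (Suc j)
    show ?thesis unfolding Suc tor_cycles_def nat.case by (rule subsp_ker[OF vT vT d])
  qed
  show ?B unfolding tor_boundaries_def by (rule subsp_image[OF vT vT d subsp_self[OF vT]])
  show ?BZ
  proof
    fix Y assume "Y \<in> tor_boundaries A P N l"
    then obtain X where X: "X \<in> carrier (tensor A (obj P (Suc l)) N)" "Y = tensor_map A (obj P l) N (bd P l) (\<lambda>y. y) X"
      unfolding tor_boundaries_def by blast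
    have Yc: "Y \<in> carrier (tensor A (obj P l) N)" unfolding X(2) by (rule lin_closed[OF d X(1)])
    show "Y \<in> tor_cycles A P N l"
    proof (cases l)
      case 0
      show ?thesis using Yc unfolding 0 tor_cycles_def nat.case .
    next
      case (Suc j)
      have X': "X \<in> carrier (tensor A (obj P (Suc (Suc j))) N)" using X(1) unfolding Suc .
      have "tensor_map A (obj P j) N (bd P j) (\<lambda>y. y) Y = tensor_map A (obj P j) N (\<lambda>x. bd P j (bd P (Suc j) x)) (\<lambda>y. y) X"
        unfolding X(2) Suc by (rule tensor_map_comp[OF PD(2,2,2,3,3) lmod_end_id lmod_end_id X'])
      also have "\<dots> = \<zero>\<^bsub>tensor A (obj P j) N\<^esub>"
        by (rule tensor_map_zero[OF PD(2,2) rmod_hom_comp[OF PD(3,3)] lmod_end_id PD(9) X'])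
      finally show ?thesis using Yc unfolding Suc tor_cycles_def nat.case by blast
    qed
  qed
qed

lemma tor_subquot:
  assumes P: "exact_res M P"
    and X: "same_space X (tor_space A P N l)"
  shows "subquot (tensor A (obj P l) N) (tor_cycles A P N l) (tor_boundaries A P N l) X (\<lambda>z. tor_class P N l z)"
  by (rule subquot_quot_space[OF vsp_tensor[OF exact_resD(2)[OF P] N] tor_subsp[OF P]]) (use X in \<open>simp_all add: tor_space_def\<close>)

context
  fixes Q P M W F \<phi> \<psi>
  assumes P: "exact_res M P" and Q: "exact_res W Q" and F: "chain_map P Q \<phi> F" and \<psi>: "\<psi> \<in> lmod_end N"
begin

lemma tor_push_bd:
  assumes X: "X \<in> carrier (tensor A (obj P (Suc l)) N)"
  shows "tensor_map A (obj Q l) N (bd Q l) (\<lambda>y. y) (tensor_map A (obj Q (Suc l)) N (F (Suc l)) \<psi> X) =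
    tensor_map A (obj Q l) N (F l) \<psi> (tensor_map A (obj P l) N (bd P l) (\<lambda>y. y) X)"
proof -
  note PD = exact_resD[OF P] and QD = exact_resD[OF Q] and FD = chain_mapD[OF F]
  have "tensor_map A (obj Q l) N (bd Q l) (\<lambda>y. y) (tensor_map A (obj Q (Suc l)) N (F (Suc l)) \<psi> X) =
     tensor_map A (obj Q l) N (\<lambda>x. bd Q l (F (Suc l) x)) \<psi> X"
    by (rule tensor_map_comp[OF PD(2) QD(2,2) FD(1) QD(3) \<psi> lmod_end_id X])
  also have "\<dots> = tensor_map A (obj Q l) N (\<lambda>x. F l (bd P l x)) \<psi> X"
    by (rule tensor_map_cong[OF PD(2) QD(2) rmod_hom_comp[OF FD(1) QD(3)] rmod_hom_comp[OF PD(3) FD(1)] \<psi> \<psi> FD(3) refl X])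
  also have "\<dots> = tensor_map A (obj Q l) N (F l) \<psi> (tensor_map A (obj P l) N (bd P l) (\<lambda>y. y) X)"
    by (rule tensor_map_comp[OF PD(2,2) QD(2) PD(3) FD(1) lmod_end_id \<psi> X, symmetric])
  finally show ?thesis .
qed

lemma tor_push:
  shows "tensor_map A (obj Q l) N (F l) \<psi> \<in> lin (tensor A (obj P l) N) (tensor A (obj Q l) N)"
    "z \<in> tor_cycles A P N l \<Longrightarrow> tensor_map A (obj Q l) N (F l) \<psi> z \<in> tor_cycles A Q N l"
    "z \<in> tor_boundaries A P N l \<Longrightarrow> tensor_map A (obj Q l) N (F l) \<psi> z \<in> tor_boundaries A Q N l"
proof -
  note PD = exact_resD[OF P] and QD = exact_resD[OF Q] and FD = chain_mapD[OF F]
  have l: "tensor_map A (obj Q l) N (F l) \<psi> \<in> lin (tensor A (obj P l) N) (tensor A (obj Q l) N)" for l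
    by (rule tensor_map(1)[OF PD(2) QD(2) N FD(1) \<psi>])
  then show "tensor_map A (obj Q l) N (F l) \<psi> \<in> lin (tensor A (obj P l) N) (tensor A (obj Q l) N)" .
  show "tensor_map A (obj Q l) N (F l) \<psi> z \<in> tor_cycles A Q N l" if z: "z \<in> tor_cycles A P N l"
  proof (cases l)
    case 0
    show ?thesis using z lin_closed[OF l] unfolding 0 tor_cycles_def nat.case by blast
  next
    case (Suc j)
    have zc: "z \<in> carrier (tensor A (obj P (Suc j)) N)"
      and z0: "tensor_map A (obj P j) N (bd P j) (\<lambda>y. y) z = \<zero>\<^bsub>tensor A (obj P j) N\<^esub>"
      using z unfolding Suc tor_cycles_def nat.case by auto
    have "tensor_map A (obj Q j) N (bd Q j) (\<lambda>y. y) (tensor_map A (obj Q (Suc j)) N (F (Suc j)) \<psi> z) = \<zero>\<^bsub>tensor A (obj Q j) N\<^esub>"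
      unfolding tor_push_bd[OF zc] z0 by (rule lin_zero[OF vsp_tensor[OF PD(2) N] vsp_tensor[OF QD(2) N] l])
    then show ?thesis using lin_closed[OF l zc] unfolding Suc tor_cycles_def nat.case by blast
  qed
  show "tensor_map A (obj Q l) N (F l) \<psi> z \<in> tor_boundaries A Q N l" if z: "z \<in> tor_boundaries A P N l"
  proof -
    obtain X where X: "X \<in> carrier (tensor A (obj P (Suc l)) N)" "z = tensor_map A (obj P l) N (bd P l) (\<lambda>y. y) X"
      using z unfolding tor_boundaries_def by blast
    show ?thesis unfolding X(2) tor_push_bd[OF X(1), symmetric] tor_boundaries_def
      using lin_closed[OF l X(1)] by blast
  qed
qed

lemma tor_ind_class:
  assumes z: "z \<in> tor_cycles A P N l"
  shows "tor_ind N Q F \<psi> l (tor_class P N l z) = tor_class Q N l (tensor_map A (obj Q l) N (F l) \<psi> z)"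
  unfolding tor_ind_def
proof (rule quot_map_coset[OF _ _ _ _ _ _ _ _ z])
  show "vsp (tensor A (obj Q l) N)" "vsp (tensor A (obj P l) N)"
    using vsp_tensor exact_resD(2)[OF Q] exact_resD(2)[OF P] N by auto
  show "tensor_map A (obj Q l) N (F l) \<psi> \<in> lin ((tensor A (obj P l) N)\<lparr>carrier := tor_cycles A P N l\<rparr>) (tensor A (obj Q l) N)"
    by (rule lin_restrict_dom[OF tor_push(1) subspD(1)[OF tor_subsp(1)[OF P]]])
qed (use tor_subsp[OF P] tor_subsp[OF Q] tor_push(3) subspD(1)[OF tor_subsp(1)[OF P]] in auto)

lemma tor_ind_lin:
  assumes X: "same_space X (tor_space A P N l)"
    and Y: "same_space Y (tor_space A Q N l)"
  shows "tor_ind N Q F \<psi> l \<in> lin X Y"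
proof -
  have f: "tensor_map A (obj Q l) N (F l) \<psi> \<in>
      lin ((tensor A (obj P l) N)\<lparr>carrier := tor_cycles A P N l\<rparr>) ((tensor A (obj Q l) N)\<lparr>carrier := tor_cycles A Q N l\<rparr>)"
    by (rule lin_restrict[OF tor_push(1) subspD(1)[OF tor_subsp(1)[OF P]]]) (use tor_push(2) in auto)
  have g: "(\<lambda>z. tor_class Q N l (tensor_map A (obj Q l) N (F l) \<psi> z)) \<in> lin ((tensor A (obj P l) N)\<lparr>carrier := tor_cycles A P N l\<rparr>) Y"
    by (rule lin_comp[OF f subquotD(6)[OF tor_subquot[OF Q Y]]])
  show ?thesis by (rule subquot_lin[OF tor_subquot[OF P X] g tor_ind_class])
qed

end

lemma tor_space_cases:
  assumes "exact_res M P" "X \<in> carrier (tor_space A P N l)"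
  obtains z where "z \<in> tor_cycles A P N l" "X = tor_class P N l z"
  using subquot_cases[OF tor_subquot[OF assms(1) same_space_refl] assms(2)] that by blast

text \<open>Homotopic chain maps agree on homology. A cycle need not be an elementary tensor, so the
  homotopy relation cannot be applied inside it; it is first made into an identity between induced
  maps.\<close>

lemma tor_ind_cong:
  assumes P: "exact_res M P" and Q: "exact_res W Q" and ls: "\<And>l. lifts (obj P l) (obj Q (Suc l)) (obj Q l)"
    and F: "chain_map P Q \<phi> F" and G: "chain_map P Q \<phi>' G" and eq: "\<And>x. x \<in> carrier M \<Longrightarrow> \<phi> x = \<phi>' x"
    and \<psi>: "\<psi> \<in> lmod_end N" and \<psi>': "\<psi>' \<in> lmod_end N" and eq': "\<And>y. y \<in> carrier N \<Longrightarrow> \<psi> y = \<psi>' y"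
    and X: "X \<in> carrier (tor_space A P N l)"
  shows "tor_ind N Q F \<psi> l X = tor_ind N Q G \<psi>' l X"
proof -
  note QD = exact_resD[OF Q] and PD = exact_resD[OF P] and FD = chain_mapD[OF F] and GD = chain_mapD[OF G]
  obtain h where h: "\<And>l. h l \<in> rmod_hom A (obj P l) (obj Q (Suc l))"
    "\<And>x. x \<in> carrier (obj P 0) \<Longrightarrow> F 0 x \<ominus>\<^bsub>obj Q 0\<^esub> G 0 x = bd Q 0 (h 0 x)"
    "\<And>l x. x \<in> carrier (obj P (Suc l)) \<Longrightarrow>
       F (Suc l) x \<ominus>\<^bsub>obj Q (Suc l)\<^esub> G (Suc l) x = bd Q (Suc l) (h (Suc l) x) \<oplus>\<^bsub>obj Q (Suc l)\<^esub> h l (bd P l x)"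
    by (rule chain_map_homotopic[OF P Q ls F G eq], assumption) (rule that, assumption+)
  obtain z where z: "z \<in> tor_cycles A P N l" and Xz: "X = tor_class P N l z" by (rule tor_space_cases[OF P X])
  have zc: "z \<in> carrier (tensor A (obj P l) N)" using z subspD(1)[OF tor_subsp(1)[OF P]] by blast
  let ?T = "tensor A (obj Q l) N" and ?m = "\<lambda>f. tensor_map A (obj Q l) N f \<psi> z"
  note vT = vsp_tensor[OF QD(2)[of l] N]
  \<comment> \<open>The difference \<open>D\<close> splits as \<open>H + K\<close> before tensoring.
    \<open>H\<close> ends in a differential and maps into the boundaries, while \<open>K\<close>,
    present in positive degrees, begins with one and kills cycles.\<close>
  define H where "H = (\<lambda>x. bd Q l (h l x))"
  have Hh: "H \<in> rmod_hom A (obj P l) (obj Q l)" unfolding H_def by (rule rmod_hom_comp[OF h(1) QD(3)])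
  define D where "D = (\<lambda>x. F l x \<ominus>\<^bsub>obj Q l\<^esub> G l x)"
  have Dh: "D \<in> rmod_hom A (obj P l) (obj Q l)" unfolding D_def by (rule rmod_hom_minus[OF QD(2) FD(1) GD(1)])
  have c: "?m (F l) \<in> carrier ?T" "?m (G l) \<in> carrier ?T" "?m D \<in> carrier ?T"
    using lin_closed[OF tensor_map(1)[OF PD(2) QD(2) N FD(1) \<psi>] zc] lin_closed[OF tensor_map(1)[OF PD(2) QD(2) N GD(1) \<psi>] zc]
      lin_closed[OF tensor_map(1)[OF PD(2) QD(2) N Dh \<psi>] zc] by auto
  have mH: "?m H = tensor_map A (obj Q l) N (bd Q l) (\<lambda>y. y) (tensor_map A (obj Q (Suc l)) N (h l) \<psi> z)"
    unfolding H_def by (rule tensor_map_comp[OF PD(2) QD(2,2) h(1) QD(3) \<psi> lmod_end_id zc, symmetric])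
  have HB: "?m H \<in> tor_boundaries A Q N l"
    unfolding mH tor_boundaries_def using lin_closed[OF tensor_map(1)[OF PD(2) QD(2) N h(1) \<psi>] zc] by blast
  have DH: "?m D = ?m H"
  proof (cases l)
    case 0
    show ?thesis
      by (rule tensor_map_cong[OF PD(2) QD(2) Dh Hh \<psi> \<psi> _ refl zc]) (use h(2) 0 in \<open>simp add: D_def H_def\<close>)
  next
    case (Suc j)
    define K where "K = (\<lambda>x. h j (bd P j x))"
    have hj: "h j \<in> rmod_hom A (obj P j) (obj Q l)" using h(1)[of j] Suc by simp
    have bj: "bd P j \<in> rmod_hom A (obj P l) (obj P j)" using PD(3)[of j] Suc by simp
    have Kh: "K \<in> rmod_hom A (obj P l) (obj Q l)" unfolding K_def by (rule rmod_hom_comp[OF bj hj])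
    have "?m D = ?m H \<oplus>\<^bsub>?T\<^esub> ?m K"
      by (rule tensor_map_add[OF PD(2) QD(2) Dh Hh Kh \<psi> _ zc]) (use h(3) Suc in \<open>simp add: D_def H_def K_def\<close>)
    moreover have "?m K = tensor_map A (obj Q l) N (h j) \<psi> (tensor_map A (obj P j) N (bd P j) (\<lambda>y. y) z)"
      unfolding K_def by (rule tensor_map_comp[OF PD(2,2) QD(2) bj hj lmod_end_id \<psi> zc, symmetric])
    moreover have "tensor_map A (obj P j) N (bd P j) (\<lambda>y. y) z = \<zero>\<^bsub>tensor A (obj P j) N\<^esub>"
      using z unfolding Suc tor_cycles_def nat.case by auto
    ultimately have "?m D = ?m H \<oplus>\<^bsub>?T\<^esub> \<zero>\<^bsub>?T\<^esub>"
      using lin_zero[OF vsp_tensor[OF PD(2) N] vT tensor_map(1)[OF PD(2) QD(2) N hj \<psi>]] by simp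
    then show ?thesis using vs_add_zero[OF vT] HB subspD(1)[OF tor_subsp(2)[OF Q]] by auto
  qed
  have "?m (F l) = ?m D \<oplus>\<^bsub>?T\<^esub> ?m (G l)"
    by (rule tensor_map_add[OF PD(2) QD(2) FD(1) Dh GD(1) \<psi> _ zc])
      (use vs_minus_add_cancel[OF QD(11)] rmod_homD(1)[OF FD(1)] rmod_homD(1)[OF GD(1)] in \<open>simp add: D_def\<close>)
  then have "?m (F l) \<ominus>\<^bsub>?T\<^esub> ?m (G l) = ?m H" using vs_add_minus_cancel[OF vT c(3,2)] DH by simp
  then have "tor_class Q N l (?m (F l)) = tor_class Q N l (?m (G l))"
    using HB by (subst coset_eq_iff[OF vT tor_subsp(2)[OF Q] c(1,2)]) simp
  moreover have "tensor_map A (obj Q l) N (G l) \<psi>' z = ?m (G l)"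
    by (rule tensor_map_cong[OF PD(2) QD(2) GD(1) GD(1) \<psi>' \<psi> refl _ zc]) (simp add: eq')
  ultimately show ?thesis
    unfolding Xz tor_ind_class[OF P Q F \<psi> z] tor_ind_class[OF P Q G \<psi>' z] by simp
qed

lemma tor_ind_comp:
  assumes P: "exact_res W P" and Q: "exact_res V Q" and R: "exact_res M R"
    and F: "chain_map P Q \<phi> F" and G: "chain_map Q R \<phi>' G"
    and \<psi>: "\<psi> \<in> lmod_end N" and \<psi>': "\<psi>' \<in> lmod_end N" and X: "X \<in> carrier (tor_space A P N l)"
  shows "tor_ind N R G \<psi>' l (tor_ind N Q F \<psi> l X) = tor_ind N R (\<lambda>l x. G l (F l x)) (\<lambda>y. \<psi>' (\<psi> y)) l X"
proof -
  note PD = exact_resD[OF P] and QD = exact_resD[OF Q] and RD = exact_resD[OF R]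
  obtain z where z: "z \<in> tor_cycles A P N l" and Xz: "X = tor_class P N l z" by (rule tor_space_cases[OF P X])
  have zc: "z \<in> carrier (tensor A (obj P l) N)" using z subspD(1)[OF tor_subsp(1)[OF P]] by blast
  show ?thesis
    unfolding Xz tor_ind_class[OF P Q F \<psi> z] tor_ind_class[OF Q R G \<psi>' tor_push(2)[OF P Q F \<psi> z]]
      tor_ind_class[OF P R chain_map_comp[OF F G P] lmod_end_comp[OF \<psi> \<psi>'] z]
      tensor_map_comp[OF PD(2) QD(2) RD(2) chain_mapD(1)[OF F] chain_mapD(1)[OF G] \<psi> \<psi>' zc] ..
qed

lemma tor_ind_id:
  assumes P: "exact_res M P" and X: "X \<in> carrier (tor_space A P N l)"
  shows "tor_ind N P (\<lambda>l x. x) (\<lambda>y. y) l X = X"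
proof -
  obtain z where z: "z \<in> tor_cycles A P N l" and Xz: "X = tor_class P N l z" by (rule tor_space_cases[OF P X])
  have zc: "z \<in> carrier (tensor A (obj P l) N)" using z subspD(1)[OF tor_subsp(1)[OF P]] by blast
  show ?thesis unfolding Xz tor_ind_class[OF P P chain_map_id lmod_end_id z] tensor_map_id[OF exact_resD(2)[OF P] zc] ..
qed

text \<open>Mirror image of \<open>hom_partition\<close>. The coordinate maps send the tensor of
  \<open>x\<close> and \<open>y\<close> to \<open>S_i(x) y\<close> and owe their existence to the
  universal property.\<close>

lemma tensor_partition:
  fixes m :: nat
  assumes P: "dual_basis P {..<m} S q"
  shows "\<exists>p. (\<forall>i. p i \<in> lin (tensor A P N) N) \<and>
    (\<forall>i. \<forall>x\<in>carrier P. \<forall>y\<in>carrier N. p i (pure P N x y) = lact N (S x i) y) \<and>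
    (\<forall>X\<in>carrier (tensor A P N). finsum (tensor A P N) (\<lambda>i. pure P N (q i) (p i X)) {..<m} = X)"
    "i \<in> {..<m} \<Longrightarrow> (\<lambda>y. pure P N (q i) y) \<in> lin N (tensor A P N)"
proof -
  note D = dual_basisD[OF P] and C = dual_basis_coord[OF P] and ND = left_moduleD[OF N]
  note PD = right_moduleD[OF D(1)] and vT = vsp_tensor[OF D(1) N]
  show j: "(\<lambda>y. pure P N (q i) y) \<in> lin N (tensor A P N)" if "i \<in> {..<m}" for i
    by (rule linI) (use C(5)[OF that] pure_closed[OF D(1) N] pure_add_right[OF D(1) N] pure_smult_right[OF D(1) N] in simp_all)
  have "\<exists>F\<in>lin (tensor A P N) N. \<forall>x\<in>carrier P. \<forall>y\<in>carrier N. F (pure P N x y) = lact N (S x i) y" for i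
    by (rule tensor_universal[OF D(1) N ND(1)]) (use C ND in simp_all)
  then obtain p where p: "\<And>i. p i \<in> lin (tensor A P N) N"
    "\<And>i x y. x \<in> carrier P \<Longrightarrow> y \<in> carrier N \<Longrightarrow> p i (pure P N x y) = lact N (S x i) y" by metis
  have "finsum (tensor A P N) (\<lambda>i. pure P N (q i) (p i X)) {..<m} = X" if X: "X \<in> carrier (tensor A P N)" for X
  proof (rule tensor_lin_eqI[OF D(1) N vT lin_finsum_map[OF vT vT lin_comp[OF p(1) j]] lin_id _ X], assumption)
    fix x y assume xy: "x \<in> carrier P" "y \<in> carrier N"
    have l: "(\<lambda>x. pure P N x y) \<in> lin P (tensor A P N)"
      by (rule linI) (use xy(2) pure_closed[OF D(1) N] pure_add_left[OF D(1) N] pure_smult_left[OF D(1) N] in simp_all)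
    have rc: "(\<lambda>i. ract P (q i) (S x i)) \<in> {..<m} \<rightarrow> carrier P" using PD(2) C(1)[OF xy(1)] C(5) by auto
    have "finsum (tensor A P N) (\<lambda>i. pure P N (q i) (p i (pure P N x y))) {..<m} =
      finsum (tensor A P N) (\<lambda>i. pure P N (ract P (q i) (S x i)) y) {..<m}"
      by (rule vs_finsum_cong[OF vT refl])
        (use p(2)[OF xy] pure_ract[OF D(1) N C(5) C(1)[OF xy(1)] xy(2)] pure_closed[OF D(1) N C(5) ND(2)[OF xy(2) C(1)[OF xy(1)]]] in auto)
    also have "\<dots> = pure P N (finsum P (\<lambda>i. ract P (q i) (S x i)) {..<m}) y"
      by (rule lin_finsum[OF PD(1) vT l rc, symmetric])
    also have "\<dots> = pure P N x y" unfolding dual_basis_expand[OF P xy(1)] ..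
    finally show "finsum (tensor A P N) (\<lambda>i. pure P N (q i) (p i (pure P N x y))) {..<m} = pure P N x y" .
  qed
  then show "\<exists>p. (\<forall>i. p i \<in> lin (tensor A P N) N) \<and>
    (\<forall>i. \<forall>x\<in>carrier P. \<forall>y\<in>carrier N. p i (pure P N x y) = lact N (S x i) y) \<and>
    (\<forall>X\<in>carrier (tensor A P N). finsum (tensor A P N) (\<lambda>i. pure P N (q i) (p i X)) {..<m} = X)"
    using p by blast
qed

lemma
  fixes m :: nat
  assumes P: "dual_basis P {..<m} S q" and fN: "fd N"
  shows fd_tensor: "fd (tensor A P N)"
    and lin_trace_tensor: "F \<in> rmod_hom A P P \<Longrightarrow> \<psi> \<in> lmod_end N \<Longrightarrow>
      lin_trace (tensor A P N) (tensor_map A P N F \<psi>) = (\<Sum>i<m. lin_trace N (\<lambda>y. lact N (S (F (q i)) i) (\<psi> y)))"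
proof -
  note D = dual_basisD[OF P] and C = dual_basis_coord[OF P] and ND = left_moduleD[OF N]
  note vT = vsp_tensor[OF D(1) N] and j = tensor_partition(2)[OF P]
  obtain p where p: "\<And>i. p i \<in> lin (tensor A P N) N"
    "\<And>i x y. x \<in> carrier P \<Longrightarrow> y \<in> carrier N \<Longrightarrow> p i (pure P N x y) = lact N (S x i) y"
    "\<And>X. X \<in> carrier (tensor A P N) \<Longrightarrow> finsum (tensor A P N) (\<lambda>i. pure P N (q i) (p i X)) {..<m} = X"
    using tensor_partition(1)[OF P] by (elim exE conjE) (rule that, blast+)
  show fT: "fd (tensor A P N)" by (rule partition_fd[OF vT ND(1) fN _ j p(1) p(3)]) simp_all
  assume F: "F \<in> rmod_hom A P P" and \<psi>: "\<psi> \<in> lmod_end N"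
  note T = tensor_map[OF D(1) D(1) N F \<psi>]
  have "lin_trace (tensor A P N) (tensor_map A P N F \<psi>) = (\<Sum>i<m. lin_trace N (\<lambda>y. p i (tensor_map A P N F \<psi> (pure P N (q i) y))))"
    by (rule lin_trace_partition[where j = "\<lambda>i y. pure P N (q i) y" and p = p, OF vT ND(1) fN finite_lessThan j p(1,3) T(1)])
  also have "\<dots> = (\<Sum>i<m. lin_trace N (\<lambda>y. lact N (S (F (q i)) i) (\<psi> y)))"
  proof (rule sum.cong[OF refl])
    fix i assume i: "i \<in> {..<m}"
    show "lin_trace N (\<lambda>y. p i (tensor_map A P N F \<psi> (pure P N (q i) y))) = lin_trace N (\<lambda>y. lact N (S (F (q i)) i) (\<psi> y))"
      by (rule lin_trace_cong[OF ND(1) fN lin_comp[OF lin_comp[OF j[OF i] T(1)] p(1)]])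
        (simp add: T(2)[OF C(5)[OF i]] p(2)[OF rmod_homD(1)[OF F C(5)[OF i]]] lin_closed[OF lmod_end_lin[OF \<psi>]])
  qed
  finally show "lin_trace (tensor A P N) (tensor_map A P N F \<psi>) = (\<Sum>i<m. lin_trace N (\<lambda>y. lact N (S (F (q i)) i) (\<psi> y)))" .
qed

end

end

context elem_alg
begin

lemma trace_form_left:
  assumes N: "left_module A N" "fd N" and \<psi>: "\<psi> \<in> lmod_end N" and a: "a \<in> carrier A"
  shows "lin_trace N (\<lambda>y. lact N a (\<psi> y)) = (\<Sum>j<n. chi j a * lin_trace N (\<lambda>y. lact N (e j) (\<psi> y)))"
proof -
  note ND = left_moduleD[OF N(1)] and pl = lmod_end_lin[OF \<psi>]
  have pc: "\<psi> x \<in> carrier N" if "x \<in> carrier N" for x by (rule lin_closed[OF pl that])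
  have pA: "\<psi> (lact N a y) = lact N a (\<psi> y)" if "a \<in> carrier A" "y \<in> carrier N" for a y using \<psi> that by (simp add: lmod_end_def)
  have la: "(\<lambda>y. lact N a y) \<in> lin N N" if "a \<in> carrier A" for a by (rule linI) (use that ND in simp_all)
  have kc: "(\<psi> ^^ k) x \<in> carrier N" if "x \<in> carrier N" for k x using that pc by (induction k) auto
  \<comment> \<open>As for right modules, now with the powers of \<open>y\<close> acting from the
    left.\<close>
  have pow: "((\<lambda>z. lact N y (\<psi> z)) ^^ k) x = lact N (y [^] k) ((\<psi> ^^ k) x)" if y: "y \<in> carrier A" and x: "x \<in> carrier N" for x y and k :: nat
  proof (induction k)
    case (Suc k)
    have "((\<lambda>z. lact N y (\<psi> z)) ^^ Suc k) x = lact N y (\<psi> (lact N (y [^] k) ((\<psi> ^^ k) x)))" using Suc by simp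
    also have "\<dots> = lact N y (lact N (y [^] k) (\<psi> ((\<psi> ^^ k) x)))" using pA[OF _ kc[OF x], of "y [^] k"] y by simp
    also have "\<dots> = lact N (y \<otimes> y [^] k) (\<psi> ((\<psi> ^^ k) x))" using ND(7)[OF pc[OF kc[OF x]] y, of "y [^] k"] y by simp
    also have "y \<otimes> y [^] k = y [^] Suc k" using y nat_pow_Suc2 by simp
    finally show ?case by simp
  qed (use x ND in simp)
  have z: "lact N \<zero> z = \<zero>\<^bsub>N\<^esub>" if "z \<in> carrier N" for z using ND(6)[OF that one_closed, of 0] ND(8)[OF that] that ND(1) by simp
  show ?thesis
  proof (rule trace_form_operator[where f = "\<lambda>a y. lact N a (\<psi> y)", OF ND(1) N(2) lin_comp[OF pl la] _ _ _ a])
    show "((\<lambda>y. lact N b (\<psi> y)) ^^ r) x = \<zero>\<^bsub>N\<^esub>" if "b \<in> carrier A" "b [^] r = \<zero>" "x \<in> carrier N" for b x and r :: nat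
      unfolding pow[OF that(1,3)] that(2) by (rule z[OF kc[OF that(3)]])
  qed (use ND pc in simp_all)
qed

lemma lin_trace_tensor_eq:
  assumes P: "dual_basis P {..<m} S q" and N: "left_module A N" "fd N"
    and F: "F \<in> rmod_hom A P P" and \<psi>: "\<psi> \<in> lmod_end N"
  shows "lin_trace (tensor A P N) (tensor_map A P N F \<psi>) = (\<Sum>j<n. mult_trace m S q F j * lin_trace N (\<lambda>y. lact N (e j) (\<psi> y)))"
proof -
  have "lin_trace (tensor A P N) (tensor_map A P N F \<psi>) = (\<Sum>i<m. \<Sum>j<n. chi j (S (F (q i)) i) * lin_trace N (\<lambda>y. lact N (e j) (\<psi> y)))"
    unfolding lin_trace_tensor[OF N(1) P N(2) F \<psi>]
    by (rule sum.cong[OF refl], rule trace_form_left[OF N \<psi>])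
       (use dual_basis_coord[OF P] rmod_homD(1)[OF F] in simp)
  then show ?thesis by (subst (asm) sum.swap) (simp add: mult_trace_def sum_distrib_right)
qed

lemma tor_euler:
  assumes N: "left_module A N" "fd N" and Q: "exact_res M Q" and db: "\<And>l. dual_basis (obj Q l) {..<m l} (S l) (q l)"
    and L: "\<And>l. l > L \<Longrightarrow> zero_space (obj Q l)"
    and \<Phi>: "chain_map Q Q \<phi> \<Phi>" and \<psi>: "\<psi> \<in> lmod_end N"
  shows "(\<Sum>l\<le>L. (- 1) ^ l * lin_trace (tor_space A Q N l) (tor_ind N Q \<Phi> \<psi> l)) =
    (\<Sum>j<n. (\<Sum>l\<le>L. (- 1) ^ l * mult_trace (m l) (S l) (q l) (\<Phi> l) j) * lin_trace N (\<lambda>y. lact N (e j) (\<psi> y)))"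
    "l > L \<Longrightarrow> zero_space (tor_space A Q N l)" "fd (tor_space A Q N l)"
proof -
  note QD = exact_resD[OF Q] and \<Phi>D = chain_mapD[OF \<Phi>] and ND = left_moduleD[OF N(1)]
  let ?H = "\<lambda>l. tensor A (obj Q l) N"
  let ?Z = "\<lambda>l. (?H l)\<lparr>carrier := tor_cycles A Q N l\<rparr>" and ?B = "\<lambda>l. (?H l)\<lparr>carrier := tor_boundaries A Q N l\<rparr>"
  define T where "T l = tensor_map A (obj Q l) N (\<Phi> l) \<psi>" for l
  define h where "h l = lin_trace (tor_space A Q N l) (tor_ind N Q \<Phi> \<psi> l)" for l
  note sq = tor_subquot[OF N(1) Q same_space_refl]
  note vH = vsp_tensor[OF QD(2) N(1)] and fH = fd_tensor[OF N(1) db N(2)]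
  note sZ = tor_subsp(1)[OF N(1) Q] and sB = tor_subsp(2)[OF N(1) Q]
  have p: "T l \<in> lin (?H l) (?H l)" "z \<in> tor_cycles A Q N l \<Longrightarrow> T l z \<in> tor_cycles A Q N l"
    "z \<in> tor_boundaries A Q N l \<Longrightarrow> T l z \<in> tor_boundaries A Q N l" for l z
    unfolding T_def by (rule tor_push(1)[OF N(1) Q Q \<Phi> \<psi>], rule tor_push(2)[OF N(1) Q Q \<Phi> \<psi>], assumption,
      rule tor_push(3)[OF N(1) Q Q \<Phi> \<psi>], assumption)
  show "fd (tor_space A Q N l)" by (rule subquot_fd[OF sq fH])
  have H0: "zero_space (?H l)" if l: "l > L" for l
  proof -
    have "X = \<zero>\<^bsub>?H l\<^esub>" if X: "X \<in> carrier (?H l)" for X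
    proof (rule tensor_lin_eqI[OF QD(2) N(1) vH lin_id lin_zero_map[OF vH] _ X])
      fix x y assume x: "x \<in> carrier (obj Q l)" and y: "y \<in> carrier N"
      have x0: "x = \<zero>\<^bsub>obj Q l\<^esub>" using x L[OF l] by blast
      show "pure (obj Q l) N x y = \<zero>\<^bsub>?H l\<^esub>" unfolding x0 by (rule pure_zero_left[OF N(1) QD(2) y])
    qed
    then show ?thesis using vs_zero[OF vH] by blast
  qed
  show "zero_space (tor_space A Q N l)" if l: "l > L"
  proof (rule subquot_trivial[OF sq])
    show "tor_cycles A Q N l \<subseteq> tor_boundaries A Q N l"
      using subspD(1)[OF sZ, of l] subspD(2)[OF sB, of l] unfolding H0[OF l] by blast
  qed
  have Z: "lin_trace (?Z l) (T l) = lin_trace (?B l) (T l) + h l" for l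
    unfolding h_def by (rule subquot_trace[OF sq fH p(1)]; elim p(2) tor_ind_class[OF N(1) Q Q \<Phi> \<psi>, folded T_def])
  \<comment> \<open>The differential lowers degrees, so the shift runs opposite to that for Ext:
    \<open>b (Suc j)\<close> is the trace on boundaries in degree \<open>j\<close>. The value
    \<open>b 0 = 0\<close> reflects that everything in degree 0 is a cycle, and
    \<open>b (Suc L)\<close> vanishes because boundaries in degree \<open>L\<close> come from a zero
    term.\<close>
  define b where "b l = (case l of 0 \<Rightarrow> 0 | Suc j \<Rightarrow> lin_trace (?B j) (T j))" for l
  have bl: "lin_trace (?H l) (T l) - h l = b l + b (Suc l)" for l
  proof (cases l)
    case 0
    have "?Z 0 = ?H 0" by (simp add: tor_cycles_def)
    then show ?thesis using Z[of 0] by (simp add: 0 b_def)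
  next
    case (Suc j)
    let ?d = "tensor_map A (obj Q j) N (bd Q j) (\<lambda>y. y)"
    have d: "?d \<in> lin (?H (Suc j)) (?B j)"
      using lin_restrict[OF tensor_bd_lin[OF N(1) Q], of "carrier (?H (Suc j))" j "tor_boundaries A Q N j"]
      by (simp add: tor_boundaries_def)
    have dc: "?d ` carrier (?H (Suc j)) = carrier (?B j)" by (simp add: tor_boundaries_def)
    have TB: "T j \<in> lin (?B j) (?B j)"
      by (rule lin_restrict[OF p(1) subspD(1)[OF sB]]) (use p(3) in auto)
    have c: "?d (T (Suc j) z) = T j (?d z)" if "z \<in> carrier (?H (Suc j))" for z
      unfolding T_def by (rule tor_push_bd[OF N(1) Q Q \<Phi> \<psi> that])
    have "lin_trace (?H (Suc j)) (T (Suc j)) = lin_trace ((?H (Suc j))\<lparr>carrier := {z \<in> carrier (?H (Suc j)). ?d z = \<zero>\<^bsub>?B j\<^esub>}\<rparr>) (T (Suc j)) + lin_trace (?B j) (T j)"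
      by (rule lin_trace_exact[OF vH fH vsp_subsp[OF vH sB] d dc p(1) TB c])
    moreover have "{z \<in> carrier (?H (Suc j)). ?d z = \<zero>\<^bsub>?B j\<^esub>} = tor_cycles A Q N (Suc j)"
      by (simp add: tor_cycles_def)
    ultimately show ?thesis using Z[of "Suc j"] by (simp add: Suc b_def)
  qed
  have "b (Suc L) = 0"
  proof -
    have S: "zero_space (?H (Suc L))" by (rule H0) simp
    have B0: "tor_boundaries A Q N L = {\<zero>\<^bsub>?H L\<^esub>}"
      unfolding tor_boundaries_def S using lin_zero[OF vH vH tensor_bd_lin[OF N(1) Q]] by simp
    have "lin_trace (?B L) (T L) = 0"
    proof (rule lin_trace_zero[OF vsp_subsp[OF vH sB] fd_subsp[OF vH fH sB]])
      fix x assume "x \<in> carrier (?B L)"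
      then have "x = \<zero>\<^bsub>?H L\<^esub>" using B0 by simp
      then show "T L x = \<zero>\<^bsub>?B L\<^esub>" using lin_zero[OF vH vH p(1)] by simp
    qed
    then show ?thesis by (simp add: b_def)
  qed
  then show "(\<Sum>l\<le>L. (- 1) ^ l * lin_trace (tor_space A Q N l) (tor_ind N Q \<Phi> \<psi> l)) =
    (\<Sum>j<n. (\<Sum>l\<le>L. (- 1) ^ l * mult_trace (m l) (S l) (q l) (\<Phi> l) j) * lin_trace N (\<lambda>y. lact N (e j) (\<psi> y)))"
    using alternating_sum_exact[of "\<lambda>l. lin_trace (?H l) (T l)" h b, OF bl] lin_trace_tensor_eq[OF db N \<Phi>D(1) \<psi>]
    by (simp add: b_def h_def T_def)
qed

text \<open>By covariance the lifts appear in \<open>\<Phi>\<close> in the opposite order compared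
  with \<open>ext_transfer\<close>.\<close>

lemma tor_transfer:
  fixes N :: "('k, 'n, 'c, 'a, 'z) bimod_scheme" and X :: "('k, ('p \<times> 'n \<Rightarrow> 'k) set set, 'x) module_scheme"
    and P :: "('k, 'p, 'a, 'm) resolution"
  assumes M: "right_module A M" and N: "left_module A N" and fN: "fd N" and P: "projective_resolution A M P"
    and Q: "exact_res M Q" and db: "dual_basis (obj Q l) {..<m::nat} S q"
    and \<alpha>: "chain_map P Q (\<lambda>x. x) \<alpha>" and \<beta>: "chain_map Q P (\<lambda>x. x) \<beta>"
    and \<phi>: "\<phi> \<in> rmod_hom A M M" and u: "u \<in> rmod_hom A M M"
    and uu: "\<And>x. x \<in> carrier M \<Longrightarrow> u (u x) = u x" "\<And>x. x \<in> carrier M \<Longrightarrow> u (\<phi> x) = \<phi> (u x)"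
    and \<psi>: "\<psi> \<in> lmod_end N" and v: "v \<in> lmod_end N"
    and vv: "\<And>y. y \<in> carrier N \<Longrightarrow> v (v y) = v y" "\<And>y. y \<in> carrier N \<Longrightarrow> v (\<psi> y) = \<psi> (v y)"
    and X: "same_space X (tor_space A P N l)"
  defines "\<Phi> \<equiv> \<lambda>l x. \<alpha> l (chain_lift A P u l (chain_lift A P (\<lambda>x. x) l (chain_lift A P \<phi> l (\<beta> l x))))"
  shows "fd X" "zero_space (tor_space A Q N l) \<Longrightarrow> zero_space X"
    "lin_trace (X\<lparr>carrier := {tor_map A P N u (\<lambda>y. y) l (tor_map A P N (\<lambda>x. x) v l x) | x. x \<in> carrier X}\<rparr>) (tor_map A P N \<phi> \<psi> l)
      = lin_trace (tor_space A Q N l) (tor_ind N Q \<Phi> (\<lambda>y. v (\<psi> y)) l)" (is "lin_trace (X\<lparr>carrier := ?U\<rparr>) _ = _")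
    "zero_space X \<Longrightarrow>
      lin_trace (X\<lparr>carrier := {tor_map A P N u (\<lambda>y. y) l (tor_map A P N (\<lambda>x. x) v l x) | x. x \<in> carrier X}\<rparr>) (tor_map A P N \<phi> \<psi> l) = 0"
    "chain_map Q Q (\<lambda>x. \<phi> (u x)) \<Phi>"
proof -
  note EP = exact_res_projective[OF M P] and i = rmod_hom_id and li = lmod_end_id
  note lP = projective_lifts[OF EP(2) exact_resD(2)[OF EP(1)] exact_resD(2)[OF EP(1)]]
  let ?Y = "tor_space A Q N l" and ?a = "tor_ind N Q \<alpha> (\<lambda>y. y) l" and ?b = "tor_ind N P \<beta> (\<lambda>y. y) l"
  note sqQ = tor_subquot[OF N Q same_space_refl] and sqP = tor_subquot[OF N EP(1) X]
  have fY: "fd ?Y" by (rule subquot_fd[OF sqQ fd_tensor[OF N db fN]])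
  define \<theta> where "\<theta> = tor_ind N P (chain_lift A P \<phi>) \<psi> l"
  define E1 where "E1 = tor_ind N P (chain_lift A P (\<lambda>x. x)) v l"
  define E2 where "E2 = tor_ind N P (chain_lift A P u) (\<lambda>y. y) l"
  note c\<phi> = chain_lift[OF M P \<phi>] and cu = chain_lift[OF M P u] and ci = chain_lift[OF M P i]
  note lin = tor_ind_lin[OF N EP(1) EP(1) _ _ X X]
  have lE1: "E1 \<in> lin X X" unfolding E1_def by (rule lin[OF ci v])
  have lE2: "E2 \<in> lin X X" unfolding E2_def by (rule lin[OF cu li])
  have l\<theta>: "\<theta> \<in> lin X X" unfolding \<theta>_def by (rule lin[OF c\<phi> \<psi>])
  have a: "?a \<in> lin X ?Y" by (rule tor_ind_lin[OF N EP(1) Q \<alpha> li X same_space_refl])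
  have b: "?b \<in> lin ?Y X" by (rule tor_ind_lin[OF N Q EP(1) \<beta> li same_space_refl X])
  have ba: "?b (?a x) = x" if x: "x \<in> carrier X" for x
  proof -
    have xP: "x \<in> carrier (tor_space A P N l)" using x X(1) by simp
    have "?b (?a x) = tor_ind N P (\<lambda>l x. \<beta> l (\<alpha> l x)) (\<lambda>y. y) l x"
      by (rule tor_ind_comp[OF N EP(1) Q EP(1) \<alpha> \<beta> li li xP])
    also have "\<dots> = tor_ind N P (\<lambda>l x. x) (\<lambda>y. y) l x"
      by (rule tor_ind_cong[OF N EP(1) EP(1) lP chain_map_comp[OF \<alpha> \<beta> EP(1)] chain_map_id refl li li refl xP])
    also have "\<dots> = x" by (rule tor_ind_id[OF N EP(1) xP])
    finally show ?thesis .
  qed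
  let ?E = "\<lambda>x. E2 (E1 x)"
  have lE: "?E \<in> lin X X" by (rule lin_comp[OF lE1 lE2])
  note cp = chain_map_comp[OF _ _ EP(1)] and vp = lmod_end_comp
  note comp = tor_ind_comp[OF N EP(1) EP(1) EP(1)]
  have E12: "?E x = tor_ind N P (\<lambda>l x. chain_lift A P u l (chain_lift A P (\<lambda>x. x) l x)) v l x" (is "_ = tor_ind N P ?F v l x")
    if x: "x \<in> carrier (tor_space A P N l)" for x
    unfolding E1_def E2_def by (rule comp[OF ci cu v li x])
  have cF: "chain_map P P u ?F" by (rule cp[OF ci cu])
  have \<theta>E: "\<theta> (?E x) = tor_ind N P (\<lambda>l x. chain_lift A P \<phi> l (?F l x)) (\<lambda>y. \<psi> (v y)) l x"
    if x: "x \<in> carrier (tor_space A P N l)" for x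
    unfolding E12[OF x] \<theta>_def by (rule comp[OF cF c\<phi> v \<psi> x])
  have E\<theta>: "?E (\<theta> x) = tor_ind N P (\<lambda>l x. ?F l (chain_lift A P \<phi> l x)) (\<lambda>y. v (\<psi> y)) l x"
    if x: "x \<in> carrier (tor_space A P N l)" for x
  proof -
    have t: "\<theta> x \<in> carrier (tor_space A P N l)" using lin_closed[OF l\<theta>, of x] x X(1) by simp
    show ?thesis unfolding E12[OF t] unfolding \<theta>_def by (rule comp[OF c\<phi> cF \<psi> v x])
  qed
  have c: "?E (\<theta> (?E x)) = \<theta> (?E x)" if x: "x \<in> carrier X" for x
  proof -
    have xP: "x \<in> carrier (tor_space A P N l)" using x X(1) by simp
    have t: "\<theta> (?E x) \<in> carrier (tor_space A P N l)" using lin_closed[OF l\<theta> lin_closed[OF lE x]] X(1) by simp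
    have "?E (\<theta> (?E x)) = tor_ind N P (\<lambda>l x. ?F l (chain_lift A P \<phi> l (?F l x))) (\<lambda>y. v (\<psi> (v y))) l x"
      unfolding E12[OF t] unfolding \<theta>E[OF xP] by (rule comp[OF cp[OF cF c\<phi>] cF vp[OF v \<psi>] v xP])
    also have "\<dots> = tor_ind N P (\<lambda>l x. chain_lift A P \<phi> l (?F l x)) (\<lambda>y. \<psi> (v y)) l x"
      by (rule tor_ind_cong[OF N EP(1) EP(1) lP cp[OF cp[OF cF c\<phi>] cF] cp[OF cF c\<phi>] _ vp[OF vp[OF v \<psi>] v] vp[OF v \<psi>] _ xP])
        (use uu vv rmod_homD(1)[OF \<phi>] rmod_homD(1)[OF u] lin_closed[OF lmod_end_lin[OF v]] in simp_all)
    also have "\<dots> = \<theta> (?E x)" by (rule \<theta>E[OF xP, symmetric])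
    finally show ?thesis .
  qed
  have U: "?U = ?E ` carrier X" unfolding tor_map_eq_ind E1_def E2_def by blast
  note tr = lin_trace_transfer[OF subquotD(5)[OF sqP] subquotD(5)[OF sqQ] fY a b ba lE l\<theta> U c]
  show "fd X" by (rule tr(1))
  show "zero_space X" if "zero_space ?Y" by (rule tr(3)[OF _ _ that])
  have "lin_trace (X\<lparr>carrier := ?U\<rparr>) \<theta> = lin_trace ?Y (\<lambda>y. ?a (?E (\<theta> (?b y))))" by (rule tr(2))
  also have "\<dots> = lin_trace ?Y (tor_ind N Q \<Phi> (\<lambda>y. v (\<psi> y)) l)"
  proof (rule lin_trace_cong[OF subquotD(5)[OF sqQ] fY lin_comp[OF lin_comp[OF lin_comp[OF b l\<theta>] lE] a]])
    fix y assume y: "y \<in> carrier ?Y"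
    have yP: "?b y \<in> carrier (tor_space A P N l)" using lin_closed[OF b y] X(1) by simp
    have "?a (?E (\<theta> (?b y))) = ?a (tor_ind N P (\<lambda>l x. ?F l (chain_lift A P \<phi> l x)) (\<lambda>y. v (\<psi> y)) l (?b y))"
      unfolding E\<theta>[OF yP] ..
    also have "\<dots> = ?a (tor_ind N P (\<lambda>l x. ?F l (chain_lift A P \<phi> l (\<beta> l x))) (\<lambda>y. v (\<psi> y)) l y)"
      unfolding tor_ind_comp[OF N Q EP(1) EP(1) \<beta> cp[OF c\<phi> cF] li vp[OF \<psi> v] y] ..
    also have "\<dots> = tor_ind N Q \<Phi> (\<lambda>y. v (\<psi> y)) l y"
      unfolding \<Phi>_def by (rule tor_ind_comp[OF N Q EP(1) Q chain_map_comp[OF \<beta> cp[OF c\<phi> cF] Q] \<alpha> vp[OF \<psi> v] li y])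
    finally show "?a (?E (\<theta> (?b y))) = tor_ind N Q \<Phi> (\<lambda>y. v (\<psi> y)) l y" .
  qed
  finally show "lin_trace (X\<lparr>carrier := ?U\<rparr>) (tor_map A P N \<phi> \<psi> l) = lin_trace ?Y (tor_ind N Q \<Phi> (\<lambda>y. v (\<psi> y)) l)"
    by (simp only: tor_map_eq_ind \<theta>_def)
  show "lin_trace (X\<lparr>carrier := ?U\<rparr>) (tor_map A P N \<phi> \<psi> l) = 0" if "zero_space X"
    using lin_trace_trivial_image[OF subquotD(5)[OF sqP] tr(1) that lE l\<theta> U] by (simp only: tor_map_eq_ind \<theta>_def)
  \<comment> \<open>In this order \<open>\<Phi>\<close> lies over \<open>u \<circ> \<phi>\<close>,
    which agrees with \<open>\<phi> \<circ> u\<close> on \<open>M\<close>; the latter is the form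
    expected by the formula for multiplicities.\<close>
  have "chain_map Q Q (\<lambda>x. u (\<phi> x)) \<Phi>"
    unfolding \<Phi>_def by (rule chain_map_comp[OF \<beta> cp[OF cp[OF c\<phi> cF] \<alpha>] Q])
  then show "chain_map Q Q (\<lambda>x. \<phi> (u x)) \<Phi>" by (rule chain_map_cong[OF _ Q]) (rule uu(2))
qed

theorem tor_trace_formula:
  fixes B :: "('k, 'b) module" and C :: "('k, 'c) module" and f :: "'b list" and g :: "'c list"
    and M :: "('k, 'm, 'a, 'b) bimod" and N :: "('k, 'n, 'c, 'a) bimod" and P :: "('k, 'p, 'a, 'm) resolution"
  assumes gl: "finite_gldim A" and M: "fd_bimodule B A M" and \<phi>: "\<phi> \<in> bimod_end B A M"
    and C: "fin_alg C" and N: "fd_bimodule A C N" and \<psi>: "\<psi> \<in> bimod_end A C N" and P: "projective_resolution A M P"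
    and f: "\<And>i. i < length f \<Longrightarrow> idempotent B (f ! i)" and g: "\<And>i. i < length g \<Longrightarrow> idempotent C (g ! i)"
  shows "fd_total (Tor A P M N)" (is ?fd)
    "alt_trace_matrix g f (Tor A P M N) (tor_map A P N \<phi> \<psi>) =
      euler_form_op A es (transpose_mat (trace_matrix g es N \<psi>)) (trace_matrix es f M \<phi>)" (is ?tr)
proof -
  note RM = bimod_right[OF M] and RC = fin_alg.bimod_right[OF C N]
  note NC = fin_alg.right_moduleD[OF C RC]
  have LN: "left_module A N" "fd N" using N by (auto simp: fd_bimodule_def bimodule_def)
  have \<psi>N: "\<psi> \<in> rmod_hom C N N" using \<psi> by (simp add: bimod_end_def)
  have \<psi>l: "\<psi> \<in> lmod_end N"
    using fin_alg.rmod_hom_lin[OF C RC RC \<psi>N] \<psi> by (simp add: lmod_end_def bimod_end_def)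
  have v: "(\<lambda>y. ract N y c) \<in> lmod_end N" if "c \<in> carrier C" for c
    using fin_alg.lin_ract[OF C RC that] N that by (simp add: lmod_end_def fd_bimodule_def bimodule_def)
  have gc: "g ! k \<in> carrier C" and gg: "y \<in> carrier N \<Longrightarrow> ract N (ract N y (g ! k)) (g ! k) = ract N y (g ! k)"
    and g\<psi>: "y \<in> carrier N \<Longrightarrow> ract N (\<psi> y) (g ! k) = \<psi> (ract N y (g ! k))" if k: "k < length g" for k y
    using g[OF k] NC(7)[of y "g ! k" "g ! k"] fin_alg.rmod_homD(3)[OF C \<psi>N, of y "g ! k"] by (simp_all add: idempotent_def)
  have hom: "\<phi> \<in> rmod_hom A M M" by (rule bimod_end_hom[OF \<phi>])
  obtain Q :: "('k, nat \<Rightarrow> 'a, 'a, 'm) resolution" and L m S q \<alpha> \<beta> where Q: "exact_res M Q"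
    and db: "\<And>l. dual_basis (obj Q l) {..<m l :: nat} (S l) (q l)" and L: "\<And>l. l > L \<Longrightarrow> zero_space (obj Q l)"
    and \<alpha>: "chain_map P Q (\<lambda>x. x) \<alpha>" and \<beta>: "chain_map Q P (\<lambda>x. x) \<beta>"
    by (rule finite_comparison[OF RM bimod_fd[OF M] gl P]) (rule that)
  have X: "same_space (Tor A P M N l) (tor_space A P N l)" for l
    by (simp_all add: Tor_def)
  note idh = rmod_hom_id[of M] lmod_end_id[of N]
  note t0 = tor_transfer[OF RM LN P Q db \<alpha> \<beta> idh(1,1) refl refl idh(2,2) refl refl X]
  have triv: "zero_space (tor_space A Q N l)" if "l > L" for l
    by (rule tor_euler(2)[OF LN Q db L chain_map_id idh(2) that])
  have XL: "zero_space (Tor A P M N l)" if "l > L" for l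
    by (rule t0(2)[OF triv[OF that]])
  show ?fd by (rule fd_totalI[OF t0(1) XL])
  show ?tr
  proof (rule alt_trace_matrix_eqI[OF XL])
    have cM: "trace_matrix es f M \<phi> \<in> carrier_mat n (length f)" and cN: "trace_matrix g es N \<psi> \<in> carrier_mat (length g) n"
      by (rule trace_matrix_carrier)+
    show "euler_form_op A es (transpose_mat (trace_matrix g es N \<psi>)) (trace_matrix es f M \<phi>) \<in> carrier_mat (length g) (length f)"
      by (intro carrier_matI) (simp_all add: euler_form_op_def trace_matrix_def)
    fix k i assume k: "k < length g" and i: "i < length f"
    define \<Phi> where "\<Phi> = (\<lambda>l x. \<alpha> l (chain_lift A P (lact M (f ! i)) l (chain_lift A P (\<lambda>x. x) l (chain_lift A P \<phi> l (\<beta> l x)))))"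
    note t = tor_transfer[OF RM LN P Q db \<alpha> \<beta> hom bimod_lact_hom[OF M f[OF i]] bimod_lact_idem[OF M f[OF i]]
      bimod_end_lact[OF \<phi> f[OF i]] \<psi>l v[OF gc[OF k]] gg[OF k] g\<psi>[OF k] X, folded \<Phi>_def]
    have ti: "trace_matrix g f (Tor A P M N l) (tor_map A P N \<phi> \<psi> l) $$ (k, i) =
      lin_trace ((Tor A P M N l)\<lparr>carrier := {tor_map A P N (lact M (f ! i)) (\<lambda>y. y) l
        (tor_map A P N (\<lambda>x. x) (\<lambda>y. ract N y (g ! k)) l x) | x. x \<in> carrier (Tor A P M N l)}\<rparr>) (tor_map A P N \<phi> \<psi> l)" for l
      unfolding trace_matrix_index[OF k i] by (simp add: Tor_def)
    show "trace_matrix g f (Tor A P M N l) (tor_map A P N \<phi> \<psi> l) $$ (k, i) = 0"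
      if "zero_space (Tor A P M N l)" for l
      unfolding ti by (rule t(4)[OF _ _ _ _ that])
    have c\<Phi>: "chain_map Q Q (\<lambda>x. \<phi> (lact M (f ! i) x)) \<Phi>" by (rule t(5))
    have h\<psi>: "(\<lambda>y. ract N (\<psi> y) (g ! k)) \<in> lmod_end N" by (rule lmod_end_comp[OF \<psi>l v[OF gc[OF k]]])
    have h\<phi>: "(\<lambda>x. \<phi> (lact M (f ! i) x)) \<in> rmod_hom A M M" by (rule rmod_hom_comp[OF bimod_lact_hom[OF M f[OF i]] hom])
    have tM: "lin_trace (corner M (e a)) (\<lambda>x. \<phi> (lact M (f ! i) x)) = trace_matrix es f M \<phi> $$ (a, i)" if a: "a < n" for a
      unfolding trace_matrix_index[OF a i] by (rule bimod_trace(2)[OF M \<phi> f[OF i] e_idempotent[OF a]])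
    have tN: "lin_trace N (\<lambda>y. lact N (e j) (ract N (\<psi> y) (g ! k))) = trace_matrix g es N \<psi> $$ (k, j)" if j: "j < n" for j
    proof -
      have l: "(\<lambda>y. lact N (e j) (ract N (\<psi> y) (g ! k))) \<in> lin N N"
        by (rule lin_comp[OF lmod_end_lin[OF h\<psi>]]) (rule linI; use left_moduleD[OF LN(1)] e_closed[OF j] in simp)
      \<comment> \<open>The right idempotent is moved inside \<open>\<psi>\<close>, because
        \<open>bimod_trace\<close>, applied over \<open>C\<close>, has it act first.\<close>
      have "lin_trace N (\<lambda>y. lact N (e j) (ract N (\<psi> y) (g ! k))) = lin_trace N (\<lambda>y. lact N (e j) (\<psi> (ract N y (g ! k))))"
        by (rule lin_trace_cong[OF NC(1) LN(2) l]) (simp add: g\<psi>[OF k])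
      also have "\<dots> = trace_matrix g es N \<psi> $$ (k, j)"
        unfolding trace_matrix_index[OF k j] by (rule fin_alg.bimod_trace(1)[OF C N \<psi> e_idempotent[OF j] g[OF k], symmetric])
      finally show ?thesis .
    qed
    have "(\<Sum>l\<le>L. (- 1) ^ l * trace_matrix g f (Tor A P M N l) (tor_map A P N \<phi> \<psi> l) $$ (k, i)) =
      (\<Sum>l\<le>L. (- 1) ^ l * lin_trace (tor_space A Q N l) (tor_ind N Q \<Phi> (\<lambda>y. ract N (\<psi> y) (g ! k)) l))"
      unfolding ti by (intro sum.cong refl arg_cong2[of _ _ _ _ times] t(3))
    also have "\<dots> = (\<Sum>j<n. (\<Sum>l\<le>L. (- 1) ^ l * mult_trace (m l) (S l) (q l) (\<Phi> l) j) * lin_trace N (\<lambda>y. lact N (e j) (ract N (\<psi> y) (g ! k))))"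
      by (rule tor_euler(1)[OF LN Q db L c\<Phi> h\<psi>])
    also have "\<dots> = (\<Sum>j<n. (\<Sum>a<n. cartan_inv A es $$ (j, a) * trace_matrix es f M \<phi> $$ (a, i)) * trace_matrix g es N \<psi> $$ (k, j))"
      by (rule sum.cong[OF refl]) (simp add: multiplicity_formula[OF gl Q db L h\<phi> c\<Phi>] tM tN)
    also have "\<dots> = euler_form_op A es (transpose_mat (trace_matrix g es N \<psi>)) (trace_matrix es f M \<phi>) $$ (k, i)"
      by (rule euler_form_op_index[OF gl cM cN i k, symmetric])
    finally show "(\<Sum>l\<le>L. (- 1) ^ l * trace_matrix g f (Tor A P M N l) (tor_map A P N \<phi> \<psi> l) $$ (k, i)) =
      euler_form_op A es (transpose_mat (trace_matrix g es N \<psi>)) (trace_matrix es f M \<phi>) $$ (k, i)" .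
  qed
qed

end

text \<open>The two statements are proved in parallel rather than derived from one another; what
  they share is the evaluation of the multiplicities of a finite resolution of
  \<open>M\<close>.\<close>

theorem theorem7:
  fixes A :: "('k::field, 'a) module"
    and B :: "('k, 'b) module"
    and C :: "('k, 'c) module"
    and e :: "'a list" and f :: "'b list" and g :: "'c list"
  assumes "fd_algebra A" and "fd_algebra B" and "fd_algebra C"
    and "elementary A" and "elementary B" and "elementary C"
    and "finite_gldim A"
    and "complete_idempotents A e" and "complete_idempotents B f" and "complete_idempotents C g"
  shows
    "(\<forall>(M :: ('k, 'm1, 'a, 'b) bimod) (N :: ('k, 'n1, 'a, 'c) bimod) \<phi> \<psi>
        (P :: ('k, 'p1, 'a, 'm1) resolution).
        fd_bimodule B A M \<longrightarrow> \<phi> \<in> bimod_end B A M \<longrightarrow>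
        fd_bimodule C A N \<longrightarrow> \<psi> \<in> bimod_end C A N \<longrightarrow>
        projective_resolution A M P \<longrightarrow>
          fd_total (Ext A P M N) \<and>
          alt_trace_matrix f g (Ext A P M N) (ext_map A P N \<phi> \<psi>) =
            euler_form A e (trace_matrix e f M \<phi>) (trace_matrix e g N \<psi>))
     \<and>
     (\<forall>(M :: ('k, 'm2, 'a, 'b) bimod) (N :: ('k, 'n2, 'c, 'a) bimod) \<phi> \<psi>
        (P :: ('k, 'p2, 'a, 'm2) resolution).
        fd_bimodule B A M \<longrightarrow> \<phi> \<in> bimod_end B A M \<longrightarrow>
        fd_bimodule A C N \<longrightarrow> \<psi> \<in> bimod_end A C N \<longrightarrow>
        projective_resolution A M P \<longrightarrow>
          fd_total (Tor A P M N) \<and>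
          alt_trace_matrix g f (Tor A P M N) (tor_map A P N \<phi> \<psi>) =
            euler_form_op A e (transpose_mat (trace_matrix g e N \<psi>)) (trace_matrix e f M \<phi>))"
proof -
  have A: "elem_alg A e"
    using assms by (simp add: elem_alg_def elem_alg_axioms_def fin_alg_def)
  have C: "fin_alg C" using assms by (simp add: fin_alg_def)
  have f: "\<And>i. i < length f \<Longrightarrow> idempotent B (f ! i)" and g: "\<And>i. i < length g \<Longrightarrow> idempotent C (g ! i)"
    using assms by (simp_all add: complete_idempotents_def primitive_idempotent_def)
  note E = elem_alg.ext_trace_formula[OF A \<open>finite_gldim A\<close> _ _ _ _ _ f g]
  note T = elem_alg.tor_trace_formula[OF A \<open>finite_gldim A\<close> _ _ C _ _ _ f g]
  show ?thesis by (intro conjI allI impI E T)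
qed

end
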